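(* Let $d\ge 2$, $\mu\in\mathbb{R}^d$, let $\Sigma\in\mathbb{R}^{d\times d}$ be symmetric and positive definite, and let $h:\mathbb{R}_+\to\mathbb{R}_+$ satisfy $0<c_d(h)<\infty$ and $\sup_{0\le t\le\epsilon}h(t)<\infty$ for some $\epsilon>0$. Let $X_n$, $n\in\mathbb{N}$, be independent random vectors with distribution $P=\mathrm{Ell}_d(\mu,\Sigma;h)$, let $P_n=n^{-1}\sum_{k=1}^n\delta_{X_k}$, and let $$\sigma_{\mathrm{QMed}}^2=\frac{c_d(h)^2}{(2c_{d-1}(h))^2}.$$ (a) Suppose that $(\theta_n,U_n)_{n\in\mathbb{N}}$ is a sequence of random variables with values in $\mathbb{R}^d\times\mathbb{O}(d)$, with $\theta_n=\theta_n(X_1,\dots,X_n)$ and $U_n=U_n(X_1,\dots,X_n)$ Borel measurable functions of the data, such that for all $n\in\mathbb{N}$, $(\theta_n,U_n)$ solves the quarter median problem for $P_n$. Then, if $P$ is strictly elliptical, $$\sqrt{n}\,(\theta_n-\mu)\;\to_d\;N_d(0,\sigma_{\mathrm{QMed}}^2\,\Sigma)\quad\text{as }n\to\infty.$$ (b) Suppose that $\Sigma=\lambda I_d$ for some $\lambda>0$. Let $(U_n)_{n\in\mathbb{N}}$ be an arbitrary sequence of elements of $\mathbb{O}(d)$ and suppose that, for all $n\in\mathbb{N}$, $\theta_n$ is an $\mathbb{R}^d$-valued random vector such that $U_n\theta_n$ is a marginal median of $P_n^{U_n}$. Then $$\sqrt{n}\,(\theta_n-\mu)\;\to_d\;N_d(0,\sigma_{\mathrm{QMed}}^2\,\Sigma)\quad\text{as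 }n\to\infty.$$
   Context: For $h:\mathbb{R}_+\to\mathbb{R}_+$ (measurable, $\mathbb{R}_+=[0,\infty)$) and $k\in\mathbb{N}$ let $$c_k(h)=\frac{2\pi^{k/2}}{\Gamma(k/2)}\int_0^\infty r^{k-1}h(r^2)\,dr ,$$ so that $c_d(h)=\int_{\mathbb{R}^d}h(\|x\|^2)\,dx$. If $0<c_d(h)<\infty$, the elliptical distribution $\mathrm{Ell}_d(\mu,\Sigma;h)$ is the probability measure on $\mathbb{R}^d$ with density $$f(x)=\frac{1}{c_d(h)(\det\Sigma)^{1/2}}\,h\bigl((x-\mu)^{t}\Sigma^{-1}(x-\mu)\bigr),\quad x\in\mathbb{R}^d.$$ It is called strictly elliptical if no two of the eigenvalues of $\Sigma$ (listed with multiplicity) coincide. Vectors are columns, $x^{t}$ denotes the transpose, $\langle x,y\rangle=x^{t}y$, $\|\cdot\|$ is the Euclidean norm, $\mathbb{S}_{d-1}$ is the unit sphere in $\mathbb{R}^d$, $\mathbb{O}(d)$ is the group of orthogonal $d\times d$ matrices, $\delta_x$ is unit mass at $x$, $\to_d$ is convergence in distribution, $N_d(m,C)$ is the $d$-dimensional normal distribution with mean $m$ and covariance matrix $C$. For $U\in\mathbb{O}(d)$ and a probability measure $Q$ on $\mathbb{R}^d$, $Q^U$ is the push-forward of $Q$ under $x\mapsto Ux$. A median of a probability measure $R$ on $\mathbb{R}$ is any $m$ with $R((-\infty,m])\ge 1/2$ and $R([m,\infty))\ge 1/2$. A marginal median of a probability measure $Q$ on $\mathbb{R}^d$ is any vector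 whose $i$th coordinate is a median of the $i$th marginal distribution of $Q$, $i=1,\dots,d$. For $a\in\mathbb{R}^d$ and $b\in\mathbb{S}_{d-1}$ let $H_-(a;b)=\{x:\langle b,x-a\rangle\le 0\}$ and $H_+(a;b)=\{x:\langle b,x-a\rangle\ge 0\}$. For orthogonal $b,b'\in\mathbb{S}_{d-1}$ and signs $\sigma,\sigma'\in\{+,-\}$ let $V_{\sigma\sigma'}(a;b,b')=H_\sigma(a;b)\cap H_{\sigma'}(a;b')$. A pair $(\theta,U)\in\mathbb{R}^d\times\mathbb{O}(d)$, where $U$ has rows $b_1^{t},\ldots,b_d^{t}$, solves the quarter median problem for a probability measure $Q$ on $\mathbb{R}^d$ if $Q(H_\pm(\theta;b_i))\ge 1/2$ for $1\le i\le d$ and both signs, and $Q(V_{\sigma\sigma'}(\theta;b_i,b_j))\ge 1/4$ for $1\le i<j\le d$ and all four sign combinations. *)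

theory Defs
  imports "HOL-Probability.Probability"
begin

section \<open>Elliptical distributions\<close>

(* Takes values in [0, \<infinity>], so that finiteness is a genuine condition. Only the values of h on
   [0, \<infinity>) enter. Meant for k >= 1. *)
definition radial_const :: "nat \<Rightarrow> (real \<Rightarrow> real) \<Rightarrow> ennreal" where
  "radial_const k h =
     ennreal (2 * pi powr (real k / 2) / Gamma (real k / 2)) *
     (\<integral>\<^sup>+r\<in>{0..}. ennreal (r ^ (k - 1) * h (r\<^sup>2)) \<partial>lborel)"

definition positive_definite :: "real ^ 'n ^ 'n \<Rightarrow> bool" where
  "positive_definite A \<longleftrightarrow> (\<forall>x. x \<noteq> 0 \<longrightarrow> x \<bullet> (A *v x) > 0)"

definition elliptical :: "real ^ 'n \<Rightarrow> real ^ 'n ^ 'n \<Rightarrow> (real \<Rightarrow> real) \<Rightarrow> (real ^ 'n) measure" where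
  "elliptical \<mu> \<Sigma> h = density lborel (\<lambda>x. ennreal
     (1 / (enn2real (radial_const CARD('n) h) * sqrt (det \<Sigma>)) *
      h ((x - \<mu>) \<bullet> (matrix_inv \<Sigma> *v (x - \<mu>)))))"

(* l lists the eigenvalues of A with (algebraic) multiplicity. *)
definition lists_eigenvalues :: "real ^ 'n ^ 'n \<Rightarrow> ('n \<Rightarrow> real) \<Rightarrow> bool" where
  "lists_eigenvalues A l \<longleftrightarrow> (\<forall>t. det (mat t - A) = (\<Prod>i\<in>UNIV. t - l i))"

(* A property of the symmetric parameter matrix, for which a listing always exists and is unique
   up to order. *)
definition strictly_elliptical :: "real ^ 'n ^ 'n \<Rightarrow> bool" where
  "strictly_elliptical \<Sigma> \<longleftrightarrow> (\<exists>l. lists_eigenvalues \<Sigma> l \<and> (\<forall>i j. i \<noteq> j \<longrightarrow> l i \<noteq> l j))"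

definition qmed_variance :: "nat \<Rightarrow> (real \<Rightarrow> real) \<Rightarrow> real" where
  "qmed_variance d h =
     (enn2real (radial_const d h))\<^sup>2 / (2 * enn2real (radial_const (d - 1) h))\<^sup>2"


section \<open>Normal distribution and convergence in distribution\<close>

(* Via the density, hence meaningful for positive definite C only. *)
definition multivariate_normal :: "real ^ 'n \<Rightarrow> real ^ 'n ^ 'n \<Rightarrow> (real ^ 'n) measure" where
  "multivariate_normal m C = density lborel (\<lambda>x. ennreal
     (1 / sqrt ((2 * pi) ^ CARD('n) * det C) *
      exp (- ((x - m) \<bullet> (matrix_inv C *v (x - m))) / 2)))"

(* Weak convergence of Borel probability measures; weak_conv_m covers the real line only. *)
definition weakly_converges :: "(nat \<Rightarrow> 'b :: metric_space measure) \<Rightarrow> 'b measure \<Rightarrow> bool" where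
  "weakly_converges Q R \<longleftrightarrow>
     (\<forall>f :: 'b \<Rightarrow> real. continuous_on UNIV f \<longrightarrow> bounded (range f) \<longrightarrow>
        (\<lambda>n. \<integral>x. f x \<partial>Q n) \<longlonglongrightarrow> (\<integral>x. f x \<partial>R))"

definition converges_in_distribution ::
    "'a measure \<Rightarrow> (nat \<Rightarrow> 'a \<Rightarrow> 'b :: metric_space) \<Rightarrow> 'b measure \<Rightarrow> bool" where
  "converges_in_distribution M Y R \<longleftrightarrow> weakly_converges (\<lambda>n. distr M borel (Y n)) R"


section \<open>Empirical distributions, marginal medians, quarter medians\<close>

(* Image of the uniform distribution on the indices 1, ..., n; meant for n >= 1. *)
definition empirical :: "nat \<Rightarrow> (nat \<Rightarrow> 'b :: topological_space) \<Rightarrow> 'b measure" where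
  "empirical n x = distr (uniform_count_measure {1..n}) borel x"

lemma emeasure_empirical:
  assumes "n \<ge> 1" and A: "A \<in> sets borel"
  shows "emeasure (empirical n x) A =
    ennreal (1 / real n) * (\<Sum>k=1..n. emeasure (return borel (x k)) A)"
proof -
  have "emeasure (empirical n x) A = emeasure (uniform_count_measure {1..n}) (x -` A \<inter> {1..n})"
    unfolding empirical_def using A
    by (subst emeasure_distr) (auto simp: space_uniform_count_measure measurable_def sets_uniform_count_measure)
  also have "\<dots> = ennreal (real (card (x -` A \<inter> {1..n})) / real n)"
    by (subst emeasure_uniform_count_measure) auto
  also have "real (card (x -` A \<inter> {1..n})) = (\<Sum>k=1..n. indicator A (x k))"
    by (simp add: indicator_def sum.If_cases Int_def conj_commute)
  also have "ennreal ((\<Sum>k=1..n. indicator A (x k)) / real n) =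
      ennreal (1 / real n) * ennreal (\<Sum>k=1..n. indicator A (x k))"
    by (subst ennreal_mult'[symmetric]) (auto intro: sum_nonneg)
  also have "ennreal (\<Sum>k=1..n. indicator A (x k)) = (\<Sum>k=1..n. emeasure (return borel (x k)) A)"
    using A by (subst sum_ennreal[symmetric]) (auto simp: ennreal_indicator)
  finally show ?thesis .
qed

definition rotated :: "real ^ 'n ^ 'n \<Rightarrow> (real ^ 'n) measure \<Rightarrow> (real ^ 'n) measure" where
  "rotated U Q = distr Q borel (\<lambda>x. U *v x)"

definition is_median :: "real measure \<Rightarrow> real \<Rightarrow> bool" where
  "is_median R m \<longleftrightarrow> measure R {..m} \<ge> 1 / 2 \<and> measure R {m..} \<ge> 1 / 2"

definition is_marginal_median :: "(real ^ 'n) measure \<Rightarrow> real ^ 'n \<Rightarrow> bool" where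
  "is_marginal_median Q m \<longleftrightarrow> (\<forall>i. is_median (distr Q borel (\<lambda>x. x $ i)) (m $ i))"

datatype side = Minus | Plus

fun halfspace :: "side \<Rightarrow> real ^ 'n \<Rightarrow> real ^ 'n \<Rightarrow> (real ^ 'n) set" where
  "halfspace Minus a b = {x. b \<bullet> (x - a) \<le> 0}"
| "halfspace Plus a b = {x. b \<bullet> (x - a) \<ge> 0}"

definition quadrant :: "side \<Rightarrow> side \<Rightarrow> real ^ 'n \<Rightarrow> real ^ 'n \<Rightarrow> real ^ 'n \<Rightarrow> (real ^ 'n) set" where
  "quadrant s s' a b b' = halfspace s a b \<inter> halfspace s' a b'"

(* Since quadrant s s' a b b' = quadrant s' s a b' b and all sign pairs are covered, ranging over
   i \<noteq> j is the same as ranging over i < j for any ordering of the index type. *)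
definition solves_quarter_median ::
    "(real ^ 'n) measure \<Rightarrow> real ^ 'n \<Rightarrow> real ^ 'n ^ 'n \<Rightarrow> bool" where
  "solves_quarter_median Q \<theta> U \<longleftrightarrow>
     orthogonal_matrix U \<and>
     (\<forall>i s. measure Q (halfspace s \<theta> (row i U)) \<ge> 1 / 2) \<and>
     (\<forall>i j s s'. i \<noteq> j \<longrightarrow> measure Q (quadrant s s' \<theta> (row i U) (row j U)) \<ge> 1 / 4)"

end

theory Submission
  imports Defs "HOL-Real_Asymp.Real_Asymp"
begin

text \<open>
  Why the theorem is true. Diagonalise \<open>\<Sigma> = E\<^sup>t diag(l) E\<close> and standardise the observations:
  \<open>X\<^sub>k = \<mu> + T Z\<^sub>k\<close> with \<open>T z = E\<^sup>t diag(sqrt l) z\<close>, where the \<open>Z\<^sub>k\<close> are independent with a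
  rotation invariant law \<open>Q\<close>. A half-space or quadrant count of the data with normals \<open>b\<close> is a count
  of the \<open>Z\<^sub>k\<close> with normals proportional to \<open>diag(sqrt l) E b\<close>. All one-dimensional projections of
  \<open>Q\<close> have the same density at the origin, \<open>f0 = c\<^sub>d\<^sub>-\<^sub>1(h) / c\<^sub>d(h)\<close>, and the asymptotic standard
  deviation in the theorem is \<open>1 / (2 f0)\<close>, as for the median of a sample on the line.

  The core is a Bahadur representation (\<open>bahadur\<close>). For a unit vector \<open>p0\<close> let the score be
  \<open>sqrt n (F\<^sub>n{p0 \<bullet> z \<ge> 0} - 1/2)\<close>. If \<open>m\<close> is a median of the sample in direction \<open>p\<close>, then
  \<open>sqrt n m\<close> equals the score of \<open>p0\<close> divided by \<open>f0\<close> up to \<open>o(1)\<close>, uniformly over all unit vectors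
  \<open>p\<close> within \<open>O(n powr (-1/3))\<close> of \<open>p0\<close>. So a data dependent direction may be replaced by its limit
  although it converges more slowly than \<open>1 / sqrt n\<close>: all half-spaces with the origin on their
  boundary have probability \<open>1/2\<close>, and the symmetric difference of two of them with close normals
  has a small probability, on which the empirical measure fluctuates only by \<open>o(1 / sqrt n)\<close>. The
  uniformity comes from the Chernoff bound, applied to brackets around polynomially many directions
  (\<open>uniform_deviation\<close>).

  In part (a) the directions have to be located first. If \<open>p\<close> and \<open>q\<close> are unit vectors with
  \<open>p \<bullet> q \<ge> 0\<close>, then the quadrant \<open>{p \<bullet> z \<ge> 0, q \<bullet> z \<le> 0}\<close> has probability at most
  \<open>1/4 - (p \<bullet> q) / (4 \<pi>)\<close> (\<open>quadrant_bound\<close>). Hence the quadrant conditions force the standardised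
  directions to be orthogonal up to \<open>O(n powr (-1/3))\<close> (\<open>orthogonality_rate\<close>); that is, the orthogonal
  matrix \<open>B = U\<^sub>n E\<^sup>t\<close> diagonalises \<open>diag(l)\<close> up to this order. Since the eigenvalues are distinct,
  some row of \<open>B\<close> is close to each coordinate axis, up to sign (\<open>almost_diagonalising\<close>). The Bahadur
  representation at the axes then expands \<open>sqrt n E (\<theta>\<^sub>n - \<mu>)\<close> as \<open>diag(sqrt l)\<close> applied to the vector
  of coordinate scores over \<open>f0\<close>; the error from the directions is of order
  \<open>sqrt n * n powr (-2/3)\<close> (\<open>quarter_median_expansion\<close>).

  The signs of the coordinates of \<open>Z\<^sub>k\<close> are independent fair coin flips, because \<open>Q\<close> is invariant
  under reflection of single coordinates (\<open>orthant_prob\<close>). The coordinate scores are therefore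
  independent, and the central limit theorem on the line gives convergence of the doubled score vector
  to the standard Gaussian law, in the form of an almost sure representation (\<open>skorohod_scores\<close>).
  Its image under \<open>diag(sqrt l) / (2 f0)\<close> followed by \<open>E\<^sup>t\<close> is the asserted normal law.

  In part (b) the directions are given and deterministic, so the Bahadur representation is used at the
  rows of \<open>U\<^sub>n\<close> themselves. The law of the score vector does not depend on the orthogonal frame, and
  the limiting Gaussian law is rotation invariant; so \<open>U\<^sub>n\<close> may vary arbitrarily with \<open>n\<close>.
\<close>

section \<open>Lebesgue measure in Cartesian and polar coordinates\<close>

lemma prod_Basis_vec: "(\<Prod>b\<in>(Basis::(real^'n) set). g b) = (\<Prod>i\<in>UNIV. g (axis i 1))"
proof -
  have "(Basis::(real^'n) set) = range (\<lambda>i. axis i 1)"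
    by (auto simp: Basis_vec_def)
  moreover have "inj (\<lambda>i. axis i (1::real) :: real^'n)"
    by (auto simp: inj_on_def axis_eq_axis)
  ultimately show ?thesis using prod.reindex[of "\<lambda>i. axis i (1::real) :: real^'n" UNIV g] by (simp add: comp_def)
qed

lemma measurable_vec_lambda:
  assumes "\<And>i. (\<lambda>x. f x i) \<in> borel_measurable M"
  shows "(\<lambda>x. (\<chi> i. f x i) :: real^'n) \<in> borel_measurable M"
  by (subst borel_measurable_euclidean_space)
     (auto simp: Basis_vec_def inner_axis intro!: assms)

lemma lborel_vec:
  "(lborel :: (real^'n) measure) = distr (\<Pi>\<^sub>M i\<in>UNIV. lborel) borel (\<lambda>f. \<chi> i. f i)"
proof (rule lborel_eqI)
  interpret product_sigma_finite "\<lambda>_::'n. lborel :: real measure" by standard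
  fix l u :: "real^'n"
  assume le: "\<And>b. b \<in> Basis \<Longrightarrow> l \<bullet> b \<le> u \<bullet> b"
  have le': "l $ i \<le> u $ i" for i
    using le[of "axis i 1"] by (auto simp: inner_axis Basis_vec_def)
  have "emeasure (distr (\<Pi>\<^sub>M i\<in>(UNIV::'n set). lborel) borel (\<lambda>f. \<chi> i. f i)) (box l u) =
    emeasure (\<Pi>\<^sub>M i\<in>(UNIV::'n set). lborel) (\<Pi>\<^sub>E i\<in>UNIV. {l$i<..<u$i})"
    by (subst emeasure_distr)
       (auto intro!: measurable_vec_lambda arg_cong2[where f=emeasure] simp: mem_box_cart space_PiM PiE_def Pi_def extensional_def)
  also have "\<dots> = (\<Prod>i\<in>UNIV. ennreal (u$i - l$i))"
    by (subst emeasure_PiM) (auto simp: le')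
  also have "\<dots> = ennreal (\<Prod>i\<in>UNIV. (u$i - l$i))"
    by (simp add: prod_ennreal le')
  also have "(\<Prod>i\<in>UNIV. (u$i - l$i)) = (\<Prod>b\<in>Basis. (u - l) \<bullet> b)"
    by (simp add: prod_Basis_vec inner_axis)
  finally show "emeasure (distr (\<Pi>\<^sub>M i\<in>(UNIV::'n set). lborel) borel (\<lambda>f. \<chi> i. f i)) (box l u) = ennreal (\<Prod>b\<in>Basis. (u - l) \<bullet> b)" .
qed simp

lemma nn_integral_lborel_vec:
  assumes [measurable]: "g \<in> borel_measurable borel"
  shows "(\<integral>\<^sup>+x. g x \<partial>(lborel :: (real^'n) measure)) = (\<integral>\<^sup>+f. g (\<chi> i. f i) \<partial>(\<Pi>\<^sub>M i\<in>UNIV. lborel))"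
  by (subst lborel_vec, subst nn_integral_distr) (auto intro!: measurable_vec_lambda)

lemma borel_measurable_matrix_vector_mult [measurable]:
  "(\<lambda>x. (A::real^'n^'m) *v x) \<in> borel_measurable borel"
  by (intro borel_measurable_continuous_onI) (intro continuous_intros)

lemma nn_integral_lborel_shift:
  fixes t :: "'a::euclidean_space"
  assumes [measurable]: "g \<in> borel_measurable borel"
  shows "(\<integral>\<^sup>+x. g (x + t) \<partial>lborel) = (\<integral>\<^sup>+x. g x \<partial>lborel)"
proof -
  have "distr lborel borel (\<lambda>x. t + x) = (lborel :: 'a measure)"
    using lborel_affine[of 1 t] by (simp add: density_1)
  then have "(\<integral>\<^sup>+x. g x \<partial>lborel) = (\<integral>\<^sup>+x. g x \<partial>(distr lborel borel (\<lambda>x. t + x)))" by simp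
  then show ?thesis by (simp add: nn_integral_distr add.commute)
qed

text \<open>The image \<open>\<nu>\<close> of Lebesgue measure under \<open>f\<close> is again translation invariant, and it gives the unit
  ball the same mass. Integrating the ball's indicator at \<open>x\<close> times \<open>g\<close> at \<open>x + y\<close> over \<open>lborel\<close> in \<open>x\<close>
  and \<open>\<nu>\<close> in \<open>y\<close>, in both orders, shows that the two measures integrate every \<open>g\<close> alike.\<close>

lemma lborel_orthogonal:
  fixes f :: "'a::euclidean_space \<Rightarrow> 'a"
  assumes f: "orthogonal_transformation f"
  shows "distr lborel borel f = lborel"
proof -
  have lin: "linear f" and nrm: "\<And>x. norm (f x) = norm x"
    using f by (auto simp: orthogonal_transformation)
  have [measurable]: "f \<in> borel_measurable borel"
    by (intro borel_measurable_continuous_onI linear_continuous_on linear_conv_bounded_linear[THEN iffD1] lin)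
  obtain f' where f': "\<And>x. f (f' x) = x"
    using orthogonal_transformation_surj[OF f] by (metis surj_def)
  define \<nu> where "\<nu> = distr lborel borel f"
  have sets_\<nu>[measurable_cong]: "sets \<nu> = sets borel" by (simp add: \<nu>_def)
  have int\<nu>: "(\<integral>\<^sup>+y. g y \<partial>\<nu>) = (\<integral>\<^sup>+y. g (f y) \<partial>lborel)" if "g \<in> borel_measurable borel" for g
    using that by (simp add: \<nu>_def nn_integral_distr)
  have shift: "(\<integral>\<^sup>+y. g (y + t) \<partial>\<nu>) = (\<integral>\<^sup>+y. g y \<partial>\<nu>)" if [measurable]: "g \<in> borel_measurable borel" for g t
    using nn_integral_lborel_shift[of "\<lambda>y. g (f y)" "f' t"]
    by (simp add: int\<nu> linear_add[OF lin] f')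
  define b where "b = (indicator (cball 0 1) :: 'a \<Rightarrow> ennreal)"
  have [measurable]: "b \<in> borel_measurable borel"
    unfolding b_def by (intro borel_measurable_indicator) auto
  have b_uminus: "b (- x) = b x" for x by (simp add: b_def indicator_def)
  have b\<nu>: "(\<integral>\<^sup>+y. b y \<partial>\<nu>) = (\<integral>\<^sup>+y. b y \<partial>lborel)"
    by (simp add: int\<nu>) (simp add: b_def indicator_def nrm)
  have sf: "sigma_finite_measure \<nu>"
  proof
    show "\<exists>A. countable A \<and> A \<subseteq> sets \<nu> \<and> \<Union> A = space \<nu> \<and> (\<forall>a\<in>A. emeasure \<nu> a \<noteq> \<infinity>)"
    proof (intro exI[of _ "range (\<lambda>n::nat. cball 0 (real n))"] conjI ballI)
      show "\<Union> (range (\<lambda>n::nat. cball (0::'a) (real n))) = space \<nu>"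
        by (auto simp: \<nu>_def real_arch_simple)
      fix a assume "a \<in> range (\<lambda>n::nat. cball (0::'a) (real n))"
      then obtain n where a: "a = cball 0 (real n)" by auto
      have "f -` a = cball 0 (real n)" by (auto simp: a nrm)
      then show "emeasure \<nu> a \<noteq> \<infinity>"
        using emeasure_lborel_cball_finite[of 0 "real n"] by (simp add: \<nu>_def emeasure_distr a less_top[symmetric])
    qed (auto simp: \<nu>_def)
  qed
  interpret \<nu>: sigma_finite_measure \<nu> by fact
  interpret pair_sigma_finite "lborel :: 'a measure" \<nu> ..
  \<comment> \<open>Integrate the function with value b x * g (y + x) at (x, y) in both orders; b is even.\<close>
  have key: "(\<integral>\<^sup>+x. b x \<partial>lborel) * (\<integral>\<^sup>+y. g y \<partial>\<nu>) = (\<integral>\<^sup>+x. b x \<partial>lborel) * (\<integral>\<^sup>+y. g y \<partial>lborel)"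
    if [measurable]: "g \<in> borel_measurable borel" for g
  proof -
    have "(\<integral>\<^sup>+x. b x \<partial>lborel) * (\<integral>\<^sup>+y. g y \<partial>\<nu>) = (\<integral>\<^sup>+x. \<integral>\<^sup>+y. b x * g (y + x) \<partial>\<nu> \<partial>lborel)"
      by (simp add: nn_integral_cmult nn_integral_multc shift)
    also have "\<dots> = (\<integral>\<^sup>+y. \<integral>\<^sup>+x. b x * g (y + x) \<partial>lborel \<partial>\<nu>)"
      by (rule Fubini'[symmetric]) simp
    also have "\<dots> = (\<integral>\<^sup>+y. \<integral>\<^sup>+x. b (x + - y) * g x \<partial>lborel \<partial>\<nu>)"
    proof (rule nn_integral_cong)
      fix y show "(\<integral>\<^sup>+x. b x * g (y + x) \<partial>lborel) = (\<integral>\<^sup>+x. b (x + - y) * g x \<partial>lborel)"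
        using nn_integral_lborel_shift[of "\<lambda>x. b x * g (y + x)" "- y"] by simp
    qed
    also have "\<dots> = (\<integral>\<^sup>+x. \<integral>\<^sup>+y. b (x + - y) * g x \<partial>\<nu> \<partial>lborel)"
      by (rule Fubini') simp
    also have "\<dots> = (\<integral>\<^sup>+x. \<integral>\<^sup>+y. b (y + - x) * g x \<partial>\<nu> \<partial>lborel)"
    proof (intro nn_integral_cong)
      show "b (x + - y) * g x = b (y + - x) * g x" for x y
        using b_uminus[of "x - y"] by simp
    qed
    also have "\<dots> = (\<integral>\<^sup>+x. (\<integral>\<^sup>+y. b y \<partial>\<nu>) * g x \<partial>lborel)"
      by (simp add: nn_integral_multc shift del: add_uminus_conv_diff)
    finally show ?thesis by (simp add: nn_integral_cmult b\<nu>)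
  qed
  have "\<nu> = lborel"
  proof (rule measure_eqI)
    fix A assume "A \<in> sets \<nu>"
    then have A[measurable]: "A \<in> sets borel" by (simp add: sets_\<nu>)
    have b1: "(\<integral>\<^sup>+x. b x \<partial>lborel) = emeasure lborel (cball (0::'a) 1)"
      by (simp add: b_def)
    have V: "unit_ball_vol (real DIM('a)) \<noteq> 0"
      by (metis less_irrefl of_nat_0_le_iff unit_ball_vol_pos)
    have "(\<integral>\<^sup>+x. b x \<partial>lborel) \<noteq> 0" "(\<integral>\<^sup>+x. b x \<partial>lborel) \<noteq> \<infinity>"
      unfolding b1 using emeasure_lborel_cball_finite[of "0::'a" 1] V
      by (auto simp: emeasure_cball)
    then show "emeasure \<nu> A = emeasure lborel A"
      using key[of "indicator A"] A by (simp add: ennreal_mult_cancel_left sets_\<nu>)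
  qed (simp add: sets_\<nu>)
  then show ?thesis by (simp add: \<nu>_def)
qed

lemma nn_integral_lborel_orthogonal:
  fixes f :: "'a::euclidean_space \<Rightarrow> 'a"
  assumes f: "orthogonal_transformation f" and [measurable]: "g \<in> borel_measurable borel"
  shows "(\<integral>\<^sup>+x. g (f x) \<partial>lborel) = (\<integral>\<^sup>+x. g x \<partial>lborel)"
proof -
  have [measurable]: "f \<in> borel_measurable borel"
    using f by (intro borel_measurable_continuous_onI linear_continuous_on linear_conv_bounded_linear[THEN iffD1]) (auto simp: orthogonal_transformation)
  show ?thesis
    by (subst (2) lborel_orthogonal[OF f, symmetric]) (simp add: nn_integral_distr)
qed

lemma nn_integral_lborel_diagonal:
  fixes c :: "'n::finite \<Rightarrow> real"
  assumes c: "\<And>i. c i \<noteq> 0" and [measurable]: "g \<in> borel_measurable borel"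
  shows "(\<integral>\<^sup>+x. g x \<partial>lborel) = ennreal (\<Prod>i\<in>UNIV. \<bar>c i\<bar>) * (\<integral>\<^sup>+x. g (\<chi> i. c i * x $ i) \<partial>(lborel :: (real^'n) measure))"
proof -
  have sumB: "(\<Sum>j\<in>(Basis::(real^'n) set). G j) = (\<Sum>i\<in>UNIV. G (axis i 1))" for G :: "real^'n \<Rightarrow> real^'n"
  proof -
    have "(Basis::(real^'n) set) = range (\<lambda>i. axis i 1)"
      by (auto simp: Basis_vec_def)
    moreover have "inj (\<lambda>i. axis i (1::real) :: real^'n)"
      by (auto simp: inj_on_def axis_eq_axis)
    ultimately show ?thesis using sum.reindex[of "\<lambda>i. axis i (1::real) :: real^'n" UNIV G] by (simp add: comp_def)
  qed
  define C where "C = (\<lambda>v::real^'n. \<Sum>i\<in>UNIV. c i * v $ i)"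
  have C: "C (axis i 1) = c i" for i
    unfolding C_def by (simp add: axis_def if_distrib cong: if_cong)
  have T: "0 + (\<Sum>j\<in>Basis. (C j * (x \<bullet> j)) *\<^sub>R j) = (\<chi> i. c i * x $ i)" for x :: "real^'n"
  proof -
    have "0 + (\<Sum>j\<in>Basis. (C j * (x \<bullet> j)) *\<^sub>R j) = (\<Sum>i\<in>UNIV. (c i * x $ i) *\<^sub>R axis i 1)"
      by (subst sumB) (simp add: C inner_axis)
    also have "\<dots> = (\<chi> i. c i * x $ i)"
      by (simp add: vec_eq_iff axis_def if_distrib cong: if_cong)
    finally show ?thesis .
  qed
  have [measurable]: "(\<lambda>x. (\<chi> i. c i * x $ i) :: real^'n) \<in> borel_measurable borel"
    by (intro measurable_vec_lambda) (intro borel_measurable_continuous_onI continuous_intros)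
  have "(lborel::(real^'n) measure) = density (distr lborel borel (\<lambda>x. \<chi> i. c i * x $ i)) (\<lambda>_. (\<Prod>j\<in>Basis. \<bar>C j\<bar>))"
  proof -
    have "C j \<noteq> 0" if "j \<in> Basis" for j using that by (auto simp: Basis_vec_def C c)
    from lborel_affine_euclidean[of C 0, OF this] show ?thesis unfolding T .
  qed
  then have "(\<integral>\<^sup>+x. g x \<partial>lborel) = (\<integral>\<^sup>+x. g x \<partial>(density (distr lborel borel (\<lambda>x. \<chi> i. c i * x $ i)) (\<lambda>_. (\<Prod>j\<in>Basis. \<bar>C j\<bar>))))"
    by metis
  then show ?thesis
    by (simp add: nn_integral_density nn_integral_distr nn_integral_cmult prod_Basis_vec C)
qed

text \<open>The ball of radius \<open>r\<close> has volume \<open>unit_ball_vol k * r ^ k\<close>, so the image of Lebesgue measure under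
  the Euclidean norm and the measure with the derivative of this function as density agree on all
  half-lines \<open>{..r}\<close>.\<close>

lemma radial_PiM:
  fixes g :: "real \<Rightarrow> ennreal"
  assumes A: "finite A" "A \<noteq> {}" and [measurable]: "g \<in> borel_measurable borel"
  defines "k \<equiv> card A"
  shows "(\<integral>\<^sup>+f. g (sqrt (\<Sum>i\<in>A. (f i)\<^sup>2)) \<partial>(\<Pi>\<^sub>M i\<in>A. lborel)) =
    (\<integral>\<^sup>+r. ennreal (indicator {0..} r * (k * unit_ball_vol k * r ^ (k - 1))) * g r \<partial>lborel)"
proof -
  define N where "N = (\<lambda>f::'a \<Rightarrow> real. sqrt (\<Sum>i\<in>A. (f i)\<^sup>2))"
  have k: "k > 0" using A by (auto simp: k_def card_gt_0_iff)
  have [measurable]: "N \<in> borel_measurable (\<Pi>\<^sub>M i\<in>A. lborel)"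
    unfolding N_def by measurable
  let ?M1 = "distr (\<Pi>\<^sub>M i\<in>A. lborel) borel N"
  define w where "w = (\<lambda>r::real. ennreal (indicator {0..} r * (k * unit_ball_vol k * r ^ (k - 1))))"
  have [measurable]: "w \<in> borel_measurable borel" unfolding w_def by measurable
  have e2: "emeasure (density lborel w) {..r} = ennreal (if r \<ge> 0 then unit_ball_vol k * r ^ k else 0)" for r
  proof (cases "r \<ge> 0")
    case True
    have "emeasure (density lborel w) {..r} = (\<integral>\<^sup>+x. ennreal (k * unit_ball_vol k * x ^ (k - 1)) * indicator {0..r} x \<partial>lborel)"
      by (subst emeasure_density) (auto intro!: nn_integral_cong simp: w_def indicator_def)
    also have "\<dots> = ennreal (unit_ball_vol k * r ^ k - unit_ball_vol k * 0 ^ k)"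
      using True by (intro nn_integral_FTC_Icc[where F = "\<lambda>x. unit_ball_vol k * x ^ k"])
         (auto intro!: derivative_eq_intros)
    finally show ?thesis using True k by simp
  next
    case False
    have "(\<lambda>x. w x * indicator {..r} x) = (\<lambda>x. 0)"
      using False by (auto simp: w_def fun_eq_iff split: split_indicator)
    then have "(\<integral>\<^sup>+x. w x * indicator {..r} x \<partial>lborel) = (\<integral>\<^sup>+x. 0 \<partial>(lborel :: real measure))"
      by (simp only:)
    then have "emeasure (density lborel w) {..r} = 0"
      by (subst emeasure_density) auto
    then show ?thesis using False by simp
  qed
  have e1p: "emeasure ?M1 {..r} = ennreal (unit_ball_vol k * r ^ k)" if "r > 0" for r
  proof -
    have "N -` {..r} \<inter> space (\<Pi>\<^sub>M i\<in>A. lborel) = {f. sqrt (\<Sum>i\<in>A. (f i)\<^sup>2) \<le> r} \<inter> space (\<Pi>\<^sub>M i\<in>A. lborel)"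
      by (auto simp: N_def)
    then show ?thesis
      using emeasure_cball_aux[OF A(1) that] by (subst emeasure_distr) (auto simp: k_def)
  qed
  have e10: "emeasure ?M1 {..0} = 0"
  proof -
    have le: "emeasure ?M1 {..0} \<le> ennreal (unit_ball_vol k * (1 / Suc n) ^ k)" for n
    proof -
      have "emeasure ?M1 {..0} \<le> emeasure ?M1 {..1 / Suc n}" by (intro emeasure_mono) auto
      also have "\<dots> = ennreal (unit_ball_vol k * (1 / Suc n) ^ k)" by (rule e1p) simp
      finally show ?thesis .
    qed
    have "(\<lambda>n. ennreal (unit_ball_vol k * (1 / Suc n) ^ k)) \<longlonglongrightarrow> ennreal (unit_ball_vol k * 0 ^ k)"
      by (intro tendsto_ennrealI tendsto_intros) (use LIMSEQ_inverse_real_of_nat in \<open>simp add: inverse_eq_divide\<close>)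
    from tendsto_lowerbound[OF this, of "emeasure ?M1 {..0}"] le k show ?thesis by (simp add: power_0_left)
  qed
  have e1: "emeasure ?M1 {..r} = ennreal (if r \<ge> 0 then unit_ball_vol k * r ^ k else 0)" for r
  proof -
    consider "r > 0" | "r = 0" | "r < 0" by linarith
    then show ?thesis
    proof cases
      case 3
      have "emeasure ?M1 {..r} \<le> emeasure ?M1 {..0}" using 3 by (intro emeasure_mono) auto
      then show ?thesis using e10 3 by simp
    qed (use e1p e10 k in auto)
  qed
  have "?M1 = density lborel w"
  proof (rule measure_eqI_generator_eq[where E = "range atMost" and \<Omega> = UNIV and A = "\<lambda>n. {..real n}"])
    show "Int_stable (range (atMost :: real \<Rightarrow> _))" by (auto simp: Int_stable_def Int_atMost)
    show "sets ?M1 = sigma_sets UNIV (range atMost)" "sets (density lborel w) = sigma_sets UNIV (range atMost)"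
      by (simp_all add: borel_eq_atMost)
    show "(\<Union>n. {..real n}) = UNIV" by (auto intro: real_arch_simple)
    show "emeasure ?M1 {..real n} \<noteq> \<infinity>" for n unfolding e1 by simp
  qed (auto simp: e1 e2)
  then have "(\<integral>\<^sup>+r. g r \<partial>?M1) = (\<integral>\<^sup>+r. g r \<partial>(density lborel w))" by simp
  then show ?thesis
    by (simp add: nn_integral_distr nn_integral_density N_def w_def)
qed

text \<open>The surface area of the unit sphere, in the form in which it enters \<open>radial_const\<close>.\<close>

lemma sphere_area:
  assumes "k > 0" shows "real k * unit_ball_vol k = 2 * pi powr (k / 2) / Gamma (k / 2)"
proof -
  have "Gamma (real k / 2 + 1) = (real k / 2) * Gamma (real k / 2)"
    using assms by (intro Gamma_plus1) (auto simp: nonpos_Ints_def)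
  moreover have "real k / (real k / 2 * Gamma (real k / 2)) = 2 / Gamma (real k / 2)"
    using assms by simp
  ultimately show ?thesis
    unfolding unit_ball_vol_def by (metis (no_types) mult.commute times_divide_eq_right)
qed

text \<open>The other \<open>k\<close> coordinates enter only through their norm \<open>r\<close>, which \<open>radial_PiM\<close> integrates. The
  substitutions \<open>x $ i = r * \<tau>\<close> and then \<open>u = r * sqrt (1 + \<tau>\<^sup>2)\<close> turn the pair of \<open>x $ i\<close> and \<open>r\<close> into
  the full norm \<open>u\<close> and the slope \<open>\<tau>\<close>, in which the density factorises.\<close>

lemma nn_integral_polar:
  fixes \<phi> :: "real \<times> real \<Rightarrow> ennreal" and i :: "'n::finite"
  assumes d: "CARD('n) \<ge> 2" and [measurable]: "\<phi> \<in> borel_measurable (borel \<Otimes>\<^sub>M borel)"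
  defines "k \<equiv> CARD('n) - 1"
  shows "(\<integral>\<^sup>+x. \<phi> (x $ i, norm x) \<partial>(lborel :: (real^'n) measure)) =
    (\<integral>\<^sup>+\<tau>. \<integral>\<^sup>+u. ennreal (indicator {0<..} u * (k * unit_ball_vol k * u ^ k / sqrt (1 + \<tau>\<^sup>2) ^ (k + 1))) *
        \<phi> (u * \<tau> / sqrt (1 + \<tau>\<^sup>2), u) \<partial>lborel \<partial>lborel)"
proof -
  interpret product_sigma_finite "\<lambda>_::'n. lborel :: real measure" by standard
  define A where "A = UNIV - {i}"
  have UA: "UNIV = insert i A" and iA: "i \<notin> A" and fA: "finite A" by (auto simp: A_def)
  have cA: "card A = k" by (simp add: A_def k_def)
  with d have neA: "A \<noteq> {}" by (auto simp: k_def)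
  have kp: "k > 0" using d by (simp add: k_def)
  let ?w = "\<lambda>r::real. ennreal (indicator {0<..} r * (k * unit_ball_vol k * r ^ (k - 1)))"
  have "(\<integral>\<^sup>+x. \<phi> (x $ i, norm x) \<partial>(lborel :: (real^'n) measure)) =
      (\<integral>\<^sup>+f. \<phi> (f i, sqrt (\<Sum>j\<in>UNIV. (f j)\<^sup>2)) \<partial>(\<Pi>\<^sub>M i\<in>UNIV. lborel))"
    by (subst nn_integral_lborel_vec) (auto simp: norm_vec_def L2_set_def)
  also have "\<dots> = (\<integral>\<^sup>+t. \<integral>\<^sup>+f. \<phi> (t, sqrt (t\<^sup>2 + (sqrt (\<Sum>j\<in>A. (f j)\<^sup>2))\<^sup>2)) \<partial>(\<Pi>\<^sub>M i\<in>A. lborel) \<partial>lborel)"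
  proof (unfold UA, subst product_nn_integral_insert_rev[OF fA iA], goal_cases)
    case 2
    have "(\<Sum>j\<in>A. (if j = i then t else f j)\<^sup>2) = (\<Sum>j\<in>A. (f j)\<^sup>2)" for t :: real and f
      using iA by (intro sum.cong) auto
    then show ?case using fA iA by (simp add: sum_nonneg)
  qed simp
  also have "\<dots> = (\<integral>\<^sup>+t. \<integral>\<^sup>+r. ennreal (indicator {0..} r * (k * unit_ball_vol k * r ^ (k - 1))) * \<phi> (t, sqrt (t\<^sup>2 + r\<^sup>2)) \<partial>lborel \<partial>lborel)"
    by (subst radial_PiM[OF fA neA]) (simp_all add: cA)
  also have "\<dots> = (\<integral>\<^sup>+t. \<integral>\<^sup>+r. ?w r * \<phi> (t, sqrt (t\<^sup>2 + r\<^sup>2)) \<partial>lborel \<partial>lborel)"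
  proof (rule nn_integral_cong, rule nn_integral_cong_AE)
    show "AE r in lborel. ennreal (indicator {0..} r * (k * unit_ball_vol k * r ^ (k - 1))) * \<phi> (t, sqrt (t\<^sup>2 + r\<^sup>2)) =
       ?w r * \<phi> (t, sqrt (t\<^sup>2 + r\<^sup>2))" for t
      using AE_lborel_singleton[of "0::real"] by eventually_elim (auto simp: indicator_def)
  qed
  also have "\<dots> = (\<integral>\<^sup>+r. \<integral>\<^sup>+t. ?w r * \<phi> (t, sqrt (t\<^sup>2 + r\<^sup>2)) \<partial>lborel \<partial>lborel)"
    by (rule lborel_pair.Fubini'[symmetric]) simp
  also have "\<dots> = (\<integral>\<^sup>+r. \<integral>\<^sup>+\<tau>. ennreal (indicator {0<..} r * (k * unit_ball_vol k * r ^ k)) * \<phi> (r * \<tau>, r * sqrt (1 + \<tau>\<^sup>2)) \<partial>lborel \<partial>lborel)"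
  proof (rule nn_integral_cong)
    fix r :: real
    show "(\<integral>\<^sup>+t. ?w r * \<phi> (t, sqrt (t\<^sup>2 + r\<^sup>2)) \<partial>lborel) = (\<integral>\<^sup>+\<tau>. ennreal (indicator {0<..} r * (k * unit_ball_vol k * r ^ k)) * \<phi> (r * \<tau>, r * sqrt (1 + \<tau>\<^sup>2)) \<partial>lborel)"
    proof (cases "r > 0")
      case True
      have s: "sqrt ((r * \<tau>)\<^sup>2 + r\<^sup>2) = r * sqrt (1 + \<tau>\<^sup>2)" for \<tau>
      proof -
        have "(r * \<tau>)\<^sup>2 + r\<^sup>2 = r\<^sup>2 * (1 + \<tau>\<^sup>2)" by (simp add: algebra_simps power_mult_distrib)
        then show ?thesis using True by (simp add: real_sqrt_mult)
      qed
      have "(\<integral>\<^sup>+t. ?w r * \<phi> (t, sqrt (t\<^sup>2 + r\<^sup>2)) \<partial>lborel) = ennreal r * (\<integral>\<^sup>+\<tau>. ?w r * \<phi> (r * \<tau>, r * sqrt (1 + \<tau>\<^sup>2)) \<partial>lborel)"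
        using True by (subst nn_integral_real_affine[of _ r 0]) (simp_all add: s)
      also have "\<dots> = (\<integral>\<^sup>+\<tau>. ennreal r * (?w r * \<phi> (r * \<tau>, r * sqrt (1 + \<tau>\<^sup>2))) \<partial>lborel)"
        by (subst nn_integral_cmult) auto
      also have "\<dots> = (\<integral>\<^sup>+\<tau>. ennreal (indicator {0<..} r * (k * unit_ball_vol k * r ^ k)) * \<phi> (r * \<tau>, r * sqrt (1 + \<tau>\<^sup>2)) \<partial>lborel)"
      proof (intro nn_integral_cong)
        fix \<tau> :: real
        have "r * (k * unit_ball_vol k * r ^ (k - 1)) = k * unit_ball_vol k * r ^ k"
          using kp by (cases k) auto
        then have "ennreal r * ?w r = ennreal (indicator {0<..} r * (k * unit_ball_vol k * r ^ k))"
          using True by (subst ennreal_mult'[symmetric]) simp_all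
        then show "ennreal r * (?w r * \<phi> (r * \<tau>, r * sqrt (1 + \<tau>\<^sup>2))) = ennreal (indicator {0<..} r * (k * unit_ball_vol k * r ^ k)) * \<phi> (r * \<tau>, r * sqrt (1 + \<tau>\<^sup>2))"
          by (simp only: mult.assoc[symmetric])
      qed
      finally show ?thesis .
    qed simp
  qed
  also have "\<dots> = (\<integral>\<^sup>+\<tau>. \<integral>\<^sup>+r. ennreal (indicator {0<..} r * (k * unit_ball_vol k * r ^ k)) * \<phi> (r * \<tau>, r * sqrt (1 + \<tau>\<^sup>2)) \<partial>lborel \<partial>lborel)"
    by (rule lborel_pair.Fubini'[symmetric]) simp
  also have "\<dots> = (\<integral>\<^sup>+\<tau>. \<integral>\<^sup>+u. ennreal (indicator {0<..} u * (k * unit_ball_vol k * u ^ k / sqrt (1 + \<tau>\<^sup>2) ^ (k + 1))) *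
        \<phi> (u * \<tau> / sqrt (1 + \<tau>\<^sup>2), u) \<partial>lborel \<partial>lborel)"
  proof (rule nn_integral_cong)
    fix \<tau> :: real
    define s where "s = sqrt (1 + \<tau>\<^sup>2)"
    have s: "s > 0" unfolding s_def by (simp add: add_pos_nonneg)
    have "(\<integral>\<^sup>+r. ennreal (indicator {0<..} r * (k * unit_ball_vol k * r ^ k)) * \<phi> (r * \<tau>, r * s) \<partial>lborel)
      = ennreal (1 / s) * (\<integral>\<^sup>+u. ennreal (indicator {0<..} (u / s) * (k * unit_ball_vol k * (u / s) ^ k)) * \<phi> ((u / s) * \<tau>, (u / s) * s) \<partial>lborel)"
      using s by (subst nn_integral_real_affine[of _ "1 / s" 0]) (simp_all)
    also have "\<dots> = (\<integral>\<^sup>+u. ennreal (1 / s) * (ennreal (indicator {0<..} (u / s) * (k * unit_ball_vol k * (u / s) ^ k)) * \<phi> ((u / s) * \<tau>, (u / s) * s)) \<partial>lborel)"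
      by (subst nn_integral_cmult) auto
    also have "\<dots> = (\<integral>\<^sup>+u. ennreal (indicator {0<..} u * (k * unit_ball_vol k * u ^ k / s ^ (k + 1))) * \<phi> (u * \<tau> / s, u) \<partial>lborel)"
    proof (intro nn_integral_cong)
      fix u :: real
      have "1 / s * (indicator {0<..} (u / s) * (k * unit_ball_vol k * (u / s) ^ k)) = indicator {0<..} u * (k * unit_ball_vol k * u ^ k / s ^ (k + 1))"
        using s by (simp add: indicator_def power_divide zero_less_divide_iff)
      then show "ennreal (1 / s) * (ennreal (indicator {0<..} (u / s) * (k * unit_ball_vol k * (u / s) ^ k)) * \<phi> ((u / s) * \<tau>, (u / s) * s)) = ennreal (indicator {0<..} u * (k * unit_ball_vol k * u ^ k / s ^ (k + 1))) * \<phi> (u * \<tau> / s, u)"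
        using s by (simp add: mult.assoc[symmetric] ennreal_mult'[symmetric] del: times_divide_eq_right)
    qed
    finally show "(\<integral>\<^sup>+r. ennreal (indicator {0<..} r * (k * unit_ball_vol k * r ^ k)) * \<phi> (r * \<tau>, r * sqrt (1 + \<tau>\<^sup>2)) \<partial>lborel) =
      (\<integral>\<^sup>+u. ennreal (indicator {0<..} u * (k * unit_ball_vol k * u ^ k / sqrt (1 + \<tau>\<^sup>2) ^ (k + 1))) * \<phi> (u * \<tau> / sqrt (1 + \<tau>\<^sup>2), u) \<partial>lborel)"
      by (simp add: s_def)
  qed
  finally show ?thesis .
qed

section \<open>Spherical laws with a radial density\<close>

text \<open>The law of the standardised observations: the elliptical law with centre \<open>0\<close> and matrix \<open>I\<close>.\<close>

definition spherical :: "(real \<Rightarrow> real) \<Rightarrow> (real ^ 'n) measure" where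
  "spherical h = density lborel (\<lambda>z. ennreal (h ((norm z)\<^sup>2) / enn2real (radial_const CARD('n) h)))"

text \<open>Nothing is known about a profile on the negative half-line, where it need not be measurable.\<close>

lemma measurable_profile:
  assumes "h \<in> borel_measurable (restrict_space borel {0..})" "g \<in> borel_measurable M" "\<And>x. g x \<ge> (0::real)"
  shows "(\<lambda>x. h (g x) :: real) \<in> borel_measurable M"
  using assms(1) by (rule measurable_compose[rotated]) (use assms in \<open>auto intro!: measurable_restrict_space2\<close>)

text \<open>The standing assumptions on the profile. The dimension is a number here, since the constants of
  dimensions \<open>d\<close> and \<open>d - 1\<close> both occur.\<close>

locale profile =
  fixes h :: "real \<Rightarrow> real" and d :: nat
  assumes d2: "d \<ge> 2"
    and h_meas: "h \<in> borel_measurable (restrict_space borel {0..})"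
    and h_nonneg: "\<And>t. t \<ge> 0 \<Longrightarrow> h t \<ge> 0"
    and c_pos: "0 < radial_const d h" and c_fin: "radial_const d h < \<infinity>"
    and h_bdd: "\<exists>\<epsilon>>0. bdd_above (h ` {0..\<epsilon>})"
begin

lemma h_sq_measurable [measurable]: "(\<lambda>r. h (r\<^sup>2)) \<in> borel_measurable borel"
  by (intro measurable_profile[OF h_meas]) auto

definition c :: real where "c = enn2real (radial_const d h)"

lemma c_gt0: "c > 0"
  using c_pos c_fin by (simp add: c_def enn2real_positive_iff)

lemma ennreal_c: "ennreal c = radial_const d h"
  using c_fin by (simp add: c_def less_top[symmetric] ennreal_enn2real_if)

text \<open>Radial moments: \<open>radial_const k h\<close> is the area of the unit sphere of \<open>k\<close>-space times
  \<open>mom (k - 1)\<close>. They are extended reals because the finiteness of \<open>mom (d - 2)\<close> is a result.\<close>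

definition mom :: "nat \<Rightarrow> ennreal" where
  "mom k = (\<integral>\<^sup>+r. ennreal (indicator {0<..} r * (r ^ k * h (r\<^sup>2))) \<partial>lborel)"

lemma radial_const_mom:
  assumes "k > 0"
  shows "radial_const k h = ennreal (k * unit_ball_vol k) * mom (k - 1)"
proof -
  have "(\<integral>\<^sup>+r\<in>{0..}. ennreal (r ^ (k - 1) * h (r\<^sup>2)) \<partial>lborel) = mom (k - 1)"
    unfolding mom_def
    by (rule nn_integral_cong_AE, use AE_lborel_singleton[of "0::real"] in eventually_elim) (auto simp: indicator_def)
  then show ?thesis
    unfolding radial_const_def sphere_area[OF assms] by simp
qed

lemma radial_const_lborel:
  assumes "CARD('n::finite) = d"
  shows "(\<integral>\<^sup>+x. ennreal (h ((norm x)\<^sup>2)) \<partial>(lborel :: (real^'n) measure)) = radial_const d h"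
proof -
  have "(\<integral>\<^sup>+x. ennreal (h ((norm x)\<^sup>2)) \<partial>(lborel :: (real^'n) measure))
    = (\<integral>\<^sup>+f. ennreal (h ((sqrt (\<Sum>j\<in>UNIV. (f j)\<^sup>2))\<^sup>2)) \<partial>(\<Pi>\<^sub>M i\<in>(UNIV::'n set). lborel))"
    by (subst nn_integral_lborel_vec) (auto simp: norm_vec_def L2_set_def)
  also have "\<dots> = (\<integral>\<^sup>+r. ennreal (indicator {0..} r * (d * unit_ball_vol d * r ^ (d - 1))) * ennreal (h (r\<^sup>2)) \<partial>lborel)"
    by (subst radial_PiM) (simp_all add: assms)
  also have "\<dots> = (\<integral>\<^sup>+r. ennreal (d * unit_ball_vol d) * ennreal (indicator {0<..} r * (r ^ (d - 1) * h (r\<^sup>2))) \<partial>lborel)"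
    by (rule nn_integral_cong_AE, use AE_lborel_singleton[of "0::real"] in eventually_elim)
       (auto simp: indicator_def ennreal_mult'[symmetric] h_nonneg mult_ac)
  also have "\<dots> = radial_const d h"
    using d2 by (subst nn_integral_cmult) (auto simp: radial_const_mom mom_def)
  finally show ?thesis .
qed

lemma mom_fin: "mom (d - 1) < \<infinity>" and mom_pos: "mom (d - 1) > 0"
proof -
  have "unit_ball_vol d > 0" by simp
  then have K: "unit_ball_vol d \<noteq> 0" by linarith
  show "mom (d - 1) < \<infinity>" "mom (d - 1) > 0"
    using c_fin c_pos d2 K by (auto simp: radial_const_mom ennreal_mult_less_top ennreal_zero_less_mult_iff)
qed

text \<open>On a neighbourhood \<open>r \<le> a\<close> of the origin the profile is bounded, and for \<open>r > a\<close> the integrand is at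
  most \<open>1 / a\<close> times that of \<open>mom (d - 1)\<close>. This is where local boundedness of the profile enters.\<close>

lemma mom_lower_fin: "mom (d - 2) < \<infinity>"
proof -
  obtain \<epsilon> B where e: "\<epsilon> > 0" and B: "\<And>t. 0 \<le> t \<Longrightarrow> t \<le> \<epsilon> \<Longrightarrow> h t \<le> B"
    using h_bdd unfolding bdd_above_def by fastforce
  define a where "a = sqrt \<epsilon>"
  have a: "a > 0" using e by (simp add: a_def)
  have B0: "B \<ge> 0" using B[of 0] h_nonneg[of 0] e by auto
  have "mom (d - 2) \<le> (\<integral>\<^sup>+r. (ennreal (a ^ (d - 2) * B) * indicator {0..a} r + ennreal (1 / a) * ennreal (indicator {0<..} r * (r ^ (d - 1) * h (r\<^sup>2)))) \<partial>lborel)"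
    unfolding mom_def
  proof (rule nn_integral_mono)
    fix r :: real
    have h0: "h (r\<^sup>2) \<ge> 0" by (simp add: h_nonneg)
    show "ennreal (indicator {0<..} r * (r ^ (d - 2) * h (r\<^sup>2))) \<le> ennreal (a ^ (d - 2) * B) * indicator {0..a} r + ennreal (1 / a) * ennreal (indicator {0<..} r * (r ^ (d - 1) * h (r\<^sup>2)))"
    proof (cases "r > 0")
      case r: True
      show ?thesis
      proof (cases "r \<le> a")
        case True
        have "r\<^sup>2 \<le> \<epsilon>" using power_mono[of r a 2] r True e by (simp add: a_def)
        then have "r ^ (d - 2) * h (r\<^sup>2) \<le> a ^ (d - 2) * B"
          using r True B0 a by (intro mult_mono power_mono B h0) auto
        then have "ennreal (r ^ (d - 2) * h (r\<^sup>2)) \<le> ennreal (a ^ (d - 2) * B)"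
          by (rule ennreal_leI)
        then show ?thesis using r True by (simp add: add_increasing2)
      next
        case False
        have "r ^ (d - 2) * a \<le> r ^ (d - 2) * r" using r False by (intro mult_left_mono) auto
        also have "\<dots> = r ^ (d - 1)" 
        proof -
          have "d - 1 = Suc (d - 2)" using d2 by simp
          then show ?thesis by simp
        qed
        finally have "r ^ (d - 2) * h (r\<^sup>2) \<le> 1 / a * (r ^ (d - 1) * h (r\<^sup>2))"
          using a h0 by (simp add: field_simps) (metis mult.commute mult.left_commute mult_left_mono)
        then show ?thesis using r a False
          by (simp add: ennreal_mult'[symmetric] ennreal_leI)
      qed
    qed simp
  qed
  also have "\<dots> = ennreal (a ^ (d - 2) * B) * ennreal a + ennreal (1 / a) * mom (d - 1)"
    using a by (subst nn_integral_add) (auto simp: nn_integral_cmult mom_def)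
  also have "\<dots> < \<infinity>"
    using mom_fin by (simp add: ennreal_mult_less_top)
  finally show ?thesis .
qed

lemma mom_lower_pos: "mom (d - 2) > 0"
proof (rule ccontr)
  assume "\<not> mom (d - 2) > 0"
  then have "mom (d - 2) = 0" by (simp add: not_less)
  then have "AE r in lborel. ennreal (indicator {0<..} r * (r ^ (d - 2) * h (r\<^sup>2))) = 0"
    unfolding mom_def by (subst (asm) nn_integral_0_iff_AE) auto
  then have "AE r in lborel. ennreal (indicator {0<..} r * (r ^ (d - 1) * h (r\<^sup>2))) = 0"
  proof eventually_elim
    case (elim r)
    show ?case
    proof (cases "r > 0")
      case True
      then have "h (r\<^sup>2) \<le> 0"
        using elim zero_less_power[OF True, of "d - 2"] h_nonneg[of "r\<^sup>2"] by (simp add: ennreal_eq_0_iff mult_le_0_iff)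
      then show ?thesis using True by (simp add: ennreal_eq_0_iff mult_le_0_iff)
    qed simp
  qed
  then have "mom (d - 1) = 0"
    unfolding mom_def by (subst nn_integral_0_iff_AE) auto
  with mom_pos show False by simp
qed

text \<open>The density at the origin of every one-dimensional projection of the spherical law; see
  \<open>spherical_slab_deriv\<close>.\<close>

definition f0 :: real where "f0 = enn2real (radial_const (d - 1) h) / c"

definition K :: real where "K = (d - 1) * unit_ball_vol (d - 1)"

lemma K_pos: "K > 0" using d2 by (simp add: K_def)

lemma radial_const_lower: "radial_const (d - 1) h = ennreal K * mom (d - 2)"
  using radial_const_mom[of "d - 1"] d2 by (simp add: K_def numeral_2_eq_2 of_nat_diff)

lemma f0_pos: "f0 > 0"
  using K_pos mom_lower_fin mom_lower_pos c_gt0 by (simp add: f0_def radial_const_lower[simplified] enn2real_mult enn2real_positive_iff)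

lemma ennreal_f0: "ennreal f0 = ennreal (K / c) * mom (d - 2)"
proof -
  obtain m where m: "mom (d - 2) = ennreal m" "m \<ge> 0"
    using mom_lower_fin by (cases "mom (d - 2)") auto
  show ?thesis
    using K_pos c_gt0 m by (simp add: f0_def radial_const_lower[simplified] ennreal_mult'[symmetric] enn2real_mult)
qed

lemma sets_spherical [measurable_cong, simp]: "sets (spherical h) = sets borel"
  by (simp add: spherical_def)

lemma space_spherical [simp]: "space (spherical h) = UNIV"
  by (simp add: spherical_def)

lemma spherical_eq:
  assumes "CARD('n::finite) = d"
  shows "(spherical h :: (real^'n) measure) = density lborel (\<lambda>z. ennreal (h ((norm z)\<^sup>2) / c))"
  by (simp add: spherical_def c_def assms)

lemma h_norm_measurable [measurable]: "(\<lambda>x::'b::real_normed_vector. h ((norm x)\<^sup>2)) \<in> borel_measurable borel"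
  by (intro measurable_profile[OF h_meas]) auto

lemma prob_space_spherical:
  assumes "CARD('n::finite) = d"
  shows "prob_space (spherical h :: (real^'n) measure)"
proof
  have "emeasure (spherical h :: (real^'n) measure) (space (spherical h)) = (\<integral>\<^sup>+x. ennreal (1 / c) * ennreal (h ((norm x)\<^sup>2)) \<partial>(lborel :: (real^'n) measure))"
    unfolding space_spherical spherical_eq[OF assms]
    by (subst emeasure_density) (auto simp: ennreal_mult'[symmetric] c_gt0 less_imp_le)
  also have "\<dots> = 1"
    using c_gt0 by (subst nn_integral_cmult) (auto simp: radial_const_lborel[OF assms] ennreal_c[symmetric] ennreal_mult'[symmetric])
  finally show "emeasure (spherical h :: (real^'n) measure) (space (spherical h)) = 1" .
qed

lemma spherical_rotation:
  assumes "CARD('n::finite) = d" and f: "orthogonal_transformation (f :: real^'n \<Rightarrow> real^'n)"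
  shows "distr (spherical h) borel f = spherical h"
proof (rule measure_eqI)
  have [measurable]: "f \<in> borel_measurable borel"
    using f by (intro borel_measurable_continuous_onI linear_continuous_on linear_conv_bounded_linear[THEN iffD1]) (auto simp: orthogonal_transformation)
  have nf: "norm (f x) = norm x" for x using f by (simp add: orthogonal_transformation)
  fix A assume "A \<in> sets (distr (spherical h) borel f)"
  then have [measurable]: "A \<in> sets borel" by simp
  have "emeasure (distr (spherical h) borel f) A = emeasure (density lborel (\<lambda>z. ennreal (h ((norm z)\<^sup>2) / c))) (f -` A)"
    by (subst emeasure_distr) (simp_all add: spherical_eq[OF assms(1), symmetric])
  also have "\<dots> = (\<integral>\<^sup>+x. ennreal (h ((norm (f x))\<^sup>2) / c) * indicator A (f x) \<partial>lborel)"
    using measurable_sets[of f borel borel A] by (subst emeasure_density) (auto simp: nf indicator_def intro!: nn_integral_cong)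
  also have "\<dots> = emeasure (spherical h) A"
    by (subst nn_integral_lborel_orthogonal[OF f]) (auto simp: spherical_eq[OF assms(1)] emeasure_density)
  finally show "emeasure (distr (spherical h) borel f) A = emeasure (spherical h) A" .
qed simp

lemma vec_nth_measurable [measurable]: "(\<lambda>x::real^'n. x $ i) \<in> borel_measurable borel"
  by (intro borel_measurable_continuous_onI continuous_intros)

text \<open>The joint law of a coordinate and the norm.\<close>

lemma spherical_polar:
  assumes n: "CARD('n::finite) = d" and S[measurable]: "S \<in> sets (borel \<Otimes>\<^sub>M borel)"
  shows "emeasure (spherical h) {x::real^'n. (x $ i, norm x) \<in> S} =
    (\<integral>\<^sup>+u. ennreal (indicator {0<..} u * (K / c * (u ^ (d - 1) * h (u\<^sup>2)))) *
      (\<integral>\<^sup>+\<tau>. ennreal (1 / sqrt (1 + \<tau>\<^sup>2) ^ d) * indicator S (u * \<tau> / sqrt (1 + \<tau>\<^sup>2), u) \<partial>lborel) \<partial>lborel)"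
proof -
  have [measurable]: "{x::real^'n. (x $ i, norm x) \<in> S} \<in> sets borel"
    by measurable
  have dS: "d - 1 + 1 = d" "real (d - 1) = real d - 1" using d2 by auto
  have "emeasure (spherical h) {x::real^'n. (x $ i, norm x) \<in> S} =
    (\<integral>\<^sup>+x. (\<lambda>(t, r). ennreal (h (r\<^sup>2) / c) * indicator S (t, r)) (x $ i, norm x) \<partial>(lborel :: (real^'n) measure))"
    unfolding spherical_eq[OF n] by (subst emeasure_density) (auto simp: indicator_def intro!: nn_integral_cong)
  also have "\<dots> = (\<integral>\<^sup>+\<tau>. \<integral>\<^sup>+u. ennreal (indicator {0<..} u * (K * u ^ (d - 1) / sqrt (1 + \<tau>\<^sup>2) ^ d)) *
        (ennreal (h (u\<^sup>2) / c) * indicator S (u * \<tau> / sqrt (1 + \<tau>\<^sup>2), u)) \<partial>lborel \<partial>lborel)"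
    using d2 by (subst nn_integral_polar) (auto simp: n dS K_def)
  also have "\<dots> = (\<integral>\<^sup>+u. \<integral>\<^sup>+\<tau>. ennreal (indicator {0<..} u * (K * u ^ (d - 1) / sqrt (1 + \<tau>\<^sup>2) ^ d)) *
        (ennreal (h (u\<^sup>2) / c) * indicator S (u * \<tau> / sqrt (1 + \<tau>\<^sup>2), u)) \<partial>lborel \<partial>lborel)"
    by (rule lborel_pair.Fubini'[symmetric]) simp
  also have "\<dots> = (\<integral>\<^sup>+u. \<integral>\<^sup>+\<tau>. ennreal (indicator {0<..} u * (K / c * (u ^ (d - 1) * h (u\<^sup>2)))) *
      (ennreal (1 / sqrt (1 + \<tau>\<^sup>2) ^ d) * indicator S (u * \<tau> / sqrt (1 + \<tau>\<^sup>2), u)) \<partial>lborel \<partial>lborel)"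
  proof (intro nn_integral_cong)
    fix u \<tau> :: real
    have s: "sqrt (1 + \<tau>\<^sup>2) > 0" by (simp add: add_pos_nonneg)
    have "ennreal (indicator {0<..} u * (K * u ^ (d - 1) / sqrt (1 + \<tau>\<^sup>2) ^ d)) * ennreal (h (u\<^sup>2) / c) =
      ennreal (indicator {0<..} u * (K / c * (u ^ (d - 1) * h (u\<^sup>2)))) * ennreal (1 / sqrt (1 + \<tau>\<^sup>2) ^ d)"
      using K_pos c_gt0 s h_nonneg[of "u\<^sup>2"]
      by (cases "u > 0", subst (1 2) ennreal_mult[symmetric]) (auto simp: indicator_def zero_le_mult_iff field_simps)
    then show "ennreal (indicator {0<..} u * (K * u ^ (d - 1) / sqrt (1 + \<tau>\<^sup>2) ^ d)) *
        (ennreal (h (u\<^sup>2) / c) * indicator S (u * \<tau> / sqrt (1 + \<tau>\<^sup>2), u)) = ennreal (indicator {0<..} u * (K / c * (u ^ (d - 1) * h (u\<^sup>2)))) *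
      (ennreal (1 / sqrt (1 + \<tau>\<^sup>2) ^ d) * indicator S (u * \<tau> / sqrt (1 + \<tau>\<^sup>2), u))"
      by (simp only: mult.assoc[symmetric])
  qed
  also have "\<dots> = (\<integral>\<^sup>+u. ennreal (indicator {0<..} u * (K / c * (u ^ (d - 1) * h (u\<^sup>2)))) *
      (\<integral>\<^sup>+\<tau>. ennreal (1 / sqrt (1 + \<tau>\<^sup>2) ^ d) * indicator S (u * \<tau> / sqrt (1 + \<tau>\<^sup>2), u) \<partial>lborel) \<partial>lborel)"
    by (rule nn_integral_cong, rule nn_integral_cmult) simp
  finally show ?thesis .
qed

text \<open>In the coordinates of \<open>spherical_polar\<close> the double cone is, for \<open>u \<le> 1/2\<close>, contained in the set of slopes
  at most \<open>2 * u\<close>, which has length \<open>4 * u\<close>; for \<open>u > 1/2\<close> the trivial bound \<open>1 \<le> 2 * u\<close> suffices.\<close>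

lemma spherical_cone_bound:
  "\<exists>C\<ge>0. \<forall>(i::'n::finite) u. CARD('n) = d \<longrightarrow> u \<ge> 0 \<longrightarrow>
     measure (spherical h) {x::real^'n. \<bar>x $ i\<bar> \<le> u * norm x} \<le> C * u"
proof -
  obtain m where m: "mom (d - 1) = ennreal m" "m \<ge> 0"
    using mom_fin by (cases "mom (d - 1)") auto
  define C where "C = max 2 (4 * (K / c * m))"
  have "measure (spherical h) {x::real^'n. \<bar>x $ i\<bar> \<le> u * norm x} \<le> C * u" if n: "CARD('n) = d" and u: "u \<ge> 0" for i :: 'n and u
  proof -
    interpret Q: prob_space "spherical h :: (real^'n) measure" by (rule prob_space_spherical[OF n])
    show ?thesis
    proof (cases "u \<le> 1 / 2")
      case False
      have "measure (spherical h) {x::real^'n. \<bar>x $ i\<bar> \<le> u * norm x} \<le> 1" by simp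
      also have "1 \<le> 2 * u" using False by simp
      also have "\<dots> \<le> C * u" using u by (intro mult_right_mono) (auto simp: C_def)
      finally show ?thesis .
    next
      case True
      let ?S = "{(t::real, r). \<bar>t\<bar> \<le> u * r}"
      have "?S = {p \<in> space (borel \<Otimes>\<^sub>M borel). \<bar>fst p\<bar> \<le> u * snd p}" by (auto simp: space_pair_measure)
      then have S[measurable]: "?S \<in> sets (borel \<Otimes>\<^sub>M borel)" by simp
      have inner: "(\<integral>\<^sup>+\<tau>. ennreal (1 / sqrt (1 + \<tau>\<^sup>2) ^ d) * indicator ?S (v * \<tau> / sqrt (1 + \<tau>\<^sup>2), v) \<partial>lborel) \<le> ennreal (4 * u)" if v: "v > 0" for v
      proof -
        have "(\<integral>\<^sup>+\<tau>. ennreal (1 / sqrt (1 + \<tau>\<^sup>2) ^ d) * indicator ?S (v * \<tau> / sqrt (1 + \<tau>\<^sup>2), v) \<partial>lborel) \<le> (\<integral>\<^sup>+\<tau>. indicator {-2*u..2*u} \<tau> \<partial>lborel)"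
        proof (rule nn_integral_mono)
          fix \<tau> :: real
          define s where "s = sqrt (1 + \<tau>\<^sup>2)"
          have s: "s \<ge> 1" "s\<^sup>2 = 1 + \<tau>\<^sup>2" by (auto simp: s_def)
          have "\<bar>\<tau>\<bar> \<le> 2 * u" if "\<bar>v * \<tau> / s\<bar> \<le> u * v"
          proof -
            have "\<bar>v * \<tau> / s\<bar> = v * (\<bar>\<tau>\<bar> / s)" using v s by (simp add: abs_mult)
            then have "v * (\<bar>\<tau>\<bar> / s) \<le> v * u" using that by (simp only: mult.commute)
            then have "\<bar>\<tau>\<bar> / s \<le> u" using v by (simp only: mult_le_cancel_left_pos)
            then have "\<bar>\<tau>\<bar> \<le> u * s" using s by (simp add: field_simps)
            then have "\<bar>\<tau>\<bar>\<^sup>2 \<le> (u * s)\<^sup>2" by (intro power_mono) auto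
            then have "\<tau>\<^sup>2 \<le> u\<^sup>2 * (1 + \<tau>\<^sup>2)" by (simp add: power_mult_distrib s)
            moreover have "u\<^sup>2 * \<tau>\<^sup>2 \<le> (1/2)\<^sup>2 * \<tau>\<^sup>2" using True u by (intro mult_right_mono power_mono) auto
            moreover have half: "(1 / 2)\<^sup>2 * \<tau>\<^sup>2 = \<tau>\<^sup>2 / 4" by (simp add: power2_eq_square)
            moreover have "u\<^sup>2 * (1 + \<tau>\<^sup>2) = u\<^sup>2 + u\<^sup>2 * \<tau>\<^sup>2" by (simp add: algebra_simps)
            ultimately have "\<tau>\<^sup>2 \<le> 4 * u\<^sup>2" using zero_le_power2[of u] half by linarith
            then have "\<bar>\<tau>\<bar>\<^sup>2 \<le> (2 * u)\<^sup>2" by (simp add: power_mult_distrib)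
            then show ?thesis using u by (meson abs_ge_zero mult_nonneg_nonneg power2_le_imp_le zero_le_numeral)
          qed
          moreover have "1 / s ^ d \<le> 1" using s by simp
          moreover have "\<tau> \<in> {-2*u..2*u}" if "\<bar>\<tau>\<bar> \<le> 2 * u" using that by auto
          ultimately show "ennreal (1 / sqrt (1 + \<tau>\<^sup>2) ^ d) * indicator ?S (v * \<tau> / sqrt (1 + \<tau>\<^sup>2), v) \<le> indicator {-2*u..2*u} \<tau>"
            unfolding s_def[symmetric] by (cases "\<bar>v * \<tau> / s\<bar> \<le> u * v") (simp_all add: ennreal_le_1)
        qed
        also have "\<dots> = ennreal (4 * u)" using u by simp
        finally show ?thesis .
      qed
      have "emeasure (spherical h) {x::real^'n. (x $ i, norm x) \<in> ?S} \<le> (\<integral>\<^sup>+v. ennreal (indicator {0<..} v * (K / c * (v ^ (d - 1) * h (v\<^sup>2)))) * ennreal (4 * u) \<partial>lborel)"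
        unfolding spherical_polar[OF n S]
      proof (rule nn_integral_mono)
        fix v :: real
        show "ennreal (indicator {0<..} v * (K / c * (v ^ (d - 1) * h (v\<^sup>2)))) *
          (\<integral>\<^sup>+\<tau>. ennreal (1 / sqrt (1 + \<tau>\<^sup>2) ^ d) * indicator ?S (v * \<tau> / sqrt (1 + \<tau>\<^sup>2), v) \<partial>lborel)
          \<le> ennreal (indicator {0<..} v * (K / c * (v ^ (d - 1) * h (v\<^sup>2)))) * ennreal (4 * u)"
        proof (cases "v > 0")
          case True
          then show ?thesis by (intro mult_left_mono inner) auto
        qed simp
      qed
      also have "\<dots> = (\<integral>\<^sup>+v. ennreal (4 * u * (K / c)) * ennreal (indicator {0<..} v * (v ^ (d - 1) * h (v\<^sup>2))) \<partial>lborel)"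
        using K_pos c_gt0 u by (intro nn_integral_cong) (auto simp: indicator_def ennreal_mult'[symmetric] mult_ac h_nonneg)
      also have "\<dots> = ennreal (4 * u * (K / c)) * mom (d - 1)"
        by (subst nn_integral_cmult) (auto simp: mom_def)
      also have "\<dots> = ennreal (4 * (K / c * m) * u)"
        using K_pos c_gt0 u m by (simp add: ennreal_mult'[symmetric] mult_ac)
      finally have "measure (spherical h) {x::real^'n. \<bar>x $ i\<bar> \<le> u * norm x} \<le> 4 * (K / c * m) * u"
        using K_pos c_gt0 u m by (simp add: Q.emeasure_eq_measure)
      also have "\<dots> \<le> C * u" using u by (intro mult_right_mono) (auto simp: C_def)
      finally show ?thesis .
    qed
  qed
  moreover have "C \<ge> 0" by (simp add: C_def)
  ultimately show ?thesis by blast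
qed

text \<open>The contribution of a sphere of radius \<open>u\<close> to the slab \<open>0 < x $ i \<le> w * u\<close>, up to normalisation.\<close>

definition arc :: "real \<Rightarrow> ennreal" where
  "arc w = (\<integral>\<^sup>+\<tau>. ennreal (1 / sqrt (1 + \<tau>\<^sup>2) ^ d) * indicator {\<tau>. 0 < \<tau> \<and> \<tau> / sqrt (1 + \<tau>\<^sup>2) \<le> w} \<tau> \<partial>lborel)"

lemma arc_measurable [measurable]: "arc \<in> borel_measurable borel"
  unfolding arc_def indicator_def by measurable

lemma arc_upper:
  assumes w: "0 \<le> w" "w < 1"
  shows "arc w \<le> ennreal (w / sqrt (1 - w\<^sup>2))"
proof -
  define b where "b = w / sqrt (1 - w\<^sup>2)"
  have w2: "w\<^sup>2 < 1" using w by (simp add: power_less_one_iff abs_square_less_1)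
  have b0: "b \<ge> 0" using w w2 by (simp add: b_def)
  have "arc w \<le> (\<integral>\<^sup>+\<tau>. indicator {0..b} \<tau> \<partial>lborel)"
    unfolding arc_def
  proof (rule nn_integral_mono)
    fix \<tau> :: real
    define s where "s = sqrt (1 + \<tau>\<^sup>2)"
    have s: "s \<ge> 1" "s\<^sup>2 = 1 + \<tau>\<^sup>2" by (auto simp: s_def)
    have "\<tau> \<le> b" if "\<tau> > 0" "\<tau> / s \<le> w"
    proof -
      have "\<tau> \<le> w * s" using that s by (simp add: field_simps)
      then have "\<tau>\<^sup>2 \<le> (w * s)\<^sup>2" using that by (intro power_mono) auto
      then have "\<tau>\<^sup>2 * (1 - w\<^sup>2) \<le> w\<^sup>2" by (simp add: power_mult_distrib s algebra_simps)
      then have "\<tau>\<^sup>2 \<le> w\<^sup>2 / (1 - w\<^sup>2)" using w2 by (simp add: field_simps)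
      also have "\<dots> = b\<^sup>2" using w2 by (simp add: b_def power_divide)
      finally show ?thesis using b0 by (rule power2_le_imp_le)
    qed
    moreover have "1 / s ^ d \<le> 1" using s by simp
    ultimately show "ennreal (1 / sqrt (1 + \<tau>\<^sup>2) ^ d) * indicator {\<tau>. 0 < \<tau> \<and> \<tau> / sqrt (1 + \<tau>\<^sup>2) \<le> w} \<tau> \<le> indicator {0..b} \<tau>"
      unfolding s_def by (auto simp: indicator_def ennreal_le_1)
  qed
  also have "\<dots> = ennreal b" using b0 by simp
  finally show ?thesis by (simp add: b_def)
qed

lemma arc_lower:
  assumes w: "0 \<le> w"
  shows "ennreal (w / sqrt (1 + w\<^sup>2) ^ d) \<le> arc w"
proof -
  have "ennreal (w / sqrt (1 + w\<^sup>2) ^ d) = (\<integral>\<^sup>+\<tau>. ennreal (1 / sqrt (1 + w\<^sup>2) ^ d) * indicator {0<..w} \<tau> \<partial>lborel)"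
    using w by (subst nn_integral_cmult) (auto simp: ennreal_mult'[symmetric])
  also have "\<dots> \<le> arc w"
    unfolding arc_def
  proof (rule nn_integral_mono)
    fix \<tau> :: real
    show "ennreal (1 / sqrt (1 + w\<^sup>2) ^ d) * indicator {0<..w} \<tau> \<le> ennreal (1 / sqrt (1 + \<tau>\<^sup>2) ^ d) * indicator {\<tau>. 0 < \<tau> \<and> \<tau> / sqrt (1 + \<tau>\<^sup>2) \<le> w} \<tau>"
    proof (cases "0 < \<tau> \<and> \<tau> \<le> w")
      case True
      have s: "1 \<le> sqrt (1 + \<tau>\<^sup>2)" "0 < 1 + \<tau>\<^sup>2" "0 < 1 + w\<^sup>2" by (auto intro: add_pos_nonneg)
      have "\<tau> / sqrt (1 + \<tau>\<^sup>2) \<le> \<tau> / 1" using True s by (intro divide_left_mono) auto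
      moreover have "1 / sqrt (1 + w\<^sup>2) ^ d \<le> 1 / sqrt (1 + \<tau>\<^sup>2) ^ d"
        using True s by (intro divide_left_mono power_mono mult_pos_pos zero_less_power real_sqrt_le_mono add_left_mono real_sqrt_gt_zero add_pos_nonneg) auto
      ultimately show ?thesis using True by (simp add: ennreal_leI)
    qed (auto simp: indicator_def)
  qed
  finally show ?thesis .
qed

lemma arc_bounded: "arc w \<le> ennreal (pi / 2)"
proof -
  have "arc w \<le> (\<integral>\<^sup>+\<tau>. ennreal (inverse (1 + \<tau>\<^sup>2)) * indicator {0..} \<tau> \<partial>lborel)"
    unfolding arc_def
  proof (rule nn_integral_mono)
    fix \<tau> :: real
    have "sqrt (1 + \<tau>\<^sup>2) ^ 2 \<le> sqrt (1 + \<tau>\<^sup>2) ^ d" using d2 by (intro power_increasing) auto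
    then have "1 / sqrt (1 + \<tau>\<^sup>2) ^ d \<le> inverse (1 + \<tau>\<^sup>2)"
      by (subst inverse_eq_divide, intro divide_left_mono) (auto intro!: mult_pos_pos zero_less_power add_pos_nonneg)
    then show "ennreal (1 / sqrt (1 + \<tau>\<^sup>2) ^ d) * indicator {\<tau>. 0 < \<tau> \<and> \<tau> / sqrt (1 + \<tau>\<^sup>2) \<le> w} \<tau> \<le> ennreal (inverse (1 + \<tau>\<^sup>2)) * indicator {0..} \<tau>"
      by (auto simp: indicator_def ennreal_leI)
  qed
  also have "\<dots> = ennreal (pi / 2 - arctan 0)"
    by (rule nn_integral_FTC_atLeast) (auto intro!: DERIV_arctan tendsto_arctan_at_top borel_measurable_continuous_onI continuous_intros simp: add_nonneg_eq_0_iff)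
  finally show ?thesis by simp
qed

text \<open>A bound that is global in \<open>w\<close>, as required for dominated convergence.\<close>

lemma arc_le_linear:
  assumes w: "w \<ge> 0"
  shows "arc w \<le> ennreal (4 * w)"
proof (cases "w \<le> 1 / 2")
  case True
  have "w\<^sup>2 \<le> (1/2)\<^sup>2" using w True by (intro power_mono) auto
  then have w2: "w\<^sup>2 < 1" by (simp add: power2_eq_square)
  have "sqrt (1 / 4) \<le> sqrt (1 - w\<^sup>2)" using \<open>w\<^sup>2 \<le> _\<close> by (intro real_sqrt_le_mono) (simp add: power2_eq_square)
  then have "1 / 2 \<le> sqrt (1 - w\<^sup>2)" by (simp add: real_sqrt_divide)
  then have "w / sqrt (1 - w\<^sup>2) \<le> w / (1 / 2)" using w w2 by (intro divide_left_mono) auto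
  also have "\<dots> \<le> 4 * w" using w by simp
  finally have "w / sqrt (1 - w\<^sup>2) \<le> 4 * w" .
  then show ?thesis using arc_upper[of w] w True by (auto intro: order_trans[OF arc_upper] ennreal_leI)
next
  case False
  then have "pi / 2 \<le> 4 * w" using pi_less_4 by simp
  then show ?thesis using arc_bounded[of w] by (meson ennreal_leI order_trans)
qed

lemma spherical_slab:
  assumes n: "CARD('n::finite) = d" and s: "s > 0"
  shows "emeasure (spherical h) {x::real^'n. 0 < x $ i \<and> x $ i \<le> s} =
    (\<integral>\<^sup>+u. ennreal (indicator {0<..} u * (K / c * (u ^ (d - 1) * h (u\<^sup>2)))) * arc (s / u) \<partial>lborel)"
proof -
  let ?S = "{(t::real, r::real). 0 < t \<and> t \<le> s}"
  have "?S = {p \<in> space (borel \<Otimes>\<^sub>M borel). 0 < fst p \<and> fst p \<le> s}" by (auto simp: space_pair_measure)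
  then have S: "?S \<in> sets (borel \<Otimes>\<^sub>M borel)" by simp
  have eq: "{x::real^'n. 0 < x $ i \<and> x $ i \<le> s} = {x. (x $ i, norm x) \<in> ?S}" by auto
  show ?thesis
    unfolding eq spherical_polar[OF n S]
  proof (rule nn_integral_cong)
    fix u :: real
    show "ennreal (indicator {0<..} u * (K / c * (u ^ (d - 1) * h (u\<^sup>2)))) *
      (\<integral>\<^sup>+\<tau>. ennreal (1 / sqrt (1 + \<tau>\<^sup>2) ^ d) * indicator ?S (u * \<tau> / sqrt (1 + \<tau>\<^sup>2), u) \<partial>lborel) =
      ennreal (indicator {0<..} u * (K / c * (u ^ (d - 1) * h (u\<^sup>2)))) * arc (s / u)"
    proof (cases "u > 0")
      case True
      have "indicator ?S (u * \<tau> / sqrt (1 + \<tau>\<^sup>2), u) = (indicator {\<tau>. 0 < \<tau> \<and> \<tau> / sqrt (1 + \<tau>\<^sup>2) \<le> s / u} \<tau> :: ennreal)" for \<tau>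
      proof -
        have p: "sqrt (1 + \<tau>\<^sup>2) > 0" by (simp add: add_pos_nonneg)
        have "u * \<tau> / sqrt (1 + \<tau>\<^sup>2) \<le> s \<longleftrightarrow> \<tau> / sqrt (1 + \<tau>\<^sup>2) \<le> s / u" using True p by (simp add: field_simps)
        moreover have "0 < u * \<tau> / sqrt (1 + \<tau>\<^sup>2) \<longleftrightarrow> 0 < \<tau>" using True p by (simp add: zero_less_divide_iff zero_less_mult_iff)
        ultimately show ?thesis by (simp add: indicator_def)
      qed
      then show ?thesis by (simp add: arc_def)
    qed simp
  qed
qed

text \<open>Since \<open>arc w\<close> behaves like \<open>w\<close> at the origin, the slab of thickness \<open>s\<close> has mass about
  \<open>(K / c) * (\<integral>u. u ^ (d - 1) * h (u\<^sup>2) * (s / u)) = f0 * s\<close>. The limit may be taken under the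
  integral because \<open>arc\<close> grows at most linearly and \<open>mom (d - 2)\<close> is finite.\<close>

lemma spherical_slab_deriv:
  assumes n: "CARD('n::finite) = d"
  shows "((\<lambda>s. measure (spherical h) {x::real^'n. 0 < x $ i \<and> x $ i \<le> s} / s) \<longlongrightarrow> f0) (at_right 0)"
proof (rule tendsto_at_right_sequentially[of 0 1])
  interpret Q: prob_space "spherical h :: (real^'n) measure" by (rule prob_space_spherical[OF n])
  fix S :: "nat \<Rightarrow> real" assume S: "\<And>n. 0 < S n" "S \<longlonglongrightarrow> 0"
  let ?p = "\<lambda>m. measure (spherical h) {x::real^'n. 0 < x $ i \<and> x $ i \<le> S m} / S m"
  let ?g = "\<lambda>m u. ennreal (indicator {0<..} u * (K / c * (u ^ (d - 1) * h (u\<^sup>2)))) * (arc (S m / u) * ennreal (1 / S m))"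
  let ?lim = "\<lambda>u. ennreal (K / c) * ennreal (indicator {0<..} u * (u ^ (d - 2) * h (u\<^sup>2)))"
  have p: "ennreal (?p m) = (\<integral>\<^sup>+u. ?g m u \<partial>lborel)" for m
  proof -
    have "ennreal (?p m) = emeasure (spherical h) {x::real^'n. 0 < x $ i \<and> x $ i \<le> S m} * ennreal (1 / S m)"
      using S(1)[of m] by (simp add: Q.emeasure_eq_measure ennreal_mult''[symmetric])
    also have "\<dots> = (\<integral>\<^sup>+u. ?g m u \<partial>lborel)"
      unfolding spherical_slab[OF n S(1)] by (subst nn_integral_multc[symmetric]) (auto simp: mult_ac)
    finally show ?thesis .
  qed
  have ud: "u * u ^ (d - 2) = u ^ (d - 1)" for u :: real
  proof -
    have "d - 1 = Suc (d - 2)" using d2 by simp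
    then show ?thesis by simp
  qed
  have "(\<lambda>m. \<integral>\<^sup>+u. ?g m u \<partial>lborel) \<longlonglongrightarrow> (\<integral>\<^sup>+u. ?lim u \<partial>lborel)"
  proof (rule nn_integral_dominated_convergence[where w = "\<lambda>u. 4 * ?lim u"])
    show "(\<integral>\<^sup>+u. 4 * ?lim u \<partial>lborel) < \<infinity>"
      using mom_lower_fin by (subst nn_integral_cmult, simp, subst nn_integral_cmult) (auto simp: mom_def[symmetric] ennreal_mult_less_top)
    show "AE u in lborel. ?g m u \<le> 4 * ?lim u" for m
    proof (rule AE_I2)
      fix u :: real
      show "?g m u \<le> 4 * ?lim u"
      proof (cases "u > 0")
        case u: True
        have "arc (S m / u) * ennreal (1 / S m) \<le> ennreal (4 * (S m / u)) * ennreal (1 / S m)"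
          using u S(1)[of m] by (intro mult_right_mono arc_le_linear) auto
        also have "\<dots> = ennreal (4 / u)"
          using u S(1)[of m] by (subst ennreal_mult'[symmetric]) auto
        finally have "?g m u \<le> ennreal (K / c * (u ^ (d - 1) * h (u\<^sup>2))) * ennreal (4 / u)"
          using u by (simp add: mult_left_mono)
        also have "\<dots> = ennreal (4 * (K / c * (u ^ (d - 2) * h (u\<^sup>2))))"
          using u K_pos c_gt0 h_nonneg[of "u\<^sup>2"] by (subst ennreal_mult'[symmetric]) (auto simp: ud[symmetric, simplified One_nat_def] field_simps)
        also have "\<dots> = 4 * ennreal (K / c * (u ^ (d - 2) * h (u\<^sup>2)))"
          by (subst ennreal_mult') auto
        also have "\<dots> = 4 * ?lim u"
          using u K_pos c_gt0 by (subst ennreal_mult') auto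
        finally show ?thesis .
      qed simp
    qed
    show "AE u in lborel. (\<lambda>m. ?g m u) \<longlonglongrightarrow> ?lim u"
    proof (rule AE_I2)
      fix u :: real
      show "(\<lambda>m. ?g m u) \<longlonglongrightarrow> ?lim u"
      proof (cases "u > 0")
        case u: True
        have w0: "(\<lambda>m. S m / u) \<longlonglongrightarrow> 0" using S(2) tendsto_divide[OF S(2) tendsto_const, of u] u by simp
        have lim: "(\<lambda>m. arc (S m / u) * ennreal (1 / S m)) \<longlonglongrightarrow> ennreal (1 / u)"
        proof (rule tendsto_sandwich)
          have ev: "eventually (\<lambda>m. S m / u < 1) sequentially"
            using order_tendstoD(2)[OF w0, of 1] by simp
          show "eventually (\<lambda>m. ennreal (1 / u / sqrt (1 + (S m / u)\<^sup>2) ^ d) \<le> arc (S m / u) * ennreal (1 / S m)) sequentially"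
          proof (rule always_eventually, rule allI)
            fix m
            have "ennreal (1 / u / sqrt (1 + (S m / u)\<^sup>2) ^ d) = ennreal (S m / u / sqrt (1 + (S m / u)\<^sup>2) ^ d) * ennreal (1 / S m)"
              using S(1)[of m] u by (subst ennreal_mult'[symmetric]) (auto simp: add_nonneg_nonneg)
            also have "\<dots> \<le> arc (S m / u) * ennreal (1 / S m)"
              using S(1)[of m] u by (intro mult_right_mono arc_lower) auto
            finally show "ennreal (1 / u / sqrt (1 + (S m / u)\<^sup>2) ^ d) \<le> arc (S m / u) * ennreal (1 / S m)" .
          qed
          show "eventually (\<lambda>m. arc (S m / u) * ennreal (1 / S m) \<le> ennreal (1 / u / sqrt (1 - (S m / u)\<^sup>2))) sequentially"
            using ev
          proof eventually_elim
            case (elim m)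
            have "arc (S m / u) * ennreal (1 / S m) \<le> ennreal (S m / u / sqrt (1 - (S m / u)\<^sup>2)) * ennreal (1 / S m)"
              using S(1)[of m] u elim by (intro mult_right_mono arc_upper) auto
            also have "\<dots> = ennreal (1 / u / sqrt (1 - (S m / u)\<^sup>2))"
              using S(1)[of m] u by (subst ennreal_mult''[symmetric]) auto
            finally show ?case .
          qed
          have "(\<lambda>m. 1 / u / sqrt (1 + (S m / u)\<^sup>2) ^ d) \<longlonglongrightarrow> 1 / u / sqrt (1 + 0\<^sup>2) ^ d"
            by (intro tendsto_intros w0) auto
          then show "(\<lambda>m. ennreal (1 / u / sqrt (1 + (S m / u)\<^sup>2) ^ d)) \<longlonglongrightarrow> ennreal (1 / u)"
            by (intro tendsto_ennrealI) simp
          have "(\<lambda>m. 1 / u / sqrt (1 - (S m / u)\<^sup>2)) \<longlonglongrightarrow> 1 / u / sqrt (1 - 0\<^sup>2)"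
            by (intro tendsto_intros w0) auto
          then show "(\<lambda>m. ennreal (1 / u / sqrt (1 - (S m / u)\<^sup>2))) \<longlonglongrightarrow> ennreal (1 / u)"
            by (intro tendsto_ennrealI) simp
        qed
        have "(\<lambda>m. ?g m u) \<longlonglongrightarrow> ennreal (indicator {0<..} u * (K / c * (u ^ (d - 1) * h (u\<^sup>2)))) * ennreal (1 / u)"
          by (intro ennreal_tendsto_cmult lim) auto
        also have "ennreal (indicator {0<..} u * (K / c * (u ^ (d - 1) * h (u\<^sup>2)))) * ennreal (1 / u) = ?lim u"
          using u K_pos c_gt0 h_nonneg[of "u\<^sup>2"]
          by (subst (1 2) ennreal_mult'[symmetric]) (auto simp: ud[symmetric, simplified One_nat_def] field_simps)
        finally show ?thesis .
      qed simp
    qed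
  qed simp_all
  also have "(\<integral>\<^sup>+u. ?lim u \<partial>lborel) = ennreal f0"
    unfolding ennreal_f0 mom_def by (subst nn_integral_cmult) auto
  finally have "(\<lambda>m. ennreal (?p m)) \<longlonglongrightarrow> ennreal f0" by (simp only: p)
  then show "?p \<longlonglongrightarrow> f0"
    using f0_pos S(1) by (subst (asm) tendsto_ennreal_iff) (auto simp: less_imp_le)
qed simp

lemma spherical_hyperplane_null:
  assumes n: "CARD('n::finite) = d"
  shows "measure (spherical h) {x::real^'n. x $ i = s} = 0"
proof -
  have "negligible {x::real^'n. axis i 1 \<bullet> x = s}" by (rule negligible_hyperplane) (simp add: axis_eq_0_iff)
  then have "negligible {x::real^'n. x $ i = s}" by (simp add: inner_axis')
  then have "{x::real^'n. x $ i = s} \<in> null_sets lebesgue" by (simp add: negligible_iff_null_sets)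
  then have "{x::real^'n. x $ i = s} \<in> null_sets lborel"
    by (subst (asm) null_sets_completion_iff) auto
  then have "AE x in lborel. x \<notin> {x::real^'n. x $ i = s}" by (rule AE_not_in)
  then have "(\<integral>\<^sup>+x. ennreal (h ((norm x)\<^sup>2) / c) * indicator {x::real^'n. x $ i = s} x \<partial>lborel) = 0"
    by (subst nn_integral_0_iff_AE) (auto elim: eventually_mono)
  then have "emeasure (spherical h) {x::real^'n. x $ i = s} = 0"
    unfolding spherical_eq[OF n] by (subst emeasure_density) auto
  then show ?thesis by (simp add: measure_def)
qed

end

section \<open>Rotation invariant laws: projections, cones and wedges\<close>

text \<open>The reflection in the hyperplane orthogonal to \<open>u - v\<close>.\<close>

lemma reflection_exists:
  fixes u v :: "'a::euclidean_space"
  assumes uv: "norm u = norm v"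
  shows "\<exists>f. orthogonal_transformation f \<and> f u = v \<and> (\<forall>w. w \<bullet> u = w \<bullet> v \<longrightarrow> f w = w)"
proof (cases "u = v")
  case True
  then show ?thesis by (intro exI[of _ "\<lambda>x. x"]) (auto simp: orthogonal_transformation)
next
  case False
  define a where "a = u - v"
  define k where "k = 2 / (a \<bullet> a)"
  define f where "f = (\<lambda>x. x - (k * (a \<bullet> x)) *\<^sub>R a)"
  have a0: "a \<bullet> a \<noteq> 0" using False by (simp add: a_def)
  have ka: "k * (a \<bullet> a) = 2" using a0 by (simp add: k_def)
  have lin: "linear f"
    unfolding f_def by (intro linearI) (simp_all add: inner_add_right algebra_simps)
  have "f x \<bullet> f y = x \<bullet> y" for x y
  proof -
    have "f x \<bullet> f y = x \<bullet> y - 2 * k * (a \<bullet> x) * (a \<bullet> y) + k * (a \<bullet> a) * (k * (a \<bullet> x) * (a \<bullet> y))"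
      by (simp add: f_def inner_diff_left inner_diff_right inner_commute algebra_simps)
    then show ?thesis unfolding ka by simp
  qed
  then have "orthogonal_transformation f" using lin by (simp add: orthogonal_transformation_def)
  moreover have "f u = v"
  proof -
    have "u \<bullet> u = v \<bullet> v" using uv by (simp add: norm_eq_sqrt_inner)
    then have "a \<bullet> a = 2 * (a \<bullet> u)" by (simp add: a_def inner_diff_left inner_diff_right inner_commute)
    then have "k * (a \<bullet> u) = 1" using ka by simp
    then show ?thesis by (simp add: f_def a_def)
  qed
  moreover have "f w = w" if "w \<bullet> u = w \<bullet> v" for w
  proof -
    have "a \<bullet> w = 0" using that by (simp add: a_def inner_diff_left inner_commute[of w])
    then show ?thesis by (simp add: f_def)
  qed
  ultimately show ?thesis by blast
qed

text \<open>A first reflection moves \<open>p\<close> to \<open>p'\<close>, a second one the image of \<open>q\<close> to \<open>q'\<close>. The second fixes \<open>p'\<close>, since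
  \<open>p'\<close> has the same inner product with both.\<close>

lemma orthogonal_transformation_pair:
  fixes p q p' q' :: "'a::euclidean_space"
  assumes "norm p = norm p'" "norm q = norm q'" "p \<bullet> q = p' \<bullet> q'"
  shows "\<exists>f. orthogonal_transformation f \<and> f p = p' \<and> f q = q'"
proof -
  obtain f where f: "orthogonal_transformation f" "f p = p'"
    using reflection_exists[OF assms(1)] by blast
  have "norm (f q) = norm q'" using f(1) assms(2) by (simp add: orthogonal_transformation)
  then obtain g where g: "orthogonal_transformation g" "g (f q) = q'" "\<And>w. w \<bullet> f q = w \<bullet> q' \<Longrightarrow> g w = w"
    using reflection_exists[of "f q" q'] by blast
  have "p' \<bullet> f q = p' \<bullet> q'"
    using f assms(3) by (metis orthogonal_transformation_def)
  then have "g p' = p'" by (rule g(3))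
  then show ?thesis
    using f g orthogonal_transformation_compose[OF g(1) f(1)] by (intro exI[of _ "g \<circ> f"]) auto
qed

text \<open>The properties of the standardised law on which the statistical argument rests. The quantitative
  ones are stated for coordinate directions and are transported to all unit vectors by rotation.\<close>

locale spherical_law = prob_space Q for Q :: "(real ^ 'n) measure" +
  fixes f0 :: real
  assumes sets_Q [measurable_cong, simp]: "sets Q = sets borel"
    and rotation: "\<And>f. orthogonal_transformation f \<Longrightarrow> distr Q borel f = Q"
    and cone_bound_axis: "\<exists>C\<ge>0. \<forall>i u. u \<ge> 0 \<longrightarrow> measure Q {z. \<bar>z $ i\<bar> \<le> u * norm z} \<le> C * u"
    and slab_deriv_axis: "\<And>i. ((\<lambda>s. measure Q {z. 0 < z $ i \<and> z $ i \<le> s} / s) \<longlongrightarrow> f0) (at_right 0)"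
    and hyperplane_null_axis: "\<And>i s. measure Q {z. z $ i = s} = 0"
    and f0_pos: "f0 > 0"
begin

lemma space_Q [simp]: "space Q = UNIV"
  using sets_eq_imp_space_eq[OF sets_Q] by simp

lemma rotation_measure:
  assumes f: "orthogonal_transformation f" and S[measurable]: "S \<in> sets borel"
  shows "measure Q {z. f z \<in> S} = measure Q S"
proof -
  have [measurable]: "f \<in> borel_measurable borel"
    using f by (intro borel_measurable_continuous_onI linear_continuous_on linear_conv_bounded_linear[THEN iffD1]) (auto simp: orthogonal_transformation)
  have "measure Q S = measure (distr Q borel f) S" by (simp add: rotation[OF f])
  also have "\<dots> = measure Q (f -` S)" by (subst measure_distr) auto
  also have "f -` S = {z. f z \<in> S}" by auto
  finally show ?thesis by simp
qed

text \<open>A reflection takes the coordinate axis to \<open>p\<close> and preserves norms; so the joint law of \<open>p \<bullet> z\<close> and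
  \<open>norm z\<close> is the same for all unit vectors.\<close>

lemma direction_measure:
  fixes p :: "real^'n" and T :: "(real \<times> real) set"
  assumes p: "norm p = 1" and [measurable]: "T \<in> sets (borel \<Otimes>\<^sub>M borel)"
  shows "measure Q {z. (p \<bullet> z, norm z) \<in> T} = measure Q {z. (z $ i, norm z) \<in> T}"
proof -
  have "norm (axis i 1 :: real^'n) = norm p" using p by simp
  from reflection_exists[OF this] obtain f where f: "orthogonal_transformation f" "f (axis i (1::real)) = p"
    by metis
  have "measure Q {z. f z \<in> {z. (p \<bullet> z, norm z) \<in> T}} = measure Q {z. (p \<bullet> z, norm z) \<in> T}"
    by (rule rotation_measure[OF f(1)]) measurable
  also have "{z. f z \<in> {z. (p \<bullet> z, norm z) \<in> T}} = {z. (z $ i, norm z) \<in> T}"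
  proof -
    have "p \<bullet> f z = z $ i" for z
      using f by (metis inner_axis' mult_1 orthogonal_transformation_def real_inner_1_left inner_real_def)
    then show ?thesis using f(1) by (simp add: orthogonal_transformation)
  qed
  finally show ?thesis by simp
qed

lemma direction_measure_pred:
  fixes p :: "real^'n"
  assumes p: "norm p = 1" and P[measurable]: "Measurable.pred (borel \<Otimes>\<^sub>M borel) (\<lambda>x. P (fst x) (snd x))"
  shows "measure Q {z. P (p \<bullet> z) (norm z)} = measure Q {z. P (z $ i) (norm z)}"
proof -
  have "{x. P (fst x) (snd x)} \<in> sets (borel \<Otimes>\<^sub>M (borel :: real measure))"
    using P by (simp add: pred_def space_pair_measure)
  from direction_measure[OF p this, of i] show ?thesis by simp
qed

lemma cone_bound: "\<exists>C>0. \<forall>p u. norm p = 1 \<longrightarrow> u \<ge> 0 \<longrightarrow> measure Q {z. \<bar>p \<bullet> z\<bar> \<le> u * norm z} \<le> C * u"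
proof -
  obtain C where C: "C \<ge> 0" "\<And>i u. u \<ge> 0 \<Longrightarrow> measure Q {z. \<bar>z $ i\<bar> \<le> u * norm z} \<le> C * u"
    using cone_bound_axis by blast
  have "measure Q {z. \<bar>p \<bullet> z\<bar> \<le> u * norm z} \<le> (C + 1) * u" if "norm p = 1" "u \<ge> 0" for p :: "real^'n" and u
  proof -
    have "measure Q {z. \<bar>p \<bullet> z\<bar> \<le> u * norm z} = measure Q {z. \<bar>z $ undefined\<bar> \<le> u * norm z}"
      by (rule direction_measure_pred[OF that(1)]) simp
    also have "\<dots> \<le> C * u" by (rule C(2)[OF that(2)])
    also have "\<dots> \<le> (C + 1) * u" using that by (intro mult_right_mono) auto
    finally show ?thesis .
  qed
  then show ?thesis using C(1) by (intro exI[of _ "C + 1"]) auto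
qed

lemma hyperplane_null:
  assumes "norm p = 1" shows "measure Q {z. p \<bullet> z = s} = 0"
  using direction_measure_pred[OF assms, of "\<lambda>t r. t = s" undefined] hyperplane_null_axis by simp

lemma hyperplane_AE:
  assumes "norm p = 1" shows "AE z in Q. p \<bullet> z \<noteq> s"
proof -
  have "{z. p \<bullet> z = s} \<in> null_sets Q"
    using hyperplane_null[OF assms, of s] by (intro null_setsI) (auto simp: emeasure_eq_measure)
  then show ?thesis by (auto dest: AE_not_in)
qed

lemma slab_deriv:
  assumes "norm p = 1" shows "((\<lambda>s. measure Q {z. 0 < p \<bullet> z \<and> p \<bullet> z \<le> s} / s) \<longlongrightarrow> f0) (at_right 0)"
  using slab_deriv_axis[of undefined]
  by (subst direction_measure_pred[OF assms, of "\<lambda>t r. 0 < t \<and> t \<le> s" undefined for s]) auto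

lemma uminus_measure: "S \<in> sets borel \<Longrightarrow> measure Q {z. - z \<in> S} = measure Q S"
  by (rule rotation_measure) (auto simp: orthogonal_transformation_neg intro!: orthogonal_transformation_def[THEN iffD2] linear_uminus)

text \<open>The survival function common to all projections \<open>p \<bullet> z\<close>; the choice of the coordinate is immaterial
  by \<open>tail_eq\<close>.\<close>

definition tail :: "real \<Rightarrow> real" where
  "tail s = measure Q {z. s \<le> z $ undefined}"

lemma tail_eq:
  assumes "norm p = 1" shows "measure Q {z. s \<le> p \<bullet> z} = tail s"
  unfolding tail_def by (rule direction_measure_pred[OF assms]) simp

lemma half_open: assumes p: "norm p = 1" shows "measure Q {z. 0 < p \<bullet> z} = 1 / 2"
proof -
  have "measure Q {z. - z \<in> {z. 0 < p \<bullet> z}} = measure Q {z. 0 < p \<bullet> z}"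
    by (rule uminus_measure) measurable
  moreover have "measure Q {z. - z \<in> {z. 0 < p \<bullet> z}} = measure Q (space Q - {z. 0 < p \<bullet> z})"
    by (rule finite_measure_eq_AE) (use hyperplane_AE[OF p, of 0] in \<open>auto elim!: eventually_mono\<close>)
  moreover have "measure Q (space Q - {z. 0 < p \<bullet> z}) = 1 - measure Q {z. 0 < p \<bullet> z}"
    by (rule prob_compl) simp
  ultimately show ?thesis by linarith
qed

lemma tail_pos: assumes "s \<ge> 0" "norm p = 1" shows "tail s = 1 / 2 - measure Q {z. 0 < p \<bullet> z \<and> p \<bullet> z \<le> s}"
proof -
  have "measure Q {z. 0 < p \<bullet> z} = measure Q ({z. 0 < p \<bullet> z \<and> p \<bullet> z \<le> s} \<union> {z. s < p \<bullet> z})"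
    using assms by (intro arg_cong[where f="measure Q"]) auto
  also have "\<dots> = measure Q {z. 0 < p \<bullet> z \<and> p \<bullet> z \<le> s} + measure Q {z. s < p \<bullet> z}"
    by (rule finite_measure_Union) auto
  also have "measure Q {z. s < p \<bullet> z} = tail s"
    unfolding tail_eq[OF assms(2), symmetric]
    by (rule finite_measure_eq_AE) (use hyperplane_AE[OF assms(2), of s] in \<open>auto elim!: eventually_mono\<close>)
  finally show ?thesis using half_open[OF assms(2)] by simp
qed

lemma tail_uminus: "tail (- s) = 1 - tail s"
proof -
  define p :: "real^'n" where "p = axis undefined 1"
  have p: "norm p = 1" by (simp add: p_def)
  have "tail (- s) = measure Q {z. - z \<in> {z. - s \<le> p \<bullet> z}}"
    unfolding tail_eq[OF p, symmetric] by (rule uminus_measure[symmetric]) measurable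
  also have "\<dots> = measure Q (space Q - {z. s \<le> p \<bullet> z})"
    by (rule finite_measure_eq_AE) (use hyperplane_AE[OF p, of s] in \<open>auto elim!: eventually_mono\<close>)
  also have "\<dots> = 1 - tail s"
    by (subst prob_compl) (auto simp: tail_eq[OF p])
  finally show ?thesis .
qed

lemma tail_0: "tail 0 = 1 / 2"
  using tail_uminus[of 0] by simp

text \<open>The right derivative is the slab limit, and the left one follows by symmetry.\<close>

lemma tail_deriv: "((\<lambda>s. (tail s - 1 / 2) / s) \<longlongrightarrow> - f0) (at 0)"
proof -
  define p :: "real^'n" where "p = axis undefined 1"
  have p: "norm p = 1" by (simp add: p_def)
  have r: "((\<lambda>s. (tail s - 1 / 2) / s) \<longlongrightarrow> - f0) (at_right 0)"
    using tendsto_minus[OF slab_deriv[OF p]]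
    by (rule Lim_transform_eventually) (auto simp: eventually_at_right_less tail_pos[OF _ p] intro!: eventually_at_rightI[of 0 1])
  have "((\<lambda>s. (tail (- s) - 1 / 2) / (- s)) \<longlongrightarrow> - f0) (at_right 0)"
    using r by (rule Lim_transform_eventually) (auto simp: tail_uminus field_simps intro!: eventually_at_rightI[of 0 1])
  then have "((\<lambda>s. (tail s - 1 / 2) / s) \<longlongrightarrow> - f0) (at_left 0)"
    by (subst filterlim_at_left_to_right) simp
  with r show ?thesis by (simp add: filterlim_split_at)
qed

text \<open>For small \<open>s\<close> this is the slab limit, and for \<open>s \<ge> b\<close> the bound \<open>1 \<le> s / b\<close> is enough.\<close>

lemma slab_bound: "\<exists>C>0. \<forall>p s. norm p = 1 \<longrightarrow> s \<ge> 0 \<longrightarrow> measure Q {z. \<bar>p \<bullet> z\<bar> \<le> s} \<le> C * s"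
proof -
  define p0 :: "real^'n" where "p0 = axis undefined 1"
  have p0: "norm p0 = 1" by (simp add: p0_def)
  have "eventually (\<lambda>s. measure Q {z. 0 < p0 \<bullet> z \<and> p0 \<bullet> z \<le> s} / s < f0 + 1) (at_right 0)"
    using order_tendstoD(2)[OF slab_deriv[OF p0], of "f0 + 1"] by simp
  then obtain b where b: "b > 0" "\<And>s. 0 < s \<Longrightarrow> s < b \<Longrightarrow> measure Q {z. 0 < p0 \<bullet> z \<and> p0 \<bullet> z \<le> s} / s < f0 + 1"
    by (auto simp: eventually_at_right_field)
  define C where "C = max (2 * (f0 + 1)) (1 / b)"
  have C: "C > 0" using b by (auto simp: C_def less_max_iff_disj)
  have "measure Q {z. \<bar>p \<bullet> z\<bar> \<le> s} \<le> C * s" if p: "norm p = 1" and s: "s \<ge> 0" for p :: "real^'n" and s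
  proof -
    have "tail (- s) = measure Q ({z. \<bar>p \<bullet> z\<bar> \<le> s} \<union> {z. s < p \<bullet> z})"
      unfolding tail_eq[OF p, symmetric] using s by (intro arg_cong[where f="measure Q"]) auto
    also have "\<dots> = measure Q {z. \<bar>p \<bullet> z\<bar> \<le> s} + measure Q {z. s < p \<bullet> z}"
      by (rule finite_measure_Union) auto
    also have "measure Q {z. s < p \<bullet> z} = tail s"
      unfolding tail_eq[OF p, symmetric]
      by (rule finite_measure_eq_AE) (use hyperplane_AE[OF p, of s] in \<open>auto elim!: eventually_mono\<close>)
    finally have e: "measure Q {z. \<bar>p \<bullet> z\<bar> \<le> s} = 2 * measure Q {z. 0 < p0 \<bullet> z \<and> p0 \<bullet> z \<le> s}"
      using tail_pos[OF s p0] tail_uminus[of s] by simp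
    consider "s = 0" | "0 < s" "s < b" | "s \<ge> b" using s by linarith
    then show ?thesis
    proof cases
      case 1
      then have E: "{z. 0 < p0 \<bullet> z \<and> p0 \<bullet> z \<le> s} = {}" by auto
      show ?thesis using e 1 unfolding E by simp
    next
      case 2
      then have "measure Q {z. 0 < p0 \<bullet> z \<and> p0 \<bullet> z \<le> s} \<le> (f0 + 1) * s"
        using b(2)[of s] by (simp add: field_simps)
      then have "measure Q {z. \<bar>p \<bullet> z\<bar> \<le> s} \<le> (2 * (f0 + 1)) * s" using e by (simp only: mult.assoc)
      also have "\<dots> \<le> C * s" using s by (intro mult_right_mono) (auto simp: C_def)
      finally show ?thesis .
    next
      case 3
      have "measure Q {z. \<bar>p \<bullet> z\<bar> \<le> s} \<le> 1" by simp
      also have "1 \<le> 1 / b * s" using 3 b by (simp add: field_simps)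
      also have "\<dots> \<le> C * s" using s by (intro mult_right_mono) (auto simp: C_def)
      finally show ?thesis .
    qed
  qed
  with C show ?thesis by blast
qed

text \<open>The set on which the sign of \<open>p \<bullet> z\<close> can change when the threshold is moved by \<open>s\<close> and the direction by
  \<open>u\<close>. One of the two summands \<open>s\<close> and \<open>u * norm z\<close> is at least half of the sum, which leaves a slab or a
  cone.\<close>

lemma thick_cone_bound:
  "\<exists>C>0. \<forall>p s u. norm p = 1 \<longrightarrow> s \<ge> 0 \<longrightarrow> u \<ge> 0 \<longrightarrow> measure Q {z. \<bar>p \<bullet> z\<bar> \<le> s + u * norm z} \<le> C * (s + u)"
proof -
  obtain C1 where C1: "C1 > 0" "\<And>p u. norm p = 1 \<Longrightarrow> u \<ge> 0 \<Longrightarrow> measure Q {z. \<bar>p \<bullet> z\<bar> \<le> u * norm z} \<le> C1 * u"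
    using cone_bound by blast
  obtain C2 where C2: "C2 > 0" "\<And>p s. norm p = 1 \<Longrightarrow> s \<ge> 0 \<Longrightarrow> measure Q {z. \<bar>p \<bullet> z\<bar> \<le> s} \<le> C2 * s"
    using slab_bound by blast
  define C where "C = 2 * (C1 + C2)"
  have "measure Q {z. \<bar>p \<bullet> z\<bar> \<le> s + u * norm z} \<le> C * (s + u)" if p: "norm p = 1" and s: "s \<ge> 0" and u: "u \<ge> 0" for p :: "real^'n" and s u
  proof -
    have "measure Q {z. \<bar>p \<bullet> z\<bar> \<le> s + u * norm z} \<le> measure Q ({z. \<bar>p \<bullet> z\<bar> \<le> 2 * s} \<union> {z. \<bar>p \<bullet> z\<bar> \<le> 2 * u * norm z})"
      by (rule finite_measure_mono) (auto simp: not_le)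
    also have "\<dots> \<le> measure Q {z. \<bar>p \<bullet> z\<bar> \<le> 2 * s} + measure Q {z. \<bar>p \<bullet> z\<bar> \<le> 2 * u * norm z}"
      by (rule measure_Un_le) auto
    also have "\<dots> \<le> C2 * (2 * s) + C1 * (2 * u)"
      using C1(2)[OF p, of "2 * u"] C2(2)[OF p, of "2 * s"] s u by simp
    also have "\<dots> \<le> C * (s + u)" using s u C1(1) C2(1) by (simp add: C_def algebra_simps)
    finally show ?thesis .
  qed
  moreover have "C > 0" using C1(1) C2(1) by (simp add: C_def)
  ultimately show ?thesis by blast
qed

text \<open>One side is open and the other closed, so that wedges satisfy an exact triangle inequality.\<close>

definition wedge :: "real^'n \<Rightarrow> real^'n \<Rightarrow> real" where
  "wedge p q = measure Q {z. 0 < p \<bullet> z \<and> q \<bullet> z \<le> 0}"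

lemma wedge_rotate:
  assumes "norm p = norm p'" "norm q = norm q'" "p \<bullet> q = p' \<bullet> q'"
  shows "wedge p q = wedge p' q'"
proof -
  obtain f where f: "orthogonal_transformation f" "f p = p'" "f q = q'"
    using orthogonal_transformation_pair[OF assms] by blast
  have "wedge p' q' = measure Q {z. f z \<in> {z. 0 < p' \<bullet> z \<and> q' \<bullet> z \<le> 0}}"
    unfolding wedge_def by (rule rotation_measure[OF f(1), symmetric]) measurable
  also have "\<dots> = wedge p q"
    unfolding wedge_def using f by (auto simp: orthogonal_transformation_def intro!: arg_cong[where f="measure Q"])
  finally show ?thesis by simp
qed

lemma wedge_triangle: "wedge p r \<le> wedge p q + wedge q r"
proof -
  have "wedge p r \<le> measure Q ({z. 0 < p \<bullet> z \<and> q \<bullet> z \<le> 0} \<union> {z. 0 < q \<bullet> z \<and> r \<bullet> z \<le> 0})"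
    unfolding wedge_def by (rule finite_measure_mono) auto
  also have "\<dots> \<le> wedge p q + wedge q r"
    unfolding wedge_def by (rule measure_Un_le) auto
  finally show ?thesis .
qed

lemma wedge_orthogonal:
  assumes p: "norm p = 1" and q: "norm q = 1" and pq: "p \<bullet> q = 0"
  shows "wedge p q = 1 / 4"
proof -
  have "wedge p q = wedge p (- q)" using p q pq by (intro wedge_rotate) auto
  moreover have "wedge p q + wedge p (- q) = 1 / 2"
  proof -
    have "wedge p (- q) = measure Q {z. 0 < p \<bullet> z \<and> 0 < q \<bullet> z}"
      unfolding wedge_def
      by (rule finite_measure_eq_AE) (use hyperplane_AE[OF q, of 0] in \<open>auto elim!: eventually_mono\<close>)
    then have "wedge p q + wedge p (- q) = measure Q ({z. 0 < p \<bullet> z \<and> q \<bullet> z \<le> 0} \<union> {z. 0 < p \<bullet> z \<and> 0 < q \<bullet> z})"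
      unfolding wedge_def by (subst finite_measure_Union) auto
    also have "{z. 0 < p \<bullet> z \<and> q \<bullet> z \<le> 0} \<union> {z. 0 < p \<bullet> z \<and> 0 < q \<bullet> z} = {z. 0 < p \<bullet> z}" by auto
    finally show ?thesis using half_open[OF p] by simp
  qed
  ultimately show ?thesis by simp
qed

text \<open>If \<open>q\<close> is obtained from \<open>r\<close> by rotation through \<open>\<beta>\<close>, then about \<open>\<pi> / (2 * \<beta>)\<close> further rotations of the
  same kind lead past the vector \<open>p\<close> orthogonal to \<open>r\<close>. All the wedges passed on the way have equal mass,
  and together they cover a wedge of mass \<open>1/4\<close>.\<close>

lemma wedge_lower:
  assumes q: "norm q = 1" and r: "norm r = 1" and p: "norm p = 1" and pr: "p \<bullet> r = 0"
    and \<beta>: "0 < \<beta>" "\<beta> \<le> pi / 2" and qq: "q = cos \<beta> *\<^sub>R r + sin \<beta> *\<^sub>R p"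
  shows "\<beta> / (4 * pi) \<le> wedge q r"
proof -
  \<comment> \<open>the iterated rotations, starting with e 0 = r and e 1 = q\<close>
  define e where "e = (\<lambda>k::nat. cos (k * \<beta>) *\<^sub>R r + sin (k * \<beta>) *\<^sub>R p)"
  have pp: "p \<bullet> p = 1" "r \<bullet> r = 1" "r \<bullet> p = 0" using p r pr by (auto simp: norm_eq_1 inner_commute)
  have ee: "e j \<bullet> e k = cos (j * \<beta> - k * \<beta>)" for j k
    by (simp add: e_def inner_add_left inner_add_right pp pr cos_diff)
  have ne: "norm (e k) = 1" for k by (simp add: norm_eq_1 ee)
  have e0: "e 0 = r" and e1: "e 1 = q" by (simp_all add: e_def qq)
  have step: "wedge (e (Suc k)) (e k) = wedge q r" for k
    using ee[of "Suc k" k] ee[of 1 0] by (intro wedge_rotate) (simp_all add: ne q r e0 e1[simplified] algebra_simps)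
  have chain: "wedge (e k) r \<le> k * wedge q r" for k
  proof (induction k)
    case 0
    have "{z. 0 < r \<bullet> z \<and> r \<bullet> z \<le> 0} = {}" by auto
    then have "wedge r r = 0" unfolding wedge_def by (simp only: measure_empty)
    then show ?case by (simp add: e0)
  next
    case (Suc k)
    have "wedge (e (Suc k)) r \<le> wedge (e (Suc k)) (e k) + wedge (e k) r" by (rule wedge_triangle)
    also have "\<dots> \<le> wedge q r + k * wedge q r" using Suc step by simp
    finally show ?case by (simp add: algebra_simps)
  qed
  \<comment> \<open>The angle N * \<beta> lies between a right and a straight angle, so the wedge of e N and r covers that of p and r.\<close>
  define N where "N = nat \<lceil>pi / (2 * \<beta>)\<rceil>"
  have N: "pi / (2 * \<beta>) \<le> N" "N \<le> pi / (2 * \<beta>) + 1"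
    using \<beta> by (auto simp: N_def of_nat_nat le_of_int_ceiling) linarith?
  have NB1: "pi / 2 \<le> N * \<beta>" using N(1) \<beta> by (simp add: field_simps)
  have NB2: "N * \<beta> \<le> pi"
  proof -
    have "N * \<beta> \<le> (pi / (2 * \<beta>) + 1) * \<beta>" using N(2) \<beta> by (intro mult_right_mono) auto
    also have "\<dots> = pi / 2 + \<beta>" using \<beta> by (simp add: field_simps)
    finally show ?thesis using \<beta> by simp
  qed
  have sc: "sin (N * \<beta>) \<ge> 0" "cos (N * \<beta>) \<le> 0" "cos (N * \<beta>) \<noteq> 0 \<or> sin (N * \<beta>) \<noteq> 0"
  proof -
    show "sin (N * \<beta>) \<ge> 0" using NB1 NB2 \<beta> by (intro sin_ge_zero) auto
    show "cos (N * \<beta>) \<le> 0" using cos_monotone_0_pi_le[of "pi / 2" "N * \<beta>"] NB1 NB2 by simp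
    show "cos (N * \<beta>) \<noteq> 0 \<or> sin (N * \<beta>) \<noteq> 0" by (metis cos_zero_iff sin_zero_iff sin_cos_squared_add power_zero_numeral add_0 zero_neq_one)
  qed
  have "1 / 4 = wedge p r" using wedge_orthogonal[OF p r pr] by simp
  also have "\<dots> \<le> wedge (e N) r"
  proof -
    have "wedge p r = measure Q {z. 0 < p \<bullet> z \<and> r \<bullet> z < 0}"
      unfolding wedge_def
      by (rule finite_measure_eq_AE) (use hyperplane_AE[OF r, of 0] in \<open>auto elim!: eventually_mono\<close>)
    also have "\<dots> \<le> wedge (e N) r"
      unfolding wedge_def
    proof (rule finite_measure_mono)
      show "{z. 0 < p \<bullet> z \<and> r \<bullet> z < 0} \<subseteq> {z. 0 < e N \<bullet> z \<and> r \<bullet> z \<le> 0}"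
      proof safe
        fix z assume z: "0 < p \<bullet> z" "r \<bullet> z < 0"
        have "0 \<le> cos (N * \<beta>) * (r \<bullet> z)" "0 \<le> sin (N * \<beta>) * (p \<bullet> z)"
          using sc z by (auto simp: zero_le_mult_iff mult_nonpos_nonpos)
        moreover have "0 < cos (N * \<beta>) * (r \<bullet> z) \<or> 0 < sin (N * \<beta>) * (p \<bullet> z)"
          using sc z by (auto simp: zero_less_mult_iff)
        ultimately show "0 < e N \<bullet> z" by (auto simp: e_def inner_add_left)
      qed auto
    qed auto
    finally show ?thesis .
  qed
  also have "\<dots> \<le> N * wedge q r" by (rule chain)
  also have "\<dots> \<le> (pi / \<beta>) * wedge q r"
  proof (rule mult_right_mono)
    have "pi / (2 * \<beta>) + 1 \<le> pi / \<beta>" using \<beta> by (simp add: field_simps)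
    then show "N \<le> pi / \<beta>" using N(2) by simp
  qed (simp add: wedge_def)
  finally show ?thesis using \<beta> by (simp add: field_simps)
qed

text \<open>Let \<open>r\<close> be the unit vector orthogonal to \<open>p\<close> in the plane of \<open>p\<close> and \<open>q\<close>, on the side of \<open>q\<close>. Then
  \<open>q\<close> lies between \<open>p\<close> and \<open>r\<close>, so that the wedge of \<open>p\<close> and \<open>r\<close>, of mass \<open>1/4\<close>, splits at \<open>q\<close>; the part
  between \<open>q\<close> and \<open>r\<close> has the angle \<open>arcsin (p \<bullet> q) \<ge> p \<bullet> q\<close> and is bounded below by \<open>wedge_lower\<close>.\<close>

lemma wedge_upper:
  assumes p: "norm p = 1" and q: "norm q = 1" and pq: "0 \<le> p \<bullet> q"
  shows "wedge p q \<le> 1 / 4 - (p \<bullet> q) / (4 * pi)"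
proof -
  define a where "a = p \<bullet> q"
  have a1: "a \<le> 1" using norm_cauchy_schwarz[of p q] p q by (simp add: a_def)
  have pp: "p \<bullet> p = 1" "q \<bullet> q = 1" using p q by (auto simp: norm_eq_1)
  consider "a = 0" | "a = 1" | "0 < a" "a < 1" using pq a1 unfolding a_def by linarith
  then show ?thesis
  proof cases
    case 1
    then show ?thesis using wedge_orthogonal[OF p q] by (simp add: a_def)
  next
    case 2
    then have "(p - q) \<bullet> (p - q) = 0" using pp by (simp add: a_def inner_diff_left inner_diff_right inner_commute)
    then have "p = q" by simp
    then have "{z. 0 < p \<bullet> z \<and> q \<bullet> z \<le> 0} = {}" by auto
    then have "wedge p q = 0" unfolding wedge_def by (simp only: measure_empty)
    moreover have "1 / (4 * pi) \<le> 1 / 4" using pi_gt3 by (simp add: field_simps)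
    ultimately show ?thesis using 2 by (simp add: a_def)
  next
    case 3
    define b where "b = sqrt (1 - a\<^sup>2)"
    have a2: "a\<^sup>2 < 1" using 3 by (simp add: power_less_one_iff abs_square_less_1)
    have b: "b > 0" "b\<^sup>2 = 1 - a\<^sup>2" using a2 by (auto simp: b_def)
    define r where "r = (1 / b) *\<^sub>R (q - a *\<^sub>R p)"
    have pr: "p \<bullet> r = 0" by (simp add: r_def inner_diff_right pp a_def)
    have "(q - a *\<^sub>R p) \<bullet> (q - a *\<^sub>R p) = b\<^sup>2"
      using b(2) pp by (simp add: inner_diff_left inner_diff_right inner_commute a_def[symmetric] power2_eq_square)
    moreover have "r \<bullet> r = (1 / b)\<^sup>2 * ((q - a *\<^sub>R p) \<bullet> (q - a *\<^sub>R p))"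
      by (simp only: r_def inner_scaleR_left inner_scaleR_right power2_eq_square mult.assoc)
    ultimately have "r \<bullet> r = 1" using b(1) by (simp add: power_divide)
    then have r: "norm r = 1" by (simp add: norm_eq_1)
    have qr: "q = b *\<^sub>R r + a *\<^sub>R p" using b by (simp add: r_def)
    define \<beta> where "\<beta> = arcsin a"
    have \<beta>: "0 < \<beta>" "\<beta> \<le> pi / 2" "sin \<beta> = a" "cos \<beta> = b"
    proof -
      show "0 < \<beta>" using 3 arcsin_less_arcsin[of 0 a] by (simp add: \<beta>_def)
      show "\<beta> \<le> pi / 2" unfolding \<beta>_def using 3 by (intro arcsin_ubound) auto
      show "sin \<beta> = a" "cos \<beta> = b" using 3 by (auto simp: \<beta>_def cos_arcsin b_def)
    qed
    have "a / (4 * pi) \<le> \<beta> / (4 * pi)"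
      using sin_x_le_x[of \<beta>] \<beta> by (intro divide_right_mono) auto
    also have "\<dots> \<le> wedge q r"
      using wedge_lower[OF q r p pr \<beta>(1,2)] qr \<beta> by simp
    finally have 1: "a / (4 * pi) \<le> wedge q r" .
    have "1 / 4 = wedge p r" using wedge_orthogonal[OF p r pr] by simp
    also have "\<dots> = measure Q ({z. 0 < p \<bullet> z \<and> q \<bullet> z \<le> 0} \<union> {z. 0 < q \<bullet> z \<and> r \<bullet> z \<le> 0})"
      unfolding wedge_def
    proof (intro arg_cong[where f="measure Q"] set_eqI iffI)
      fix z
      have qz: "q \<bullet> z = b * (r \<bullet> z) + a * (p \<bullet> z)" by (subst qr) (simp add: inner_add_left)
      assume "z \<in> {z. 0 < p \<bullet> z \<and> q \<bullet> z \<le> 0} \<union> {z. 0 < q \<bullet> z \<and> r \<bullet> z \<le> 0}"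
      then show "z \<in> {z. 0 < p \<bullet> z \<and> r \<bullet> z \<le> 0}"
      proof
        assume z: "z \<in> {z. 0 < p \<bullet> z \<and> q \<bullet> z \<le> 0}"
        then have "0 < a * (p \<bullet> z)" using 3 by simp
        then have "b * (r \<bullet> z) < 0" using z qz by auto
        then show ?thesis using b z by (auto simp: mult_less_0_iff)
      next
        assume z: "z \<in> {z. 0 < q \<bullet> z \<and> r \<bullet> z \<le> 0}"
        then have "b * (r \<bullet> z) \<le> 0" using b by (simp add: mult_le_0_iff)
        then have "0 < a * (p \<bullet> z)" using z qz by auto
        then show ?thesis using 3 z by (simp add: zero_less_mult_iff)
      qed
    qed auto
    also have "\<dots> = wedge p q + wedge q r"
      unfolding wedge_def by (rule finite_measure_Union) auto
    finally show ?thesis using 1 by (simp add: a_def)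
  qed
qed

text \<open>The excess of the angle over a right angle costs mass at a linear rate. This is what makes quadrant
  counts informative about angles.\<close>

lemma quadrant_bound:
  assumes p: "norm p = 1" and q: "norm q = 1" and pq: "0 \<le> p \<bullet> q"
  shows "measure Q {z. 0 \<le> p \<bullet> z \<and> q \<bullet> z \<le> 0} \<le> 1 / 4 - (p \<bullet> q) / (4 * pi)"
proof -
  have "measure Q {z. 0 \<le> p \<bullet> z \<and> q \<bullet> z \<le> 0} = wedge p q"
    unfolding wedge_def
    by (rule finite_measure_eq_AE) (use hyperplane_AE[OF p, of 0] in \<open>auto elim!: eventually_mono\<close>)
  then show ?thesis using wedge_upper[OF assms] by simp
qed

end

lemma (in profile) spherical_law_spherical:
  assumes n: "CARD('n::finite) = d"
  shows "spherical_law (spherical h :: (real^'n) measure) f0"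
proof -
  interpret prob_space "spherical h :: (real^'n) measure" by (rule prob_space_spherical[OF n])
  show ?thesis
    using n spherical_cone_bound spherical_rotation[OF n] spherical_slab_deriv[OF n] spherical_hyperplane_null[OF n] f0_pos
    by unfold_locales auto
qed

section \<open>Empirical fractions and uniform deviations\<close>

text \<open>The empirical measure as a function on all sets, so that monotonicity and additivity hold without
  measurability conditions.\<close>

definition frac :: "nat \<Rightarrow> (nat \<Rightarrow> 'b) \<Rightarrow> 'b set \<Rightarrow> real" where
  "frac n x A = (\<Sum>k=1..n. indicator A (x k)) / real n"

lemma measure_empirical:
  assumes "n \<ge> 1" "A \<in> sets borel"
  shows "measure (empirical n x) A = frac n x A"
proof -
  have "emeasure (empirical n x) A = ennreal (1 / real n) * (\<Sum>k=1..n. ennreal (indicator A (x k)))"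
    using assms by (simp add: emeasure_empirical ennreal_indicator)
  also have "\<dots> = ennreal (frac n x A)"
    by (subst sum_ennreal) (auto simp: frac_def ennreal_mult'[symmetric])
  finally show ?thesis by (simp add: measure_def frac_def sum_nonneg)
qed

lemma frac_mono: "A \<subseteq> B \<Longrightarrow> frac n x A \<le> frac n x B"
  unfolding frac_def by (intro divide_right_mono sum_mono) (auto simp: indicator_def)

lemma frac_Un:
  assumes "A \<inter> B = {}"
  shows "frac n x (A \<union> B) = frac n x A + frac n x B"
proof -
  have "indicator (A \<union> B) (x k) = (indicator A (x k) + indicator B (x k) :: real)" for k
    using assms by (auto simp: indicator_def)
  then show ?thesis by (simp only: frac_def sum.distrib add_divide_distrib)
qed

text \<open>With probability tending to one, in the sense of inner probability: the predicates to which this is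
  applied quantify over uncountably many directions and need not define events.\<close>

definition (in prob_space) whp :: "(nat \<Rightarrow> 'a \<Rightarrow> bool) \<Rightarrow> bool" where
  "whp P \<longleftrightarrow> (\<exists>G. (\<forall>n. G n \<in> events) \<and> (\<lambda>n. prob (G n)) \<longlonglongrightarrow> 1 \<and> (\<forall>n. \<forall>\<omega>\<in>G n. P n \<omega>))"

lemma (in prob_space) whp_conj:
  assumes "whp P" "whp R" shows "whp (\<lambda>n \<omega>. P n \<omega> \<and> R n \<omega>)"
proof -
  obtain G where G: "\<And>n. G n \<in> events" "(\<lambda>n. prob (G n)) \<longlonglongrightarrow> 1" "\<And>n \<omega>. \<omega> \<in> G n \<Longrightarrow> P n \<omega>"
    using assms(1) by (auto simp: whp_def)
  obtain H where H: "\<And>n. H n \<in> events" "(\<lambda>n. prob (H n)) \<longlonglongrightarrow> 1" "\<And>n \<omega>. \<omega> \<in> H n \<Longrightarrow> R n \<omega>"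
    using assms(2) by (auto simp: whp_def)
  have "(\<lambda>n. prob (G n \<inter> H n)) \<longlonglongrightarrow> 1"
  proof (rule tendsto_sandwich)
    show "eventually (\<lambda>n. prob (G n) + prob (H n) - 1 \<le> prob (G n \<inter> H n)) sequentially"
    proof (rule always_eventually, rule allI)
      fix n
      have "prob (G n \<union> H n) = prob (G n) + prob (H n) - prob (G n \<inter> H n)"
        using measure_Un3[of "G n" M "H n"] G(1) H(1) by (simp add: fmeasurable_eq_sets)
      then show "prob (G n) + prob (H n) - 1 \<le> prob (G n \<inter> H n)"
        using prob_le_1[of "G n \<union> H n"] by linarith
    qed
    show "(\<lambda>n. prob (G n) + prob (H n) - 1) \<longlonglongrightarrow> 1"
      using tendsto_diff[OF tendsto_add[OF G(2) H(2)] tendsto_const[of 1]] by simp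
  qed auto
  then show ?thesis
    unfolding whp_def using G H by (intro exI[of _ "\<lambda>n. G n \<inter> H n"]) auto
qed

lemma (in prob_space) whp_mono:
  assumes "whp P" "eventually (\<lambda>n. \<forall>\<omega>\<in>space M. P n \<omega> \<longrightarrow> R n \<omega>) sequentially"
  shows "whp R"
proof -
  obtain G where G: "\<And>n. G n \<in> events" "(\<lambda>n. prob (G n)) \<longlonglongrightarrow> 1" "\<And>n \<omega>. \<omega> \<in> G n \<Longrightarrow> P n \<omega>"
    using assms(1) by (auto simp: whp_def)
  obtain N where N: "\<And>n \<omega>. n \<ge> N \<Longrightarrow> \<omega> \<in> space M \<Longrightarrow> P n \<omega> \<Longrightarrow> R n \<omega>"
    using assms(2) by (auto simp: eventually_sequentially)
  have "(\<lambda>n. prob (if n \<ge> N then G n else {})) \<longlonglongrightarrow> 1"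
    by (rule Lim_transform_eventually[OF G(2)]) (auto simp: eventually_sequentially)
  moreover have "\<omega> \<in> space M" if "\<omega> \<in> G n" for n \<omega> using that G(1) sets.sets_into_space by blast
  ultimately show ?thesis
    unfolding whp_def using G N by (intro exI[of _ "\<lambda>n. if n \<ge> N then G n else {}"]) auto
qed

lemma (in prob_space) whp_AE:
  assumes "eventually (\<lambda>n. AE \<omega> in M. P n \<omega>) sequentially"
  shows "whp P"
proof -
  obtain N where N: "\<And>n. n \<ge> N \<Longrightarrow> AE \<omega> in M. P n \<omega>"
    using assms by (auto simp: eventually_sequentially)
  have "\<forall>n. \<exists>G. G \<in> events \<and> (n \<ge> N \<longrightarrow> prob G = 1) \<and> (\<forall>\<omega>\<in>G. P n \<omega>)"
  proof
    fix n show "\<exists>G. G \<in> events \<and> (n \<ge> N \<longrightarrow> prob G = 1) \<and> (\<forall>\<omega>\<in>G. P n \<omega>)"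
    proof (cases "n \<ge> N")
      case True
      from N[OF True] obtain E where E: "{\<omega>\<in>space M. \<not> P n \<omega>} \<subseteq> E" "E \<in> events" "emeasure M E = 0"
        by (auto elim!: AE_E)
      have "prob E = 0" using E by (simp add: measure_def)
      then have "prob (space M - E) = 1" using prob_compl[OF E(2)] by simp
      then show ?thesis using E by (intro exI[of _ "space M - E"]) auto
    qed (auto intro!: exI[of _ "{}"])
  qed
  then obtain G where G: "\<And>n. G n \<in> events" "\<And>n. n \<ge> N \<Longrightarrow> prob (G n) = 1" "\<And>n \<omega>. \<omega> \<in> G n \<Longrightarrow> P n \<omega>"
    by metis
  have "(\<lambda>n. prob (G n)) \<longlonglongrightarrow> 1"
    by (rule tendsto_eventually) (use G(2) in \<open>auto simp: eventually_sequentially\<close>)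
  then show ?thesis unfolding whp_def using G by (intro exI[of _ G]) auto
qed

lemma (in prob_space) whp_ball_finite:
  assumes "finite I" "\<And>i. i \<in> I \<Longrightarrow> whp (P i)"
  shows "whp (\<lambda>n \<omega>. \<forall>i\<in>I. P i n \<omega>)"
  using assms
proof (induction I rule: finite_induct)
  case empty
  show ?case by (rule whp_AE) simp
next
  case (insert i I)
  have "whp (\<lambda>n \<omega>. P i n \<omega> \<and> (\<forall>i\<in>I. P i n \<omega>))"
    using insert by (intro whp_conj) auto
  then show ?case by simp
qed

lemma exp_le_quadratic:
  fixes s :: real assumes "\<bar>s\<bar> \<le> 1" shows "exp s \<le> 1 + s + s\<^sup>2"
proof (cases "s \<ge> 0")
  case True
  then show ?thesis using exp_bound[of s] assms by simp
next
  case False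
  define t where "t = - s"
  have t: "0 < t" "t \<le> 1" using False assms by (auto simp: t_def)
  have "1 \<le> (1 - t + t\<^sup>2) * (1 + t)" using t by (simp add: algebra_simps power2_eq_square power3_eq_cube[symmetric])
  also have "\<dots> \<le> (1 - t + t\<^sup>2) * exp t"
  proof (rule mult_left_mono)
    show "0 \<le> 1 - t + t\<^sup>2" using t zero_le_power2[of t] by linarith
  qed (rule exp_ge_add_one_self)
  finally have "exp (- t) \<le> 1 - t + t\<^sup>2" by (simp add: exp_minus field_simps)
  then show ?thesis by (simp add: t_def)
qed

text \<open>Positive \<open>s\<close> gives the upper and negative \<open>s\<close> the lower deviation.\<close>

lemma (in prob_space) chernoff_signed:
  fixes Y :: "nat \<Rightarrow> 'a \<Rightarrow> real"
  assumes indep: "indep_vars (\<lambda>_. borel) Y {1..n}"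
    and Y01: "\<And>k \<omega>. Y k \<omega> \<in> {0, 1}"
    and mean: "\<And>k. k \<in> {1..n} \<Longrightarrow> expectation (Y k) = p"
    and s: "\<bar>s\<bar> \<le> 1"
  shows "prob {\<omega>\<in>space M. s * ((\<Sum>k=1..n. Y k \<omega>) - n * p) \<ge> n * (\<bar>s\<bar> * t)} \<le> exp (n * (p * s\<^sup>2 - \<bar>s\<bar> * t))"
proof -
  have rv[measurable]: "Y k \<in> borel_measurable M" if "k \<in> {1..n}" for k
    using indep that by (simp add: indep_vars_def)
  have int: "integrable M (Y k)" if "k \<in> {1..n}" for k
    using that Y01 by (intro integrable_const_bound[where B=1] AE_I2) (auto, metis Y01 abs_0 abs_1 insert_iff order_refl singletonD zero_le_one)
  have e: "exp (s * Y k \<omega>) = 1 + (exp s - 1) * Y k \<omega>" for k \<omega>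
    using Y01[of k \<omega>] by auto
  have mgf: "expectation (\<lambda>\<omega>. exp (s * Y k \<omega>)) \<le> exp (p * s + p * s\<^sup>2)" if k: "k \<in> {1..n}" for k
  proof -
    have p0: "p \<ge> 0" using mean[OF k] Y01 by (metis (no_types, lifting) Bochner_Integration.integral_nonneg insertE order_refl singletonD zero_le_one)
    have "expectation (\<lambda>\<omega>. exp (s * Y k \<omega>)) = 1 + (exp s - 1) * p"
      unfolding e using int[OF k] mean[OF k] by (simp add: prob_space)
    also have "\<dots> \<le> 1 + (s + s\<^sup>2) * p"
      using exp_le_quadratic[OF s] p0 by (intro add_left_mono mult_right_mono) auto
    also have "\<dots> \<le> exp (p * s + p * s\<^sup>2)"
      using exp_ge_add_one_self[of "p * s + p * s\<^sup>2"] by (simp add: algebra_simps)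
    finally show ?thesis .
  qed
  have int2: "integrable M (\<lambda>\<omega>. exp (s * Y k \<omega>))" if "k \<in> {1..n}" for k
    unfolding e using int[OF that] by simp
  have ind2: "indep_vars (\<lambda>_. borel) (\<lambda>k \<omega>. exp (s * Y k \<omega>)) {1..n}"
    by (rule indep_vars_compose2[OF indep]) simp
  let ?u = "\<lambda>\<omega>. \<Prod>k=1..n. exp (s * Y k \<omega>)"
  have intu: "integrable M ?u" by (intro indep_vars_integrable ind2 int2) auto
  have "expectation ?u = (\<Prod>k=1..n. expectation (\<lambda>\<omega>. exp (s * Y k \<omega>)))"
    by (intro indep_vars_lebesgue_integral ind2 int2) auto
  also have "\<dots> \<le> (\<Prod>k=1..n. exp (p * s + p * s\<^sup>2))"
    by (intro prod_mono) (auto intro!: mgf)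
  also have "\<dots> = exp (n * (p * s + p * s\<^sup>2))"
    by (simp add: exp_of_nat_mult)
  finally have eu: "expectation ?u \<le> exp (n * (p * s + p * s\<^sup>2))" .
  \<comment> \<open>the exponent at which Markov's inequality is applied\<close>
  define a where "a = n * (\<bar>s\<bar> * t) + s * n * p"
  have ueq: "?u \<omega> = exp (s * (\<Sum>k=1..n. Y k \<omega>))" for \<omega>
    by (simp add: exp_sum sum_distrib_left)
  have "{\<omega>\<in>space M. s * ((\<Sum>k=1..n. Y k \<omega>) - n * p) \<ge> n * (\<bar>s\<bar> * t)} = {\<omega>\<in>space M. ?u \<omega> \<ge> exp a}"
    unfolding ueq a_def by (simp add: algebra_simps)
  then have "prob {\<omega>\<in>space M. s * ((\<Sum>k=1..n. Y k \<omega>) - n * p) \<ge> n * (\<bar>s\<bar> * t)} = prob {\<omega>\<in>space M. ?u \<omega> \<ge> exp a}"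
    by simp
  also have "\<dots> \<le> expectation ?u / exp a"
    by (rule integral_Markov_inequality_measure[OF intu, of "{}"]) (simp_all add: prod_nonneg)
  also have "\<dots> \<le> exp (n * (p * s + p * s\<^sup>2)) / exp a"
    using eu by (intro divide_right_mono) auto
  also have "\<dots> = exp (n * (p * s\<^sup>2 - \<bar>s\<bar> * t))"
    unfolding exp_diff[symmetric] a_def by (simp add: algebra_simps)
  finally show ?thesis .
qed

text \<open>Choose one point of \<open>A\<close> for each value of the coordinatewise integer part of \<open>m * p\<close> on \<open>A\<close>. The net lies inside
  \<open>A\<close>, so it serves for small caps of the sphere as well as for the whole sphere.\<close>

lemma sphere_net:
  fixes A :: "(real^'n) set"
  assumes A: "\<And>p. p \<in> A \<Longrightarrow> norm p = 1" and m: "m \<ge> (1::nat)"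
  shows "\<exists>N\<subseteq>A. finite N \<and> card N \<le> (2 * m + 1) ^ CARD('n) \<and> (\<forall>p\<in>A. \<exists>b\<in>N. norm (p - b) \<le> CARD('n) / m)"
proof -
  define F where "F = (\<lambda>p::real^'n. \<lambda>i. \<lfloor>m * p $ i\<rfloor>)"
  define B where "B = (\<Pi>\<^sub>E i\<in>(UNIV::'n set). {- int m..int m})"
  have FB: "F ` A \<subseteq> B"
  proof safe
    fix p assume p: "p \<in> A"
    have "\<bar>p $ i\<bar> \<le> 1" for i using component_le_norm_cart[of p i] A[OF p] by simp
    then have b: "\<bar>m * p $ i\<bar> \<le> m" for i using m by (simp add: abs_mult mult_left_le)
    have "- int m \<le> \<lfloor>m * p $ i\<rfloor> \<and> \<lfloor>m * p $ i\<rfloor> \<le> int m" for i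
      using b[of i] by (auto simp: le_floor_iff floor_le_iff abs_le_iff)
    then show "F p \<in> B" by (auto simp: F_def B_def)
  qed
  have cB: "card B = (2 * m + 1) ^ CARD('n)" by (simp add: B_def card_PiE nat_add_distrib nat_mult_distrib)
  have fB: "finite B" by (simp add: B_def finite_PiE)
  define g where "g = (\<lambda>c. SOME p. p \<in> A \<and> F p = c)"
  have g: "g (F p) \<in> A \<and> F (g (F p)) = F p" if "p \<in> A" for p
    unfolding g_def by (rule someI[of _ p]) (use that in auto)
  define N where "N = g ` F ` A"
  have "card N \<le> card (F ` A)" unfolding N_def by (rule card_image_le) (use FB fB finite_subset in auto)
  also have "\<dots> \<le> card B" by (rule card_mono[OF fB FB])
  finally have "card N \<le> (2 * m + 1) ^ CARD('n)" by (simp add: cB)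
  moreover have "finite N" using FB fB by (auto simp: N_def intro: finite_subset)
  moreover have "N \<subseteq> A" using g by (auto simp: N_def)
  moreover have "norm (p - g (F p)) \<le> CARD('n) / m" if p: "p \<in> A" for p
  proof -
    have "\<bar>(p - g (F p)) $ i\<bar> \<le> 1 / m" for i
    proof -
      have "\<lfloor>m * p $ i\<rfloor> = \<lfloor>m * g (F p) $ i\<rfloor>" using g[OF p] by (auto simp: F_def fun_eq_iff)
      then have "\<bar>m * p $ i - m * g (F p) $ i\<bar> \<le> 1" by linarith
      then have "m * \<bar>p $ i - g (F p) $ i\<bar> \<le> 1"
        by (simp add: abs_mult right_diff_distrib[symmetric])
      then show ?thesis using m by (simp add: field_simps)
    qed
    then have "(\<Sum>i\<in>UNIV. \<bar>(p - g (F p)) $ i\<bar>) \<le> (\<Sum>i\<in>(UNIV::'n set). 1 / m)" by (intro sum_mono) auto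
    then show ?thesis using norm_le_l1_cart[of "p - g (F p)"] by simp
  qed
  ultimately show ?thesis by (intro exI[of _ N]) (auto simp: N_def)
qed

text \<open>The union bound: exponentially small probabilities against polynomially many events.\<close>

lemma poly_exp_tendsto_0:
  assumes e: "\<epsilon> > 0"
  shows "(\<lambda>n. real ((2 * n\<^sup>2 + 1) ^ D) * (a * exp (c - \<epsilon> * real n powr (1/6)))) \<longlonglongrightarrow> 0"
proof -
  have lim1: "filterlim (\<lambda>n. \<epsilon> * real n powr (1/6)) at_top sequentially"
    using e by real_asymp
  have "(\<lambda>n. (\<epsilon> * real n powr (1/6)) ^ (12 * D) / exp (\<epsilon> * real n powr (1/6))) \<longlonglongrightarrow> 0"
    by (rule filterlim_compose[OF tendsto_power_div_exp_0 lim1])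
  then have "(\<lambda>n. 3 ^ D * \<bar>a\<bar> * exp c / \<epsilon> ^ (12 * D) * ((\<epsilon> * real n powr (1/6)) ^ (12 * D) / exp (\<epsilon> * real n powr (1/6)))) \<longlonglongrightarrow> 0"
    by (rule tendsto_mult_right_zero)
  then show ?thesis
  proof (rule Lim_null_comparison[rotated])
    show "eventually (\<lambda>n. norm (real ((2 * n\<^sup>2 + 1) ^ D) * (a * exp (c - \<epsilon> * real n powr (1/6)))) \<le>
      3 ^ D * \<bar>a\<bar> * exp c / \<epsilon> ^ (12 * D) * ((\<epsilon> * real n powr (1/6)) ^ (12 * D) / exp (\<epsilon> * real n powr (1/6)))) sequentially"
    proof (rule eventually_sequentiallyI[of 1])
      fix n :: nat assume n: "n \<ge> 1"
      have x: "(real n powr (1/6)) ^ (12 * D) = real n ^ (2 * D)"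
      proof -
        have "(real n powr (1/6)) ^ (12 * D) = real n powr (real (2 * D))"
          using n by (simp add: powr_power)
        also have "\<dots> = real n ^ (2 * D)" using n by (intro powr_realpow) auto
        finally show ?thesis .
      qed
      have "real (2 * n\<^sup>2 + 1) \<le> 3 * real n ^ 2" using n by (simp add: one_le_power)
      then have "real (2 * n\<^sup>2 + 1) ^ D \<le> (3 * real n ^ 2) ^ D" by (intro power_mono) auto
      then have "real ((2 * n\<^sup>2 + 1) ^ D) \<le> 3 ^ D * (real n powr (1/6)) ^ (12 * D)"
        unfolding x by (simp add: power_mult_distrib power_mult)
      then have "real ((2 * n\<^sup>2 + 1) ^ D) * (\<bar>a\<bar> * exp (c - \<epsilon> * real n powr (1/6))) \<le> 3 ^ D * (real n powr (1/6)) ^ (12 * D) * (\<bar>a\<bar> * exp (c - \<epsilon> * real n powr (1/6)))"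
        by (intro mult_right_mono) auto
      then show "norm (real ((2 * n\<^sup>2 + 1) ^ D) * (a * exp (c - \<epsilon> * real n powr (1/6)))) \<le>
        3 ^ D * \<bar>a\<bar> * exp c / \<epsilon> ^ (12 * D) * ((\<epsilon> * real n powr (1/6)) ^ (12 * D) / exp (\<epsilon> * real n powr (1/6)))"
        using e by (simp add: abs_mult power_mult_distrib exp_diff mult_ac)
    qed
  qed
qed

locale spherical_sample = spherical_law Q f0 + M: prob_space M
  for Q :: "(real^'n) measure" and f0 :: real and M :: "'a measure" +
  fixes Z :: "nat \<Rightarrow> 'a \<Rightarrow> real^'n"
  assumes Z_indep: "M.indep_vars (\<lambda>_. borel) Z {1..}"
    and Z_distr: "\<And>k. k \<ge> 1 \<Longrightarrow> distr M borel (Z k) = Q"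
begin

lemma Z_measurable [measurable]: "k \<ge> 1 \<Longrightarrow> Z k \<in> borel_measurable M"
  using Z_indep by (simp add: M.indep_vars_def)

abbreviation F :: "nat \<Rightarrow> 'a \<Rightarrow> (real^'n) set \<Rightarrow> real" where
  "F n \<omega> A \<equiv> frac n (\<lambda>k. Z k \<omega>) A"

lemma F_measurable [measurable]:
  assumes [measurable]: "A \<in> sets borel"
  shows "(\<lambda>\<omega>. F n \<omega> A) \<in> borel_measurable M"
proof -
  have "(\<lambda>\<omega>. indicator A (Z k \<omega>) :: real) \<in> borel_measurable M" if "k \<in> {1..n}" for k
  proof -
    have [measurable]: "Z k \<in> borel_measurable M" using that by (intro Z_measurable) auto
    show ?thesis by measurable
  qed
  then show ?thesis unfolding frac_def by (intro borel_measurable_divide borel_measurable_sum) auto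
qed

lemma chernoff:
  assumes A[measurable]: "A \<in> sets borel" and q: "measure Q A \<le> q" and l: "0 < l" "l \<le> 1" and n: "n \<ge> 1"
  shows "measure M {\<omega>\<in>space M. \<bar>F n \<omega> A - measure Q A\<bar> \<ge> t} \<le> 2 * exp (n * (q * l\<^sup>2 - l * t))"
proof -
  define Y where "Y = (\<lambda>k \<omega>. indicator A (Z k \<omega>) :: real)"
  have ind: "M.indep_vars (\<lambda>_. borel) Y {1..n}"
    unfolding Y_def by (rule M.indep_vars_compose2[OF M.indep_vars_subset[OF Z_indep]]) auto
  have mean: "M.expectation (Y k) = measure Q A" if "k \<in> {1..n}" for k
  proof -
    have k: "k \<ge> 1" using that by simp
    have [measurable]: "Z k \<in> borel_measurable M" using k by measurable
    have "M.expectation (Y k) = (\<integral>z. indicator A z \<partial>distr M borel (Z k))"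
      unfolding Y_def by (subst integral_distr) auto
    then show ?thesis by (simp add: Z_distr[OF k])
  qed
  have Y01: "Y k \<omega> \<in> {0, 1}" for k \<omega> by (auto simp: Y_def indicator_def)
  have FY: "F n \<omega> A = (\<Sum>k=1..n. Y k \<omega>) / n" for \<omega> by (simp add: frac_def Y_def)
  let ?E = "\<lambda>s. {\<omega>\<in>space M. s * ((\<Sum>k=1..n. Y k \<omega>) - n * measure Q A) \<ge> n * (\<bar>s\<bar> * t)}"
  have EM: "?E s \<in> sets M" for s
  proof -
    have "(\<lambda>\<omega>. \<Sum>k=1..n. Y k \<omega>) \<in> borel_measurable M"
      using ind by (intro borel_measurable_sum) (simp add: M.indep_vars_def)
    then show ?thesis by measurable
  qed
  have bnd: "measure M (?E s) \<le> exp (n * (q * l\<^sup>2 - l * t))" if "\<bar>s\<bar> = l" for s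
  proof -
    have "measure M (?E s) \<le> exp (n * (measure Q A * s\<^sup>2 - \<bar>s\<bar> * t))"
      by (rule M.chernoff_signed[OF ind Y01 mean]) (use that l in auto)
    also have "s\<^sup>2 = l\<^sup>2" using that by (metis power2_abs)
    also have "exp (n * (measure Q A * l\<^sup>2 - \<bar>s\<bar> * t)) \<le> exp (n * (q * l\<^sup>2 - l * t))"
      using q that by (simp add: mult_left_mono mult_right_mono)
    finally show ?thesis .
  qed
  have "{\<omega>\<in>space M. \<bar>F n \<omega> A - measure Q A\<bar> \<ge> t} \<subseteq> ?E l \<union> ?E (- l)"
  proof
    fix \<omega> assume "\<omega> \<in> {\<omega>\<in>space M. \<bar>F n \<omega> A - measure Q A\<bar> \<ge> t}"
    then have w: "\<omega> \<in> space M" "\<bar>F n \<omega> A - measure Q A\<bar> \<ge> t" by auto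
    define S where "S = (\<Sum>k=1..n. Y k \<omega>)"
    have eq: "S - n * measure Q A = n * (F n \<omega> A - measure Q A)" using n by (simp add: FY S_def field_simps)
    consider "F n \<omega> A - measure Q A \<ge> t" | "- (F n \<omega> A - measure Q A) \<ge> t" using w(2) by linarith
    then show "\<omega> \<in> ?E l \<union> ?E (- l)"
    proof cases
      case 1
      then have "l * n * t \<le> l * n * (F n \<omega> A - measure Q A)" using l by (intro mult_left_mono) auto
      then have "n * (\<bar>l\<bar> * t) \<le> l * (S - n * measure Q A)" unfolding eq using l by (simp add: mult_ac)
      then show ?thesis using w(1) unfolding S_def by blast
    next
      case 2
      then have "l * n * t \<le> l * n * (- (F n \<omega> A - measure Q A))" using l by (intro mult_left_mono) auto
      moreover have "n * (\<bar>- l\<bar> * t) = l * n * t" using l by simp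
      moreover have "- l * (n * x) = l * n * (- x)" for x :: real by simp
      ultimately have "n * (\<bar>- l\<bar> * t) \<le> - l * (S - n * measure Q A)" unfolding eq by metis
      then show ?thesis using w(1) unfolding S_def by blast
    qed
  qed
  then have "measure M {\<omega>\<in>space M. \<bar>F n \<omega> A - measure Q A\<bar> \<ge> t} \<le> measure M (?E l \<union> ?E (- l))"
    by (rule M.finite_measure_mono) (intro sets.Un EM)
  also have "\<dots> \<le> measure M (?E l) + measure M (?E (- l))"
    by (rule measure_Un_le[OF EM EM])
  also have "\<dots> \<le> 2 * exp (n * (q * l\<^sup>2 - l * t))"
    using bnd[of l] bnd[of "- l"] l by simp
  finally show ?thesis .
qed

text \<open>A union bound over Chernoff estimates with tilt \<open>l n\<close>. For sets of probability at most \<open>q n\<close>, the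
  variance term \<open>n * q n * (l n)\<^sup>2\<close> stays bounded, while the gain \<open>n * l n * t n\<close> is at least of the order
  \<open>n powr (1/6)\<close>.\<close>

lemma uniform_deviation:
  assumes A: "\<And>n B. B \<in> \<A> n \<Longrightarrow> B \<in> sets borel \<and> measure Q B \<le> q n"
    and card: "\<And>n. n \<ge> 1 \<Longrightarrow> finite (\<A> n) \<and> card (\<A> n) \<le> (2 * n\<^sup>2 + 1) ^ D"
    and l: "\<And>n. n \<ge> 1 \<Longrightarrow> 0 < l n \<and> l n \<le> 1"
    and c: "\<And>n. n \<ge> 1 \<Longrightarrow> n * (q n * (l n)\<^sup>2) \<le> c"
    and t: "\<And>n. n \<ge> 1 \<Longrightarrow> n * (l n * t n) \<ge> \<epsilon> * n powr (1/6)" and e: "\<epsilon> > 0"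
  shows "M.whp (\<lambda>n \<omega>. \<forall>B\<in>\<A> n. \<bar>F n \<omega> B - measure Q B\<bar> < t n)"
proof -
  define G where "G = (\<lambda>n. if n \<ge> 1 then {\<omega>\<in>space M. \<forall>B\<in>\<A> n. \<bar>F n \<omega> B - measure Q B\<bar> < t n} else {})"
  have Bad: "{\<omega>\<in>space M. \<bar>F n \<omega> B - measure Q B\<bar> \<ge> t n} \<in> sets M" if "B \<in> \<A> n" for n B
  proof -
    have [measurable]: "B \<in> sets borel" using A that by auto
    show ?thesis by measurable
  qed
  have G: "G n \<in> M.events" for n
  proof (cases "n \<ge> 1")
    case True
    have "G n = space M - (\<Union>B\<in>\<A> n. {\<omega>\<in>space M. \<bar>F n \<omega> B - measure Q B\<bar> \<ge> t n})"
      using True by (auto simp: G_def not_le)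
    also have "\<dots> \<in> M.events" using card[OF True] Bad by (intro sets.Diff sets.finite_UN) auto
    finally show ?thesis .
  qed (simp add: G_def)
  have lower: "1 - real ((2 * n\<^sup>2 + 1) ^ D) * (2 * exp (c - \<epsilon> * real n powr (1/6))) \<le> M.prob (G n)" if n: "n \<ge> 1" for n
  proof -
    have "M.prob (\<Union>B\<in>\<A> n. {\<omega>\<in>space M. \<bar>F n \<omega> B - measure Q B\<bar> \<ge> t n}) \<le> (\<Sum>B\<in>\<A> n. M.prob {\<omega>\<in>space M. \<bar>F n \<omega> B - measure Q B\<bar> \<ge> t n})"
      using card[OF n] Bad by (intro M.finite_measure_subadditive_finite) auto
    also have "\<dots> \<le> (\<Sum>B\<in>\<A> n. 2 * exp (c - \<epsilon> * real n powr (1/6)))"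
    proof (rule sum_mono)
      fix B assume B: "B \<in> \<A> n"
      have "M.prob {\<omega>\<in>space M. \<bar>F n \<omega> B - measure Q B\<bar> \<ge> t n} \<le> 2 * exp (n * (q n * (l n)\<^sup>2 - l n * t n))"
        using A[OF B] l[OF n] n by (intro chernoff) auto
      also have "n * (q n * (l n)\<^sup>2 - l n * t n) = n * (q n * (l n)\<^sup>2) - n * (l n * t n)" by (simp add: algebra_simps)
      also have "2 * exp (n * (q n * (l n)\<^sup>2) - n * (l n * t n)) \<le> 2 * exp (c - \<epsilon> * real n powr (1/6))"
        using c[OF n] t[OF n] by simp
      finally show "M.prob {\<omega>\<in>space M. \<bar>F n \<omega> B - measure Q B\<bar> \<ge> t n} \<le> 2 * exp (c - \<epsilon> * real n powr (1/6))" .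
    qed
    also have "\<dots> = real (card (\<A> n)) * (2 * exp (c - \<epsilon> * real n powr (1/6)))" by simp
    also have "\<dots> \<le> real ((2 * n\<^sup>2 + 1) ^ D) * (2 * exp (c - \<epsilon> * real n powr (1/6)))"
      using card[OF n] by (intro mult_right_mono of_nat_mono) auto
    finally have "M.prob (\<Union>B\<in>\<A> n. {\<omega>\<in>space M. \<bar>F n \<omega> B - measure Q B\<bar> \<ge> t n}) \<le> real ((2 * n\<^sup>2 + 1) ^ D) * (2 * exp (c - \<epsilon> * real n powr (1/6)))" .
    moreover have "M.prob (G n) = 1 - M.prob (\<Union>B\<in>\<A> n. {\<omega>\<in>space M. \<bar>F n \<omega> B - measure Q B\<bar> \<ge> t n})"
    proof -
      have "G n = space M - (\<Union>B\<in>\<A> n. {\<omega>\<in>space M. \<bar>F n \<omega> B - measure Q B\<bar> \<ge> t n})"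
        using n by (auto simp: G_def not_le)
      then show ?thesis using card[OF n] Bad by (simp add: M.prob_compl sets.finite_UN)
    qed
    ultimately show ?thesis by simp
  qed
  have "(\<lambda>n. M.prob (G n)) \<longlonglongrightarrow> 1"
  proof (rule tendsto_sandwich)
    show "(\<lambda>n. 1 - real ((2 * n\<^sup>2 + 1) ^ D) * (2 * exp (c - \<epsilon> * real n powr (1/6)))) \<longlonglongrightarrow> 1"
      using tendsto_diff[OF tendsto_const[of 1] poly_exp_tendsto_0[OF e, of D 2 c]] by simp
    show "eventually (\<lambda>n. 1 - real ((2 * n\<^sup>2 + 1) ^ D) * (2 * exp (c - \<epsilon> * real n powr (1/6))) \<le> M.prob (G n)) sequentially"
      using lower by (auto simp: eventually_sequentially)
  qed auto
  then show ?thesis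
    unfolding M.whp_def using G by (intro exI[of _ G]) (auto simp: G_def split: if_splits)
qed

end

section \<open>Preliminary rates for medians and angles\<close>

text \<open>The order of the preliminary bounds on medians and angles. It is large enough for Chernoff bounds
  over polynomially many sets, and small enough that \<open>sqrt n * (rate n)\<^sup>2\<close> tends to \<open>0\<close>.\<close>

abbreviation rate :: "nat \<Rightarrow> real" where "rate n \<equiv> real n powr (- (1/3))"

lemma bracket_borel:
  fixes b b' :: "'b::euclidean_space"
  shows "{z. s \<le> b \<bullet> z} \<in> sets borel" "{z. b \<bullet> z \<le> s} \<in> sets borel"
    "{z. s - u * norm z \<le> b \<bullet> z} \<in> sets borel"
    "{z. \<bar>b \<bullet> z\<bar> \<le> s + u * norm z} \<in> sets borel"
    "{z. s \<le> b \<bullet> z \<and> b' \<bullet> z \<le> t} \<in> sets borel"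
    "{z. s - u * norm z \<le> b \<bullet> z \<and> b' \<bullet> z \<le> t + v * norm z} \<in> sets borel"
  by (intro borel_closed closed_Collect_le closed_Collect_conj continuous_intros)+

context spherical_sample
begin

lemmas bracket_events = bracket_borel[where 'b = "real^'n", folded sets_Q]

text \<open>A constant for \<open>thick_cone_bound\<close>.\<close>

definition thick :: real where
  "thick = (SOME C. C > 0 \<and> (\<forall>p s u. norm p = 1 \<longrightarrow> s \<ge> 0 \<longrightarrow> u \<ge> 0 \<longrightarrow> measure Q {z. \<bar>p \<bullet> z\<bar> \<le> s + u * norm z} \<le> C * (s + u)))"

lemma thick_pos: "thick > 0"
  and thick_bound: "norm p = 1 \<Longrightarrow> s \<ge> 0 \<Longrightarrow> u \<ge> 0 \<Longrightarrow> measure Q {z. \<bar>p \<bullet> z\<bar> \<le> s + u * norm z} \<le> thick * (s + u)"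
  using someI_ex[OF thick_cone_bound, folded thick_def] by auto

text \<open>The fineness of the nets. Moving a direction by \<open>mesh n\<close> changes \<open>p \<bullet> z\<close> by at most
  \<open>mesh n * norm z\<close>, which for \<open>norm z \<le> n\<close> is \<open>O(1 / n)\<close>, hence below the scale \<open>1 / sqrt n\<close>.\<close>

definition mesh :: "nat \<Rightarrow> real" where "mesh n = CARD('n) / real (n\<^sup>2)"

lemma mesh_nonneg: "mesh n \<ge> 0" by (simp add: mesh_def)

definition cover :: "nat \<Rightarrow> (real^'n) set \<Rightarrow> (real^'n) set" where
  "cover n A = (SOME N. N \<subseteq> A \<and> finite N \<and> card N \<le> (2 * n\<^sup>2 + 1) ^ CARD('n) \<and> (\<forall>p\<in>A. \<exists>b\<in>N. norm (p - b) \<le> mesh n))"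

lemma cover:
  assumes "\<forall>p\<in>A. norm p = 1" "n \<ge> 1"
  shows "cover n A \<subseteq> A" "finite (cover n A)" "card (cover n A) \<le> (2 * n\<^sup>2 + 1) ^ CARD('n)"
    "p \<in> A \<Longrightarrow> \<exists>b\<in>cover n A. norm (p - b) \<le> mesh n"
proof -
  have ex: "\<exists>N. N \<subseteq> A \<and> finite N \<and> card N \<le> (2 * n\<^sup>2 + 1) ^ CARD('n) \<and> (\<forall>p\<in>A. \<exists>b\<in>N. norm (p - b) \<le> mesh n)"
    unfolding mesh_def by (rule sphere_net) (use assms in \<open>auto simp: one_le_power\<close>)
  from someI_ex[OF ex, folded cover_def]
  show "cover n A \<subseteq> A" "finite (cover n A)" "card (cover n A) \<le> (2 * n\<^sup>2 + 1) ^ CARD('n)"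
    "p \<in> A \<Longrightarrow> \<exists>b\<in>cover n A. norm (p - b) \<le> mesh n" by auto
qed

lemma inner_close:
  fixes p b z :: "real^'n"
  assumes "norm (p - b) \<le> \<eta>" shows "\<bar>p \<bullet> z - b \<bullet> z\<bar> \<le> \<eta> * norm z"
proof -
  have "\<bar>(p - b) \<bullet> z\<bar> \<le> norm (p - b) * norm z" by (rule Cauchy_Schwarz_ineq2)
  also have "\<dots> \<le> \<eta> * norm z" using assms by (intro mult_right_mono) auto
  finally show ?thesis by (simp add: inner_diff_left)
qed

text \<open>With the tilt \<open>1 / sqrt n\<close> the variance term is \<open>1\<close> for arbitrary sets, and the deviation \<open>rate n\<close>
  gains \<open>n powr (1 - 1/2 - 1/3) = n powr (1/6)\<close>.\<close>

lemma coarse_deviation: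
  assumes "\<And>n B. B \<in> \<A> n \<Longrightarrow> B \<in> sets borel"
    and "\<And>n. n \<ge> 1 \<Longrightarrow> finite (\<A> n) \<and> card (\<A> n) \<le> (2 * n\<^sup>2 + 1) ^ D"
  shows "M.whp (\<lambda>n \<omega>. \<forall>B\<in>\<A> n. \<bar>F n \<omega> B - measure Q B\<bar> < rate n)"
proof (rule uniform_deviation[where q = "\<lambda>_. 1" and l = "\<lambda>n. real n powr (- (1/2))" and c = 1 and \<epsilon> = 1 and D = D])
  fix n :: nat assume n: "n \<ge> 1"
  show "0 < real n powr (- (1/2)) \<and> real n powr (- (1/2)) \<le> 1"
    using n powr_mono[of "- (1/2)" 0 "real n"] by simp
  show "real n * (1 * (real n powr (- (1/2)))\<^sup>2) \<le> 1"
    using n by (simp add: powr_power powr_minus field_simps)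
  have "real n * (real n powr (- (1/2)) * rate n) = real n powr 1 * (real n powr (- (1/2)) * rate n)" using n by simp
  also have "\<dots> = real n powr (1/6)" unfolding powr_add[symmetric] by simp
  finally show "1 * real n powr (1/6) \<le> real n * (real n powr (- (1/2)) * rate n)" by simp
qed (use assms in auto)

text \<open>Sets of probability \<open>O(rate n)\<close> admit the larger tilt \<open>rate n\<close>. Then a deviation of the order
  \<open>1 / sqrt n\<close>, with an arbitrarily small constant, gains \<open>n powr (1 - 1/3 - 1/2) = n powr (1/6)\<close>.\<close>

lemma fine_deviation:
  assumes "\<And>n B. B \<in> \<A> n \<Longrightarrow> B \<in> sets borel \<and> measure Q B \<le> C * rate n"
    and "\<And>n. n \<ge> 1 \<Longrightarrow> finite (\<A> n) \<and> card (\<A> n) \<le> (2 * n\<^sup>2 + 1) ^ D" and e: "\<epsilon> > 0"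
  shows "M.whp (\<lambda>n \<omega>. \<forall>B\<in>\<A> n. \<bar>F n \<omega> B - measure Q B\<bar> < \<epsilon> / sqrt n)"
proof (rule uniform_deviation[where q = "\<lambda>n. C * rate n" and l = rate and c = C and \<epsilon> = \<epsilon> and D = D])
  fix n :: nat assume n: "n \<ge> 1"
  show "0 < rate n \<and> rate n \<le> 1"
    using n powr_mono[of "- (1/3)" 0 "real n"] by simp
  have "real n * (rate n * (rate n)\<^sup>2) = real n powr 1 * (rate n * (rate n * rate n))" using n by (simp add: power2_eq_square)
  also have "\<dots> = 1" unfolding powr_add[symmetric] using n by simp
  finally have "real n * (rate n * (rate n)\<^sup>2) = 1" .
  then have "C * (real n * (rate n * (rate n)\<^sup>2)) = C" by (simp only: mult_1_right)
  then show "real n * (C * rate n * (rate n)\<^sup>2) \<le> C" by (simp only: mult_ac order_refl)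
  have "real n * (rate n * (\<epsilon> / sqrt n)) = \<epsilon> * (real n powr 1 * (rate n * real n powr (- (1/2))))"
    using n by (simp add: powr_minus powr_half_sqrt field_simps)
  also have "\<dots> = \<epsilon> * real n powr (1/6)" unfolding powr_add[symmetric] by simp
  finally show "\<epsilon> * real n powr (1/6) \<le> real n * (rate n * (\<epsilon> / sqrt n))" by simp
qed (use assms in auto)

lemma mesh_le_rate: "eventually (\<lambda>n. a * mesh n \<le> b * rate n) sequentially" if "b > 0"
  unfolding mesh_def using that by real_asymp

lemma tail_upper:
  assumes a: "a < f0" shows "eventually (\<lambda>s. tail s \<le> 1 / 2 - a * s) (at_right 0)"
proof -
  have "eventually (\<lambda>s. (tail s - 1 / 2) / s < - a) (at_right 0)"
    using order_tendstoD(2)[OF tendsto_mono[OF at_le[of "{0<..}" UNIV 0] tail_deriv], of "- a"] a by auto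
  then show ?thesis
    using eventually_at_right_less[of 0] by eventually_elim (simp add: field_simps)
qed

text \<open>A half-space at distance \<open>R * rate n\<close> from the origin has mass below \<open>1/2\<close> by a multiple of \<open>rate n\<close>,
  which the empirical measure cannot make up. Directions are replaced by points of a net, at the
  price of a thin double cone.\<close>

lemma location_one_sided:
  "\<exists>R>0. M.whp (\<lambda>n \<omega>. \<forall>p m. norm p = 1 \<longrightarrow> 1 / 2 \<le> F n \<omega> {z. m \<le> p \<bullet> z} \<longrightarrow> m \<le> R * rate n)"
proof -
  \<comment> \<open>At half this distance the mass is below 1/2 by 2 * rate n: one rate n pays for the empirical deviation,
    another half for the passage to the net.\<close>
  define R where "R = 8 / f0"
  have R: "R > 0" using f0_pos by (simp add: R_def)
  define W where "W = (\<lambda>n (b::real^'n). {z. R * rate n - mesh n * norm z \<le> b \<bullet> z})"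
  define S where "S = {p::real^'n. norm p = 1}"
  have S1: "\<forall>p\<in>S. norm p = 1" by (simp add: S_def)
  have whp: "M.whp (\<lambda>n \<omega>. \<forall>B\<in>W n ` cover n S. \<bar>F n \<omega> B - measure Q B\<bar> < rate n)"
  proof (rule coarse_deviation[where D = "CARD('n)"])
    show "finite (W n ` cover n S) \<and> card (W n ` cover n S) \<le> (2 * n\<^sup>2 + 1) ^ CARD('n)" if "n \<ge> 1" for n
      using cover(2,3)[OF S1 that] card_image_le[of "cover n S" "W n"] by (auto intro: order_trans)
    show "B \<in> sets borel" if "B \<in> W n ` cover n S" for n B
      using that by (auto simp: W_def simp del: mem_Collect_eq intro: bracket_borel)
  qed
  have ev1: "eventually (\<lambda>n. tail (R / 2 * rate n) \<le> 1 / 2 - f0 / 2 * (R / 2 * rate n)) sequentially"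
  proof (rule eventually_compose_filterlim[OF tail_upper[of "f0 / 2"]])
    show "filterlim (\<lambda>n. R / 2 * rate n) (at_right 0) sequentially" using R by real_asymp
  qed (use f0_pos in simp)
  have ev: "eventually (\<lambda>n. n \<ge> 1 \<and> tail (R / 2 * rate n) \<le> 1 / 2 - f0 / 2 * (R / 2 * rate n) \<and> thick * mesh n \<le> 1 / 2 * rate n) sequentially"
    using ev1 mesh_le_rate[of "1/2" thick] by (intro eventually_conj eventually_ge_at_top) auto
  have "M.whp (\<lambda>n \<omega>. \<forall>p m. norm p = 1 \<longrightarrow> 1 / 2 \<le> F n \<omega> {z. m \<le> p \<bullet> z} \<longrightarrow> m \<le> R * rate n)"
  proof (rule M.whp_mono[OF whp], rule eventually_mono[OF ev], intro ballI impI allI)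
    fix n \<omega> p m
    assume n: "n \<ge> 1 \<and> tail (R / 2 * rate n) \<le> 1 / 2 - f0 / 2 * (R / 2 * rate n) \<and> thick * mesh n \<le> 1 / 2 * rate n"
      and dev: "\<forall>B\<in>W n ` cover n S. \<bar>F n \<omega> B - measure Q B\<bar> < rate n"
      and p: "norm p = 1" and half: "1 / 2 \<le> F n \<omega> {z. m \<le> p \<bullet> z}"
    show "m \<le> R * rate n"
    proof (rule ccontr)
      assume "\<not> m \<le> R * rate n"
      then have m: "R * rate n \<le> m" by simp
      have n1: "n \<ge> 1" using n by simp
      obtain b where b: "b \<in> cover n S" "norm (p - b) \<le> mesh n"
        using cover(4)[OF S1 n1, of p] p by (auto simp: S_def)
      have b1: "norm b = 1" using cover(1)[OF S1 n1] b S1 by blast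
      have "F n \<omega> {z. m \<le> p \<bullet> z} \<le> F n \<omega> (W n b)"
      proof (rule frac_mono, rule subsetI)
        fix z assume "z \<in> {z. m \<le> p \<bullet> z}"
        then show "z \<in> W n b" using inner_close[OF b(2), of z] m by (auto simp: W_def)
      qed
      moreover have "F n \<omega> (W n b) < measure Q (W n b) + rate n"
        using dev b(1) by (force simp: abs_less_iff)
      moreover have "measure Q (W n b) \<le> tail (R / 2 * rate n) + thick * mesh n"
      proof -
        have "measure Q (W n b) \<le> measure Q ({z. R / 2 * rate n \<le> b \<bullet> z} \<union> {z. \<bar>b \<bullet> z\<bar> \<le> 0 + mesh n * norm z})"
        proof (rule finite_measure_mono)
          show "W n b \<subseteq> {z. R / 2 * rate n \<le> b \<bullet> z} \<union> {z. \<bar>b \<bullet> z\<bar> \<le> 0 + mesh n * norm z}"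
          proof
            fix z assume z: "z \<in> W n b"
            show "z \<in> {z. R / 2 * rate n \<le> b \<bullet> z} \<union> {z. \<bar>b \<bullet> z\<bar> \<le> 0 + mesh n * norm z}"
            proof (cases "R / 2 * rate n \<le> b \<bullet> z")
              case False
              have "R * rate n \<ge> 0" using R by simp
              then show ?thesis using z False by (auto simp: W_def abs_le_iff)
            qed simp
          qed
        qed (intro sets.Un bracket_events)
        also have "\<dots> \<le> measure Q {z. R / 2 * rate n \<le> b \<bullet> z} + measure Q {z. \<bar>b \<bullet> z\<bar> \<le> 0 + mesh n * norm z}"
          by (rule measure_Un_le) (intro sets.Un bracket_events)+
        also have "\<dots> \<le> tail (R / 2 * rate n) + thick * (0 + mesh n)"
          using thick_bound[OF b1 order_refl mesh_nonneg, of n] tail_eq[OF b1, of "R / 2 * rate n"] by linarith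
        finally show ?thesis by simp
      qed
      moreover have "f0 / 2 * (R / 2 * rate n) = 2 * rate n" using f0_pos by (simp add: R_def)
      moreover have "rate n > 0" using n by simp
      ultimately show False using n half by linarith
    qed
  qed
  with R show ?thesis by blast
qed

lemma location_rate:
  "\<exists>R>0. M.whp (\<lambda>n \<omega>. \<forall>p m. norm p = 1 \<longrightarrow> 1 / 2 \<le> F n \<omega> {z. m \<le> p \<bullet> z} \<longrightarrow> 1 / 2 \<le> F n \<omega> {z. p \<bullet> z \<le> m} \<longrightarrow> \<bar>m\<bar> \<le> R * rate n)"
proof -
  obtain R where R: "R > 0" "M.whp (\<lambda>n \<omega>. \<forall>p m. norm p = 1 \<longrightarrow> 1 / 2 \<le> F n \<omega> {z. m \<le> p \<bullet> z} \<longrightarrow> m \<le> R * rate n)"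
    using location_one_sided by blast
  have "M.whp (\<lambda>n \<omega>. \<forall>p m. norm p = 1 \<longrightarrow> 1 / 2 \<le> F n \<omega> {z. m \<le> p \<bullet> z} \<longrightarrow> 1 / 2 \<le> F n \<omega> {z. p \<bullet> z \<le> m} \<longrightarrow> \<bar>m\<bar> \<le> R * rate n)"
  proof (rule M.whp_mono[OF R(2)], intro always_eventually allI ballI impI)
    fix n \<omega> p m
    assume H: "\<forall>p m. norm p = 1 \<longrightarrow> 1 / 2 \<le> F n \<omega> {z. m \<le> p \<bullet> z} \<longrightarrow> m \<le> R * rate n"
      and p: "norm p = 1" and 1: "1 / 2 \<le> F n \<omega> {z. m \<le> p \<bullet> z}" and 2: "1 / 2 \<le> F n \<omega> {z. p \<bullet> z \<le> m}"
    have "m \<le> R * rate n" using H p 1 by blast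
    moreover have "- m \<le> R * rate n" using H[rule_format, of "- p" "- m"] p 2 by simp
    ultimately show "\<bar>m\<bar> \<le> R * rate n" by (simp add: abs_le_iff)
  qed
  with R(1) show ?thesis by blast
qed

text \<open>By \<open>quadrant_bound\<close> the quadrant falls short of \<open>1/4\<close> by a multiple of \<open>p \<bullet> q\<close>, while the empirical
  fluctuation, the shifts \<open>a\<close> and \<open>b\<close>, and the passage to the net all cost \<open>O(rate n)\<close>.\<close>

lemma wedge_one_sided:
  assumes R: "R > 0"
  shows "\<exists>R'>0. M.whp (\<lambda>n \<omega>. \<forall>p q a b. norm p = 1 \<longrightarrow> norm q = 1 \<longrightarrow> - (R * rate n) \<le> a \<longrightarrow> b \<le> R * rate n \<longrightarrow>
    1 / 4 \<le> F n \<omega> {z. a \<le> p \<bullet> z \<and> q \<bullet> z \<le> b} \<longrightarrow> p \<bullet> q \<le> R' * rate n)"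
proof -
  \<comment> \<open>From the bottom of the proof: 2 for the net, 1 for the empirical deviation, the rest for the shifts of the two half-spaces.\<close>
  define R' where "R' = 4 * pi * (2 * thick * (R + 1) + 1) + 2"
  have R': "R' \<ge> 2" "R' > 0" using R thick_pos by (auto simp: R'_def intro!: add_nonneg_pos mult_nonneg_nonneg)
  define W where "W = (\<lambda>n (b::real^'n, b'::real^'n). {z. - (R * rate n) - mesh n * norm z \<le> b \<bullet> z \<and> b' \<bullet> z \<le> R * rate n + mesh n * norm z})"
  have Wm: "W n bb \<in> sets borel" for n bb
  proof (cases bb)
    case (Pair b b')
    show ?thesis unfolding W_def Pair prod.case by (rule bracket_borel)
  qed
  define S where "S = {p::real^'n. norm p = 1}"
  have S1: "\<forall>p\<in>S. norm p = 1" by (simp add: S_def)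
  have whp: "M.whp (\<lambda>n \<omega>. \<forall>B\<in>W n ` (cover n S \<times> cover n S). \<bar>F n \<omega> B - measure Q B\<bar> < rate n)"
  proof (rule coarse_deviation[where D = "CARD('n) + CARD('n)"])
    show "finite (W n ` (cover n S \<times> cover n S)) \<and> card (W n ` (cover n S \<times> cover n S)) \<le> (2 * n\<^sup>2 + 1) ^ (CARD('n) + CARD('n))" if n: "n \<ge> 1" for n
    proof
      show "finite (W n ` (cover n S \<times> cover n S))" using cover(2)[OF S1 n] by simp
      have "card (W n ` (cover n S \<times> cover n S)) \<le> card (cover n S \<times> cover n S)"
        using cover(2)[OF S1 n] by (intro card_image_le) simp
      also have "\<dots> \<le> (2 * n\<^sup>2 + 1) ^ CARD('n) * (2 * n\<^sup>2 + 1) ^ CARD('n)"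
        unfolding card_cartesian_product using cover(3)[OF S1 n] by (intro mult_mono) auto
      finally show "card (W n ` (cover n S \<times> cover n S)) \<le> (2 * n\<^sup>2 + 1) ^ (CARD('n) + CARD('n))"
        by (simp only: power_add)
    qed
    show "B \<in> sets borel" if "B \<in> W n ` (cover n S \<times> cover n S)" for n B
      using that Wm by blast
  qed
  have ev: "eventually (\<lambda>n. n \<ge> 1 \<and> 1 * mesh n \<le> 1 * rate n) sequentially"
    using mesh_le_rate[of 1 1] by (intro eventually_conj eventually_ge_at_top) auto
  have "M.whp (\<lambda>n \<omega>. \<forall>p q a b. norm p = 1 \<longrightarrow> norm q = 1 \<longrightarrow> - (R * rate n) \<le> a \<longrightarrow> b \<le> R * rate n \<longrightarrow>
    1 / 4 \<le> F n \<omega> {z. a \<le> p \<bullet> z \<and> q \<bullet> z \<le> b} \<longrightarrow> p \<bullet> q \<le> R' * rate n)"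
  proof (rule M.whp_mono[OF whp], rule eventually_mono[OF ev], intro ballI impI allI)
    fix n \<omega> p q a b
    assume n: "n \<ge> 1 \<and> 1 * mesh n \<le> 1 * rate n"
      and dev: "\<forall>B\<in>W n ` (cover n S \<times> cover n S). \<bar>F n \<omega> B - measure Q B\<bar> < rate n"
      and p: "norm p = 1" and q: "norm q = 1" and a: "- (R * rate n) \<le> a" and b: "b \<le> R * rate n"
      and quarter: "1 / 4 \<le> F n \<omega> {z. a \<le> p \<bullet> z \<and> q \<bullet> z \<le> b}"
    have n1: "n \<ge> 1" using n by simp
    have r0: "rate n > 0" using n by simp
    obtain p' where p': "p' \<in> cover n S" "norm (p - p') \<le> mesh n"
      using cover(4)[OF S1 n1, of p] p by (auto simp: S_def)
    obtain q' where q': "q' \<in> cover n S" "norm (q - q') \<le> mesh n"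
      using cover(4)[OF S1 n1, of q] q by (auto simp: S_def)
    have p1: "norm p' = 1" and q1: "norm q' = 1" using cover(1)[OF S1 n1] p'(1) q'(1) S1 by blast+
    have "\<bar>p \<bullet> q - p' \<bullet> q\<bar> \<le> mesh n * 1" using inner_close[OF p'(2), of q] q by simp
    moreover have "\<bar>q \<bullet> p' - q' \<bullet> p'\<bar> \<le> mesh n * 1" using inner_close[OF q'(2), of p'] p1 by simp
    ultimately have close: "p \<bullet> q \<le> p' \<bullet> q' + 2 * mesh n" by (simp add: inner_commute)
    show "p \<bullet> q \<le> R' * rate n"
    proof (cases "0 \<le> p' \<bullet> q'")
      case False
      then have "p \<bullet> q \<le> 2 * rate n" using close n by linarith
      also have "\<dots> \<le> R' * rate n" using R' r0 by (intro mult_right_mono) auto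
      finally show ?thesis .
    next
      case True
      have "F n \<omega> {z. a \<le> p \<bullet> z \<and> q \<bullet> z \<le> b} \<le> F n \<omega> (W n (p', q'))"
      proof (rule frac_mono, rule subsetI)
        fix z assume "z \<in> {z. a \<le> p \<bullet> z \<and> q \<bullet> z \<le> b}"
        then show "z \<in> W n (p', q')" using inner_close[OF p'(2), of z] inner_close[OF q'(2), of z] a b by (auto simp: W_def)
      qed
      moreover have "F n \<omega> (W n (p', q')) < measure Q (W n (p', q')) + rate n"
        using dev p'(1) q'(1) by (force simp: abs_less_iff)
      moreover have "measure Q (W n (p', q')) \<le> (1 / 4 - (p' \<bullet> q') / (4 * pi)) + 2 * thick * (R * rate n + mesh n)"
      proof -
        let ?T = "\<lambda>b. {z. \<bar>b \<bullet> z\<bar> \<le> R * rate n + mesh n * norm z}"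
        have "measure Q (W n (p', q')) \<le> measure Q ({z. 0 \<le> p' \<bullet> z \<and> q' \<bullet> z \<le> 0} \<union> (?T p' \<union> ?T q'))"
        proof (rule finite_measure_mono)
          show "W n (p', q') \<subseteq> {z. 0 \<le> p' \<bullet> z \<and> q' \<bullet> z \<le> 0} \<union> (?T p' \<union> ?T q')"
          proof
            fix z assume z: "z \<in> W n (p', q')"
            have nn: "0 \<le> R * rate n + mesh n * norm z" using R r0 mesh_nonneg[of n] by simp
            show "z \<in> {z. 0 \<le> p' \<bullet> z \<and> q' \<bullet> z \<le> 0} \<union> (?T p' \<union> ?T q')"
              using z nn by (auto simp: W_def abs_le_iff)
          qed
        qed (intro sets.Un bracket_events)
        also have "\<dots> \<le> measure Q {z. 0 \<le> p' \<bullet> z \<and> q' \<bullet> z \<le> 0} + measure Q (?T p' \<union> ?T q')"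
          by (rule measure_Un_le) (intro sets.Un bracket_events)+
        also have "measure Q (?T p' \<union> ?T q') \<le> measure Q (?T p') + measure Q (?T q')"
          by (rule measure_Un_le) (intro sets.Un bracket_events)+
        also have "measure Q {z. 0 \<le> p' \<bullet> z \<and> q' \<bullet> z \<le> 0} \<le> 1 / 4 - (p' \<bullet> q') / (4 * pi)"
          by (rule quadrant_bound[OF p1 q1 True])
        finally show ?thesis
          using thick_bound[OF p1, of "R * rate n" "mesh n"] thick_bound[OF q1, of "R * rate n" "mesh n"] R r0
          by (simp add: mesh_nonneg)
      qed
      moreover have "2 * thick * (R * rate n + mesh n) \<le> 2 * thick * ((R + 1) * rate n)"
        using thick_pos n by (intro mult_left_mono) (auto simp: algebra_simps)
      ultimately have "(p' \<bullet> q') / (4 * pi) \<le> 2 * thick * ((R + 1) * rate n) + rate n" using quarter by linarith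
      then have "p' \<bullet> q' \<le> (4 * pi) * (2 * thick * ((R + 1) * rate n) + rate n)" by (simp add: pos_divide_le_eq mult.commute)
      also have "\<dots> = (R' - 2) * rate n" by (simp add: R'_def algebra_simps)
      finally show ?thesis using close n by (simp add: algebra_simps)
    qed
  qed
  with R' show ?thesis by blast
qed

text \<open>The two quadrants bound \<open>p \<bullet> q\<close> and \<open>p \<bullet> (- q)\<close>.\<close>

lemma orthogonality_rate:
  assumes R: "R > 0"
  shows "\<exists>R'>0. M.whp (\<lambda>n \<omega>. \<forall>p q a b. norm p = 1 \<longrightarrow> norm q = 1 \<longrightarrow> \<bar>a\<bar> \<le> R * rate n \<longrightarrow> \<bar>b\<bar> \<le> R * rate n \<longrightarrow>
    1 / 4 \<le> F n \<omega> {z. a \<le> p \<bullet> z \<and> q \<bullet> z \<le> b} \<longrightarrow> 1 / 4 \<le> F n \<omega> {z. a \<le> p \<bullet> z \<and> b \<le> q \<bullet> z} \<longrightarrow> \<bar>p \<bullet> q\<bar> \<le> R' * rate n)"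
proof -
  obtain R' where R': "R' > 0" "M.whp (\<lambda>n \<omega>. \<forall>p q a b. norm p = 1 \<longrightarrow> norm q = 1 \<longrightarrow> - (R * rate n) \<le> a \<longrightarrow> b \<le> R * rate n \<longrightarrow>
    1 / 4 \<le> F n \<omega> {z. a \<le> p \<bullet> z \<and> q \<bullet> z \<le> b} \<longrightarrow> p \<bullet> q \<le> R' * rate n)"
    using wedge_one_sided[OF R] by blast
  have "M.whp (\<lambda>n \<omega>. \<forall>p q a b. norm p = 1 \<longrightarrow> norm q = 1 \<longrightarrow> \<bar>a\<bar> \<le> R * rate n \<longrightarrow> \<bar>b\<bar> \<le> R * rate n \<longrightarrow>
    1 / 4 \<le> F n \<omega> {z. a \<le> p \<bullet> z \<and> q \<bullet> z \<le> b} \<longrightarrow> 1 / 4 \<le> F n \<omega> {z. a \<le> p \<bullet> z \<and> b \<le> q \<bullet> z} \<longrightarrow> \<bar>p \<bullet> q\<bar> \<le> R' * rate n)"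
  proof (rule M.whp_mono[OF R'(2)], intro always_eventually allI ballI impI)
    fix n \<omega> p q a b
    assume H: "\<forall>p q a b. norm p = 1 \<longrightarrow> norm q = 1 \<longrightarrow> - (R * rate n) \<le> a \<longrightarrow> b \<le> R * rate n \<longrightarrow>
      1 / 4 \<le> F n \<omega> {z. a \<le> p \<bullet> z \<and> q \<bullet> z \<le> b} \<longrightarrow> p \<bullet> q \<le> R' * rate n"
      and p: "norm p = 1" and q: "norm q = 1" and ab: "\<bar>a\<bar> \<le> R * rate n" "\<bar>b\<bar> \<le> R * rate n"
      and 1: "1 / 4 \<le> F n \<omega> {z. a \<le> p \<bullet> z \<and> q \<bullet> z \<le> b}" and 2: "1 / 4 \<le> F n \<omega> {z. a \<le> p \<bullet> z \<and> b \<le> q \<bullet> z}"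
    have "p \<bullet> q \<le> R' * rate n" using H[rule_format, OF p q _ _ 1] ab by (simp add: abs_le_iff)
    moreover have "p \<bullet> (- q) \<le> R' * rate n" using H[rule_format, of p "- q" a "- b"] p q ab 2 by (simp add: abs_le_iff)
    ultimately show "\<bar>p \<bullet> q\<bar> \<le> R' * rate n" by (simp add: abs_le_iff)
  qed
  with R' show ?thesis by blast
qed

section \<open>Bahadur representation of directional medians\<close>

definition scaled_score :: "(real^'n) \<Rightarrow> nat \<Rightarrow> 'a \<Rightarrow> real" where
  "scaled_score p n \<omega> = sqrt n * (F n \<omega> {z. 0 \<le> p \<bullet> z} - 1 / 2)"

text \<open>The shift \<open>CARD('n) / n\<close> is \<open>mesh n * n\<close>, the error that the net causes at points of norm at most \<open>n\<close>.\<close>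

lemma tail_expansion:
  "(\<lambda>n. sqrt n * (1 / 2 - tail (c / sqrt n - CARD('n) / n))) \<longlonglongrightarrow> f0 * c"
proof -
  define \<phi> where "\<phi> = (\<lambda>s. if s = 0 then - f0 else (tail s - 1 / 2) / s)"
  have ts: "1 / 2 - tail s = - \<phi> s * s" for s by (simp add: \<phi>_def tail_0)
  have "(\<phi> \<longlongrightarrow> - f0) (at 0)"
    by (rule Lim_transform_eventually[OF tail_deriv]) (auto simp: \<phi>_def eventually_at_filter)
  then have cont: "isCont \<phi> 0" by (simp add: isCont_def \<phi>_def)
  have lim0: "(\<lambda>n. c / sqrt (real n) - real CARD('n) / real n) \<longlonglongrightarrow> 0"
  proof -
    have "(\<lambda>n. c * (1 / sqrt (real n)) - real CARD('n) * (1 / real n)) \<longlonglongrightarrow> c * 0 - real CARD('n) * 0"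
      by (intro tendsto_intros) real_asymp+
    then show ?thesis by simp
  qed
  have lim1: "(\<lambda>n. c - real CARD('n) * (1 / sqrt (real n))) \<longlonglongrightarrow> c - real CARD('n) * 0"
    by (intro tendsto_intros) real_asymp
  have "(\<lambda>n. - \<phi> (c / sqrt n - CARD('n) / n) * (c - real CARD('n) * (1 / sqrt (real n)))) \<longlonglongrightarrow> - \<phi> 0 * (c - real CARD('n) * 0)"
    by (intro tendsto_mult tendsto_minus isCont_tendsto_compose[OF cont lim0] lim1)
  moreover have "- \<phi> 0 * (c - real CARD('n) * 0) = f0 * c" by (simp add: \<phi>_def)
  ultimately have lim: "(\<lambda>n. - \<phi> (c / sqrt n - CARD('n) / n) * (c - real CARD('n) * (1 / sqrt (real n)))) \<longlonglongrightarrow> f0 * c" by simp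
  show ?thesis
  proof (rule Lim_transform_eventually[OF lim], rule eventually_sequentiallyI[of 1])
    fix n :: nat assume n: "n \<ge> 1"
    have "sqrt n * (c / sqrt n - CARD('n) / n) = c - real CARD('n) * (sqrt n / n)" using n by (simp add: algebra_simps)
    also have "sqrt n / n = 1 / sqrt n" using n by (simp add: field_simps)
    finally show "- \<phi> (c / sqrt n - CARD('n) / n) * (c - real CARD('n) * (1 / sqrt (real n))) = sqrt n * (1 / 2 - tail (c / sqrt n - CARD('n) / n))"
      unfolding ts by (simp add: mult_ac)
  qed
qed

text \<open>If a half-space with normal \<open>p\<close> near \<open>p0 n\<close> and threshold at least \<open>c / sqrt n\<close> contains half of the sample,
  then so does the slightly larger bracket \<open>W\<close> belonging to a net point. The bracket has mass
  \<open>1/2 - f0 * c / sqrt n + o(1 / sqrt n)\<close>, and it differs from the half-space \<open>E\<close> through the origin by sets of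
  probability \<open>O(rate n)\<close>, on which the empirical measure is exact up to \<open>o(1 / sqrt n)\<close>. Comparing masses
  bounds the empirical excess of \<open>E\<close>, which is the score, from below.\<close>

lemma bahadur_one_sided:
  assumes p0: "\<And>n. norm (p0 n) = 1" and R: "R \<ge> 0" and e: "\<epsilon> > 0"
  shows "M.whp (\<lambda>n \<omega>. \<forall>p m. norm p = 1 \<longrightarrow> norm (p - p0 n) \<le> R * rate n \<longrightarrow> c / sqrt n \<le> m \<longrightarrow>
    1 / 2 \<le> F n \<omega> {z. m \<le> p \<bullet> z} \<longrightarrow> f0 * c - \<epsilon> \<le> scaled_score (p0 n) n \<omega>)"
proof -
  define S where "S = (\<lambda>n. {p::real^'n. norm p = 1 \<and> norm (p - p0 n) \<le> R * rate n})"
  have S1: "\<forall>p\<in>S n. norm p = 1" for n by (simp add: S_def)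
  define W where "W = (\<lambda>n (b::real^'n). {z. c / sqrt n - mesh n * norm z \<le> b \<bullet> z})"
  define E where "E = (\<lambda>n. {z. 0 \<le> p0 n \<bullet> z})"
  define CC where "CC = thick * (\<bar>c\<bar> + 1 + R)"
  \<comment> \<open>Finitely many small indices, for which the mesh exceeds the rate, get the empty family, so that the
    probability bound holds for every index.\<close>
  define fam where "fam = (\<lambda>n. if 1 \<le> n \<and> mesh n \<le> rate n then (\<lambda>b. W n b - E n) ` cover n (S n) \<union> (\<lambda>b. E n - W n b) ` cover n (S n) else {})"
  have WE: "W n b \<in> sets borel" "E n \<in> sets borel" for n b
    unfolding W_def E_def by (rule bracket_borel)+
  have whp: "M.whp (\<lambda>n \<omega>. \<forall>B\<in>fam n. \<bar>F n \<omega> B - measure Q B\<bar> < (\<epsilon> / 4) / sqrt n)"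
  proof (rule fine_deviation[where D = "CARD('n) + 1" and C = CC])
    show "B \<in> sets borel \<and> measure Q B \<le> CC * rate n" if B: "B \<in> fam n" for n B
    proof -
      have n: "n \<ge> 1" and mr: "mesh n \<le> rate n" using B by (auto simp: fam_def split: if_splits)
      have r: "rate n > 0" using n by simp
      have s: "1 / sqrt n \<le> rate n"
        using n powr_mono[of "- (1/2)" "- (1/3)" "real n"] by (simp add: powr_minus powr_half_sqrt inverse_eq_divide)
      let ?T = "{z. \<bar>p0 n \<bullet> z\<bar> \<le> \<bar>c\<bar> / sqrt n + (mesh n + R * rate n) * norm z}"
      obtain b where b: "b \<in> cover n (S n)" "B = W n b - E n \<or> B = E n - W n b"
        using B by (auto simp: fam_def split: if_splits)
      have bS: "norm (b - p0 n) \<le> R * rate n" using b(1) cover(1)[OF S1 n] by (auto simp: S_def)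
      have "B \<subseteq> ?T"
      proof
        fix z assume z: "z \<in> B"
        have k: "\<bar>b \<bullet> z - p0 n \<bullet> z\<bar> \<le> R * rate n * norm z" by (rule inner_close[OF bS])
        have k2: "0 \<le> mesh n * norm z" by (simp add: mesh_nonneg)
        have k3: "0 \<le> R * rate n * norm z" using R r by simp
        have k4: "\<bar>c / sqrt n\<bar> = \<bar>c\<bar> / sqrt n" by simp
        show "z \<in> ?T"
          using b(2)
        proof
          assume "B = W n b - E n"
          then have "c / sqrt n - mesh n * norm z \<le> b \<bullet> z" "p0 n \<bullet> z < 0" using z by (auto simp: W_def E_def)
          then have "\<bar>p0 n \<bullet> z\<bar> \<le> \<bar>c / sqrt n\<bar> + mesh n * norm z + R * rate n * norm z" using k k2 k3 by linarith
          then show ?thesis by (simp add: k4 algebra_simps)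
        next
          assume "B = E n - W n b"
          then have "b \<bullet> z < c / sqrt n - mesh n * norm z" "0 \<le> p0 n \<bullet> z" using z by (auto simp: W_def E_def)
          then have "\<bar>p0 n \<bullet> z\<bar> \<le> \<bar>c / sqrt n\<bar> + mesh n * norm z + R * rate n * norm z" using k k2 k3 by linarith
          then show ?thesis by (simp add: k4 algebra_simps)
        qed
      qed
      then have "measure Q B \<le> measure Q ?T" by (rule finite_measure_mono) (rule bracket_events)
      also have "\<dots> \<le> thick * (\<bar>c\<bar> / sqrt n + (mesh n + R * rate n))"
        using R r by (intro thick_bound p0) (auto simp: mesh_nonneg)
      also have "\<dots> \<le> thick * (\<bar>c\<bar> * rate n + (rate n + R * rate n))"
        using thick_pos mr mult_left_mono[OF s, of "\<bar>c\<bar>"] R by (intro mult_left_mono add_mono) auto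
      also have "\<dots> = CC * rate n" by (simp add: CC_def algebra_simps)
      finally show ?thesis using b(2) WE by blast
    qed
    show "finite (fam n) \<and> card (fam n) \<le> (2 * n\<^sup>2 + 1) ^ (CARD('n) + 1)" if n: "n \<ge> 1" for n
    proof
      have f: "finite (cover n (S n))" by (rule cover(2)[OF S1 n])
      then show "finite (fam n)" by (simp add: fam_def)
      have "card (fam n) \<le> card (cover n (S n)) + card (cover n (S n))"
        unfolding fam_def using card_Un_le[of "(\<lambda>b. W n b - E n) ` cover n (S n)" "(\<lambda>b. E n - W n b) ` cover n (S n)"]
          card_image_le[OF f, of "\<lambda>b. W n b - E n"] card_image_le[OF f, of "\<lambda>b. E n - W n b"] by auto
      also have "\<dots> = 2 * card (cover n (S n))" by simp
      also have "\<dots> \<le> (2 * n\<^sup>2 + 1) * (2 * n\<^sup>2 + 1) ^ CARD('n)"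
        using cover(3)[OF S1 n] n by (intro mult_mono) (auto simp: one_le_power)
      finally show "card (fam n) \<le> (2 * n\<^sup>2 + 1) ^ (CARD('n) + 1)" by simp
    qed
  qed (use e in simp)
  define err where "err = (\<lambda>n. thick * (\<bar>c\<bar> * real n powr (-3/2) + mesh n))"
  have err: "(\<lambda>n. sqrt n * err n) \<longlonglongrightarrow> 0"
  proof -
    have "(\<lambda>n. thick * (\<bar>c\<bar> * (sqrt n * real n powr (-3/2)) + real CARD('n) * (sqrt n / real (n\<^sup>2)))) \<longlonglongrightarrow> thick * (\<bar>c\<bar> * 0 + real CARD('n) * 0)"
      by (intro tendsto_intros) real_asymp+
    then show ?thesis by (simp add: err_def mesh_def algebra_simps)
  qed
  have "(\<lambda>n. sqrt n * (1 / 2 - tail (c / sqrt n - CARD('n) / n)) - sqrt n * err n) \<longlonglongrightarrow> f0 * c - 0"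
    by (intro tendsto_diff tail_expansion err)
  then have "eventually (\<lambda>n. sqrt n * (1 / 2 - tail (c / sqrt n - CARD('n) / n)) - sqrt n * err n > f0 * c - \<epsilon> / 2) sequentially"
    by (rule order_tendstoD) (use e in simp)
  then have ev: "eventually (\<lambda>n. n \<ge> 1 \<and> 1 * mesh n \<le> 1 * rate n \<and> sqrt n * (1 / 2 - tail (c / sqrt n - CARD('n) / n)) - sqrt n * err n > f0 * c - \<epsilon> / 2) sequentially"
    using mesh_le_rate[of 1 1] by (intro eventually_conj eventually_ge_at_top) auto
  show ?thesis
  proof (rule M.whp_mono[OF whp], rule eventually_mono[OF ev], intro ballI impI allI)
    fix n \<omega> p m
    assume n: "n \<ge> 1 \<and> 1 * mesh n \<le> 1 * rate n \<and> sqrt n * (1 / 2 - tail (c / sqrt n - CARD('n) / n)) - sqrt n * err n > f0 * c - \<epsilon> / 2"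
      and dev: "\<forall>B\<in>fam n. \<bar>F n \<omega> B - measure Q B\<bar> < (\<epsilon> / 4) / sqrt n"
      and p: "norm p = 1" "norm (p - p0 n) \<le> R * rate n" and m: "c / sqrt n \<le> m" and half: "1 / 2 \<le> F n \<omega> {z. m \<le> p \<bullet> z}"
    have n1: "n \<ge> 1" using n by simp
    have sn: "sqrt n > 0" using n1 by simp
    obtain b where b: "b \<in> cover n (S n)" "norm (p - b) \<le> mesh n"
      using cover(4)[OF S1 n1, of p] p by (auto simp: S_def)
    have b1: "norm b = 1" using cover(1)[OF S1 n1] b S1 by blast
    have mem: "W n b - E n \<in> fam n" "E n - W n b \<in> fam n" using n b(1) by (auto simp: fam_def)
    have "F n \<omega> {z. m \<le> p \<bullet> z} \<le> F n \<omega> (W n b)"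
    proof (rule frac_mono, rule subsetI)
      fix z assume "z \<in> {z. m \<le> p \<bullet> z}"
      then show "z \<in> W n b" using inner_close[OF b(2), of z] m by (auto simp: W_def)
    qed
    then have hW: "1 / 2 \<le> F n \<omega> (W n b)" using half by simp
    have split: "F n \<omega> A = F n \<omega> (A \<inter> B) + F n \<omega> (A - B)" for A B
    proof -
      have "F n \<omega> ((A \<inter> B) \<union> (A - B)) = F n \<omega> (A \<inter> B) + F n \<omega> (A - B)"
        by (intro frac_Un) auto
      moreover have "(A \<inter> B) \<union> (A - B) = A" by blast
      ultimately show ?thesis by simp
    qed
    have splitQ: "measure Q A = measure Q (A \<inter> B) + measure Q (A - B)" if "A \<in> sets borel" "B \<in> sets borel" for A B
    proof -
      have "measure Q ((A \<inter> B) \<union> (A - B)) = measure Q (A \<inter> B) + measure Q (A - B)"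
        using that by (intro finite_measure_Union) auto
      moreover have "(A \<inter> B) \<union> (A - B) = A" by blast
      ultimately show ?thesis by simp
    qed
    have "F n \<omega> (E n) = F n \<omega> (W n b) - F n \<omega> (W n b - E n) + F n \<omega> (E n - W n b)"
      using split[of "E n" "W n b"] split[of "W n b" "E n"] by (simp add: Int_commute)
    moreover have "measure Q (E n) = measure Q (W n b) - measure Q (W n b - E n) + measure Q (E n - W n b)"
      using splitQ[of "E n" "W n b"] splitQ[of "W n b" "E n"] WE by (simp add: Int_commute)
    moreover have "measure Q (E n) = 1 / 2" using tail_eq[OF p0, of 0 n] tail_0 by (simp add: E_def)
    moreover have "\<bar>F n \<omega> (W n b - E n) - measure Q (W n b - E n)\<bar> < (\<epsilon> / 4) / sqrt n" using dev mem by blast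
    moreover have "\<bar>F n \<omega> (E n - W n b) - measure Q (E n - W n b)\<bar> < (\<epsilon> / 4) / sqrt n" using dev mem by blast
    ultimately have FE: "F n \<omega> (E n) - 1 / 2 \<ge> 1 / 2 - measure Q (W n b) - 2 * ((\<epsilon> / 4) / sqrt n)"
      using hW by linarith
    have QW: "measure Q (W n b) \<le> tail (c / sqrt n - CARD('n) / n) + err n"
    proof -
      define u where "u = \<bar>c\<bar> * real n powr (-3/2) + mesh n"
      have u0: "u \<ge> 0" by (simp add: u_def mesh_nonneg)
      let ?s = "c / sqrt n - CARD('n) / n"
      have "measure Q (W n b) \<le> measure Q ({z. ?s \<le> b \<bullet> z} \<union> {z. \<bar>b \<bullet> z\<bar> \<le> 0 + u * norm z})"
      proof (rule finite_measure_mono)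
        show "W n b \<subseteq> {z. ?s \<le> b \<bullet> z} \<union> {z. \<bar>b \<bullet> z\<bar> \<le> 0 + u * norm z}"
        proof
          fix z assume "z \<in> W n b"
          then have z: "c / sqrt n - mesh n * norm z \<le> b \<bullet> z" by (simp add: W_def)
          show "z \<in> {z. ?s \<le> b \<bullet> z} \<union> {z. \<bar>b \<bullet> z\<bar> \<le> 0 + u * norm z}"
          \<comment> \<open>Below the shifted threshold the net error exceeds its size for norm n; so z has norm larger than n
            and lies in a cone whose width comes from 1 / sqrt n = n powr (-3/2) * n.\<close>
          proof (cases "?s \<le> b \<bullet> z")
            case False
            have "CARD('n) / n < mesh n * norm z" using False z by linarith
            moreover have "CARD('n) / n = mesh n * n" using n1 by (simp add: mesh_def power2_eq_square)
            ultimately have "mesh n * n < mesh n * norm z" by simp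
            then have nz: "n < norm z" using mesh_nonneg[of n] by (simp add: mult_less_cancel_left)
            have "real n powr (-3/2) * n = real n powr (-3/2) * real n powr 1" using n1 by simp
            also have "\<dots> = 1 / sqrt n" unfolding powr_add[symmetric] using n1 by (simp add: powr_minus powr_half_sqrt inverse_eq_divide)
            finally have e1: "1 / sqrt n = real n powr (-3/2) * n" by simp
            have "\<bar>c / sqrt n\<bar> = \<bar>c\<bar> * (1 / sqrt n)" by simp
            also have "\<dots> = \<bar>c\<bar> * real n powr (-3/2) * n" unfolding e1 by simp
            also have "\<dots> \<le> \<bar>c\<bar> * real n powr (-3/2) * norm z" using nz by (intro mult_left_mono) auto
            finally have c1: "\<bar>c / sqrt n\<bar> \<le> \<bar>c\<bar> * real n powr (-3/2) * norm z" .
            have m0: "0 \<le> mesh n * norm z" "0 \<le> CARD('n) / n" by (auto simp: mesh_nonneg)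
            have "\<bar>b \<bullet> z\<bar> \<le> \<bar>c\<bar> * real n powr (-3/2) * norm z + mesh n * norm z"
              using c1 z False m0 by linarith
            then show ?thesis by (simp add: u_def algebra_simps)
          qed simp
        qed
      qed (intro sets.Un bracket_events)
      also have "\<dots> \<le> measure Q {z. ?s \<le> b \<bullet> z} + measure Q {z. \<bar>b \<bullet> z\<bar> \<le> 0 + u * norm z}"
        by (rule measure_Un_le) (intro sets.Un bracket_events)+
      also have "\<dots> \<le> tail ?s + thick * (0 + u)"
        using thick_bound[OF b1 order_refl u0] tail_eq[OF b1, of ?s] by linarith
      finally show ?thesis by (simp add: err_def u_def)
    qed
    have "sqrt n * (1 / 2 - (tail (c / sqrt n - CARD('n) / n) + err n) - 2 * ((\<epsilon> / 4) / sqrt n)) \<le> sqrt n * (F n \<omega> (E n) - 1 / 2)"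
      using FE QW sn by (intro mult_left_mono) auto
    moreover have "sqrt n * (1 / 2 - (tail (c / sqrt n - CARD('n) / n) + err n) - 2 * ((\<epsilon> / 4) / sqrt n)) =
      sqrt n * (1 / 2 - tail (c / sqrt n - CARD('n) / n)) - sqrt n * err n - \<epsilon> / 2"
      using sn by (simp add: algebra_simps)
    moreover have "scaled_score (p0 n) n \<omega> = sqrt n * (F n \<omega> (E n) - 1 / 2)"
      by (simp only: scaled_score_def E_def)
    ultimately show "f0 * c - \<epsilon> \<le> scaled_score (p0 n) n \<omega>"
      using n e by linarith
  qed
qed

text \<open>Almost surely no observation lies on the boundary hyperplane, so the two closed half-spaces share no
  observation.\<close>

lemma scaled_score_uminus_AE:
  assumes p: "norm p = 1" and n: "n \<ge> 1"
  shows "AE \<omega> in M. scaled_score (- p) n \<omega> = - scaled_score p n \<omega>"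
proof -
  have "AE \<omega> in M. \<forall>k\<in>{1..n}. p \<bullet> Z k \<omega> \<noteq> 0"
  proof (rule AE_finite_allI)
    fix k assume k: "k \<in> {1..n}"
    then have k1: "k \<ge> 1" by simp
    have "AE z in distr M borel (Z k). p \<bullet> z \<noteq> 0"
      unfolding Z_distr[OF k1] by (rule hyperplane_AE[OF p])
    then show "AE \<omega> in M. p \<bullet> Z k \<omega> \<noteq> 0"
      using k1 by (subst (asm) AE_distr_iff) auto
  qed simp
  then show ?thesis
  proof eventually_elim
    case (elim \<omega>)
    have "F n \<omega> {z. 0 \<le> (- p) \<bullet> z} = (\<Sum>k=1..n. 1 - indicator {z. 0 \<le> p \<bullet> z} (Z k \<omega>)) / n"
      unfolding frac_def using elim by (intro arg_cong2[where f="(/)"] sum.cong refl) (auto simp: indicator_def)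
    also have "\<dots> = 1 - F n \<omega> {z. 0 \<le> p \<bullet> z}"
      using n by (simp add: frac_def sum_subtractf diff_divide_distrib)
    finally have "scaled_score (- p) n \<omega> = sqrt n * (1 - F n \<omega> {z. 0 \<le> p \<bullet> z} - 1 / 2)"
      by (simp only: scaled_score_def)
    then show ?case by (simp add: scaled_score_def algebra_simps)
  qed
qed

text \<open>The one-sided bound is applied for all \<open>c\<close> in a finite grid that is fine compared to \<open>\<delta>\<close> and covers the range
  of \<open>score / f0\<close>. The other side is the same bound for the mirrored data \<open>- p\<close>, \<open>- p0\<close>, \<open>- m\<close>.\<close>

lemma bahadur:
  assumes p0: "\<And>n. norm (p0 n) = 1" and R: "R \<ge> 0" and e: "\<delta> > 0"
  shows "M.whp (\<lambda>n \<omega>. \<bar>scaled_score (p0 n) n \<omega>\<bar> \<le> L \<longrightarrow> (\<forall>p m. norm p = 1 \<longrightarrow> norm (p - p0 n) \<le> R * rate n \<longrightarrow>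
    1 / 2 \<le> F n \<omega> {z. m \<le> p \<bullet> z} \<longrightarrow> 1 / 2 \<le> F n \<omega> {z. p \<bullet> z \<le> m} \<longrightarrow> \<bar>sqrt n * m - scaled_score (p0 n) n \<omega> / f0\<bar> \<le> \<delta>))"
proof -
  define \<epsilon> where "\<epsilon> = \<delta> * f0 / 4"
  have \<epsilon>: "\<epsilon> > 0" using e f0_pos by (simp add: \<epsilon>_def)
  define N where "N = \<lceil>2 * (L / f0 + \<delta>) / \<delta>\<rceil> + 2"
  define grid where "grid = (\<lambda>k. real_of_int k * (\<delta> / 2)) ` {- N..N}"
  have up: "M.whp (\<lambda>n \<omega>. \<forall>c\<in>grid. \<forall>p m. norm p = 1 \<longrightarrow> norm (p - p0 n) \<le> R * rate n \<longrightarrow> c / sqrt n \<le> m \<longrightarrow>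
    1 / 2 \<le> F n \<omega> {z. m \<le> p \<bullet> z} \<longrightarrow> f0 * c - \<epsilon> \<le> scaled_score (p0 n) n \<omega>)"
    using p0 R \<epsilon> by (intro M.whp_ball_finite bahadur_one_sided) (auto simp: grid_def)
  have dn: "M.whp (\<lambda>n \<omega>. \<forall>c\<in>grid. \<forall>p m. norm p = 1 \<longrightarrow> norm (p - (- p0 n)) \<le> R * rate n \<longrightarrow> c / sqrt n \<le> m \<longrightarrow>
    1 / 2 \<le> F n \<omega> {z. m \<le> p \<bullet> z} \<longrightarrow> f0 * c - \<epsilon> \<le> scaled_score (- p0 n) n \<omega>)"
    using p0 R \<epsilon> by (intro M.whp_ball_finite bahadur_one_sided) (auto simp: grid_def)
  have ae: "M.whp (\<lambda>n \<omega>. scaled_score (- p0 n) n \<omega> = - scaled_score (p0 n) n \<omega>)"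
    by (rule M.whp_AE, rule eventually_sequentiallyI[of 1], rule scaled_score_uminus_AE[OF p0])
  \<comment> \<open>a grid point that exceeds t by between half and all of the tolerance\<close>
  have pick: "\<exists>c\<in>grid. t + \<delta> / 2 \<le> c \<and> c \<le> t + \<delta>" if "\<bar>t\<bar> \<le> L / f0" for t
  proof -
    define k where "k = \<lceil>(t + \<delta> / 2) / (\<delta> / 2)\<rceil>"
    have "(t + \<delta> / 2) / (\<delta> / 2) \<le> k" "k < (t + \<delta> / 2) / (\<delta> / 2) + 1" by (auto simp: k_def) linarith
    then have 1: "t + \<delta> / 2 \<le> k * (\<delta> / 2)" "k * (\<delta> / 2) \<le> t + \<delta>" using e by (auto simp: field_simps)
    have "\<bar>k * (\<delta> / 2)\<bar> \<le> L / f0 + \<delta>" using 1 that e by linarith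
    then have "\<bar>real_of_int k\<bar> * (\<delta> / 2) \<le> L / f0 + \<delta>" using e by (simp add: abs_mult)
    then have "\<bar>real_of_int k\<bar> \<le> 2 * (L / f0 + \<delta>) / \<delta>" using e by (simp add: field_simps)
    then have "\<bar>k\<bar> \<le> N" unfolding N_def by linarith
    then have "k \<in> {- N..N}" by auto
    then show ?thesis using 1 by (auto simp: grid_def)
  qed
  show ?thesis
  proof (rule M.whp_mono[OF M.whp_conj[OF M.whp_conj[OF up dn] ae]], rule eventually_sequentiallyI[of 1], intro ballI impI allI)
    fix n \<omega> p m
    assume n: "1 \<le> n"
      and H: "((\<forall>c\<in>grid. \<forall>p m. norm p = 1 \<longrightarrow> norm (p - p0 n) \<le> R * rate n \<longrightarrow> c / sqrt n \<le> m \<longrightarrow>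
        1 / 2 \<le> F n \<omega> {z. m \<le> p \<bullet> z} \<longrightarrow> f0 * c - \<epsilon> \<le> scaled_score (p0 n) n \<omega>) \<and>
        (\<forall>c\<in>grid. \<forall>p m. norm p = 1 \<longrightarrow> norm (p - (- p0 n)) \<le> R * rate n \<longrightarrow> c / sqrt n \<le> m \<longrightarrow>
        1 / 2 \<le> F n \<omega> {z. m \<le> p \<bullet> z} \<longrightarrow> f0 * c - \<epsilon> \<le> scaled_score (- p0 n) n \<omega>)) \<and>
        scaled_score (- p0 n) n \<omega> = - scaled_score (p0 n) n \<omega>"
      and L: "\<bar>scaled_score (p0 n) n \<omega>\<bar> \<le> L"
      and p: "norm p = 1" "norm (p - p0 n) \<le> R * rate n"
      and 1: "1 / 2 \<le> F n \<omega> {z. m \<le> p \<bullet> z}" and 2: "1 / 2 \<le> F n \<omega> {z. p \<bullet> z \<le> m}"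
    define T where "T = scaled_score (p0 n) n \<omega>"
    have sn: "sqrt n > 0" using n by simp
    have T: "\<bar>T / f0\<bar> \<le> L / f0" "\<bar>- T / f0\<bar> \<le> L / f0" using L f0_pos by (auto simp: T_def divide_right_mono)
    have up': "f0 * c - \<epsilon> \<le> T" if "c \<in> grid" "c / sqrt n \<le> m" for c
      using H p 1 that unfolding T_def by blast
    have dn': "f0 * c - \<epsilon> \<le> - T" if "c \<in> grid" "c / sqrt n \<le> - m" for c
    proof -
      have "1 / 2 \<le> F n \<omega> {z. - m \<le> (- p) \<bullet> z}" using 2 by simp
      moreover have "norm (- p - (- p0 n)) \<le> R * rate n" using p(2) by (simp add: norm_minus_commute)
      moreover have "norm (- p) = 1" using p by simp
      ultimately have "f0 * c - \<epsilon> \<le> scaled_score (- p0 n) n \<omega>" using H that by blast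
      then show ?thesis using H by (simp add: T_def)
    qed
    have A: "sqrt n * m \<le> T / f0 + \<delta>"
    proof (rule ccontr)
      assume a: "\<not> sqrt n * m \<le> T / f0 + \<delta>"
      obtain c where c: "c \<in> grid" "T / f0 + \<delta> / 2 \<le> c" "c \<le> T / f0 + \<delta>" using pick[OF T(1)] by blast
      have "c / sqrt n \<le> m" using a c sn by (simp add: pos_divide_le_eq mult.commute)
      from up'[OF c(1) this] have "f0 * c \<le> T + \<epsilon>" by simp
      moreover have "f0 * (T / f0 + \<delta> / 2) \<le> f0 * c" using c f0_pos by (intro mult_left_mono) auto
      ultimately show False using mult_pos_pos[OF e f0_pos] f0_pos by (simp add: \<epsilon>_def algebra_simps)
    qed
    have B: "- (sqrt n * m) \<le> - T / f0 + \<delta>"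
    proof (rule ccontr)
      assume a: "\<not> - (sqrt n * m) \<le> - T / f0 + \<delta>"
      obtain c where c: "c \<in> grid" "- T / f0 + \<delta> / 2 \<le> c" "c \<le> - T / f0 + \<delta>" using pick[OF T(2)] by blast
      have "c / sqrt n \<le> - m" using a c sn by (simp add: pos_divide_le_eq mult.commute)
      from dn'[OF c(1) this] have "f0 * c \<le> - T + \<epsilon>" by simp
      moreover have "f0 * (- T / f0 + \<delta> / 2) \<le> f0 * c" using c f0_pos by (intro mult_left_mono) auto
      ultimately show False using mult_pos_pos[OF e f0_pos] f0_pos by (simp add: \<epsilon>_def algebra_simps)
    qed
    show "\<bar>sqrt n * m - scaled_score (p0 n) n \<omega> / f0\<bar> \<le> \<delta>"
      using A B by (simp add: T_def[symmetric] abs_le_iff)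
  qed
qed

end

section \<open>Quarter medians in eigencoordinates\<close>

lemma orthogonal_matrix_columns:
  fixes B :: "real^'n^'n"
  assumes "orthogonal_matrix B"
  shows "(\<Sum>j\<in>UNIV. B $ j $ k * B $ j $ k') = (if k = k' then 1 else 0)"
proof -
  have "(transpose B ** B) $ k $ k' = (mat 1 :: real^'n^'n) $ k $ k'"
    using assms by (simp add: orthogonal_matrix_def)
  then show ?thesis by (simp add: matrix_matrix_mult_def transpose_def mat_def)
qed

lemma orthogonal_matrix_rows:
  fixes B :: "real^'n^'n"
  assumes "orthogonal_matrix B"
  shows "row i B \<bullet> row j B = (if i = j then 1 else 0)"
proof -
  have "(B ** transpose B) $ i $ j = (mat 1 :: real^'n^'n) $ i $ j"
    using assms by (simp add: orthogonal_matrix_def)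
  then show ?thesis by (simp add: matrix_matrix_mult_def transpose_def mat_def row_def inner_vec_def)
qed

lemma norm_row_orthogonal: "orthogonal_matrix B \<Longrightarrow> norm (row i (B :: real^'n^'n)) = 1"
  by (simp add: norm_eq_1 orthogonal_matrix_rows)

text \<open>Small off-diagonal entries of \<open>B diag(l) B\<^sup>t\<close> make every row of \<open>B\<close> an approximate eigenvector of \<open>diag(l)\<close>.
  The columns are unit vectors, so some row has a \<open>k\<close>-th entry that is not small. Its approximate
  eigenvalue is then close to \<open>l k\<close> and, by the gap, away from the other \<open>l k'\<close>; so its other entries are small.\<close>

lemma almost_diagonalising:
  fixes B :: "real^'n^'n" and l :: "'n \<Rightarrow> real"
  assumes B: "orthogonal_matrix B" and g: "g > 0" "\<And>i j. i \<noteq> j \<Longrightarrow> g \<le> \<bar>l i - l j\<bar>"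
    and off: "\<And>i j. i \<noteq> j \<Longrightarrow> \<bar>\<Sum>k\<in>UNIV. l k * B $ i $ k * B $ j $ k\<bar> \<le> \<kappa>" and k0: "\<kappa> \<ge> 0"
  shows "\<exists>i \<sigma>. (\<sigma> = 1 \<or> \<sigma> = - 1) \<and> norm (row i B - \<sigma> *\<^sub>R axis k 1) \<le> 4 * (real CARD('n))\<^sup>2 / g * \<kappa>"
proof -
  define d where "d = real CARD('n)"
  have d1: "d \<ge> 1" by (simp add: d_def Suc_leI)
  have rows: "(\<Sum>k\<in>UNIV. (B $ i $ k)\<^sup>2) = 1" for i
    using orthogonal_matrix_rows[OF B, of i i] by (simp add: inner_vec_def row_def power2_eq_square)
  have cols: "(\<Sum>i\<in>UNIV. (B $ i $ k)\<^sup>2) = 1" for k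
    using orthogonal_matrix_columns[OF B, of k k] by (simp add: power2_eq_square)
  have b1: "\<bar>B $ i $ k\<bar> \<le> 1" for i k
    using component_le_norm_cart[of "row i B" k] norm_row_orthogonal[OF B, of i] by (simp add: row_def)
  have "\<exists>i. (B $ i $ k)\<^sup>2 \<ge> 1 / d"
  proof (rule ccontr)
    assume "\<not> ?thesis"
    then have "(\<Sum>i\<in>UNIV. (B $ i $ k)\<^sup>2) < (\<Sum>i\<in>(UNIV::'n set). 1 / d)" by (intro sum_strict_mono) (auto simp: not_le)
    then show False by (simp add: cols d_def)
  qed
  then obtain i where i: "(B $ i $ k)\<^sup>2 \<ge> 1 / d" by blast
  have bk: "\<bar>B $ i $ k\<bar> \<ge> 1 / d"
  proof -
    have "(B $ i $ k)\<^sup>2 = \<bar>B $ i $ k\<bar> * \<bar>B $ i $ k\<bar>" by (simp add: power2_eq_square)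
    also have "\<dots> \<le> \<bar>B $ i $ k\<bar> * 1" by (intro mult_left_mono b1) auto
    finally show ?thesis using i by simp
  qed
  define a where "a = (\<Sum>k\<in>UNIV. l k * B $ i $ k * B $ i $ k)"
  \<comment> \<open>Expand diag(l) (row i B) in the orthonormal basis of rows; a is its coefficient at row i itself.\<close>
  have eig: "\<bar>(l k' - a) * B $ i $ k'\<bar> \<le> d * \<kappa>" for k'
  proof -
    let ?E = "\<lambda>j. \<Sum>m\<in>UNIV. l m * B $ i $ m * B $ j $ m"
    have "(\<Sum>j\<in>UNIV. B $ j $ k' * ?E j) = (\<Sum>j\<in>UNIV. \<Sum>m\<in>UNIV. l m * B $ i $ m * (B $ j $ m * B $ j $ k'))"
      by (simp add: sum_distrib_left mult_ac)
    also have "\<dots> = (\<Sum>m\<in>UNIV. l m * B $ i $ m * (\<Sum>j\<in>UNIV. B $ j $ m * B $ j $ k'))"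
      by (subst sum.swap) (simp add: sum_distrib_left)
    also have "\<dots> = l k' * B $ i $ k'"
      by (simp add: orthogonal_matrix_columns[OF B] if_distrib cong: if_cong)
    finally have "l k' * B $ i $ k' = (\<Sum>j\<in>UNIV. B $ j $ k' * ?E j)" by simp
    also have "\<dots> = B $ i $ k' * a + (\<Sum>j\<in>UNIV - {i}. B $ j $ k' * ?E j)"
      by (subst sum.remove[of _ i]) (auto simp: a_def)
    finally have "\<bar>(l k' - a) * B $ i $ k'\<bar> = \<bar>\<Sum>j\<in>UNIV - {i}. B $ j $ k' * ?E j\<bar>" by (simp add: algebra_simps)
    also have "\<dots> \<le> (\<Sum>j\<in>UNIV - {i}. \<bar>B $ j $ k' * ?E j\<bar>)" by (rule sum_abs)
    also have "\<dots> \<le> (\<Sum>j\<in>UNIV - {i}. 1 * \<kappa>)"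
      unfolding abs_mult by (intro sum_mono mult_mono b1 off) auto
    also have "\<dots> \<le> (\<Sum>j\<in>(UNIV::'n set). 1 * \<kappa>)" using k0 by (intro sum_mono2) auto
    finally show ?thesis by (simp add: d_def)
  qed
  define \<sigma> where "\<sigma> = (if B $ i $ k \<ge> 0 then 1 else - 1 :: real)"
  have s: "\<sigma> = 1 \<or> \<sigma> = - 1" by (simp add: \<sigma>_def)
  have ns: "norm (\<sigma> *\<^sub>R axis k (1::real) :: real^'n) = 1" using s by auto
  show ?thesis
  \<comment> \<open>If \<kappa> is not small, the bound is at least 2, the largest distance of unit vectors.\<close>
  proof (cases "d\<^sup>2 * \<kappa> \<le> g / 2")
    case False
    have "norm (row i B - \<sigma> *\<^sub>R axis k 1) \<le> 2"
      using norm_triangle_ineq4[of "row i B" "\<sigma> *\<^sub>R axis k 1"] norm_row_orthogonal[OF B, of i] ns by simp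
    also have "2 \<le> 4 * d\<^sup>2 / g * \<kappa>" using False g by (simp add: field_simps)
    finally show ?thesis using s unfolding d_def by blast
  next
    case True
    have lk: "\<bar>l k - a\<bar> \<le> g / 2"
    proof -
      have "\<bar>l k - a\<bar> * (1 / d) \<le> \<bar>l k - a\<bar> * \<bar>B $ i $ k\<bar>" using bk by (intro mult_left_mono) auto
      also have "\<dots> \<le> d * \<kappa>" using eig[of k] by (simp add: abs_mult)
      finally have "\<bar>l k - a\<bar> \<le> d\<^sup>2 * \<kappa>" using d1 by (simp add: field_simps power2_eq_square)
      then show ?thesis using True by simp
    qed
    have small: "\<bar>B $ i $ k'\<bar> \<le> 2 * d * \<kappa> / g" if "k' \<noteq> k" for k'
    proof -
      have "g / 2 \<le> \<bar>l k' - a\<bar>" using g(2)[OF that] lk by linarith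
      then have "g / 2 * \<bar>B $ i $ k'\<bar> \<le> \<bar>l k' - a\<bar> * \<bar>B $ i $ k'\<bar>" by (intro mult_right_mono) auto
      also have "\<dots> \<le> d * \<kappa>" using eig[of k'] by (simp add: abs_mult)
      finally show ?thesis using g by (simp add: field_simps)
    qed
    have diag: "1 - \<bar>B $ i $ k\<bar> \<le> (\<Sum>k'\<in>UNIV - {k}. \<bar>B $ i $ k'\<bar>)"
    proof -
      have sq: "(B $ i $ k')\<^sup>2 \<le> \<bar>B $ i $ k'\<bar>" for k'
      proof -
        have "(B $ i $ k')\<^sup>2 = \<bar>B $ i $ k'\<bar> * \<bar>B $ i $ k'\<bar>" by (simp add: power2_eq_square)
        also have "\<dots> \<le> \<bar>B $ i $ k'\<bar> * 1" by (intro mult_left_mono b1) auto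
        finally show ?thesis by simp
      qed
      have "1 = (B $ i $ k)\<^sup>2 + (\<Sum>k'\<in>UNIV - {k}. (B $ i $ k')\<^sup>2)"
        using rows[of i] by (subst (asm) sum.remove[of _ k]) auto
      also have "\<dots> \<le> \<bar>B $ i $ k\<bar> + (\<Sum>k'\<in>UNIV - {k}. \<bar>B $ i $ k'\<bar>)"
        by (intro add_mono sum_mono sq)
      finally show ?thesis by simp
    qed
    have "norm (row i B - \<sigma> *\<^sub>R axis k 1) \<le> (\<Sum>k'\<in>UNIV. \<bar>(row i B - \<sigma> *\<^sub>R axis k 1) $ k'\<bar>)"
      by (rule norm_le_l1_cart)
    also have "\<dots> = \<bar>B $ i $ k - \<sigma>\<bar> + (\<Sum>k'\<in>UNIV - {k}. \<bar>B $ i $ k'\<bar>)"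
      by (subst sum.remove[of _ k]) (auto simp: row_def axis_def intro!: sum.cong)
    also have "\<bar>B $ i $ k - \<sigma>\<bar> = 1 - \<bar>B $ i $ k\<bar>" using b1[of i k] by (auto simp: \<sigma>_def abs_if split: if_splits)
    also have "1 - \<bar>B $ i $ k\<bar> + (\<Sum>k'\<in>UNIV - {k}. \<bar>B $ i $ k'\<bar>) \<le> 2 * (\<Sum>k'\<in>UNIV - {k}. \<bar>B $ i $ k'\<bar>)" using diag by simp
    also have "(\<Sum>k'\<in>UNIV - {k}. \<bar>B $ i $ k'\<bar>) \<le> (\<Sum>k'\<in>UNIV - {k}. 2 * d * \<kappa> / g)" by (intro sum_mono small) auto
    also have "\<dots> \<le> (\<Sum>k'\<in>(UNIV::'n set). 2 * d * \<kappa> / g)" using k0 g d1 by (intro sum_mono2) auto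
    also have "\<dots> = 2 * d\<^sup>2 / g * \<kappa>" by (simp add: d_def power2_eq_square)
    finally have "norm (row i B - \<sigma> *\<^sub>R axis k 1) \<le> 4 * d\<^sup>2 / g * \<kappa>" by simp
    then show ?thesis using s unfolding d_def by blast
  qed
qed

lemma normalise_close:
  fixes u v :: "'a::real_normed_vector"
  assumes "v \<noteq> 0" "u \<noteq> 0"
  shows "norm (u /\<^sub>R norm u - v /\<^sub>R norm v) \<le> 2 * norm (u - v) / norm v"
proof -
  have nv: "norm v > 0" and nu: "norm u > 0" using assms by auto
  define a b where "a = norm u" and "b = norm v"
  have ab: "a > 0" "b > 0" using nv nu by (auto simp: a_def b_def)
  have "b *\<^sub>R (u /\<^sub>R a - v /\<^sub>R b) = (b / a - 1) *\<^sub>R u + (u - v)"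
    using ab by (simp add: scaleR_diff_right scaleR_diff_left divide_inverse)
  then have "norm (b *\<^sub>R (u /\<^sub>R a - v /\<^sub>R b)) \<le> norm ((b / a - 1) *\<^sub>R u) + norm (u - v)"
    by (metis norm_triangle_ineq)
  also have "norm (b *\<^sub>R (u /\<^sub>R a - v /\<^sub>R b)) = b * norm (u /\<^sub>R a - v /\<^sub>R b)" using ab by simp
  also have "norm ((b / a - 1) *\<^sub>R u) = \<bar>b / a - 1\<bar> * a" by (simp add: a_def)
  also have "\<bar>b / a - 1\<bar> * a = \<bar>(b / a - 1) * a\<bar>" using ab by (simp add: abs_mult)
  also have "(b / a - 1) * a = b - a" using ab by (simp add: field_simps)
  also have "\<bar>b - a\<bar> \<le> norm (u - v)"
    using norm_triangle_ineq3[of v u] by (simp add: a_def b_def norm_minus_commute)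
  finally show ?thesis using ab by (simp add: a_def b_def field_simps)
qed

text \<open>The action of \<open>diag(sqrt l)\<close>.\<close>

definition stretch :: "('n \<Rightarrow> real) \<Rightarrow> real^'n \<Rightarrow> real^'n" where
  "stretch l v = (\<chi> k. sqrt (l k) * v $ k)"

context spherical_sample
begin

text \<open>Here \<open>B\<close> and \<open>y\<close> stand for the frame and the centred location in eigencoordinates. Medians of
  the projections are \<open>O(rate n)\<close>, hence the stretched rows are nearly orthogonal, hence the rows are near the
  axes. For the row near the axis \<open>k\<close>, the Bahadur representation gives its median. Rescaled by the
  length of the stretched row, this median is \<open>y $ k\<close> up to a product of two terms of order \<open>rate n\<close>.\<close>

lemma quarter_median_expansion:
  fixes l :: "'n \<Rightarrow> real"
  assumes l: "\<And>k. l k > 0" and inj: "\<And>i j. i \<noteq> j \<Longrightarrow> l i \<noteq> l j" and \<delta>: "\<delta> > 0"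
  shows "M.whp (\<lambda>n \<omega>. (\<forall>k. \<bar>scaled_score (axis k 1) n \<omega>\<bar> \<le> L) \<longrightarrow>
    (\<forall>B y. orthogonal_matrix B \<longrightarrow>
      (\<forall>i. 1 / 2 \<le> F n \<omega> {z. row i B \<bullet> y \<le> stretch l (row i B) \<bullet> z} \<and> 1 / 2 \<le> F n \<omega> {z. stretch l (row i B) \<bullet> z \<le> row i B \<bullet> y}) \<longrightarrow>
      (\<forall>i j. i \<noteq> j \<longrightarrow> 1 / 4 \<le> F n \<omega> {z. row i B \<bullet> y \<le> stretch l (row i B) \<bullet> z \<and> stretch l (row j B) \<bullet> z \<le> row j B \<bullet> y} \<and>
         1 / 4 \<le> F n \<omega> {z. row i B \<bullet> y \<le> stretch l (row i B) \<bullet> z \<and> row j B \<bullet> y \<le> stretch l (row j B) \<bullet> z}) \<longrightarrow>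
      (\<forall>k. \<bar>sqrt n * y $ k - sqrt (l k) * (scaled_score (axis k 1) n \<omega> / f0)\<bar> \<le> \<delta>)))"
proof -
  define lmax lmin where "lmax = Max (range l)" and "lmin = Min (range l)"
  have lm: "l k \<le> lmax" "lmin \<le> l k" for k by (auto simp: lmax_def lmin_def)
  have lmin0: "lmin > 0" using l by (simp add: lmin_def)
  have lmax0: "lmax > 0" using lm(1)[of undefined] l[of undefined] by simp
  define sM where "sM = sqrt lmax"
  define sm where "sm = sqrt lmin"
  have sM: "sM > 0" and sm: "sm > 0" using lmax0 lmin0 by (auto simp: sM_def sm_def)
  have sl: "sqrt (l k) \<le> sM" "sm \<le> sqrt (l k)" for k using lm by (auto simp: sM_def sm_def)
  have sl0: "sqrt (l k) > 0" for k using l by simp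
  have sla: "\<bar>sqrt (l k)\<bar> \<le> sM" "sm \<le> \<bar>sqrt (l k)\<bar>" for k using sl[of k] sl0[of k] by auto
  have "\<exists>g>0. \<forall>i j. i \<noteq> j \<longrightarrow> g \<le> \<bar>l i - l j\<bar>"
  proof -
    let ?S = "insert 1 ((\<lambda>(i, j). \<bar>l i - l j\<bar>) ` {(i, j). i \<noteq> j})"
    have fin: "finite ?S" by simp
    have "Min ?S > 0" using inj by (subst Min_gr_iff[OF fin]) auto
    moreover have "Min ?S \<le> \<bar>l i - l j\<bar>" if "i \<noteq> j" for i j using that by (intro Min_le fin) auto
    ultimately show ?thesis by blast
  qed
  then obtain g where g: "g > 0" "\<And>i j. i \<noteq> j \<Longrightarrow> g \<le> \<bar>l i - l j\<bar>" by blast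
  define d where "d = real CARD('n)"
  have d0: "d > 0" by (simp add: d_def)
  obtain R1 where R1: "R1 > 0" "M.whp (\<lambda>n \<omega>. \<forall>p m. norm p = 1 \<longrightarrow> 1 / 2 \<le> F n \<omega> {z. m \<le> p \<bullet> z} \<longrightarrow> 1 / 2 \<le> F n \<omega> {z. p \<bullet> z \<le> m} \<longrightarrow> \<bar>m\<bar> \<le> R1 * rate n)"
    using location_rate by blast
  obtain R2 where R2: "R2 > 0" "M.whp (\<lambda>n \<omega>. \<forall>p q a b. norm p = 1 \<longrightarrow> norm q = 1 \<longrightarrow> \<bar>a\<bar> \<le> R1 * rate n \<longrightarrow> \<bar>b\<bar> \<le> R1 * rate n \<longrightarrow>
    1 / 4 \<le> F n \<omega> {z. a \<le> p \<bullet> z \<and> q \<bullet> z \<le> b} \<longrightarrow> 1 / 4 \<le> F n \<omega> {z. a \<le> p \<bullet> z \<and> b \<le> q \<bullet> z} \<longrightarrow> \<bar>p \<bullet> q\<bar> \<le> R2 * rate n)"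
    using orthogonality_rate[OF R1(1)] by blast
  define R3 where "R3 = 4 * d\<^sup>2 / g * (lmax * R2)"
  define R4 where "R4 = 2 * (sM * R3) / sm"
  have R3: "R3 \<ge> 0" using g lmax0 R2(1) by (simp add: R3_def)
  have R4: "R4 \<ge> 0" using sM sm R3 by (simp add: R4_def)
  define \<delta>' where "\<delta>' = \<delta> / (2 * sM)"
  have \<delta>': "\<delta>' > 0" using \<delta> sM by (simp add: \<delta>'_def)
  have bah: "M.whp (\<lambda>n \<omega>. \<forall>k\<in>UNIV. \<bar>scaled_score (axis k 1) n \<omega>\<bar> \<le> L \<longrightarrow> (\<forall>p m. norm p = 1 \<longrightarrow> norm (p - axis k 1) \<le> R4 * rate n \<longrightarrow>
    1 / 2 \<le> F n \<omega> {z. m \<le> p \<bullet> z} \<longrightarrow> 1 / 2 \<le> F n \<omega> {z. p \<bullet> z \<le> m} \<longrightarrow> \<bar>sqrt n * m - scaled_score (axis k 1) n \<omega> / f0\<bar> \<le> \<delta>'))"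
    by (intro M.whp_ball_finite bahadur[where ?p0.0 = "\<lambda>_. axis k 1" for k] R4 \<delta>') auto
  define C5 where "C5 = R3 * (d * (sM * R1))"
  define C6 where "C6 = sM * R3 * (L / f0)"
  have "(\<lambda>n. C5 * (sqrt n * (rate n * rate n)) + C6 * rate n) \<longlonglongrightarrow> C5 * 0 + C6 * 0"
    by (intro tendsto_intros) real_asymp+
  then have ev1: "eventually (\<lambda>n. C5 * (sqrt n * (rate n * rate n)) + C6 * rate n < \<delta> / 2) sequentially"
    using \<delta> by (intro order_tendstoD) auto
  have ev: "eventually (\<lambda>n. n \<ge> 1 \<and> C5 * (sqrt n * (rate n * rate n)) + C6 * rate n < \<delta> / 2) sequentially"
    using ev1 by (intro eventually_conj eventually_ge_at_top)
  show ?thesis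
  proof (rule M.whp_mono[OF M.whp_conj[OF M.whp_conj[OF R1(2) R2(2)] bah]], rule eventually_mono[OF ev], rule ballI, rule impI, elim conjE, intro impI allI)
    fix n \<omega> B y k
    assume n: "n \<ge> 1" and small: "C5 * (sqrt n * (rate n * rate n)) + C6 * rate n < \<delta> / 2"
      and H1: "\<forall>p m. norm p = 1 \<longrightarrow> 1 / 2 \<le> F n \<omega> {z. m \<le> p \<bullet> z} \<longrightarrow> 1 / 2 \<le> F n \<omega> {z. p \<bullet> z \<le> m} \<longrightarrow> \<bar>m\<bar> \<le> R1 * rate n"
      and H2: "\<forall>p q a b. norm p = 1 \<longrightarrow> norm q = 1 \<longrightarrow> \<bar>a\<bar> \<le> R1 * rate n \<longrightarrow> \<bar>b\<bar> \<le> R1 * rate n \<longrightarrow>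
        1 / 4 \<le> F n \<omega> {z. a \<le> p \<bullet> z \<and> q \<bullet> z \<le> b} \<longrightarrow> 1 / 4 \<le> F n \<omega> {z. a \<le> p \<bullet> z \<and> b \<le> q \<bullet> z} \<longrightarrow> \<bar>p \<bullet> q\<bar> \<le> R2 * rate n"
      and H3: "\<forall>k\<in>UNIV. \<bar>scaled_score (axis k 1) n \<omega>\<bar> \<le> L \<longrightarrow> (\<forall>p m. norm p = 1 \<longrightarrow> norm (p - axis k 1) \<le> R4 * rate n \<longrightarrow>
        1 / 2 \<le> F n \<omega> {z. m \<le> p \<bullet> z} \<longrightarrow> 1 / 2 \<le> F n \<omega> {z. p \<bullet> z \<le> m} \<longrightarrow> \<bar>sqrt n * m - scaled_score (axis k 1) n \<omega> / f0\<bar> \<le> \<delta>')"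
      and L: "\<forall>k. \<bar>scaled_score (axis k 1) n \<omega>\<bar> \<le> L" and B: "orthogonal_matrix B"
      and half: "\<forall>i. 1 / 2 \<le> F n \<omega> {z. row i B \<bullet> y \<le> stretch l (row i B) \<bullet> z} \<and> 1 / 2 \<le> F n \<omega> {z. stretch l (row i B) \<bullet> z \<le> row i B \<bullet> y}"
      and quarter: "\<forall>i j. i \<noteq> j \<longrightarrow> 1 / 4 \<le> F n \<omega> {z. row i B \<bullet> y \<le> stretch l (row i B) \<bullet> z \<and> stretch l (row j B) \<bullet> z \<le> row j B \<bullet> y} \<and>
         1 / 4 \<le> F n \<omega> {z. row i B \<bullet> y \<le> stretch l (row i B) \<bullet> z \<and> row j B \<bullet> y \<le> stretch l (row j B) \<bullet> z}"
    have r0: "rate n > 0" using n by simp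
    \<comment> \<open>Unit vectors p i and thresholds m i that describe the half-spaces of the stretched rows.\<close>
    define b where "b = (\<lambda>i. row i B)"
    define u where "u = (\<lambda>i. stretch l (b i))"
    define w where "w = (\<lambda>i. norm (u i))"
    define p where "p = (\<lambda>i. u i /\<^sub>R w i)"
    define m where "m = (\<lambda>i. (b i \<bullet> y) / w i)"
    have nb: "norm (b i) = 1" for i by (simp add: b_def norm_row_orthogonal[OF B])
    have stretch_norm: "norm (stretch l v) \<le> sM * norm v" "sm * norm v \<le> norm (stretch l v)" for v
    proof -
      have "norm (stretch l v) \<le> L2_set (\<lambda>k. sM * \<bar>v $ k\<bar>) UNIV"
        unfolding norm_vec_def stretch_def by (intro L2_set_mono) (auto simp: abs_mult intro!: mult_right_mono sla)
      also have "\<dots> = sM * norm v"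
        unfolding norm_vec_def using sM by (subst L2_set_right_distrib[symmetric]) auto
      finally show "norm (stretch l v) \<le> sM * norm v" .
      have "sm * norm v = L2_set (\<lambda>k. sm * \<bar>v $ k\<bar>) UNIV"
        unfolding norm_vec_def using sm by (subst L2_set_right_distrib) auto
      also have "\<dots> \<le> norm (stretch l v)"
        unfolding norm_vec_def stretch_def using sm by (intro L2_set_mono) (auto simp: abs_mult intro!: mult_right_mono sla)
      finally show "sm * norm v \<le> norm (stretch l v)" .
    qed
    have w: "sm \<le> w i" "w i \<le> sM" for i using stretch_norm[of "b i"] by (auto simp: w_def u_def nb)
    have w0: "w i > 0" for i using w(1)[of i] sm by linarith
    have np: "norm (p i) = 1" for i using w0[of i] by (simp add: p_def w_def)
    have up: "u i = w i *\<^sub>R p i" for i using w0[of i] by (simp add: p_def)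
    have ge: "(b i \<bullet> y \<le> u i \<bullet> z) = (m i \<le> p i \<bullet> z)" "(u i \<bullet> z \<le> b i \<bullet> y) = (p i \<bullet> z \<le> m i)" for i z
      using w0[of i] unfolding m_def by (auto simp: up pos_divide_le_eq pos_le_divide_eq mult.commute)
    have bi: "row i B = b i" and ui: "stretch l (b i) = u i" for i by (simp_all add: b_def u_def)
    have half': "1 / 2 \<le> F n \<omega> {z. m i \<le> p i \<bullet> z}" "1 / 2 \<le> F n \<omega> {z. p i \<bullet> z \<le> m i}" for i
      using half[rule_format, of i] unfolding bi ui ge by simp_all
    have mr: "\<bar>m i\<bar> \<le> R1 * rate n" for i using H1 np half' by blast
    have pp: "\<bar>p i \<bullet> p j\<bar> \<le> R2 * rate n" if "i \<noteq> j" for i j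
    proof -
      have "1 / 4 \<le> F n \<omega> {z. m i \<le> p i \<bullet> z \<and> p j \<bullet> z \<le> m j}" "1 / 4 \<le> F n \<omega> {z. m i \<le> p i \<bullet> z \<and> m j \<le> p j \<bullet> z}"
        using quarter[rule_format, OF that] unfolding bi ui ge by simp_all
      then show ?thesis using H2 np mr by blast
    qed
    have off: "\<bar>\<Sum>k\<in>UNIV. l k * B $ i $ k * B $ j $ k\<bar> \<le> lmax * R2 * rate n" if "i \<noteq> j" for i j
    proof -
      have "(\<Sum>k\<in>UNIV. l k * B $ i $ k * B $ j $ k) = u i \<bullet> u j"
      proof -
        have "l k * B $ i $ k * B $ j $ k = (sqrt (l k) * B $ i $ k) * (sqrt (l k) * B $ j $ k)" for k
        proof -
          have "sqrt (l k) * sqrt (l k) = l k" using l[of k] by simp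
          then show ?thesis by (metis (no_types, lifting) mult.assoc mult.commute)
        qed
        then have "(\<Sum>k\<in>UNIV. l k * B $ i $ k * B $ j $ k) = (\<Sum>k\<in>UNIV. (sqrt (l k) * B $ i $ k) * (sqrt (l k) * B $ j $ k))"
          by (rule sum.cong[OF refl])
        also have "\<dots> = u i \<bullet> u j" by (simp add: u_def stretch_def inner_vec_def b_def row_def)
        finally show ?thesis .
      qed
      also have "\<bar>u i \<bullet> u j\<bar> = (w i * w j) * \<bar>p i \<bullet> p j\<bar>" using w0[of i] w0[of j] by (simp add: up abs_mult)
      also have "\<dots> \<le> (sM * sM) * (R2 * rate n)"
        using w0 w pp[OF that] sM by (intro mult_mono) (auto intro: less_imp_le)
      also have "sM * sM = lmax" using lmax0 by (simp add: sM_def)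
      finally show ?thesis by (simp add: mult.assoc)
    qed
    obtain i \<sigma> where \<sigma>: "\<sigma> = 1 \<or> \<sigma> = - 1" and close: "norm (b i - \<sigma> *\<^sub>R axis k 1) \<le> R3 * rate n"
      using almost_diagonalising[OF B g off, of k] lmax0 R2(1) r0 unfolding b_def R3_def d_def by (auto simp: mult.assoc)
    have close': "norm (\<sigma> *\<^sub>R b i - axis k 1) \<le> R3 * rate n"
    proof -
      have "\<sigma> *\<^sub>R b i - axis k 1 = \<sigma> *\<^sub>R (b i - \<sigma> *\<^sub>R axis k 1)" using \<sigma> by auto
      then have "norm (\<sigma> *\<^sub>R b i - axis k 1) = \<bar>\<sigma>\<bar> * norm (b i - \<sigma> *\<^sub>R axis k 1)" by (metis norm_scaleR)
      moreover have "\<bar>\<sigma>\<bar> = 1" using \<sigma> by auto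
      ultimately show ?thesis using close by simp
    qed
    define v where "v = stretch l (axis k 1)"
    have v: "v = sqrt (l k) *\<^sub>R axis k 1" by (auto simp: v_def stretch_def vec_eq_iff axis_def)
    have nv: "norm v = sqrt (l k)" using l[of k] by (simp add: v)
    have su: "stretch l (\<sigma> *\<^sub>R b i - axis k 1) = \<sigma> *\<^sub>R u i - v"
      by (simp add: u_def v_def stretch_def vec_eq_iff algebra_simps)
    have uv: "norm (\<sigma> *\<^sub>R u i - v) \<le> sM * (R3 * rate n)"
      unfolding su[symmetric] using stretch_norm(1)[of "\<sigma> *\<^sub>R b i - axis k 1"] close' sM
      by (meson mult_left_mono less_imp_le order_trans)
    have wv: "norm (\<sigma> *\<^sub>R u i) = w i" using \<sigma> by (auto simp: w_def)
    have "norm ((\<sigma> *\<^sub>R u i) /\<^sub>R norm (\<sigma> *\<^sub>R u i) - v /\<^sub>R norm v) \<le> 2 * norm (\<sigma> *\<^sub>R u i - v) / norm v"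
      using nv l[of k] wv w0[of i] by (intro normalise_close) (metis norm_zero order_less_irrefl real_sqrt_gt_0_iff)+
    also have "\<dots> \<le> 2 * (sM * (R3 * rate n)) / sm"
      using uv sl(2)[of k] sm sM R3 r0 unfolding nv by (intro frac_le mult_nonneg_nonneg) auto
    also have "\<dots> = R4 * rate n" by (simp add: R4_def)
    also have "(\<sigma> *\<^sub>R u i) /\<^sub>R norm (\<sigma> *\<^sub>R u i) = \<sigma> *\<^sub>R p i" unfolding wv by (simp add: p_def)
    also have "v /\<^sub>R norm v = axis k 1" using l[of k] by (simp add: v)
    finally have pk: "norm (\<sigma> *\<^sub>R p i - axis k 1) \<le> R4 * rate n" .
    have "1 / 2 \<le> F n \<omega> {z. \<sigma> * m i \<le> (\<sigma> *\<^sub>R p i) \<bullet> z}" "1 / 2 \<le> F n \<omega> {z. (\<sigma> *\<^sub>R p i) \<bullet> z \<le> \<sigma> * m i}" "norm (\<sigma> *\<^sub>R p i) = 1"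
      using \<sigma> half'[of i] np[of i] by auto
    then have main: "\<bar>sqrt n * (\<sigma> * m i) - scaled_score (axis k 1) n \<omega> / f0\<bar> \<le> \<delta>'"
      using H3 L pk by blast
    define T where "T = scaled_score (axis k 1) n \<omega> / f0"
    have TL: "\<bar>T\<bar> \<le> L / f0" using L f0_pos by (simp add: T_def divide_right_mono)
    have L0: "L / f0 \<ge> 0" using TL by linarith
    have bym: "b j \<bullet> y = w j * m j" for j using w0[of j] by (simp add: m_def)
    have ny: "norm y \<le> d * (sM * (R1 * rate n))"
    proof -
      have "norm y = norm (B *v y)" using B by (metis orthogonal_transformation orthogonal_transformation_matrix matrix_of_matrix_vector_mul matrix_vector_mul_linear)
      also have "\<dots> \<le> (\<Sum>j\<in>UNIV. \<bar>(B *v y) $ j\<bar>)" by (rule norm_le_l1_cart)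
      also have "\<dots> = (\<Sum>j\<in>UNIV. w j * \<bar>m j\<bar>)"
      proof (intro sum.cong refl)
        fix j
        have "(B *v y) $ j = b j \<bullet> y" by (simp add: matrix_vector_mult_def inner_vec_def b_def row_def)
        then show "\<bar>(B *v y) $ j\<bar> = w j * \<bar>m j\<bar>" using w0[of j] by (simp add: bym abs_mult)
      qed
      also have "\<dots> \<le> (\<Sum>j\<in>(UNIV::'n set). sM * (R1 * rate n))"
        using w mr sM by (intro sum_mono mult_mono) auto
      finally show ?thesis by (simp add: d_def)
    qed
    have yk: "\<bar>y $ k - w i * (\<sigma> * m i)\<bar> \<le> C5 * (rate n * rate n)"
    proof -
      have "w i * (\<sigma> * m i) - y $ k = (\<sigma> *\<^sub>R b i - axis k 1) \<bullet> y"
        by (simp add: inner_diff_left bym inner_axis' mult_ac)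
      then have "\<bar>y $ k - w i * (\<sigma> * m i)\<bar> = \<bar>(\<sigma> *\<^sub>R b i - axis k 1) \<bullet> y\<bar>" by (metis abs_minus_commute)
      also have "\<dots> \<le> norm (\<sigma> *\<^sub>R b i - axis k 1) * norm y" by (rule Cauchy_Schwarz_ineq2)
      also have "\<dots> \<le> (R3 * rate n) * (d * (sM * (R1 * rate n)))" using close' ny R3 r0 by (intro mult_mono) auto
      finally show ?thesis by (simp add: C5_def mult_ac)
    qed
    \<comment> \<open>Three errors remain: row against axis, Bahadur representation, length of the stretched row.\<close>
    have wl: "\<bar>w i - sqrt (l k)\<bar> \<le> sM * (R3 * rate n)"
      using norm_triangle_ineq3[of "\<sigma> *\<^sub>R u i" v] uv unfolding wv nv by linarith
    have "\<bar>sqrt n * y $ k - sqrt (l k) * T\<bar> \<le> \<bar>sqrt n * (y $ k - w i * (\<sigma> * m i))\<bar> + \<bar>w i * (sqrt n * (\<sigma> * m i) - T)\<bar> + \<bar>(w i - sqrt (l k)) * T\<bar>"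
    proof -
      have "sqrt n * y $ k - sqrt (l k) * T = sqrt n * (y $ k - w i * (\<sigma> * m i)) + w i * (sqrt n * (\<sigma> * m i) - T) + (w i - sqrt (l k)) * T"
        by (simp add: algebra_simps)
      then show ?thesis by linarith
    qed
    also have "\<dots> \<le> sqrt n * (C5 * (rate n * rate n)) + sM * \<delta>' + sM * (R3 * rate n) * (L / f0)"
      unfolding abs_mult using yk main wl TL w[of i] w0[of i] sM R3 r0 \<delta>'
      by (intro add_mono mult_mono) (auto simp: T_def[symmetric])
    also have "\<dots> = (C5 * (sqrt n * (rate n * rate n)) + C6 * rate n) + sM * \<delta>'" by (simp add: C6_def algebra_simps)
    also have "sM * \<delta>' = \<delta> / 2" using sM by (simp add: \<delta>'_def)
    finally show "\<bar>sqrt n * y $ k - sqrt (l k) * (scaled_score (axis k 1) n \<omega> / f0)\<bar> \<le> \<delta>"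
      using small by (simp add: T_def)
  qed
qed

end

section \<open>The limit law of the scores\<close>

lemma closed_orthant: "closed {z::real^'n. \<forall>i\<in>I. 0 \<le> z $ i}"
proof -
  have "{z::real^'n. \<forall>i\<in>I. 0 \<le> z $ i} = (\<Inter>i\<in>I. {z. 0 \<le> z $ i})" by auto
  then show ?thesis by (auto intro!: closed_INT closed_Collect_le continuous_intros)
qed

lemma borel_orthant: "{z::real^'n. \<forall>i\<in>I. 0 \<le> z $ i} \<in> sets borel"
  by (intro borel_closed closed_orthant)

lemma borel_coordinate: "{z::real^'n. 0 \<le> z $ i} \<in> sets borel" "{z::real^'n. z $ i \<le> 0} \<in> sets borel"
  by (intro borel_closed closed_Collect_le continuous_intros)+

text \<open>Reflecting the coordinate \<open>j\<close> exchanges \<open>0 \<le> z $ j\<close> and \<open>z $ j \<le> 0\<close> and keeps the other signs; so each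
  further sign condition halves the probability.\<close>

lemma (in spherical_law) orthant_prob:
  assumes "finite I"
  shows "measure Q {z. \<forall>i\<in>I. 0 \<le> z $ i} = (1 / 2) ^ card I"
  using assms
proof (induction I rule: finite_induct)
  case empty
  then show ?case using prob_space by simp
next
  case (insert j I)
  let ?O = "{z::real^'n. \<forall>i\<in>I. 0 \<le> z $ i}"
  let ?P = "?O \<inter> {z. 0 \<le> z $ j}" and ?N = "?O \<inter> {z. z $ j \<le> 0}"
  have sets: "?P \<in> sets Q" "?N \<in> sets Q"
    unfolding sets_Q by (intro sets.Int borel_orthant borel_coordinate)+
  have "norm (axis j 1 :: real^'n) = norm (- axis j 1 :: real^'n)" by simp
  from reflection_exists[OF this] obtain f :: "real^'n \<Rightarrow> real^'n"
    where f: "orthogonal_transformation f" "f (axis j 1) = - axis j 1"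
      "\<And>w. w \<bullet> axis j 1 = w \<bullet> - axis j 1 \<Longrightarrow> f w = w" by blast
  have ff: "f v \<bullet> f w = v \<bullet> w" for v w using f(1) by (simp add: orthogonal_transformation_def)
  have fj: "f z $ j = - (z $ j)" for z
  proof -
    have "f z \<bullet> f (axis j 1) = z $ j" unfolding ff by (simp add: inner_axis)
    then show ?thesis unfolding f(2) by (simp add: inner_axis)
  qed
  have fi: "f z $ i = z $ i" if "i \<noteq> j" for z i
  proof -
    have "f (axis i 1) = axis i 1" using that by (intro f(3)) (simp add: inner_axis_axis)
    then have "f z \<bullet> axis i 1 = z \<bullet> axis i 1" using ff[of z "axis i 1"] by simp
    then show ?thesis by (simp add: inner_axis)
  qed
  have "measure Q {z. f z \<in> ?P} = measure Q ?P"
    using sets by (intro rotation_measure[OF f(1)]) simp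
  also have "{z. f z \<in> ?P} = ?N"
  proof (intro set_eqI iffI)
    fix z assume "z \<in> {z. f z \<in> ?P}"
    then have a: "\<And>i. i \<in> I \<Longrightarrow> 0 \<le> f z $ i" "0 \<le> f z $ j" by auto
    have "0 \<le> z $ i" if "i \<in> I" for i using a(1)[OF that] fi[of i z] that insert.hyps(2) by metis
    then show "z \<in> ?N" using a(2) by (simp add: fj)
  next
    fix z assume "z \<in> ?N"
    then have a: "\<And>i. i \<in> I \<Longrightarrow> 0 \<le> z $ i" "z $ j \<le> 0" by auto
    have "0 \<le> f z $ i" if "i \<in> I" for i using a(1)[OF that] fi[of i z] that insert.hyps(2) by metis
    then show "z \<in> {z. f z \<in> ?P}" using a(2) by (simp add: fj)
  qed
  finally have eq: "measure Q ?N = measure Q ?P" .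
  have "measure Q ?O = measure Q (?P \<union> ?N)" by (intro arg_cong[where f="measure Q"]) auto
  also have "\<dots> = measure Q ?P + measure Q (?N - ?P)" using sets by (rule finite_measure_Union')
  also have "measure Q (?N - ?P) = measure Q ?N"
  proof (rule finite_measure_eq_AE)
    have "norm (axis j 1 :: real^'n) = 1" by simp
    from hyperplane_AE[OF this, of 0] show "AE x in Q. (x \<in> ?N - ?P) = (x \<in> ?N)"
      by eventually_elim (auto simp: inner_axis')
  qed (use sets in auto)
  finally have "measure Q ?P = (1 / 2) ^ card I / 2" using insert.IH eq by simp
  moreover have "?P = {z. \<forall>i\<in>insert j I. 0 \<le> z $ i}" by auto
  ultimately show ?case using insert.hyps by simp
qed

context spherical_sample
begin

definition score_event :: "nat \<times> 'n \<Rightarrow> 'a set" where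
  "score_event ki = {\<omega>\<in>space M. 0 \<le> Z (fst ki) \<omega> $ snd ki}"

text \<open>The signs are independent coin flips both across observations, by independence of the sample, and
  across coordinates of one observation, by \<open>orthant_prob\<close>.\<close>

lemma score_event_indep: "M.indep_sets (\<lambda>ki. {score_event ki}) ({1..} \<times> UNIV)"
proof (rule M.indep_setsI)
  have ev: "score_event (k, i) \<in> M.events" if "k \<ge> 1" for k i
  proof -
    have "score_event (k, i) = Z k -` {z. 0 \<le> z $ i} \<inter> space M" by (auto simp: score_event_def)
    then show ?thesis using measurable_sets[OF Z_measurable[OF that] borel_coordinate(1)[of i]] by simp
  qed
  then show "{score_event ki} \<subseteq> M.events" if "ki \<in> {1..} \<times> UNIV" for ki using that by auto
  fix A J assume J: "J \<noteq> {}" "J \<subseteq> {1..} \<times> UNIV" "finite J" and A: "\<forall>j\<in>J. A j \<in> {score_event j}"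
  define K where "K = fst ` J"
  define I where "I k = {i. (k, i) \<in> J}" for k
  have JS: "J = Sigma K I" by (force simp: K_def I_def)
  have finI: "finite (I k)" for k by simp
  have finK: "finite K" and K1: "\<And>k. k \<in> K \<Longrightarrow> k \<ge> 1" "K \<noteq> {}" using J by (auto simp: K_def)
  have "M.prob (\<Inter>j\<in>J. A j) = M.prob (\<Inter>k\<in>K. Z k -` {z. \<forall>i\<in>I k. 0 \<le> z $ i} \<inter> space M)"
  proof (rule arg_cong[where f="M.prob"])
    have "(\<Inter>j\<in>J. A j) = (\<Inter>j\<in>J. score_event j)" using A by auto
    also have "\<dots> = (\<Inter>k\<in>K. Z k -` {z. \<forall>i\<in>I k. 0 \<le> z $ i} \<inter> space M)"
    proof (rule set_eqI)
      fix x
      have "x \<in> (\<Inter>j\<in>J. score_event j) \<longleftrightarrow> x \<in> space M \<and> (\<forall>k i. (k, i) \<in> J \<longrightarrow> 0 \<le> Z k x $ i)"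
        using J(1) by (force simp: score_event_def)
      moreover have "x \<in> (\<Inter>k\<in>K. Z k -` {z. \<forall>i\<in>I k. 0 \<le> z $ i} \<inter> space M) \<longleftrightarrow> x \<in> space M \<and> (\<forall>k i. (k, i) \<in> J \<longrightarrow> 0 \<le> Z k x $ i)"
        using K1(2) by (force simp: K_def I_def)
      ultimately show "x \<in> (\<Inter>j\<in>J. score_event j) \<longleftrightarrow> x \<in> (\<Inter>k\<in>K. Z k -` {z. \<forall>i\<in>I k. 0 \<le> z $ i} \<inter> space M)" by simp
    qed
    finally show "(\<Inter>j\<in>J. A j) = (\<Inter>k\<in>K. Z k -` {z. \<forall>i\<in>I k. 0 \<le> z $ i} \<inter> space M)" .
  qed
  also have "\<dots> = (\<Prod>k\<in>K. M.prob (Z k -` {z. \<forall>i\<in>I k. 0 \<le> z $ i} \<inter> space M))"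
    using K1 finK by (intro M.indep_varsD[OF Z_indep] borel_orthant) auto
  also have "\<dots> = (\<Prod>k\<in>K. (1 / 2) ^ card (I k))"
  proof (rule prod.cong[OF refl])
    fix k assume k: "k \<in> K"
    have "M.prob (Z k -` {z. \<forall>i\<in>I k. 0 \<le> z $ i} \<inter> space M) = measure (distr M borel (Z k)) {z. \<forall>i\<in>I k. 0 \<le> z $ i}"
      using K1(1)[OF k] by (intro measure_distr[symmetric] borel_orthant) simp
    then show "M.prob (Z k -` {z. \<forall>i\<in>I k. 0 \<le> z $ i} \<inter> space M) = (1 / 2) ^ card (I k)"
      using orthant_prob[OF finI] by (simp add: Z_distr[OF K1(1)[OF k]])
  qed
  also have "\<dots> = (1 / 2) ^ (\<Sum>k\<in>K. card (I k))" by (simp add: power_sum)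
  also have "(\<Sum>k\<in>K. card (I k)) = card J" unfolding JS by (rule card_SigmaI[symmetric]) (use finK finI in auto)
  also have "(1 / 2 :: real) ^ card J = (\<Prod>j\<in>J. 1 / 2)" by simp
  also have "\<dots> = (\<Prod>j\<in>J. M.prob (A j))"
  proof (rule prod.cong[OF refl])
    fix j assume j: "j \<in> J"
    obtain k i where ki: "j = (k, i)" by (cases j)
    have k: "k \<ge> 1" using j J(2) ki by auto
    have "score_event j = Z k -` {z. \<forall>i\<in>{i}. 0 \<le> z $ i} \<inter> space M" by (auto simp: score_event_def ki)
    then have "M.prob (A j) = measure (distr M borel (Z k)) {z. \<forall>i\<in>{i}. 0 \<le> z $ i}"
      using k A j by (subst measure_distr) (auto intro: borel_orthant)
    also have "\<dots> = 1 / 2" unfolding Z_distr[OF k] by (subst orthant_prob) auto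
    finally show "1 / 2 = M.prob (A j)" by simp
  qed
  finally show "M.prob (\<Inter>j\<in>J. A j) = (\<Prod>j\<in>J. M.prob (A j))" .
qed

definition score :: "nat \<times> 'n \<Rightarrow> 'a \<Rightarrow> real" where
  "score ki \<omega> = indicator {z. 0 \<le> z $ snd ki} (Z (fst ki) \<omega>) - 1 / 2"

lemma score_measurable: "k \<ge> 1 \<Longrightarrow> score (k, i) \<in> borel_measurable M"
proof -
  assume k: "k \<ge> 1"
  have "(\<lambda>\<omega>. indicator {z. 0 \<le> z $ i} (Z k \<omega>) :: real) \<in> borel_measurable M"
    by (rule measurable_compose[OF Z_measurable[OF k]]) (intro borel_measurable_indicator borel_coordinate)
  then show ?thesis unfolding score_def by simp
qed

lemma score_indep: "M.indep_vars (\<lambda>_. borel) score ({1..} \<times> UNIV)"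
  unfolding M.indep_vars_def2
proof
  show "\<forall>ki\<in>{1..} \<times> UNIV. M.random_variable borel (score ki)" using score_measurable by auto
  have ind: "M.indep_sets (\<lambda>ki. sigma_sets (space M) {score_event ki}) ({1..} \<times> UNIV)"
    by (rule M.indep_sets_sigma[OF score_event_indep]) (simp add: Int_stable_def)
  show "M.indep_sets (\<lambda>ki. {score ki -` A \<inter> space M |A. A \<in> sets borel}) ({1..} \<times> UNIV)"
  proof (rule M.indep_sets_mono_sets[OF ind], rule subsetI)
    fix ki B assume "B \<in> {score ki -` A \<inter> space M |A. A \<in> sets borel}"
    then obtain A where A: "B = score ki -` A \<inter> space M" by auto
    interpret S: sigma_algebra "space M" "sigma_sets (space M) {score_event ki}"
      by (rule sigma_algebra_sigma_sets) (auto simp: score_event_def)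
    have E: "score_event ki \<in> sigma_sets (space M) {score_event ki}" by auto
    have "B = (if 1 / 2 \<in> A then score_event ki else {}) \<union> (if - (1 / 2) \<in> A then space M - score_event ki else {})"
    proof -
      have sc: "score ki \<omega> = (if \<omega> \<in> score_event ki then 1 / 2 else - (1 / 2))" if "\<omega> \<in> space M" for \<omega>
        using that by (simp add: score_def score_event_def indicator_def)
      have sub: "score_event ki \<subseteq> space M" by (auto simp: score_event_def)
      show ?thesis unfolding A using sub by (auto simp: sc split: if_splits)
    qed
    also have "\<dots> \<in> sigma_sets (space M) {score_event ki}" using E by auto
    finally show "B \<in> sigma_sets (space M) {score_event ki}" .
  qed
qed

lemma scaled_score_axis: "scaled_score (axis i 1) n \<omega> = (\<Sum>k=1..n. score (k, i) \<omega>) / sqrt n"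
proof (cases "n = 0")
  case False
  then have s: "sqrt n > 0" "real n = sqrt n * sqrt n" by auto
  have "F n \<omega> {z. 0 \<le> axis i 1 \<bullet> z} - 1 / 2 = ((\<Sum>k=1..n. indicator {z. 0 \<le> z $ i} (Z k \<omega>)) - real n / 2) / real n"
    using False by (simp add: frac_def inner_axis' diff_divide_distrib)
  also have "(\<Sum>k=1..n. indicator {z. 0 \<le> z $ i} (Z k \<omega>)) - real n / 2 = (\<Sum>k=1..n. score (k, i) \<omega>)"
    by (simp add: score_def sum_subtractf)
  finally show ?thesis unfolding scaled_score_def using s by (simp add: field_simps) (metis s(2) mult.assoc)
qed (simp add: scaled_score_def)

lemma scaled_score_measurable: "(\<lambda>\<omega>. scaled_score p n \<omega>) \<in> borel_measurable M"
  unfolding scaled_score_def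
  by (intro borel_measurable_times borel_measurable_diff F_measurable bracket_borel borel_measurable_const)

lemma scaled_score_indep: "M.indep_vars (\<lambda>_. borel) (\<lambda>i \<omega>. 2 * scaled_score (axis i 1) n \<omega>) UNIV"
proof -
  \<comment> \<open>The scores of different coordinates use disjoint sets of signs.\<close>
  define G where "G i = {1..n} \<times> {i}" for i :: 'n
  have "M.indep_vars (\<lambda>i. PiM (G i) (\<lambda>_. borel)) (\<lambda>i \<omega>. restrict (\<lambda>ki. score ki \<omega>) (G i)) UNIV"
    by (rule M.indep_vars_restrict[OF score_indep]) (auto simp: G_def disjoint_family_on_def)
  then have "M.indep_vars (\<lambda>_. borel) (\<lambda>i \<omega>. 2 * ((\<Sum>k=1..n. restrict (\<lambda>ki. score ki \<omega>) (G i) (k, i)) / sqrt n)) UNIV"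
    by (rule M.indep_vars_compose2[where Y = "\<lambda>i f. 2 * ((\<Sum>k=1..n. f (k, i)) / sqrt n)"])
       (intro borel_measurable_times borel_measurable_divide borel_measurable_sum borel_measurable_const measurable_component_singleton, auto simp: G_def)
  moreover have "(\<Sum>k=1..n. restrict (\<lambda>ki. score ki \<omega>) (G i) (k, i)) = (\<Sum>k=1..n. score (k, i) \<omega>)" for i \<omega>
    by (intro sum.cong refl) (auto simp: G_def)
  ultimately show ?thesis by (simp add: scaled_score_axis)
qed

lemma score_expectation:
  assumes k: "k \<ge> 1"
  shows "M.expectation (score (k, i)) = 0"
proof -
  have "M.prob (Z k -` {z. \<forall>j\<in>{i}. 0 \<le> z $ j} \<inter> space M) = measure (distr M borel (Z k)) {z. \<forall>j\<in>{i}. 0 \<le> z $ j}"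
    using k by (intro measure_distr[symmetric] borel_orthant) simp
  also have "\<dots> = 1 / 2" unfolding Z_distr[OF k] by (subst orthant_prob) auto
  finally have p: "M.prob (score_event (k, i)) = 1 / 2"
    by (simp add: score_event_def vimage_def Int_def conj_commute)
  have ev: "score_event (k, i) \<in> M.events"
    using score_event_indep k by (auto simp: M.indep_sets_def)
  have s: "score (k, i) \<omega> = indicator (score_event (k, i)) \<omega> - 1 / 2" if "\<omega> \<in> space M" for \<omega>
    using that by (simp add: score_def score_event_def indicator_def)
  have "M.expectation (score (k, i)) = M.expectation (\<lambda>\<omega>. indicator (score_event (k, i)) \<omega> - 1 / 2)"
    by (rule Bochner_Integration.integral_cong[OF refl s])
  also have "\<dots> = M.prob (score_event (k, i)) - 1 / 2"
    using ev sets.sets_into_space[OF ev]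
    by (subst Bochner_Integration.integral_diff) (auto simp: M.prob_space Int_absorb1 Int_absorb2 M.emeasure_eq_measure intro!: integrable_real_indicator)
  finally show ?thesis by (simp add: p)
qed

lemma scaled_score_clt:
  "weak_conv_m (\<lambda>n. distr M borel (\<lambda>\<omega>. 2 * scaled_score (axis i 1) n \<omega>)) std_normal_distribution"
proof -
  define X where "X = (\<lambda>k. score (Suc k, i))"
  have ind: "M.indep_vars (\<lambda>_. borel) X UNIV"
  proof -
    have "M.indep_vars (\<lambda>k. PiM {(Suc k, i)} (\<lambda>_. borel)) (\<lambda>k \<omega>. restrict (\<lambda>ki. score ki \<omega>) {(Suc k, i)}) UNIV"
      by (rule M.indep_vars_restrict[OF score_indep]) (auto simp: disjoint_family_on_def)
    then have "M.indep_vars (\<lambda>_. borel) (\<lambda>k \<omega>. restrict (\<lambda>ki. score ki \<omega>) {(Suc k, i)} (Suc k, i)) UNIV"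
      by (rule M.indep_vars_compose2[where Y = "\<lambda>k f. f (Suc k, i)"]) (intro measurable_component_singleton, simp)
    then show ?thesis by (simp add: X_def cong: M.indep_vars_cong)
  qed
  have law: "distr M borel (X k) = distr Q borel (\<lambda>z. indicator {z. 0 \<le> z $ i} z - 1 / 2)" for k
  proof -
    have [measurable]: "(\<lambda>z::real^'n. indicator {z. 0 \<le> z $ i} z - 1 / 2 :: real) \<in> borel_measurable borel"
      by (intro borel_measurable_diff borel_measurable_indicator borel_coordinate borel_measurable_const)
    have "distr Q borel (\<lambda>z. indicator {z. 0 \<le> z $ i} z - 1 / 2) = distr (distr M borel (Z (Suc k))) borel (\<lambda>z. indicator {z. 0 \<le> z $ i} z - 1 / 2 :: real)"
      by (simp add: Z_distr)
    also have "\<dots> = distr M borel (X k)"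
      by (subst distr_distr) (auto simp: X_def score_def comp_def intro!: distr_cong)
    finally show ?thesis by simp
  qed
  have bnd: "(X k \<omega>)\<^sup>2 = 1 / 4" for k \<omega> by (simp add: X_def score_def indicator_def power2_eq_square)
  have "weak_conv_m (\<lambda>n. distr M borel (\<lambda>x. (\<Sum>k<n. X k x) / sqrt (n * (1 / 2)\<^sup>2))) std_normal_distribution"
  proof (rule M.central_limit_theorem_zero_mean[OF ind _ _ _ _ law])
    show e0: "M.expectation (X n) = 0" for n by (simp add: X_def score_expectation)
    show "M.variance (X n) = (1 / 2)\<^sup>2" for n
      by (simp only: e0 diff_zero bnd) (simp add: M.prob_space power2_eq_square)
    show "integrable M (\<lambda>x. (X n x)\<^sup>2)" for n by (simp add: bnd)
  qed simp
  moreover have "(\<Sum>k<n. X k \<omega>) / sqrt (n * (1 / 2)\<^sup>2) = 2 * scaled_score (axis i 1) n \<omega>" for n \<omega>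
  proof -
    have a: "(\<Sum>k<n. X k \<omega>) = (\<Sum>k=1..n. score (k, i) \<omega>)"
      unfolding X_def by (rule sum.reindex_bij_witness[of _ "\<lambda>k. k - 1" Suc]) auto
    have b: "sqrt (n * (1 / 2)\<^sup>2) = sqrt n / 2" by (simp add: real_sqrt_mult)
    show ?thesis unfolding a b scaled_score_axis by simp
  qed
  ultimately show ?thesis by simp
qed

text \<open>The Chernoff bound with tilt \<open>1 / sqrt n\<close>, which is uniform in the direction.\<close>

lemma scaled_score_tight:
  assumes e: "\<epsilon> > 0"
  shows "\<exists>L\<ge>0. \<forall>n p. norm p = 1 \<longrightarrow> M.prob {\<omega>\<in>space M. \<bar>scaled_score p n \<omega>\<bar> > L} \<le> \<epsilon>"
proof -
  define L where "L = max 0 (1 - ln (\<epsilon> / 2))"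
  have L: "L \<ge> 0" "2 * exp (1 - L) \<le> \<epsilon>"
  proof -
    have "exp (1 - L) \<le> exp (ln (\<epsilon> / 2))" by (subst exp_le_cancel_iff) (simp add: L_def)
    then show "2 * exp (1 - L) \<le> \<epsilon>" using e by simp
  qed (simp add: L_def)
  have "M.prob {\<omega>\<in>space M. \<bar>scaled_score p n \<omega>\<bar> > L} \<le> \<epsilon>" if p: "norm p = 1" for p n
  proof (cases "n \<ge> 1")
    case False
    then have "n = 0" by simp
    then have "{\<omega>\<in>space M. \<bar>scaled_score p n \<omega>\<bar> > L} = {}" using L by (auto simp: scaled_score_def)
    then show ?thesis using e by (simp only: measure_empty less_imp_le)
  next
    case n: True
    let ?A = "{z. 0 \<le> p \<bullet> z}"
    have QA: "measure Q ?A = 1 / 2" using tail_eq[OF p, of 0] tail_0 by simp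
    have s: "sqrt n > 0" "sqrt n \<ge> 1" "sqrt n * sqrt n = real n" using n by auto
    have "M.prob {\<omega>\<in>space M. \<bar>scaled_score p n \<omega>\<bar> > L} \<le> M.prob {\<omega>\<in>space M. \<bar>F n \<omega> ?A - measure Q ?A\<bar> \<ge> L / sqrt n}"
    proof (rule M.finite_measure_mono)
      show "{\<omega>\<in>space M. \<bar>scaled_score p n \<omega>\<bar> > L} \<subseteq> {\<omega>\<in>space M. \<bar>F n \<omega> ?A - measure Q ?A\<bar> \<ge> L / sqrt n}"
      proof safe
        fix \<omega> assume "\<bar>scaled_score p n \<omega>\<bar> > L"
        then have "L < sqrt n * \<bar>F n \<omega> ?A - 1 / 2\<bar>" using s by (simp add: scaled_score_def abs_mult)
        then show "L / sqrt n \<le> \<bar>F n \<omega> ?A - measure Q ?A\<bar>" unfolding QA using s by (simp add: pos_divide_le_eq mult.commute)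
      qed
      have m: "(\<lambda>\<omega>. \<bar>F n \<omega> ?A - measure Q ?A\<bar>) \<in> borel_measurable M"
        by (intro borel_measurable_abs borel_measurable_diff F_measurable bracket_borel borel_measurable_const)
      show "{\<omega>\<in>space M. \<bar>F n \<omega> ?A - measure Q ?A\<bar> \<ge> L / sqrt n} \<in> M.events"
        using borel_measurable_le[OF borel_measurable_const m] .
    qed
    also have "\<dots> \<le> 2 * exp (real n * (1 * (1 / sqrt n)\<^sup>2 - 1 / sqrt n * (L / sqrt n)))"
      using n s by (intro chernoff bracket_borel) auto
    also have "real n * (1 * (1 / sqrt n)\<^sup>2 - 1 / sqrt n * (L / sqrt n)) = 1 - L"
    proof -
      have e1: "(1 / sqrt n)\<^sup>2 = 1 / real n" by (simp add: power_divide)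
      have e2: "1 / sqrt n * (L / sqrt n) = L / real n" by simp
      show ?thesis unfolding e1 e2 using n by (simp add: field_simps)
    qed
    also have "2 * exp (1 - L) \<le> \<epsilon>" by (rule L)
    finally show ?thesis .
  qed
  with L show ?thesis by blast
qed

end

definition vec_of :: "('n \<Rightarrow> real) \<Rightarrow> real^'n" where "vec_of f = (\<chi> i. f i)"

lemma vec_of_measurable: "vec_of \<in> borel_measurable (PiM UNIV (\<lambda>_. borel))"
  unfolding vec_of_def by (intro measurable_vec_lambda measurable_component_singleton) simp

definition std_gauss :: "(real^'n) measure" where
  "std_gauss = distr (PiM UNIV (\<lambda>_. std_normal_distribution)) borel vec_of"

text \<open>Skorohod's representation is a theorem about laws on the line. As the coordinate scores are independent, it can be
  applied to each coordinate separately, and the product of the resulting spaces carries vectors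
  with the right joint laws.\<close>

lemma (in spherical_sample) skorohod_scores:
  "\<exists>(\<Omega> :: ('n \<Rightarrow> real) measure) W W'. prob_space \<Omega> \<and>
    (\<forall>n. W n \<in> borel_measurable \<Omega>) \<and> W' \<in> borel_measurable \<Omega> \<and>
    (\<forall>n. distr \<Omega> borel (W n) = distr M borel (\<lambda>\<omega>. \<chi> i. 2 * scaled_score (axis i 1) n \<omega>)) \<and>
    distr \<Omega> borel W' = std_gauss \<and> (\<forall>x\<in>space \<Omega>. (\<lambda>n. W n x) \<longlonglongrightarrow> W' x)"
proof -
  define \<mu> where "\<mu> = (\<lambda>i n. distr M borel (\<lambda>\<omega>. 2 * scaled_score (axis i 1) n \<omega>))"
  have m: "(\<lambda>\<omega>. 2 * scaled_score (axis i 1) n \<omega>) \<in> borel_measurable M" for i n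
    using scaled_score_measurable by (intro borel_measurable_times borel_measurable_const)
  have "\<exists>(\<Omega> :: real measure) Y Y'. prob_space \<Omega> \<and> (\<forall>n. Y n \<in> measurable \<Omega> borel) \<and> (\<forall>n. distr \<Omega> borel (Y n) = \<mu> i n) \<and>
    Y' \<in> measurable \<Omega> lborel \<and> distr \<Omega> borel Y' = std_normal_distribution \<and> (\<forall>x\<in>space \<Omega>. (\<lambda>n. Y n x) \<longlonglongrightarrow> Y' x)" for i
    unfolding \<mu>_def
    by (rule Skorohod[OF _ real_dist_normal_dist scaled_score_clt]) (intro M.real_distribution_distr m)
  then obtain \<Omega> :: "'n \<Rightarrow> real measure" and Y Y' where \<Omega>: "\<And>i. prob_space (\<Omega> i)" and Y: "\<And>i n. Y i n \<in> measurable (\<Omega> i) borel"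
    "\<And>i n. distr (\<Omega> i) borel (Y i n) = \<mu> i n" and Y': "\<And>i. Y' i \<in> measurable (\<Omega> i) lborel" "\<And>i. distr (\<Omega> i) borel (Y' i) = std_normal_distribution"
    and lim: "\<And>i x. x \<in> space (\<Omega> i) \<Longrightarrow> (\<lambda>n. Y i n x) \<longlonglongrightarrow> Y' i x" by metis
  have Y'b: "Y' i \<in> borel_measurable (\<Omega> i)" for i using Y'(1)[of i] by simp
  let ?P = "PiM UNIV \<Omega>"
  interpret P: product_prob_space \<Omega> UNIV by (intro product_prob_spaceI \<Omega>)
  have PP: "prob_space ?P" by (rule prob_space_PiM) (rule \<Omega>)
  have prod_law: "distr ?P (PiM UNIV (\<lambda>_. borel)) (\<lambda>x i. g i (x i)) = PiM UNIV (\<lambda>i. distr (\<Omega> i) borel (g i))"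
    if g: "\<And>i. g i \<in> borel_measurable (\<Omega> i)" for g :: "'n \<Rightarrow> real \<Rightarrow> real"
  proof -
    have D: "prob_space (distr (\<Omega> i) borel (g i))" for i by (intro prob_space.prob_space_distr \<Omega> g)
    interpret D: product_prob_space "\<lambda>i. distr (\<Omega> i) borel (g i)" UNIV by (intro product_prob_spaceI D)
    have gm: "(\<lambda>x i. g i (x i)) \<in> measurable ?P (PiM UNIV (\<lambda>_. borel))"
      using g by (intro measurable_PiM_single') (auto intro: measurable_compose[OF measurable_component_singleton] simp: space_PiM)
    show ?thesis
    proof (rule D.PiM_eqI)
      show "sets (distr ?P (PiM UNIV (\<lambda>_. borel)) (\<lambda>x i. g i (x i))) = sets (PiM UNIV (\<lambda>i. distr (\<Omega> i) borel (g i)))"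
        by (simp cong: sets_PiM_cong)
      fix A assume A: "\<And>i. i \<in> UNIV \<Longrightarrow> A i \<in> sets (distr (\<Omega> i) borel (g i))"
      have "(\<lambda>x i. g i (x i)) -` (Pi\<^sub>E UNIV A) \<inter> space ?P = (Pi\<^sub>E UNIV (\<lambda>i. g i -` A i \<inter> space (\<Omega> i)))"
        by (auto simp: space_PiM PiE_def Pi_def extensional_def)
      moreover have "Pi\<^sub>E UNIV A \<in> sets (PiM UNIV (\<lambda>_. borel))" using A by (intro sets_PiM_I_finite) auto
      ultimately have "emeasure (distr ?P (PiM UNIV (\<lambda>_. borel)) (\<lambda>x i. g i (x i))) (Pi\<^sub>E UNIV A) = emeasure ?P (Pi\<^sub>E UNIV (\<lambda>i. g i -` A i \<inter> space (\<Omega> i)))"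
        using gm by (simp add: emeasure_distr)
      also have "\<dots> = (\<Prod>i\<in>UNIV. emeasure (\<Omega> i) (g i -` A i \<inter> space (\<Omega> i)))"
        using A g by (intro P.emeasure_PiM) (auto intro: measurable_sets)
      also have "\<dots> = (\<Prod>i\<in>UNIV. emeasure (distr (\<Omega> i) borel (g i)) (A i))"
        using A g by (intro prod.cong refl) (simp add: emeasure_distr)
      finally show "emeasure (distr ?P (PiM UNIV (\<lambda>_. borel)) (\<lambda>x i. g i (x i))) (Pi\<^sub>E UNIV A) = (\<Prod>i\<in>UNIV. emeasure (distr (\<Omega> i) borel (g i)) (A i))" .
    qed simp
  qed
  have gm: "(\<lambda>x i. g i (x i)) \<in> measurable ?P (PiM UNIV (\<lambda>_. borel))" if "\<And>i. g i \<in> borel_measurable (\<Omega> i)" for g :: "'n \<Rightarrow> real \<Rightarrow> real"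
    using that by (intro measurable_PiM_single') (auto intro: measurable_compose[OF measurable_component_singleton] simp: space_PiM)
  define W where "W = (\<lambda>n x. vec_of (\<lambda>i. Y i n (x i)))"
  define W' where "W' = (\<lambda>x. vec_of (\<lambda>i. Y' i (x i)))"
  have vd: "distr ?P borel (\<lambda>x. vec_of (\<lambda>i. g i (x i))) = distr (PiM UNIV (\<lambda>i. distr (\<Omega> i) borel (g i))) borel vec_of"
    if g: "\<And>i. g i \<in> borel_measurable (\<Omega> i)" for g :: "'n \<Rightarrow> real \<Rightarrow> real"
    unfolding prod_law[OF g, symmetric]
    by (subst distr_distr[OF vec_of_measurable gm[OF g]]) (simp add: comp_def)
  have Wd: "distr ?P borel (W n) = distr M borel (\<lambda>\<omega>. \<chi> i. 2 * scaled_score (axis i 1) n \<omega>)" for n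
  proof -
    have "distr M (PiM UNIV (\<lambda>_. borel)) (\<lambda>\<omega>. \<lambda>i\<in>UNIV. 2 * scaled_score (axis i 1) n \<omega>) = PiM UNIV (\<lambda>i. \<mu> i n)"
      unfolding \<mu>_def using M.indep_vars_iff_distr_eq_PiM[THEN iffD1, OF _ m scaled_score_indep] by simp
    then have "distr ?P borel (W n) = distr (distr M (PiM UNIV (\<lambda>_. borel)) (\<lambda>\<omega>. \<lambda>i\<in>UNIV. 2 * scaled_score (axis i 1) n \<omega>)) borel vec_of"
      unfolding W_def by (subst vd[OF Y(1)]) (simp add: Y(2))
    also have "\<dots> = distr M borel (\<lambda>\<omega>. \<chi> i. 2 * scaled_score (axis i 1) n \<omega>)"
      by (subst distr_distr[OF vec_of_measurable]) (auto intro!: measurable_restrict m simp: comp_def vec_of_def)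
    finally show ?thesis .
  qed
  have W'd: "distr ?P borel W' = std_gauss"
    unfolding W'_def std_gauss_def by (subst vd[OF Y'b]) (simp add: Y'(2))
  have limW: "(\<lambda>n. W n x) \<longlonglongrightarrow> W' x" if "x \<in> space ?P" for x
    unfolding W_def W'_def vec_of_def
    by (rule vec_tendstoI) (use that lim in \<open>auto simp: space_PiM PiE_def Pi_def\<close>)
  show ?thesis
  proof (intro exI[of _ ?P] exI[of _ W] exI[of _ W'] conjI allI ballI)
    show "prob_space ?P" by (rule PP)
    show "W n \<in> borel_measurable ?P" for n
      unfolding W_def by (rule measurable_compose[OF gm[OF Y(1)] vec_of_measurable])
    show "W' \<in> borel_measurable ?P"
      unfolding W'_def by (rule measurable_compose[OF gm[OF Y'b] vec_of_measurable])
  qed (use Wd W'd limW in auto)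
qed

section \<open>Elliptical and normal laws as linear images of spherical laws\<close>

text \<open>The argument works with \<open>transpose E *v y\<close>, which the simplifier would turn into a product with the
  vector on the left.\<close>

declare transpose_matrix_vector [simp del]

text \<open>The rows of \<open>E\<close> are an orthonormal basis of eigenvectors. The map \<open>T\<close> below turns spherical laws into
  elliptical ones with matrix \<open>\<Sigma>\<close>, and \<open>S\<close> is its inverse.\<close>

locale eigenframe =
  fixes \<Sigma> E :: "real^'n^'n" and l :: "'n \<Rightarrow> real"
  assumes E: "orthogonal_matrix E" and l_pos: "\<And>i. l i > 0"
    and eigen: "\<And>i. \<Sigma> *v row i E = l i *\<^sub>R row i E"
begin

definition T :: "real^'n \<Rightarrow> real^'n" where "T z = transpose E *v stretch l z"

definition S :: "real^'n \<Rightarrow> real^'n" where "S x = (\<chi> k. (E *v x) $ k / sqrt (l k))"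

lemma E_inv: "E *v (transpose E *v y) = y" "transpose E *v (E *v y) = y"
  using E by (simp_all add: orthogonal_matrix_def matrix_vector_mul_assoc)

lemma orthogonal_transformation_E: "orthogonal_transformation ((*v) E)" "orthogonal_transformation ((*v) (transpose E))"
  using E by (auto simp: orthogonal_transformation_matrix orthogonal_matrix_transpose)

lemma T_S: "T (S x) = x"
proof -
  have "stretch l (S x) = E *v x" using l_pos by (simp add: stretch_def S_def vec_eq_iff less_imp_neq[THEN not_sym])
  then show ?thesis by (simp add: T_def E_inv)
qed

lemma S_T: "S (T z) = z"
  using l_pos by (simp add: S_def T_def E_inv vec_eq_iff stretch_def less_imp_neq[THEN not_sym])

lemma transpose_expansion: "transpose E *v y = (\<Sum>i\<in>UNIV. y $ i *\<^sub>R row i E)"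
  by (simp add: vec_eq_iff matrix_vector_mult_def transpose_def row_def mult.commute)

lemma Sigma_transpose: "\<Sigma> *v (transpose E *v y) = transpose E *v (\<chi> i. l i * y $ i)"
proof -
  have lin: "linear ((*v) \<Sigma>)" by simp
  have "\<Sigma> *v (transpose E *v y) = (\<Sum>i\<in>UNIV. \<Sigma> *v (y $ i *\<^sub>R row i E))"
    unfolding transpose_expansion by (rule linear_sum[OF lin])
  also have "\<dots> = (\<Sum>i\<in>UNIV. y $ i *\<^sub>R (l i *\<^sub>R row i E))"
    by (simp only: linear_cmul[OF lin] eigen)
  finally show ?thesis by (simp add: transpose_expansion mult.commute)
qed

lemma det_Sigma: "det \<Sigma> = (\<Prod>i\<in>UNIV. l i)"
proof -
  define D :: "real^'n^'n" where "D = (\<chi> i j. if i = j then l i else 0)"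
  have "D *v y = (\<chi> i. l i * y $ i)" for y
    by (simp add: D_def matrix_vector_mult_def vec_eq_iff if_distrib[where f="\<lambda>x. x * _"] cong: if_cong)
  then have "\<Sigma> ** transpose E = transpose E ** D"
    by (subst matrix_eq) (simp add: matrix_vector_mul_assoc[symmetric] Sigma_transpose)
  then have "det \<Sigma> * det (transpose E) = det (transpose E) * det D" by (metis det_mul)
  moreover have "det (transpose E) \<noteq> 0" using det_orthogonal_matrix[OF E] by (auto simp: det_transpose)
  ultimately have "det \<Sigma> = det D" by simp
  also have "det D = (\<Prod>i\<in>UNIV. D $ i $ i)" by (rule det_diagonal) (simp add: D_def)
  finally show ?thesis by (simp add: D_def)
qed

lemma det_pos: "det \<Sigma> > 0"
  unfolding det_Sigma using l_pos by (intro prod_pos) auto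

lemma quadratic_form: "T z \<bullet> (matrix_inv \<Sigma> *v T z) = (norm z)\<^sup>2"
proof -
  have "invertible \<Sigma>" using det_pos by (simp add: invertible_det_nz)
  then have "\<exists>A'. \<Sigma> ** A' = mat 1 \<and> A' ** \<Sigma> = mat 1" by (simp add: invertible_def)
  from someI_ex[OF this] have inv: "matrix_inv \<Sigma> ** \<Sigma> = mat 1" by (simp add: matrix_inv_def)
  \<comment> \<open>the preimage of T z under the matrix\<close>
  define v where "v = transpose E *v (\<chi> k. z $ k / sqrt (l k))"
  have sl: "l k * (z $ k / sqrt (l k)) = sqrt (l k) * z $ k" for k
  proof -
    have "l k = sqrt (l k) * sqrt (l k)" "sqrt (l k) \<noteq> 0" using l_pos[of k] by auto
    then show ?thesis by (metis (no_types, lifting) mult.assoc nonzero_mult_div_cancel_left times_divide_eq_right mult.commute)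
  qed
  have "\<Sigma> *v v = T z" unfolding v_def Sigma_transpose T_def stretch_def by (simp only: vec_lambda_beta sl)
  then have "matrix_inv \<Sigma> *v T z = (matrix_inv \<Sigma> ** \<Sigma>) *v v" by (metis matrix_vector_mul_assoc)
  then have "T z \<bullet> (matrix_inv \<Sigma> *v T z) = T z \<bullet> v" by (simp add: inv)
  also have "\<dots> = stretch l z \<bullet> (\<chi> k. z $ k / sqrt (l k))"
    using orthogonal_transformation_E(2) unfolding T_def v_def orthogonal_transformation_def by blast
  also have "\<dots> = (norm z)\<^sup>2"
    unfolding power2_norm_eq_inner using l_pos
    by (simp add: stretch_def inner_vec_def less_imp_neq[THEN not_sym])
  finally show ?thesis .
qed

lemma T_measurable [measurable]: "T \<in> borel_measurable borel"
  unfolding T_def stretch_def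
  by (rule measurable_compose[OF _ borel_measurable_matrix_vector_mult], intro measurable_vec_lambda)
     (intro borel_measurable_continuous_onI continuous_intros)

lemma S_measurable [measurable]: "S \<in> borel_measurable borel"
  unfolding S_def matrix_vector_mul_component
  by (intro measurable_vec_lambda borel_measurable_divide borel_measurable_const borel_measurable_inner measurable_ident_sets) simp

lemma nn_integral_T:
  assumes [measurable]: "g \<in> borel_measurable borel"
  shows "(\<integral>\<^sup>+x. g x \<partial>lborel) = ennreal (sqrt (det \<Sigma>)) * (\<integral>\<^sup>+z. g (T z) \<partial>lborel)"
proof -
  have [measurable]: "(\<lambda>x. g (transpose E *v x)) \<in> borel_measurable borel"
    by (rule measurable_compose[OF borel_measurable_matrix_vector_mult assms])
  have "(\<integral>\<^sup>+x. g x \<partial>lborel) = (\<integral>\<^sup>+x. g (transpose E *v x) \<partial>lborel)"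
    by (rule nn_integral_lborel_orthogonal[OF orthogonal_transformation_E(2), symmetric]) simp
  also have "\<dots> = ennreal (\<Prod>i\<in>UNIV. \<bar>sqrt (l i)\<bar>) * (\<integral>\<^sup>+x. g (transpose E *v (\<chi> i. sqrt (l i) * x $ i)) \<partial>lborel)"
    by (rule nn_integral_lborel_diagonal) (use l_pos in \<open>auto simp: less_imp_neq[THEN not_sym]\<close>)
  also have "(\<Prod>i\<in>UNIV. \<bar>sqrt (l i)\<bar>) = sqrt (det \<Sigma>)"
  proof -
    have "(\<Prod>i\<in>I. sqrt (l i)) = sqrt (\<Prod>i\<in>I. l i)" for I
      by (induction I rule: infinite_finite_induct) (auto simp: real_sqrt_mult)
    then show ?thesis unfolding det_Sigma using l_pos by (simp add: less_imp_le)
  qed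
  finally show ?thesis by (simp add: T_def stretch_def)
qed

text \<open>A change of variables, stated for a general radial function because elliptical and normal laws are
  both of this form.\<close>

lemma elliptical_density:
  fixes \<phi> :: "real \<Rightarrow> real"
  assumes m: "\<phi> \<in> borel_measurable (restrict_space borel {0..})" and c: "c > 0"
  shows "density lborel (\<lambda>x. ennreal (1 / (c * sqrt (det \<Sigma>)) * \<phi> ((x - \<mu>) \<bullet> (matrix_inv \<Sigma> *v (x - \<mu>))))) =
    distr (density lborel (\<lambda>z. ennreal (\<phi> ((norm z)\<^sup>2) / c))) borel (\<lambda>z. \<mu> + T z)"
proof (rule measure_eqI)
  have q: "x \<bullet> (matrix_inv \<Sigma> *v x) = (norm (S x))\<^sup>2" for x
    using quadratic_form[of "S x"] by (simp add: T_S)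
  have mN: "(\<lambda>z::real^'n. \<phi> ((norm z)\<^sup>2)) \<in> borel_measurable borel"
    by (intro measurable_profile[OF m]) auto
  have mS: "(\<lambda>x. \<phi> ((norm (S (x - \<mu>)))\<^sup>2)) \<in> borel_measurable borel"
    by (rule measurable_compose[OF _ mN]) measurable
  note [measurable] = mN mS
  fix A assume "A \<in> sets (density lborel (\<lambda>x. ennreal (1 / (c * sqrt (det \<Sigma>)) * \<phi> ((x - \<mu>) \<bullet> (matrix_inv \<Sigma> *v (x - \<mu>))))))"
  then have A[measurable]: "A \<in> sets borel" by simp
  let ?s = "sqrt (det \<Sigma>)"
  have s: "?s > 0" using det_pos by simp
  have "emeasure (density lborel (\<lambda>x. ennreal (1 / (c * ?s) * \<phi> ((x - \<mu>) \<bullet> (matrix_inv \<Sigma> *v (x - \<mu>)))))) A =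
    (\<integral>\<^sup>+x. ennreal (1 / (c * ?s) * \<phi> ((norm (S (x - \<mu>)))\<^sup>2)) * indicator A x \<partial>lborel)"
    unfolding q by (subst emeasure_density) auto
  also have "\<dots> = (\<integral>\<^sup>+x. ennreal (1 / (c * ?s) * \<phi> ((norm (S ((x + \<mu>) - \<mu>)))\<^sup>2)) * indicator A (x + \<mu>) \<partial>lborel)"
    by (rule nn_integral_lborel_shift[symmetric]) measurable
  also have "\<dots> = (\<integral>\<^sup>+x. ennreal (1 / (c * ?s) * \<phi> ((norm (S x))\<^sup>2)) * indicator A (x + \<mu>) \<partial>lborel)"
    by simp
  also have "\<dots> = ennreal ?s * (\<integral>\<^sup>+z. ennreal (1 / (c * ?s) * \<phi> ((norm (S (T z)))\<^sup>2)) * indicator A (T z + \<mu>) \<partial>lborel)"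
  proof (rule nn_integral_T)
    have "(\<lambda>x. \<phi> ((norm (S x))\<^sup>2)) \<in> borel_measurable borel"
      by (rule measurable_compose[OF S_measurable mN])
    then show "(\<lambda>x. ennreal (1 / (c * ?s) * \<phi> ((norm (S x))\<^sup>2)) * indicator A (x + \<mu>)) \<in> borel_measurable borel" by measurable
  qed
  also have "\<dots> = (\<integral>\<^sup>+z. ennreal ?s * (ennreal (1 / (c * ?s) * \<phi> ((norm z)\<^sup>2)) * indicator A (T z + \<mu>)) \<partial>lborel)"
    unfolding S_T by (rule nn_integral_cmult[symmetric]) measurable
  also have "\<dots> = (\<integral>\<^sup>+z. ennreal (\<phi> ((norm z)\<^sup>2) / c) * indicator ((\<lambda>z. \<mu> + T z) -` A) z \<partial>lborel)"
  proof (rule nn_integral_cong)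
    fix z :: "real^'n"
    have "?s * (1 / (c * ?s) * \<phi> ((norm z)\<^sup>2)) = \<phi> ((norm z)\<^sup>2) / c" using s c by simp
    then have "ennreal ?s * ennreal (1 / (c * ?s) * \<phi> ((norm z)\<^sup>2)) = ennreal (\<phi> ((norm z)\<^sup>2) / c)"
      using s by (subst ennreal_mult'[symmetric]) auto
    then show "ennreal ?s * (ennreal (1 / (c * ?s) * \<phi> ((norm z)\<^sup>2)) * indicator A (T z + \<mu>)) =
      ennreal (\<phi> ((norm z)\<^sup>2) / c) * indicator ((\<lambda>z. \<mu> + T z) -` A) z"
      by (simp add: mult.assoc[symmetric] indicator_def add.commute)
  qed
  also have "\<dots> = emeasure (density lborel (\<lambda>z. ennreal (\<phi> ((norm z)\<^sup>2) / c))) ((\<lambda>z. \<mu> + T z) -` A)"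
  proof -
    have "(\<lambda>z. \<mu> + T z) -` A \<in> sets borel" using measurable_sets[of "\<lambda>z. \<mu> + T z" borel borel A] by simp
    then show ?thesis by (subst emeasure_density) auto
  qed
  also have "\<dots> = emeasure (distr (density lborel (\<lambda>z. ennreal (\<phi> ((norm z)\<^sup>2) / c))) borel (\<lambda>z. \<mu> + T z)) A"
    by (subst emeasure_distr) auto
  finally show "emeasure (density lborel (\<lambda>x. ennreal (1 / (c * ?s) * \<phi> ((x - \<mu>) \<bullet> (matrix_inv \<Sigma> *v (x - \<mu>)))))) A =
    emeasure (distr (density lborel (\<lambda>z. ennreal (\<phi> ((norm z)\<^sup>2) / c))) borel (\<lambda>z. \<mu> + T z)) A" .
qed simp

end

lemma eigenframe_scaleR:
  assumes "eigenframe \<Sigma> E l" "v > 0"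
  shows "eigenframe (v *\<^sub>R \<Sigma>) E (\<lambda>i. v * l i)"
proof -
  interpret eigenframe \<Sigma> E l by fact
  have "(v *\<^sub>R \<Sigma>) *v x = v *\<^sub>R (\<Sigma> *v x)" for x by (simp add: scaleR_matrix_vector_assoc)
  then show ?thesis using E l_pos eigen assms(2) by unfold_locales auto
qed

lemma PiM_density:
  fixes \<phi> :: "real \<Rightarrow> ennreal"
  assumes [measurable]: "\<phi> \<in> borel_measurable borel" and prob: "prob_space (density lborel \<phi>)"
  shows "PiM (UNIV :: 'n::finite set) (\<lambda>_. density lborel \<phi>) = density (PiM UNIV (\<lambda>_. lborel)) (\<lambda>f. \<Prod>i\<in>UNIV. \<phi> (f i))"
proof -
  interpret D: prob_space "density lborel \<phi>" by fact
  interpret DP: product_prob_space "\<lambda>_::'n. density lborel \<phi>" UNIV by (intro product_prob_spaceI prob)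
  interpret L: product_sigma_finite "\<lambda>_::'n. lborel :: real measure" by standard
  have "density (PiM UNIV (\<lambda>_. lborel)) (\<lambda>f. \<Prod>i\<in>UNIV. \<phi> (f i)) = PiM (UNIV :: 'n set) (\<lambda>_. density lborel \<phi>)"
  proof (rule DP.PiM_eqI)
    show "sets (density (PiM UNIV (\<lambda>_. lborel)) (\<lambda>f. \<Prod>i\<in>(UNIV::'n set). \<phi> (f i))) = sets (PiM UNIV (\<lambda>_. density lborel \<phi>))"
      by (simp cong: sets_PiM_cong)
    fix A :: "'n \<Rightarrow> real set" assume A: "\<And>i. i \<in> UNIV \<Longrightarrow> A i \<in> sets (density lborel \<phi>)"
    then have A'[measurable]: "A i \<in> sets borel" for i by simp
    have PA: "Pi\<^sub>E UNIV A \<in> sets (PiM (UNIV::'n set) (\<lambda>_. lborel))" by (intro sets_PiM_I_finite) auto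
    have "emeasure (density (PiM UNIV (\<lambda>_. lborel)) (\<lambda>f. \<Prod>i\<in>(UNIV::'n set). \<phi> (f i))) (Pi\<^sub>E UNIV A) =
      (\<integral>\<^sup>+f. (\<Prod>i\<in>UNIV. \<phi> (f i)) * indicator (Pi\<^sub>E UNIV A) f \<partial>PiM (UNIV::'n set) (\<lambda>_. lborel))"
      using PA by (subst emeasure_density) auto
    also have "\<dots> = (\<integral>\<^sup>+f. (\<Prod>i\<in>UNIV. \<phi> (f i) * indicator (A i) (f i)) \<partial>PiM (UNIV::'n set) (\<lambda>_. lborel))"
      by (intro nn_integral_cong) (auto simp: prod.distrib indicator_def PiE_def Pi_def extensional_def prod_zero_iff split: if_splits intro!: prod.neutral)
    also have "\<dots> = (\<Prod>i\<in>UNIV. \<integral>\<^sup>+x. \<phi> x * indicator (A i) x \<partial>lborel)"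
      by (rule L.product_nn_integral_prod) auto
    also have "\<dots> = (\<Prod>i\<in>UNIV. emeasure (density lborel \<phi>) (A i))"
      by (intro prod.cong refl) (subst emeasure_density, auto)
    finally show "emeasure (density (PiM UNIV (\<lambda>_. lborel)) (\<lambda>f. \<Prod>i\<in>(UNIV::'n set). \<phi> (f i))) (Pi\<^sub>E UNIV A) = (\<Prod>i\<in>UNIV. emeasure (density lborel \<phi>) (A i))" .
  qed simp
  then show ?thesis by simp
qed

lemma std_gauss_density:
  "(std_gauss :: (real^'n) measure) = density lborel (\<lambda>x. ennreal (exp (- ((norm x)\<^sup>2) / 2) / sqrt ((2 * pi) ^ CARD('n))))"
proof (rule measure_eqI)
  show "sets (std_gauss :: (real^'n) measure) = sets (density lborel (\<lambda>x. ennreal (exp (- ((norm x)\<^sup>2) / 2) / sqrt ((2 * pi) ^ CARD('n)))))"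
    by (simp add: std_gauss_def)
  fix A assume "A \<in> sets (std_gauss :: (real^'n) measure)"
  then have A[measurable]: "A \<in> sets borel" by (simp add: std_gauss_def)
  interpret std: real_distribution std_normal_distribution by (rule real_dist_normal_dist)
  have pd: "PiM (UNIV::'n set) (\<lambda>_. std_normal_distribution) = density (PiM UNIV (\<lambda>_. lborel)) (\<lambda>f. \<Prod>i\<in>UNIV. ennreal (std_normal_density (f i)))"
    by (rule PiM_density) (auto intro: std.prob_space_axioms)
  have vm: "vec_of \<in> borel_measurable (PiM (UNIV::'n set) (\<lambda>_. lborel))"
    using vec_of_measurable by (simp cong: measurable_cong_sets sets_PiM_cong) 
  have vA: "vec_of -` A \<inter> space (PiM (UNIV::'n set) (\<lambda>_. lborel)) \<in> sets (PiM (UNIV::'n set) (\<lambda>_. lborel))"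
    by (rule measurable_sets[OF vm A])
  have "emeasure (std_gauss :: (real^'n) measure) A = emeasure (density (PiM UNIV (\<lambda>_. lborel)) (\<lambda>f. \<Prod>i\<in>UNIV. ennreal (std_normal_density (f i)))) (vec_of -` A \<inter> space (PiM (UNIV::'n set) (\<lambda>_. lborel)))"
    unfolding std_gauss_def pd using vm by (subst emeasure_distr) (auto cong: measurable_cong_sets)
  also have "\<dots> = (\<integral>\<^sup>+f. (\<Prod>i\<in>UNIV. ennreal (std_normal_density (f i))) * indicator A (vec_of f) \<partial>PiM (UNIV::'n set) (\<lambda>_. lborel))"
    using vA by (subst emeasure_density) (auto intro!: nn_integral_cong simp: indicator_def)
  also have "\<dots> = (\<integral>\<^sup>+f. ennreal (exp (- ((norm (\<chi> i. f i))\<^sup>2) / 2) / sqrt ((2 * pi) ^ CARD('n))) * indicator A (\<chi> i. f i) \<partial>PiM (UNIV::'n set) (\<lambda>_. lborel))"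
  proof (rule nn_integral_cong)
    fix f :: "'n \<Rightarrow> real"
    have "(norm (\<chi> i. f i))\<^sup>2 = (\<Sum>i\<in>UNIV. (f i)\<^sup>2)"
      by (simp add: norm_vec_def L2_set_def sum_nonneg)
    moreover have "(\<Prod>i\<in>(UNIV::'n set). std_normal_density (f i)) = exp (- (\<Sum>i\<in>UNIV. (f i)\<^sup>2) / 2) / sqrt ((2 * pi) ^ CARD('n))"
    proof -
      have sq: "sqrt ((2 * pi) ^ CARD('n)) = sqrt (2 * pi) ^ CARD('n)" by (rule real_sqrt_power)
      show ?thesis unfolding sq
        by (simp add: std_normal_density_def prod_dividef exp_sum[symmetric] sum_negf sum_divide_distrib[symmetric] prod.distrib power_divide)
    qed
    ultimately have "(\<Prod>i\<in>UNIV. ennreal (std_normal_density (f i))) = ennreal (exp (- ((norm (\<chi> i. f i))\<^sup>2) / 2) / sqrt ((2 * pi) ^ CARD('n)))"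
      by (subst prod_ennreal) auto
    then show "(\<Prod>i\<in>UNIV. ennreal (std_normal_density (f i))) * indicator A (vec_of f) =
      ennreal (exp (- ((norm (\<chi> i. f i))\<^sup>2) / 2) / sqrt ((2 * pi) ^ CARD('n))) * indicator A (\<chi> i. f i)"
      by (simp add: vec_of_def)
  qed
  also have "\<dots> = (\<integral>\<^sup>+x. ennreal (exp (- ((norm x)\<^sup>2) / 2) / sqrt ((2 * pi) ^ CARD('n))) * indicator A x \<partial>(lborel :: (real^'n) measure))"
    by (rule nn_integral_lborel_vec[symmetric]) measurable
  also have "\<dots> = emeasure (density lborel (\<lambda>x::real^'n. ennreal (exp (- ((norm x)\<^sup>2) / 2) / sqrt ((2 * pi) ^ CARD('n))))) A"
    by (subst emeasure_density) auto
  finally show "emeasure (std_gauss :: (real^'n) measure) A = emeasure (density lborel (\<lambda>x. ennreal (exp (- ((norm x)\<^sup>2) / 2) / sqrt ((2 * pi) ^ CARD('n))))) A" .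
qed

text \<open>Its density is radial.\<close>

lemma std_gauss_rotation:
  assumes f: "orthogonal_transformation (f :: real^'n \<Rightarrow> real^'n)"
  shows "distr std_gauss borel f = std_gauss"
proof (rule measure_eqI)
  have fm[measurable]: "f \<in> borel_measurable borel"
    using f by (intro borel_measurable_continuous_onI linear_continuous_on linear_conv_bounded_linear[THEN iffD1]) (auto simp: orthogonal_transformation)
  have nf: "norm (f x) = norm x" for x using f by (simp add: orthogonal_transformation)
  fix A assume "A \<in> sets (distr std_gauss borel f)"
  then have A[measurable]: "A \<in> sets borel" by simp
  let ?g = "\<lambda>x::real^'n. ennreal (exp (- ((norm x)\<^sup>2) / 2) / sqrt ((2 * pi) ^ CARD('n)))"
  have fA: "f -` A \<in> sets borel" using measurable_sets[OF fm A] by simp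
  have "emeasure (distr std_gauss borel f) A = emeasure (density lborel ?g) (f -` A)"
    unfolding std_gauss_density by (subst emeasure_distr) auto
  also have "\<dots> = (\<integral>\<^sup>+x. ?g (f x) * indicator A (f x) \<partial>lborel)"
    using fA by (subst emeasure_density) (auto simp: nf indicator_def intro!: nn_integral_cong)
  also have "\<dots> = (\<integral>\<^sup>+x. ?g x * indicator A x \<partial>lborel)"
    by (rule nn_integral_lborel_orthogonal[OF f]) measurable
  also have "\<dots> = emeasure std_gauss A" unfolding std_gauss_density by (subst emeasure_density) auto
  finally show "emeasure (distr std_gauss borel f) A = emeasure std_gauss A" .
qed (simp add: std_gauss_def)

lemma (in eigenframe) multivariate_normal_eq:
  "multivariate_normal 0 \<Sigma> = distr std_gauss borel T"
proof -
  have "(\<lambda>t::real. exp (- t / 2)) \<in> borel_measurable (restrict_space borel {0..})"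
    by (rule measurable_restrict_space1) measurable
  from elliptical_density[OF this, of "sqrt ((2 * pi) ^ CARD('n))" 0]
  show ?thesis
    by (simp add: multivariate_normal_def std_gauss_density real_sqrt_mult)
qed

section \<open>Convergence in distribution through scores\<close>

text \<open>The approximation of \<open>V\<close> by \<open>W\<close> is assumed only where \<open>R\<close> is bounded; tightness of \<open>R\<close> makes the rest negligible.\<close>

lemma (in prob_space) slutsky:
  fixes V W R :: "nat \<Rightarrow> 'a \<Rightarrow> 'b::euclidean_space" and f :: "'b \<Rightarrow> real"
  assumes V: "\<And>n. n \<ge> 1 \<Longrightarrow> V n \<in> borel_measurable M" and W: "\<And>n. n \<ge> 1 \<Longrightarrow> W n \<in> borel_measurable M"
    and Rm: "\<And>n. n \<ge> 1 \<Longrightarrow> R n \<in> borel_measurable M"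
    and close: "\<And>\<delta> L. \<delta> > 0 \<Longrightarrow> whp (\<lambda>n \<omega>. norm (R n \<omega>) \<le> L \<longrightarrow> norm (V n \<omega> - W n \<omega>) \<le> \<delta>)"
    and WR: "\<And>n \<omega>. norm (W n \<omega>) \<le> K * norm (R n \<omega>)" and K: "K \<ge> 0"
    and tight: "\<And>\<epsilon>. \<epsilon> > 0 \<Longrightarrow> \<exists>L. \<forall>n\<ge>1. prob {\<omega>\<in>space M. norm (R n \<omega>) > L} \<le> \<epsilon>"
    and f: "continuous_on UNIV f" and bnd: "bounded (range f)"
  shows "(\<lambda>n. expectation (\<lambda>\<omega>. f (V n \<omega>)) - expectation (\<lambda>\<omega>. f (W n \<omega>))) \<longlonglongrightarrow> 0"
proof (rule LIMSEQ_I)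
  fix e :: real assume e: "e > 0"
  obtain B where B: "B > 0" "\<And>x. \<bar>f x\<bar> \<le> B"
    using bnd by (auto simp: bounded_pos)
  have "e / (8 * B) > 0" using e B by simp
  from tight[OF this] obtain L where L: "\<And>n. n \<ge> 1 \<Longrightarrow> prob {\<omega>\<in>space M. norm (R n \<omega>) > L} \<le> e / (8 * B)" by blast
  have "uniformly_continuous_on (cball 0 (K * L + 1)) f"
    by (intro compact_uniformly_continuous continuous_on_subset[OF f]) auto
  then obtain \<eta> where \<eta>: "\<eta> > 0" "\<And>x y. x \<in> cball 0 (K * L + 1) \<Longrightarrow> y \<in> cball 0 (K * L + 1) \<Longrightarrow> dist y x < \<eta> \<Longrightarrow> dist (f y) (f x) < e / 4"
    unfolding uniformly_continuous_on_def using e by (metis divide_pos_pos zero_less_numeral)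
  define \<delta> where "\<delta> = min (1::real) (\<eta> / 2)"
  have \<delta>: "\<delta> > 0" "\<delta> \<le> 1" "\<delta> < \<eta>" using \<eta>(1) by (auto simp: \<delta>_def)
  \<comment> \<open>On G n with R bounded by L, both arguments lie in a fixed ball, where f is uniformly continuous.\<close>
  obtain G where G: "\<And>n. G n \<in> events" "(\<lambda>n. prob (G n)) \<longlonglongrightarrow> 1"
    "\<And>n \<omega>. \<omega> \<in> G n \<Longrightarrow> norm (R n \<omega>) \<le> L \<Longrightarrow> norm (V n \<omega> - W n \<omega>) \<le> \<delta>"
    using close[OF \<delta>(1), of L] unfolding whp_def by blast
  have "1 - e / (8 * B) < 1" using e B by simp
  then have "eventually (\<lambda>n. prob (G n) > 1 - e / (8 * B)) sequentially" using G(2) by (rule order_tendstoD(1)[rotated])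
  then obtain N where N: "\<And>n. n \<ge> N \<Longrightarrow> prob (G n) > 1 - e / (8 * B)" by (auto simp: eventually_sequentially)
  have "norm (expectation (\<lambda>\<omega>. f (V n \<omega>)) - expectation (\<lambda>\<omega>. f (W n \<omega>)) - 0) < e" if n: "n \<ge> max N 1" for n
  proof -
    have n1: "n \<ge> 1" and nN: "n \<ge> N" using n by auto
    have fb: "f \<in> borel_measurable borel" by (rule borel_measurable_continuous_onI[OF f])
    have im: "(\<lambda>\<omega>. f (V n \<omega>)) \<in> borel_measurable M" "(\<lambda>\<omega>. f (W n \<omega>)) \<in> borel_measurable M"
      using measurable_compose[OF V[OF n1] fb] measurable_compose[OF W[OF n1] fb] by auto
    have int: "integrable M (\<lambda>\<omega>. f (V n \<omega>))" "integrable M (\<lambda>\<omega>. f (W n \<omega>))"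
      using im B(2) by (auto intro!: integrable_const_bound[where B=B])
    let ?T = "{\<omega>\<in>space M. norm (R n \<omega>) > L}"
    have Tm: "?T \<in> events" using Rm[OF n1] by measurable
    let ?u = "\<lambda>\<omega>. e / 4 + 2 * B * indicator (space M - G n) \<omega> + 2 * B * indicator ?T \<omega>"
    have intu: "integrable M ?u"
      using G(1)[of n] Tm by (intro Bochner_Integration.integrable_add integrable_mult_right integrable_real_indicator) (auto simp: emeasure_eq_measure)
    have "\<bar>expectation (\<lambda>\<omega>. f (V n \<omega>)) - expectation (\<lambda>\<omega>. f (W n \<omega>))\<bar> = \<bar>expectation (\<lambda>\<omega>. f (V n \<omega>) - f (W n \<omega>))\<bar>"
      using int by simp
    also have "\<dots> \<le> expectation (\<lambda>\<omega>. \<bar>f (V n \<omega>) - f (W n \<omega>)\<bar>)" by (rule integral_abs_bound)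
    also have "\<dots> \<le> expectation ?u"
    proof (rule integral_mono)
      show "integrable M (\<lambda>\<omega>. \<bar>f (V n \<omega>) - f (W n \<omega>)\<bar>)" using int by simp
      fix \<omega> assume w: "\<omega> \<in> space M"
      show "\<bar>f (V n \<omega>) - f (W n \<omega>)\<bar> \<le> ?u \<omega>"
      proof (cases "\<omega> \<in> G n \<and> norm (R n \<omega>) \<le> L")
        case True
        then have d: "norm (V n \<omega> - W n \<omega>) \<le> \<delta>" using G(3) by blast
        have "norm (W n \<omega>) \<le> K * L" using WR[of n \<omega>] True K by (meson mult_left_mono order_trans)
        moreover have "norm (V n \<omega>) \<le> norm (W n \<omega>) + norm (V n \<omega> - W n \<omega>)" by (metis add.commute diff_add_cancel norm_triangle_ineq)
        ultimately have "dist (f (V n \<omega>)) (f (W n \<omega>)) < e / 4"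
          using d \<delta> by (intro \<eta>(2)) (auto simp: dist_norm)
        then have "\<bar>f (V n \<omega>) - f (W n \<omega>)\<bar> \<le> e / 4" by (simp add: dist_real_def)
        then show ?thesis using B(1) by (simp add: add_increasing2)
      next
        case False
        have "\<bar>f (V n \<omega>) - f (W n \<omega>)\<bar> \<le> 2 * B" using B(2)[of "V n \<omega>"] B(2)[of "W n \<omega>"] by linarith
        moreover have "2 * B \<le> 2 * B * indicator (space M - G n) \<omega> + 2 * B * indicator ?T \<omega>"
          using False w B(1) by (auto simp: indicator_def)
        ultimately show ?thesis using e by linarith
      qed
    qed (rule intu)
    also have "\<dots> = e / 4 + 2 * B * prob (space M - G n) + 2 * B * prob ?T"
      using G(1)[of n] Tm by (simp add: prob_space emeasure_eq_measure Int_absorb1 Int_absorb2 sets.sets_into_space Diff_subset)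
    also have "\<dots> < e"
    proof -
      have "prob (space M - G n) < e / (8 * B)" using N[OF nN] prob_compl[OF G(1)[of n]] by linarith
      then have "2 * B * prob (space M - G n) < 2 * B * (e / (8 * B))" using B(1) by (intro mult_strict_left_mono) auto
      moreover have "2 * B * prob ?T \<le> 2 * B * (e / (8 * B))" using L[OF n1] B(1) by (intro mult_left_mono) auto
      moreover have "2 * B * (e / (8 * B)) = e / 4" using B(1) by simp
      ultimately show ?thesis using e by linarith
    qed
    finally show ?thesis by simp
  qed
  then show "\<exists>no. \<forall>n\<ge>no. norm (expectation (\<lambda>\<omega>. f (V n \<omega>)) - expectation (\<lambda>\<omega>. f (W n \<omega>)) - 0) < e" by blast
qed

lemma (in profile) qmed_variance_eq: "qmed_variance d h = (1 / (2 * f0))\<^sup>2"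
  using c_gt0 by (simp add: qmed_variance_def f0_def c_def power_divide power_mult_distrib)

text \<open>The reduction of elliptical samples to spherical ones.\<close>

lemma (in eigenframe) sample_standardised:
  assumes "profile h CARD('n)" and M: "prob_space M"
    and indep: "prob_space.indep_vars M (\<lambda>_. borel) X {1..}"
    and distr: "\<And>k. k \<ge> 1 \<Longrightarrow> distr M borel (X k) = elliptical \<mu> \<Sigma> h"
  shows "spherical_sample (spherical h :: (real^'n) measure) (profile.f0 h CARD('n)) M (\<lambda>k \<omega>. S (X k \<omega> - \<mu>))"
proof -
  interpret P: profile h "CARD('n)" by fact
  interpret L: spherical_law "spherical h :: (real^'n) measure" P.f0 by (rule P.spherical_law_spherical) simp
  interpret M: prob_space M by fact
  have Xm: "X k \<in> borel_measurable M" if "k \<ge> 1" for k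
    using indep that by (simp add: M.indep_vars_def)
  have Sm: "(\<lambda>x. S (x - \<mu>)) \<in> borel_measurable borel"
    by (rule measurable_compose[OF _ S_measurable]) simp
  have Tm: "(\<lambda>z. \<mu> + T z) \<in> borel_measurable borel" by simp
  have ell: "elliptical \<mu> \<Sigma> h = distr (spherical h :: (real^'n) measure) borel (\<lambda>z. \<mu> + T z)"
    using elliptical_density[OF P.h_meas P.c_gt0, of \<mu>] by (simp add: elliptical_def P.spherical_eq P.c_def)
  show ?thesis
  proof unfold_locales
    show "M.indep_vars (\<lambda>_. borel) (\<lambda>k \<omega>. S (X k \<omega> - \<mu>)) {1..}"
      by (rule M.indep_vars_compose2[OF indep]) (rule Sm)
    fix k :: nat assume k: "k \<ge> 1"
    have "distr M borel (\<lambda>\<omega>. S (X k \<omega> - \<mu>)) = distr (distr M borel (X k)) borel (\<lambda>x. S (x - \<mu>))"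
      by (subst distr_distr[OF Sm Xm[OF k]]) (simp add: comp_def)
    also have "\<dots> = distr (spherical h :: (real^'n) measure) borel (\<lambda>z. S (\<mu> + T z - \<mu>))"
      unfolding distr[OF k] ell by (subst distr_distr[OF Sm]) (auto simp: comp_def)
    also have "\<dots> = spherical h" by (simp add: S_T) (rule distr_id2, simp)
    finally show "distr M borel (\<lambda>\<omega>. S (X k \<omega> - \<mu>)) = spherical h" .
  qed
qed

text \<open>The maps \<open>A n\<close> may vary without converging, as long as they take the Gaussian limit to one fixed law.
  Along the almost sure representation \<open>A n (W n)\<close> and \<open>A n (W')\<close> approach each other, since the \<open>A n\<close> share a
  Lipschitz constant, and the law of \<open>A n (W')\<close> is constant.\<close>

lemma (in prob_space) weak_limit_of_score_maps:
  fixes R :: "nat \<Rightarrow> 'a \<Rightarrow> real^'n" and A :: "nat \<Rightarrow> real^'n \<Rightarrow> real^'n" and f :: "real^'n \<Rightarrow> real"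
  assumes R: "\<And>n. n \<ge> 1 \<Longrightarrow> R n \<in> borel_measurable M"
    and \<Omega>: "prob_space \<Omega>" and W: "\<And>n. W n \<in> borel_measurable \<Omega>" and W': "W' \<in> borel_measurable \<Omega>"
    and law: "\<And>n. n \<ge> 1 \<Longrightarrow> distr \<Omega> borel (W n) = distr M borel (R n)" and law': "distr \<Omega> borel W' = std_gauss"
    and lim: "\<And>x. x \<in> space \<Omega> \<Longrightarrow> (\<lambda>n. W n x) \<longlonglongrightarrow> W' x"
    and A: "\<And>n. A n \<in> borel_measurable borel" "\<And>n x y. norm (A n x - A n y) \<le> K * norm (x - y)" "\<And>n. A n 0 = 0" and K: "K \<ge> 0"
    and f: "continuous_on UNIV f" and bnd: "bounded (range f)"
    and inv: "\<And>n. distr std_gauss borel (A n) = N"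
  shows "(\<lambda>n. expectation (\<lambda>\<omega>. f (A n (R n \<omega>)))) \<longlonglongrightarrow> (\<integral>x. f x \<partial>N)"
proof -
  interpret O: prob_space \<Omega> by fact
  obtain B where B: "B > 0" "\<And>x. \<bar>f x\<bar> \<le> B"
    using bnd by (auto simp: bounded_pos)
  have fb: "f \<in> borel_measurable borel" by (rule borel_measurable_continuous_onI[OF f])
  have fA: "(\<lambda>x. f (A n x)) \<in> borel_measurable borel" for n by (rule measurable_compose[OF A(1) fb])
  have e1: "expectation (\<lambda>\<omega>. f (A n (R n \<omega>))) = (\<integral>x. f (A n (W n x)) \<partial>\<Omega>)" if n: "n \<ge> 1" for n
  proof -
    have "expectation (\<lambda>\<omega>. f (A n (R n \<omega>))) = (\<integral>x. f (A n x) \<partial>distr M borel (R n))"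
      by (rule integral_distr[symmetric, OF R[OF n] fA])
    also have "\<dots> = (\<integral>x. f (A n (W n x)) \<partial>\<Omega>)"
      unfolding law[OF n, symmetric] by (rule integral_distr[OF W fA])
    finally show ?thesis .
  qed
  have e2: "(\<integral>x. f (A n (W' x)) \<partial>\<Omega>) = (\<integral>x. f x \<partial>N)" for n
  proof -
    have "(\<integral>x. f (A n (W' x)) \<partial>\<Omega>) = (\<integral>x. f (A n x) \<partial>std_gauss)"
      unfolding law'[symmetric] by (rule integral_distr[symmetric, OF W' fA])
    also have "\<dots> = (\<integral>x. f x \<partial>N)"
      unfolding inv[of n, symmetric] by (rule integral_distr[symmetric, OF _ fb]) (use A(1) in \<open>simp add: std_gauss_def\<close>)
    finally show ?thesis .
  qed
  have int: "integrable \<Omega> (\<lambda>x. f (A n (Y x)))" if "Y \<in> borel_measurable \<Omega>" for n Y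
    using measurable_compose[OF that fA] B(2) by (intro O.integrable_const_bound[where B=B]) auto
  have "(\<lambda>n. \<integral>x. f (A n (W n x)) - f (A n (W' x)) \<partial>\<Omega>) \<longlonglongrightarrow> (\<integral>x. 0 \<partial>\<Omega>)"
  proof (rule integral_dominated_convergence[where w = "\<lambda>_. 2 * B"])
    show "AE x in \<Omega>. (\<lambda>n. f (A n (W n x)) - f (A n (W' x))) \<longlonglongrightarrow> 0"
    proof (rule AE_I2)
      fix x assume x: "x \<in> space \<Omega>"
      have "Bseq (\<lambda>n. W n x)" using lim[OF x] by (intro convergent_imp_Bseq) (auto simp: convergent_def)
      then obtain b where b: "\<And>n. norm (W n x) \<le> b" by (auto simp: Bseq_def)
      define c where "c = K * max b (norm (W' x))"
      have nA: "norm (A n y) \<le> K * norm y" for n y using A(2)[of n y 0] by (simp add: A(3))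
      have inb: "A n (W n x) \<in> cball 0 c" "A n (W' x) \<in> cball 0 c" for n
      proof -
        have "K * norm (W n x) \<le> c" "K * norm (W' x) \<le> c" unfolding c_def using b[of n] K by (auto intro!: mult_left_mono)
        then show "A n (W n x) \<in> cball 0 c" "A n (W' x) \<in> cball 0 c"
          using nA[of n "W n x"] nA[of n "W' x"] by auto
      qed
      have uc: "uniformly_continuous_on (cball 0 c) f"
        by (intro compact_uniformly_continuous continuous_on_subset[OF f]) auto
      have d0: "(\<lambda>n. dist (A n (W n x)) (A n (W' x))) \<longlonglongrightarrow> 0"
      proof (rule Lim_null_comparison)
        show "eventually (\<lambda>n. norm (dist (A n (W n x)) (A n (W' x))) \<le> K * norm (W n x - W' x)) sequentially"
          using A(2) by (intro always_eventually allI) (simp add: dist_norm)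
        have "(\<lambda>n. K * norm (W n x - W' x)) \<longlonglongrightarrow> K * norm (W' x - W' x)"
          by (intro tendsto_intros lim[OF x])
        then show "(\<lambda>n. K * norm (W n x - W' x)) \<longlonglongrightarrow> 0" by simp
      qed
      show "(\<lambda>n. f (A n (W n x)) - f (A n (W' x))) \<longlonglongrightarrow> 0"
      proof (rule LIMSEQ_I)
        fix e :: real assume "e > 0"
        then obtain \<eta> where \<eta>: "\<eta> > 0" "\<And>u v. u \<in> cball 0 c \<Longrightarrow> v \<in> cball 0 c \<Longrightarrow> dist v u < \<eta> \<Longrightarrow> dist (f v) (f u) < e"
          using uc unfolding uniformly_continuous_on_def by metis
        have "eventually (\<lambda>n. dist (A n (W n x)) (A n (W' x)) < \<eta>) sequentially"
          using order_tendstoD(2)[OF d0 \<eta>(1)] .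
        then obtain N where "\<And>n. n \<ge> N \<Longrightarrow> dist (A n (W n x)) (A n (W' x)) < \<eta>" by (auto simp: eventually_sequentially)
        then have "dist (f (A n (W n x))) (f (A n (W' x))) < e" if "n \<ge> N" for n using \<eta>(2) inb that by blast
        then show "\<exists>no. \<forall>n\<ge>no. norm (f (A n (W n x)) - f (A n (W' x)) - 0) < e" by (auto simp: dist_norm)
      qed
    qed
    show "AE x in \<Omega>. norm (f (A n (W n x)) - f (A n (W' x))) \<le> 2 * B" for n
    proof (rule AE_I2)
      fix x show "norm (f (A n (W n x)) - f (A n (W' x))) \<le> 2 * B"
        using B(2)[of "A n (W n x)"] B(2)[of "A n (W' x)"] by simp
    qed
  qed (use measurable_compose[OF W fA] measurable_compose[OF W' fA] in auto)
  then have "(\<lambda>n. (\<integral>x. f (A n (W n x)) \<partial>\<Omega>) - (\<integral>x. f x \<partial>N)) \<longlonglongrightarrow> 0"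
    using int[OF W] int[OF W'] by (simp add: e2)
  then have "(\<lambda>n. \<integral>x. f (A n (W n x)) \<partial>\<Omega>) \<longlonglongrightarrow> (\<integral>x. f x \<partial>N)" by (simp add: LIM_zero_iff)
  then show ?thesis
    by (rule Lim_transform_eventually) (auto simp: e1 eventually_sequentially intro!: exI[of _ 1])
qed

context spherical_sample
begin

text \<open>The scores in the directions of the rows of \<open>B\<close>; the factor \<open>2\<close> makes the limiting variance \<open>1\<close>.\<close>

definition scores :: "real^'n^'n \<Rightarrow> nat \<Rightarrow> 'a \<Rightarrow> real^'n" where
  "scores B n \<omega> = (\<chi> i. 2 * scaled_score (row i B) n \<omega>)"

lemma scores_measurable: "scores B n \<in> borel_measurable M"
  unfolding scores_def
  by (intro measurable_vec_lambda borel_measurable_times borel_measurable_const scaled_score_measurable)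

lemma scores_tight:
  assumes e: "\<epsilon> > 0" and B: "\<And>n i. n \<ge> 1 \<Longrightarrow> norm (row i (B n)) = 1"
  shows "\<exists>L. \<forall>n\<ge>1. M.prob {\<omega>\<in>space M. norm (scores (B n) n \<omega>) > L} \<le> \<epsilon>"
proof -
  have "\<epsilon> / CARD('n) > 0" using e by simp
  from scaled_score_tight[OF this] obtain L where L: "L \<ge> 0"
    "\<And>n p. norm p = 1 \<Longrightarrow> M.prob {\<omega>\<in>space M. \<bar>scaled_score p n \<omega>\<bar> > L} \<le> \<epsilon> / CARD('n)" by blast
  have "M.prob {\<omega>\<in>space M. norm (scores (B n) n \<omega>) > 2 * CARD('n) * L} \<le> \<epsilon>" if n: "n \<ge> 1" for n
  proof -
    let ?E = "\<lambda>i. {\<omega>\<in>space M. \<bar>scaled_score (row i (B n)) n \<omega>\<bar> > L}"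
    have Em: "?E i \<in> M.events" for i
      using borel_measurable_less[OF borel_measurable_const borel_measurable_abs[OF scaled_score_measurable]] .
    have "{\<omega>\<in>space M. norm (scores (B n) n \<omega>) > 2 * CARD('n) * L} \<subseteq> (\<Union>i\<in>UNIV. ?E i)"
    proof
      fix \<omega> assume w: "\<omega> \<in> {\<omega>\<in>space M. norm (scores (B n) n \<omega>) > 2 * CARD('n) * L}"
      show "\<omega> \<in> (\<Union>i\<in>UNIV. ?E i)"
      proof (rule ccontr)
        assume "\<omega> \<notin> (\<Union>i\<in>UNIV. ?E i)"
        then have le: "\<bar>scaled_score (row i (B n)) n \<omega>\<bar> \<le> L" for i using w by (auto simp: not_less)
        have "norm (scores (B n) n \<omega>) \<le> (\<Sum>i\<in>UNIV. \<bar>scores (B n) n \<omega> $ i\<bar>)" by (rule norm_le_l1_cart)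
        also have "\<dots> \<le> (\<Sum>i\<in>(UNIV::'n set). 2 * L)" using le by (intro sum_mono) (simp add: scores_def abs_mult)
        finally show False using w by (simp add: mult_ac)
      qed
    qed
    then have "M.prob {\<omega>\<in>space M. norm (scores (B n) n \<omega>) > 2 * CARD('n) * L} \<le> M.prob (\<Union>i\<in>UNIV. ?E i)"
      by (rule M.finite_measure_mono) (use Em in \<open>intro sets.finite_UN\<close>, simp_all)
    also have "\<dots> \<le> (\<Sum>i\<in>UNIV. M.prob (?E i))"
      by (rule M.finite_measure_subadditive_finite) (use Em in auto)
    also have "\<dots> \<le> (\<Sum>i\<in>(UNIV::'n set). \<epsilon> / CARD('n))" by (intro sum_mono L(2) B n)
    finally show ?thesis by simp
  qed
  then show ?thesis by blast
qed

lemma rotated_sample: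
  assumes U: "orthogonal_matrix U"
  shows "spherical_sample Q f0 M (\<lambda>k \<omega>. U *v Z k \<omega>)"
proof unfold_locales
  show "M.indep_vars (\<lambda>_. borel) (\<lambda>k \<omega>. U *v Z k \<omega>) {1..}"
    by (rule M.indep_vars_compose2[OF Z_indep]) (rule borel_measurable_matrix_vector_mult)
  fix k :: nat assume k: "k \<ge> 1"
  have "distr M borel (\<lambda>\<omega>. U *v Z k \<omega>) = distr (distr M borel (Z k)) borel ((*v) U)"
    by (subst distr_distr[OF _ Z_measurable[OF k]]) (auto simp: comp_def borel_measurable_matrix_vector_mult)
  also have "\<dots> = Q"
    unfolding Z_distr[OF k] by (rule rotation) (use U in \<open>simp add: orthogonal_transformation_matrix\<close>)
  finally show "distr M borel (\<lambda>\<omega>. U *v Z k \<omega>) = Q" .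
qed

lemma joint_law:
  assumes "n \<ge> 1"
  shows "distr M (PiM {1..n} (\<lambda>_. borel)) (\<lambda>\<omega>. \<lambda>k\<in>{1..n}. Z k \<omega>) = PiM {1..n} (\<lambda>_. Q)"
proof -
  have "distr M (PiM {1..n} (\<lambda>_. borel)) (\<lambda>\<omega>. \<lambda>k\<in>{1..n}. Z k \<omega>) = PiM {1..n} (\<lambda>k. distr M borel (Z k))"
    using assms M.indep_vars_subset[OF Z_indep, of "{1..n}"]
    by (subst M.indep_vars_iff_distr_eq_PiM'[symmetric]) auto
  also have "\<dots> = PiM {1..n} (\<lambda>_. Q)" by (intro PiM_cong refl) (simp add: Z_distr)
  finally show ?thesis .
qed

text \<open>The scores of the sample in the directions of the rows of \<open>U\<close> are the coordinate scores of the
  rotated sample, which has the same law as the original one.\<close>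

lemma scores_law:
  assumes U: "orthogonal_matrix U" and n: "n \<ge> 1"
  shows "distr M borel (scores U n) = distr M borel (scores (mat 1) n)"
proof -
  interpret R: spherical_sample Q f0 M "\<lambda>k \<omega>. U *v Z k \<omega>" by (rule rotated_sample[OF U])
  \<comment> \<open>the coordinate scores as a function of the sample\<close>
  define \<Phi> where "\<Phi> = (\<lambda>x. \<chi> i. 2 * (sqrt n * (frac n x {z::real^'n. 0 \<le> z $ i} - 1 / 2)))"
  have \<Phi>m: "\<Phi> \<in> borel_measurable (PiM {1..n} (\<lambda>_. borel))"
  proof -
    have "(\<lambda>x. indicator {z::real^'n. 0 \<le> z $ i} (x k) :: real) \<in> borel_measurable (PiM {1..n} (\<lambda>_. borel))" if "k \<in> {1..n}" for k i
      by (rule measurable_compose[OF measurable_component_singleton[OF that]]) (intro borel_measurable_indicator borel_coordinate)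
    then show ?thesis
      unfolding \<Phi>_def frac_def
      by (intro measurable_vec_lambda borel_measurable_times borel_measurable_diff borel_measurable_divide borel_measurable_sum borel_measurable_const)
  qed
  have frac_restrict: "frac n (\<lambda>k\<in>{1..n}. x k) A = frac n x A" for x :: "nat \<Rightarrow> real^'n" and A
    unfolding frac_def by (intro arg_cong2[where f="(/)"] sum.cong refl) simp
  have 1: "scores (mat 1) n \<omega> = \<Phi> (\<lambda>k\<in>{1..n}. Z k \<omega>)" for \<omega>
    unfolding scores_def \<Phi>_def frac_restrict scaled_score_def
    by (simp add: row_def mat_def inner_vec_def vec_eq_iff if_distrib[where f="\<lambda>x. x * _"] cong: if_cong)
  have 2: "scores U n \<omega> = \<Phi> (\<lambda>k\<in>{1..n}. U *v Z k \<omega>)" for \<omega>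
  proof -
    have "frac n (\<lambda>k. U *v Z k \<omega>) {z. 0 \<le> z $ i} = frac n (\<lambda>k. Z k \<omega>) {z. 0 \<le> row i U \<bullet> z}" for i
      unfolding frac_def by (intro arg_cong2[where f="(/)"] sum.cong refl) (simp add: indicator_def matrix_vector_mul_component row_def)
    then show ?thesis
      unfolding scores_def \<Phi>_def frac_restrict scaled_score_def by simp
  qed
  have m: "(\<lambda>\<omega>. \<lambda>k\<in>{1..n}. Z k \<omega>) \<in> measurable M (PiM {1..n} (\<lambda>_. borel))"
    "(\<lambda>\<omega>. \<lambda>k\<in>{1..n}. U *v Z k \<omega>) \<in> measurable M (PiM {1..n} (\<lambda>_. borel))"
    by (auto intro!: measurable_restrict R.Z_measurable)
  have "distr M borel (scores U n) = distr (distr M (PiM {1..n} (\<lambda>_. borel)) (\<lambda>\<omega>. \<lambda>k\<in>{1..n}. U *v Z k \<omega>)) borel \<Phi>"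
    by (subst distr_distr[OF \<Phi>m m(2)]) (simp add: comp_def 2[abs_def] fun_eq_iff 2)
  also have "\<dots> = distr (distr M (PiM {1..n} (\<lambda>_. borel)) (\<lambda>\<omega>. \<lambda>k\<in>{1..n}. Z k \<omega>)) borel \<Phi>"
    unfolding joint_law[OF n] R.joint_law[OF n] ..
  also have "\<dots> = distr M borel (scores (mat 1) n)"
    by (subst distr_distr[OF \<Phi>m m(1)]) (simp only: comp_def 1[abs_def])
  finally show ?thesis .
qed

text \<open>The common last step of both parts: an estimator that is a linear map of a score vector up to \<open>o(1)\<close> has
  the Gaussian image law as its limit.\<close>

lemma score_maps_limit:
  fixes A :: "nat \<Rightarrow> real^'n \<Rightarrow> real^'n" and f :: "real^'n \<Rightarrow> real"
  assumes B: "\<And>n. n \<ge> 1 \<Longrightarrow> orthogonal_matrix (B n)"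
    and A: "\<And>n. A n \<in> borel_measurable borel" "\<And>n x y. norm (A n x - A n y) \<le> K * norm (x - y)" "\<And>n. A n 0 = 0" and K: "K \<ge> 0"
    and inv: "\<And>n. distr std_gauss borel (A n) = N"
    and V: "\<And>n. n \<ge> 1 \<Longrightarrow> V n \<in> borel_measurable M"
    and close: "\<And>\<delta> L. \<delta> > 0 \<Longrightarrow> M.whp (\<lambda>n \<omega>. norm (scores (B n) n \<omega>) \<le> L \<longrightarrow> norm (V n \<omega> - A n (scores (B n) n \<omega>)) \<le> \<delta>)"
  shows "converges_in_distribution M V N"
  unfolding converges_in_distribution_def weakly_converges_def
proof (intro allI impI)
  fix f :: "real^'n \<Rightarrow> real" assume f: "continuous_on UNIV f" and bnd: "bounded (range f)"
  have fb: "f \<in> borel_measurable borel" by (rule borel_measurable_continuous_onI[OF f])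
  have row1: "row i (mat 1 :: real^'n^'n) = axis i 1" for i
    by (simp add: row_def mat_def axis_def vec_eq_iff)
  obtain \<Omega> :: "('n \<Rightarrow> real) measure" and W W' where \<Omega>: "prob_space \<Omega>"
    "\<And>n. W n \<in> borel_measurable \<Omega>" "W' \<in> borel_measurable \<Omega>"
    "\<And>n. distr \<Omega> borel (W n) = distr M borel (\<lambda>\<omega>. \<chi> i. 2 * scaled_score (axis i 1) n \<omega>)"
    "distr \<Omega> borel W' = std_gauss" "\<And>x. x \<in> space \<Omega> \<Longrightarrow> (\<lambda>n. W n x) \<longlonglongrightarrow> W' x"
    using skorohod_scores by blast
  have law: "distr \<Omega> borel (W n) = distr M borel (scores (B n) n)" if "n \<ge> 1" for n
    unfolding \<Omega>(4) scores_law[OF B[OF that] that] by (simp add: scores_def[abs_def] row1)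
  have lim1: "(\<lambda>n. M.expectation (\<lambda>\<omega>. f (A n (scores (B n) n \<omega>)))) \<longlonglongrightarrow> (\<integral>x. f x \<partial>N)"
    by (rule M.weak_limit_of_score_maps[OF scores_measurable \<Omega>(1,2,3) law \<Omega>(5,6) A K f bnd inv])
  have Wm: "(\<lambda>\<omega>. A n (scores (B n) n \<omega>)) \<in> borel_measurable M" for n
    by (rule measurable_compose[OF scores_measurable A(1)])
  have bound: "norm (A n x) \<le> K * norm x" for n x using A(2)[of n x 0] by (simp add: A(3))
  have lim2: "(\<lambda>n. M.expectation (\<lambda>\<omega>. f (V n \<omega>)) - M.expectation (\<lambda>\<omega>. f (A n (scores (B n) n \<omega>)))) \<longlonglongrightarrow> 0"
    by (rule M.slutsky[where R = "\<lambda>n. scores (B n) n", OF V Wm scores_measurable close bound K scores_tight f bnd])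
       (simp_all add: norm_row_orthogonal B)
  have lim: "(\<lambda>n. M.expectation (\<lambda>\<omega>. f (V n \<omega>))) \<longlonglongrightarrow> (\<integral>x. f x \<partial>N)"
    using tendsto_add[OF lim2 lim1] by simp
  show "(\<lambda>n. \<integral>x. f x \<partial>distr M borel (V n)) \<longlonglongrightarrow> (\<integral>x. f x \<partial>N)"
  proof (rule Lim_transform_eventually[OF lim])
    show "eventually (\<lambda>n. M.expectation (\<lambda>\<omega>. f (V n \<omega>)) = (\<integral>x. f x \<partial>distr M borel (V n))) sequentially"
      by (rule eventually_sequentiallyI[of 1]) (rule integral_distr[symmetric, OF V fb])
  qed
qed

end

section \<open>Asymptotic normality of quarter medians and marginal medians\<close>

lemma row_nth: "row i (A :: real^'n^'m) = A $ i"
  by (simp add: row_def)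

lemma stretch_simps: "stretch l x - stretch l y = stretch l (x - y)" "stretch l 0 = 0"
  by (simp_all add: stretch_def vec_eq_iff algebra_simps)

lemma stretch_inner: "x \<bullet> stretch l z = stretch l x \<bullet> z"
  by (simp add: stretch_def inner_vec_def mult_ac)

lemma stretch_bound: "norm (stretch l z) \<le> (\<Sum>k\<in>UNIV. \<bar>sqrt (l k)\<bar>) * norm z"
proof -
  have "norm (stretch l z) \<le> (\<Sum>k\<in>UNIV. \<bar>stretch l z $ k\<bar>)" by (rule norm_le_l1_cart)
  also have "\<dots> \<le> (\<Sum>k\<in>UNIV. \<bar>sqrt (l k)\<bar> * norm z)"
    by (intro sum_mono) (simp add: stretch_def abs_mult mult_left_mono component_le_norm_cart)
  finally show ?thesis by (simp add: sum_distrib_right)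
qed

text \<open>For distinct eigenvalues this is elementary: every root of the characteristic polynomial has an
  eigenvector, and eigenvectors of a symmetric matrix for different eigenvalues are orthogonal.\<close>

lemma strictly_elliptical_eigenframe:
  fixes \<Sigma> :: "real^'n^'n"
  assumes sym: "transpose \<Sigma> = \<Sigma>" and pd: "positive_definite \<Sigma>" and strict: "strictly_elliptical \<Sigma>"
  shows "\<exists>E l. eigenframe \<Sigma> E l \<and> (\<forall>i j. i \<noteq> j \<longrightarrow> l i \<noteq> l j)"
proof -
  obtain l :: "'n \<Rightarrow> real" where l: "\<And>t. det (mat t - \<Sigma>) = (\<Prod>i\<in>UNIV. t - l i)" and inj: "\<And>i j. i \<noteq> j \<Longrightarrow> l i \<noteq> l j"
    using strict by (auto simp: strictly_elliptical_def lists_eigenvalues_def)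
  have "\<exists>x. norm x = 1 \<and> \<Sigma> *v x = l i *\<^sub>R x" for i
  proof -
    have "det (mat (l i) - \<Sigma>) = 0" unfolding l by (rule prod_zero) (auto intro: exI[of _ i])
    then have "\<not> invertible (mat (l i) - \<Sigma>)" by (simp add: invertible_det_nz)
    then obtain x where x: "(mat (l i) - \<Sigma>) *v x = 0" "x \<noteq> 0"
      using matrix_left_invertible_ker[of "mat (l i) - \<Sigma>"] by (auto simp: invertible_left_inverse)
    have "mat (l i) *v x = l i *\<^sub>R x"
      by (simp add: mat_def matrix_vector_mult_def vec_eq_iff if_distrib[where f="\<lambda>x. x * _"] cong: if_cong)
    then have "\<Sigma> *v x = l i *\<^sub>R x" using x(1) by (simp add: matrix_vector_mult_diff_rdistrib)
    moreover have "\<Sigma> *v (x /\<^sub>R norm x) = (\<Sigma> *v x) /\<^sub>R norm x" by (rule linear_cmul) simp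
    ultimately have "\<Sigma> *v (x /\<^sub>R norm x) = l i *\<^sub>R (x /\<^sub>R norm x)" by simp
    then show ?thesis using x(2) by (intro exI[of _ "x /\<^sub>R norm x"]) simp
  qed
  then obtain e where e: "\<And>i. norm (e i) = 1" "\<And>i. \<Sigma> *v e i = l i *\<^sub>R e i" by metis
  define E :: "real^'n^'n" where "E = (\<chi> i. e i)"
  have row: "row i E = e i" for i by (simp add: E_def row_nth)
  have orth: "e i \<bullet> e j = 0" if "i \<noteq> j" for i j
  proof -
    have "l i * (e i \<bullet> e j) = (\<Sigma> *v e i) \<bullet> e j" by (simp add: e)
    also have "\<dots> = e i \<bullet> (\<Sigma> *v e j)"
      using dot_lmul_matrix[of "e i" \<Sigma> "e j"] transpose_matrix_vector[of \<Sigma> "e i"] by (simp add: sym)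
    also have "\<dots> = l j * (e i \<bullet> e j)" by (simp add: e)
    finally show ?thesis using inj[OF that] by simp
  qed
  have "orthogonal_matrix E"
    unfolding orthogonal_matrix_orthonormal_rows row using e orth by (auto simp: orthogonal_def)
  moreover have "l i > 0" for i
  proof -
    have "e i \<noteq> 0" using e(1)[of i] by auto
    then have "0 < e i \<bullet> (\<Sigma> *v e i)" using pd by (simp add: positive_definite_def)
    also have "\<dots> = l i" using e(1)[of i] by (simp add: e dot_square_norm)
    finally show ?thesis .
  qed
  ultimately have "eigenframe \<Sigma> E l" by unfold_locales (auto simp: row e)
  with inj show ?thesis by blast
qed

lemma frac_cong:
  assumes "\<And>k. k \<in> {1..n} \<Longrightarrow> x k \<in> A \<longleftrightarrow> y k \<in> B"
  shows "frac n x A = frac n y B"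
  unfolding frac_def using assms by (intro arg_cong2[where f="(/)"] sum.cong refl) (auto simp: indicator_def)

lemma borel_halfspace: "halfspace s a b \<in> sets borel"
  by (cases s) (auto intro!: borel_closed closed_Collect_le continuous_intros)

lemma (in eigenframe) T_diff: "T x - T y = T (x - y)"
  by (simp add: T_def stretch_simps(1)[symmetric] matrix_vector_mult_diff_distrib)

lemma (in eigenframe) norm_T: "norm (T x) = norm (stretch l x)"
  using orthogonal_transformation_E(2) by (simp add: T_def orthogonal_transformation)

text \<open>Part (a), given a spectral decomposition: in eigencoordinates the quarter median conditions are those
  of \<open>quarter_median_expansion\<close>.\<close>

lemma (in eigenframe) quarter_median_limit:
  fixes \<theta> :: "nat \<Rightarrow> 'a \<Rightarrow> real^'n" and U :: "nat \<Rightarrow> 'a \<Rightarrow> real^'n^'n"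
  assumes prof: "profile h CARD('n)" and M: "prob_space M"
    and indep: "prob_space.indep_vars M (\<lambda>_. borel) X {1..}"
    and distr: "\<And>k. k \<ge> 1 \<Longrightarrow> distr M borel (X k) = elliptical \<mu> \<Sigma> h"
    and inj: "\<And>i j. i \<noteq> j \<Longrightarrow> l i \<noteq> l j"
    and meas: "\<And>n. n \<ge> 1 \<Longrightarrow> \<theta> n \<in> borel_measurable M"
    and sol: "\<And>n. n \<ge> 1 \<Longrightarrow> AE \<omega> in M. solves_quarter_median (empirical n (\<lambda>k. X k \<omega>)) (\<theta> n \<omega>) (U n \<omega>)"
  shows "converges_in_distribution M (\<lambda>n \<omega>. sqrt (real n) *\<^sub>R (\<theta> n \<omega> - \<mu>)) (multivariate_normal 0 (qmed_variance CARD('n) h *\<^sub>R \<Sigma>))"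
proof -
  interpret P: profile h "CARD('n)" by fact
  interpret Sm: spherical_sample "spherical h :: (real^'n) measure" P.f0 M "\<lambda>k \<omega>. S (X k \<omega> - \<mu>)"
    by (rule sample_standardised[OF prof M indep distr])
  \<comment> \<open>the asymptotic variance factor; the limit law is the Gaussian image under the eigenframe of v times the matrix\<close>
  define v where "v = (1 / (2 * P.f0))\<^sup>2"
  have v: "v > 0" "sqrt v = 1 / (2 * P.f0)" using P.f0_pos by (auto simp: v_def)
  interpret V: eigenframe "v *\<^sub>R \<Sigma>" E "\<lambda>i. v * l i"
    by (rule eigenframe_scaleR) (use v in \<open>auto intro: eigenframe_axioms\<close>)
  define d where "d = real CARD('n)"
  have d: "d > 0" by (simp add: d_def)
  have row1: "row i (mat 1 :: real^'n^'n) = axis i 1" for i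
    by (simp add: row_def mat_def axis_def vec_eq_iff)
  show ?thesis
    unfolding P.qmed_variance_eq v_def[symmetric] V.multivariate_normal_eq
  proof (rule Sm.score_maps_limit[where B = "\<lambda>_. mat 1" and A = "\<lambda>_. V.T" and K = "\<Sum>k\<in>UNIV. \<bar>sqrt (v * l k)\<bar>"])
    show "norm (V.T x - V.T y) \<le> (\<Sum>k\<in>UNIV. \<bar>sqrt (v * l k)\<bar>) * norm (x - y)" for x y
      unfolding V.T_diff V.norm_T by (rule stretch_bound)
    show "V.T 0 = 0" by (simp add: V.T_def stretch_simps)
    show "(\<lambda>\<omega>. sqrt (real n) *\<^sub>R (\<theta> n \<omega> - \<mu>)) \<in> borel_measurable M" if "n \<ge> 1" for n
      using meas[OF that] by measurable
    show "0 \<le> (\<Sum>k\<in>UNIV. \<bar>sqrt (v * l k)\<bar>)" by (intro sum_nonneg) simp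
    fix \<delta> L :: real assume \<delta>: "\<delta> > 0"
    then have \<delta>d: "\<delta> / d > 0" using d by simp
    have ae: "Sm.M.whp (\<lambda>n \<omega>. solves_quarter_median (empirical n (\<lambda>k. X k \<omega>)) (\<theta> n \<omega>) (U n \<omega>))"
      by (rule Sm.M.whp_AE, rule eventually_sequentiallyI[of 1], rule sol)
    have ex: "Sm.M.whp (\<lambda>n \<omega>. (\<forall>k. \<bar>Sm.scaled_score (axis k 1) n \<omega>\<bar> \<le> L) \<longrightarrow>
          (\<forall>B y. orthogonal_matrix B \<longrightarrow>
            (\<forall>i. 1 / 2 \<le> Sm.F n \<omega> {z. row i B \<bullet> y \<le> stretch l (row i B) \<bullet> z} \<and> 1 / 2 \<le> Sm.F n \<omega> {z. stretch l (row i B) \<bullet> z \<le> row i B \<bullet> y}) \<longrightarrow>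
            (\<forall>i j. i \<noteq> j \<longrightarrow> 1 / 4 \<le> Sm.F n \<omega> {z. row i B \<bullet> y \<le> stretch l (row i B) \<bullet> z \<and> stretch l (row j B) \<bullet> z \<le> row j B \<bullet> y} \<and>
               1 / 4 \<le> Sm.F n \<omega> {z. row i B \<bullet> y \<le> stretch l (row i B) \<bullet> z \<and> row j B \<bullet> y \<le> stretch l (row j B) \<bullet> z}) \<longrightarrow>
            (\<forall>k. \<bar>sqrt n * y $ k - sqrt (l k) * (Sm.scaled_score (axis k 1) n \<omega> / P.f0)\<bar> \<le> \<delta> / d)))"
      by (rule Sm.quarter_median_expansion) (use l_pos inj \<delta>d in auto)
    show "Sm.M.whp (\<lambda>n \<omega>. norm (Sm.scores (mat 1) n \<omega>) \<le> L \<longrightarrow> norm (sqrt (real n) *\<^sub>R (\<theta> n \<omega> - \<mu>) - V.T (Sm.scores (mat 1) n \<omega>)) \<le> \<delta>)"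
    proof (rule Sm.M.whp_mono[OF Sm.M.whp_conj[OF ex ae]],
        rule eventually_sequentiallyI[of 1], intro ballI impI, elim conjE)
      fix n \<omega>
      assume n: "1 \<le> n" and small: "norm (Sm.scores (mat 1) n \<omega>) \<le> L"
        and qm: "solves_quarter_median (empirical n (\<lambda>k. X k \<omega>)) (\<theta> n \<omega>) (U n \<omega>)"
        and H: "(\<forall>k. \<bar>Sm.scaled_score (axis k 1) n \<omega>\<bar> \<le> L) \<longrightarrow>
          (\<forall>B y. orthogonal_matrix B \<longrightarrow>
            (\<forall>i. 1 / 2 \<le> Sm.F n \<omega> {z. row i B \<bullet> y \<le> stretch l (row i B) \<bullet> z} \<and> 1 / 2 \<le> Sm.F n \<omega> {z. stretch l (row i B) \<bullet> z \<le> row i B \<bullet> y}) \<longrightarrow>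
            (\<forall>i j. i \<noteq> j \<longrightarrow> 1 / 4 \<le> Sm.F n \<omega> {z. row i B \<bullet> y \<le> stretch l (row i B) \<bullet> z \<and> stretch l (row j B) \<bullet> z \<le> row j B \<bullet> y} \<and>
               1 / 4 \<le> Sm.F n \<omega> {z. row i B \<bullet> y \<le> stretch l (row i B) \<bullet> z \<and> row j B \<bullet> y \<le> stretch l (row j B) \<bullet> z}) \<longrightarrow>
            (\<forall>k. \<bar>sqrt n * y $ k - sqrt (l k) * (Sm.scaled_score (axis k 1) n \<omega> / P.f0)\<bar> \<le> \<delta> / d))"
      define s where "s = (\<lambda>k. Sm.scaled_score (axis k 1) n \<omega>)"
      have sc: "Sm.scores (mat 1) n \<omega> = (\<chi> k. 2 * s k)" by (simp add: Sm.scores_def row1 s_def)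
      have sL: "\<bar>s k\<bar> \<le> L" for k
        using component_le_norm_cart[of "Sm.scores (mat 1) n \<omega>" k] small by (simp add: sc abs_mult)
      \<comment> \<open>the frame and the centred location in eigencoordinates\<close>
      define B where "B = U n \<omega> ** transpose E"
      define y where "y = E *v (\<theta> n \<omega> - \<mu>)"
      have oU: "orthogonal_matrix (U n \<omega>)" using qm by (simp add: solves_quarter_median_def)
      have oB: "orthogonal_matrix B" unfolding B_def using oU E by (intro orthogonal_matrix_mul) (simp_all add: orthogonal_matrix_transpose)
      have inB: "row i (U n \<omega>) \<bullet> (transpose E *v w) = row i B \<bullet> w" for i w
      proof -
        have "row i (U n \<omega>) \<bullet> (transpose E *v w) = (U n \<omega> *v (transpose E *v w)) $ i"
          by (simp only: matrix_vector_mul_component row_nth)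
        also have "\<dots> = (B *v w) $ i" by (simp only: B_def matrix_vector_mul_assoc)
        finally show ?thesis by (simp only: matrix_vector_mul_component row_nth)
      qed
      have key: "row i (U n \<omega>) \<bullet> (X k \<omega> - \<theta> n \<omega>) = stretch l (row i B) \<bullet> S (X k \<omega> - \<mu>) - row i B \<bullet> y" for i k
      proof -
        have "X k \<omega> - \<theta> n \<omega> = T (S (X k \<omega> - \<mu>)) - transpose E *v y" by (simp add: T_S y_def E_inv)
        then show ?thesis by (simp only: inner_diff_right T_def inB stretch_inner)
      qed
      have half: "1 / 2 \<le> frac n (\<lambda>k. X k \<omega>) (halfspace t (\<theta> n \<omega>) (row i (U n \<omega>)))" for t i
        using qm n by (simp add: solves_quarter_median_def measure_empirical borel_halfspace)
      have quarter: "1 / 4 \<le> frac n (\<lambda>k. X k \<omega>) (quadrant t t' (\<theta> n \<omega>) (row i (U n \<omega>)) (row j (U n \<omega>)))" if "i \<noteq> j" for i j t t'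
        using qm n that by (simp add: solves_quarter_median_def measure_empirical borel_halfspace quadrant_def sets.Int)
      have "1 / 2 \<le> Sm.F n \<omega> {z. row i B \<bullet> y \<le> stretch l (row i B) \<bullet> z} \<and> 1 / 2 \<le> Sm.F n \<omega> {z. stretch l (row i B) \<bullet> z \<le> row i B \<bullet> y}" for i
      proof
        have "Sm.F n \<omega> {z. row i B \<bullet> y \<le> stretch l (row i B) \<bullet> z} = frac n (\<lambda>k. X k \<omega>) (halfspace Plus (\<theta> n \<omega>) (row i (U n \<omega>)))"
          by (rule frac_cong) (simp add: key)
        then show "1 / 2 \<le> Sm.F n \<omega> {z. row i B \<bullet> y \<le> stretch l (row i B) \<bullet> z}" using half[of Plus i] by (simp only:)
        have "Sm.F n \<omega> {z. stretch l (row i B) \<bullet> z \<le> row i B \<bullet> y} = frac n (\<lambda>k. X k \<omega>) (halfspace Minus (\<theta> n \<omega>) (row i (U n \<omega>)))"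
          by (rule frac_cong) (simp add: key)
        then show "1 / 2 \<le> Sm.F n \<omega> {z. stretch l (row i B) \<bullet> z \<le> row i B \<bullet> y}" using half[of Minus i] by (simp only:)
      qed
      moreover have "1 / 4 \<le> Sm.F n \<omega> {z. row i B \<bullet> y \<le> stretch l (row i B) \<bullet> z \<and> stretch l (row j B) \<bullet> z \<le> row j B \<bullet> y} \<and>
               1 / 4 \<le> Sm.F n \<omega> {z. row i B \<bullet> y \<le> stretch l (row i B) \<bullet> z \<and> row j B \<bullet> y \<le> stretch l (row j B) \<bullet> z}" if ij: "i \<noteq> j" for i j
      proof
        have "Sm.F n \<omega> {z. row i B \<bullet> y \<le> stretch l (row i B) \<bullet> z \<and> stretch l (row j B) \<bullet> z \<le> row j B \<bullet> y} =
          frac n (\<lambda>k. X k \<omega>) (quadrant Plus Minus (\<theta> n \<omega>) (row i (U n \<omega>)) (row j (U n \<omega>)))"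
          by (rule frac_cong) (simp add: key quadrant_def)
        then show "1 / 4 \<le> Sm.F n \<omega> {z. row i B \<bullet> y \<le> stretch l (row i B) \<bullet> z \<and> stretch l (row j B) \<bullet> z \<le> row j B \<bullet> y}" using quarter[OF ij] by simp
        have "Sm.F n \<omega> {z. row i B \<bullet> y \<le> stretch l (row i B) \<bullet> z \<and> row j B \<bullet> y \<le> stretch l (row j B) \<bullet> z} =
          frac n (\<lambda>k. X k \<omega>) (quadrant Plus Plus (\<theta> n \<omega>) (row i (U n \<omega>)) (row j (U n \<omega>)))"
          by (rule frac_cong) (simp add: key quadrant_def)
        then show "1 / 4 \<le> Sm.F n \<omega> {z. row i B \<bullet> y \<le> stretch l (row i B) \<bullet> z \<and> row j B \<bullet> y \<le> stretch l (row j B) \<bullet> z}" using quarter[OF ij] by simp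
      qed
      ultimately have exp: "\<bar>sqrt n * y $ k - sqrt (l k) * (s k / P.f0)\<bar> \<le> \<delta> / d" for k
        using H sL oB unfolding s_def by blast
      define w where "w = sqrt n *\<^sub>R y - stretch (\<lambda>i. v * l i) (\<chi> k. 2 * s k)"
      have "sqrt n *\<^sub>R (\<theta> n \<omega> - \<mu>) = transpose E *v (sqrt n *\<^sub>R y)"
        by (simp add: y_def E_inv matrix_vector_mult_scaleR)
      then have "sqrt n *\<^sub>R (\<theta> n \<omega> - \<mu>) - V.T (Sm.scores (mat 1) n \<omega>) = transpose E *v w"
        unfolding sc V.T_def w_def by (simp only: matrix_vector_mult_diff_distrib)
      then have "norm (sqrt n *\<^sub>R (\<theta> n \<omega> - \<mu>) - V.T (Sm.scores (mat 1) n \<omega>)) = norm w"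
        using orthogonal_transformation_E(2) by (simp add: orthogonal_transformation)
      also have "\<dots> \<le> (\<Sum>k\<in>UNIV. \<bar>w $ k\<bar>)" by (rule norm_le_l1_cart)
      also have "\<dots> \<le> (\<Sum>k\<in>(UNIV::'n set). \<delta> / d)"
      proof (rule sum_mono)
        fix k
        have "w $ k = sqrt n * y $ k - sqrt (l k) * (s k / P.f0)"
          using v P.f0_pos by (simp add: w_def stretch_def real_sqrt_mult)
        then show "\<bar>w $ k\<bar> \<le> \<delta> / d" using exp[of k] by simp
      qed
      also have "\<dots> = \<delta>" using d by (simp add: d_def)
      finally show "norm (sqrt (real n) *\<^sub>R (\<theta> n \<omega> - \<mu>) - V.T (Sm.scores (mat 1) n \<omega>)) \<le> \<delta>" .
    qed
  qed (auto simp: orthogonal_matrix_id)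
qed

text \<open>Part (b). The Bahadur representation is used at the rows of \<open>U n\<close> with neighbourhoods of radius \<open>0\<close>. The map
  from scores to the estimator is \<open>\<kappa>\<close> times the transpose of \<open>U n\<close>; it depends on \<open>n\<close>, but its Gaussian image does not.\<close>

lemma marginal_median_limit:
  fixes \<theta> :: "nat \<Rightarrow> 'a \<Rightarrow> real^'n" and U :: "nat \<Rightarrow> real^'n^'n"
  assumes prof: "profile h CARD('n)" and M: "prob_space M"
    and indep: "prob_space.indep_vars M (\<lambda>_. borel) X {1..}"
    and c: "c > 0" and distr: "\<And>k. k \<ge> 1 \<Longrightarrow> distr M borel (X k) = elliptical \<mu> (c *\<^sub>R mat 1) h"
    and U: "\<And>n. n \<ge> 1 \<Longrightarrow> orthogonal_matrix (U n)"
    and meas: "\<And>n. n \<ge> 1 \<Longrightarrow> \<theta> n \<in> borel_measurable M"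
    and sol: "\<And>n. n \<ge> 1 \<Longrightarrow> AE \<omega> in M. is_marginal_median (rotated (U n) (empirical n (\<lambda>k. X k \<omega>))) (U n *v \<theta> n \<omega>)"
  shows "converges_in_distribution M (\<lambda>n \<omega>. sqrt (real n) *\<^sub>R (\<theta> n \<omega> - \<mu>)) (multivariate_normal 0 (qmed_variance CARD('n) h *\<^sub>R (c *\<^sub>R mat 1)))"
proof -
  have row1: "row i (mat 1 :: real^'n^'n) = axis i 1" for i
    by (simp add: row_def mat_def axis_def vec_eq_iff)
  interpret E: eigenframe "c *\<^sub>R mat 1 :: real^'n^'n" "mat 1" "\<lambda>_. c"
    by unfold_locales (auto simp: c orthogonal_matrix_id scaleR_matrix_vector_assoc[symmetric])
  interpret P: profile h "CARD('n)" by fact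
  have Sx: "E.S x = (1 / sqrt c) *\<^sub>R x" for x by (simp add: E.S_def vec_eq_iff)
  interpret Sm: spherical_sample "spherical h :: (real^'n) measure" P.f0 M "\<lambda>k \<omega>. E.S (X k \<omega> - \<mu>)"
    by (rule E.sample_standardised[OF prof M indep distr])
  \<comment> \<open>the asymptotic variance factor; the limit law is the Gaussian image under the eigenframe of v times the matrix\<close>
  define v where "v = (1 / (2 * P.f0))\<^sup>2"
  have v: "v > 0" "sqrt v = 1 / (2 * P.f0)" using P.f0_pos by (auto simp: v_def)
  interpret V: eigenframe "v *\<^sub>R (c *\<^sub>R mat 1 :: real^'n^'n)" "mat 1" "\<lambda>_. v * c"
    by (rule eigenframe_scaleR) (use v in \<open>auto intro: E.eigenframe_axioms\<close>)
  define \<kappa> where "\<kappa> = sqrt (v * c)"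
  have \<kappa>: "\<kappa> > 0" using v c by (simp add: \<kappa>_def)
  have \<kappa>2: "\<kappa> * (2 * t) = sqrt c * (t / P.f0)" for t using P.f0_pos by (simp add: \<kappa>_def real_sqrt_mult v)
  have VT: "V.T z = \<kappa> *\<^sub>R z" for z
    by (simp add: V.T_def stretch_def \<kappa>_def vec_eq_iff transpose_mat)
  \<comment> \<open>Nothing is known about U 0.\<close>
  define U' where "U' = (\<lambda>n. if n \<ge> 1 then U n else mat 1)"
  have U': "orthogonal_matrix (U' n)" for n using U by (simp add: U'_def orthogonal_matrix_id)
  have tU: "orthogonal_transformation ((*v) (transpose (U' n)))" "orthogonal_transformation ((*v) (U' n))" for n
    using U' by (auto simp: orthogonal_transformation_matrix orthogonal_matrix_transpose)
  have nU: "norm (transpose (U' n) *v x) = norm x" "norm (U' n *v x) = norm x" for n x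
    using tU by (auto simp: orthogonal_transformation)
  have Uinv: "U' n *v (transpose (U' n) *v x) = x" for n x
    using U'[of n] by (simp add: orthogonal_matrix_def matrix_vector_mul_assoc)
  define d where "d = real CARD('n)"
  have d: "d > 0" by (simp add: d_def)
  show ?thesis
    unfolding P.qmed_variance_eq v_def[symmetric] V.multivariate_normal_eq
  proof (rule Sm.score_maps_limit[where B = U' and A = "\<lambda>n z. transpose (U' n) *v (\<kappa> *\<^sub>R z)" and K = \<kappa>])
    show "orthogonal_matrix (U' n)" for n by (rule U')
    show "(\<lambda>z. transpose (U' n) *v (\<kappa> *\<^sub>R z)) \<in> borel_measurable borel" for n
      by (rule measurable_compose[OF _ borel_measurable_matrix_vector_mult]) simp
    show "norm (transpose (U' n) *v (\<kappa> *\<^sub>R x) - transpose (U' n) *v (\<kappa> *\<^sub>R y)) \<le> \<kappa> * norm (x - y)" for n x y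
      unfolding matrix_vector_mult_diff_distrib[symmetric] scaleR_diff_right[symmetric] nU using \<kappa> by simp
    show "transpose (U' n) *v (\<kappa> *\<^sub>R 0) = 0" for n by simp
    show "0 \<le> \<kappa>" using \<kappa> by simp
    show "distr std_gauss borel (\<lambda>z. transpose (U' n) *v (\<kappa> *\<^sub>R z)) = distr std_gauss borel V.T" for n
    proof -
      have "distr std_gauss borel V.T = distr (distr std_gauss borel ((*v) (transpose (U' n)))) borel V.T"
        by (simp only: std_gauss_rotation[OF tU(1)])
      also have "\<dots> = distr std_gauss borel (\<lambda>z. transpose (U' n) *v (\<kappa> *\<^sub>R z))"
        by (subst distr_distr) (auto simp: comp_def VT matrix_vector_mult_scaleR std_gauss_def borel_measurable_matrix_vector_mult)
      finally show ?thesis by simp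
    qed
    show "(\<lambda>\<omega>. sqrt (real n) *\<^sub>R (\<theta> n \<omega> - \<mu>)) \<in> borel_measurable M" if "n \<ge> 1" for n
      using meas[OF that] by measurable
    fix \<delta> L :: real assume \<delta>: "\<delta> > 0"
    define \<delta>' where "\<delta>' = \<delta> / (d * sqrt c)"
    have \<delta>': "\<delta>' > 0" using \<delta> d c by (simp add: \<delta>'_def)
    have ae: "Sm.M.whp (\<lambda>n \<omega>. is_marginal_median (rotated (U n) (empirical n (\<lambda>k. X k \<omega>))) (U n *v \<theta> n \<omega>))"
      by (rule Sm.M.whp_AE, rule eventually_sequentiallyI[of 1], rule sol)
    have bah: "Sm.M.whp (\<lambda>n \<omega>. \<forall>i\<in>UNIV. \<bar>Sm.scaled_score (row i (U' n)) n \<omega>\<bar> \<le> L \<longrightarrow> (\<forall>p m. norm p = 1 \<longrightarrow> norm (p - row i (U' n)) \<le> 0 * rate n \<longrightarrow>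
      1 / 2 \<le> Sm.F n \<omega> {z. m \<le> p \<bullet> z} \<longrightarrow> 1 / 2 \<le> Sm.F n \<omega> {z. p \<bullet> z \<le> m} \<longrightarrow> \<bar>sqrt n * m - Sm.scaled_score (row i (U' n)) n \<omega> / P.f0\<bar> \<le> \<delta>'))"
      by (intro Sm.M.whp_ball_finite Sm.bahadur[where ?p0.0 = "\<lambda>n. row i (U' n)" for i] \<delta>') (auto simp: norm_row_orthogonal[OF U'])
    show "Sm.M.whp (\<lambda>n \<omega>. norm (Sm.scores (U' n) n \<omega>) \<le> L \<longrightarrow> norm (sqrt (real n) *\<^sub>R (\<theta> n \<omega> - \<mu>) - transpose (U' n) *v (\<kappa> *\<^sub>R Sm.scores (U' n) n \<omega>)) \<le> \<delta>)"
    proof (rule Sm.M.whp_mono[OF Sm.M.whp_conj[OF bah ae]], rule eventually_sequentiallyI[of 1], intro ballI impI, elim conjE)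
      fix n \<omega>
      assume n: "1 \<le> n" and small: "norm (Sm.scores (U' n) n \<omega>) \<le> L"
        and med: "is_marginal_median (rotated (U n) (empirical n (\<lambda>k. X k \<omega>))) (U n *v \<theta> n \<omega>)"
        and H: "\<forall>i\<in>UNIV. \<bar>Sm.scaled_score (row i (U' n)) n \<omega>\<bar> \<le> L \<longrightarrow> (\<forall>p m. norm p = 1 \<longrightarrow> norm (p - row i (U' n)) \<le> 0 * rate n \<longrightarrow>
          1 / 2 \<le> Sm.F n \<omega> {z. m \<le> p \<bullet> z} \<longrightarrow> 1 / 2 \<le> Sm.F n \<omega> {z. p \<bullet> z \<le> m} \<longrightarrow> \<bar>sqrt n * m - Sm.scaled_score (row i (U' n)) n \<omega> / P.f0\<bar> \<le> \<delta>')"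
      have Un: "U' n = U n" using n by (simp add: U'_def)
      define s where "s = (\<lambda>i. Sm.scaled_score (row i (U' n)) n \<omega>)"
      have sc: "Sm.scores (U' n) n \<omega> = (\<chi> k. 2 * s k)" by (simp add: Sm.scores_def s_def)
      have sL: "\<bar>s k\<bar> \<le> L" for k
        using component_le_norm_cart[of "Sm.scores (U' n) n \<omega>" k] small by (simp add: sc abs_mult)
      define m where "m = (\<lambda>i. row i (U n) \<bullet> (\<theta> n \<omega> - \<mu>) / sqrt c)"
      have key: "row i (U n) \<bullet> E.S (X k \<omega> - \<mu>) - m i = (row i (U n) \<bullet> X k \<omega> - row i (U n) \<bullet> \<theta> n \<omega>) / sqrt c" for i k
        unfolding Sx m_def by (simp add: inner_diff_right diff_divide_distrib)
      have keyle: "(m i \<le> row i (U n) \<bullet> E.S (X k \<omega> - \<mu>)) = (row i (U n) \<bullet> \<theta> n \<omega> \<le> row i (U n) \<bullet> X k \<omega>)"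
        "(row i (U n) \<bullet> E.S (X k \<omega> - \<mu>) \<le> m i) = (row i (U n) \<bullet> X k \<omega> \<le> row i (U n) \<bullet> \<theta> n \<omega>)" for i k
      proof -
        have "(0 \<le> t / sqrt c) = (0 \<le> t)" "(t / sqrt c \<le> 0) = (t \<le> 0)" for t :: real
          using c by (simp_all add: zero_le_divide_iff divide_le_0_iff)
        from this[of "row i (U n) \<bullet> X k \<omega> - row i (U n) \<bullet> \<theta> n \<omega>"] key[of i k]
        show "(m i \<le> row i (U n) \<bullet> E.S (X k \<omega> - \<mu>)) = (row i (U n) \<bullet> \<theta> n \<omega> \<le> row i (U n) \<bullet> X k \<omega>)"
          "(row i (U n) \<bullet> E.S (X k \<omega> - \<mu>) \<le> m i) = (row i (U n) \<bullet> X k \<omega> \<le> row i (U n) \<bullet> \<theta> n \<omega>)"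
          by linarith+
      qed
      have marg: "measure (distr (rotated (U n) (empirical n (\<lambda>k. X k \<omega>))) borel (\<lambda>x. x $ i)) A = frac n (\<lambda>k. X k \<omega>) {x. row i (U n) \<bullet> x \<in> A}"
        if A: "A \<in> sets borel" for A i
      proof -
        have se: "sets (empirical n (\<lambda>k. X k \<omega>)) = sets borel" by (simp add: empirical_def)
        have m1: "(\<lambda>x. U n *v x) \<in> borel_measurable (empirical n (\<lambda>k. X k \<omega>))"
          unfolding measurable_cong_sets[OF se refl] by (rule borel_measurable_matrix_vector_mult)
        have m2: "(\<lambda>x::real^'n. x $ i) \<in> borel_measurable borel"
          by (intro borel_measurable_continuous_onI continuous_intros)
        have m3: "(\<lambda>x. row i (U n) \<bullet> x) \<in> borel_measurable borel" by simp
        have "distr (rotated (U n) (empirical n (\<lambda>k. X k \<omega>))) borel (\<lambda>x. x $ i) = distr (empirical n (\<lambda>k. X k \<omega>)) borel (\<lambda>x. row i (U n) \<bullet> x)"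
          unfolding rotated_def by (subst distr_distr[OF m2 m1]) (simp add: comp_def matrix_vector_mul_component row_nth)
        then have "measure (distr (rotated (U n) (empirical n (\<lambda>k. X k \<omega>))) borel (\<lambda>x. x $ i)) A = measure (empirical n (\<lambda>k. X k \<omega>)) ((\<lambda>x. row i (U n) \<bullet> x) -` A \<inter> space (empirical n (\<lambda>k. X k \<omega>)))"
          using A m3 by (simp add: measure_distr measurable_cong_sets[OF se refl])
        also have "space (empirical n (\<lambda>k. X k \<omega>)) = UNIV" using sets_eq_imp_space_eq[OF se] by simp
        also have "(\<lambda>x. row i (U n) \<bullet> x) -` A \<inter> UNIV = {x. row i (U n) \<bullet> x \<in> A}" by auto
        also have "measure (empirical n (\<lambda>k. X k \<omega>)) {x. row i (U n) \<bullet> x \<in> A} = frac n (\<lambda>k. X k \<omega>) {x. row i (U n) \<bullet> x \<in> A}"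
          using n measurable_sets[OF m3 A] by (intro measure_empirical) (simp_all add: vimage_def)
        finally show ?thesis .
      qed
      have "1 / 2 \<le> Sm.F n \<omega> {z. m i \<le> row i (U n) \<bullet> z}" "1 / 2 \<le> Sm.F n \<omega> {z. row i (U n) \<bullet> z \<le> m i}" for i
      proof -
        have md: "is_median (distr (rotated (U n) (empirical n (\<lambda>k. X k \<omega>))) borel (\<lambda>x. x $ i)) (row i (U n) \<bullet> \<theta> n \<omega>)"
          using med by (simp add: is_marginal_median_def matrix_vector_mul_component row_nth)
        have "Sm.F n \<omega> {z. m i \<le> row i (U n) \<bullet> z} = frac n (\<lambda>k. X k \<omega>) {x. row i (U n) \<bullet> x \<in> {row i (U n) \<bullet> \<theta> n \<omega>..}}"
          by (rule frac_cong) (simp add: keyle)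
        then show "1 / 2 \<le> Sm.F n \<omega> {z. m i \<le> row i (U n) \<bullet> z}" using md by (simp add: is_median_def marg)
        have "Sm.F n \<omega> {z. row i (U n) \<bullet> z \<le> m i} = frac n (\<lambda>k. X k \<omega>) {x. row i (U n) \<bullet> x \<in> {..row i (U n) \<bullet> \<theta> n \<omega>}}"
          by (rule frac_cong) (simp add: keyle)
        then show "1 / 2 \<le> Sm.F n \<omega> {z. row i (U n) \<bullet> z \<le> m i}" using md by (simp add: is_median_def marg)
      qed
      moreover have "norm (row i (U n)) = 1" for i using norm_row_orthogonal[OF U'[of n]] by (simp add: Un)
      ultimately have exp: "\<bar>sqrt n * m i - s i / P.f0\<bar> \<le> \<delta>'" for i
        using H sL unfolding s_def Un by simp
      define w where "w = U' n *v (sqrt (real n) *\<^sub>R (\<theta> n \<omega> - \<mu>) - transpose (U' n) *v (\<kappa> *\<^sub>R Sm.scores (U' n) n \<omega>))"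
      have "norm (sqrt (real n) *\<^sub>R (\<theta> n \<omega> - \<mu>) - transpose (U' n) *v (\<kappa> *\<^sub>R Sm.scores (U' n) n \<omega>)) = norm w"
        by (simp only: w_def nU)
      also have "\<dots> \<le> (\<Sum>k\<in>UNIV. \<bar>w $ k\<bar>)" by (rule norm_le_l1_cart)
      also have "\<dots> \<le> (\<Sum>k\<in>(UNIV::'n set). sqrt c * \<delta>')"
      proof (rule sum_mono)
        fix k
        have w2: "w = sqrt (real n) *\<^sub>R (U n *v (\<theta> n \<omega> - \<mu>)) - \<kappa> *\<^sub>R Sm.scores (U' n) n \<omega>"
          unfolding w_def by (simp only: matrix_vector_mult_diff_distrib Uinv[of n, unfolded Un] matrix_vector_mult_scaleR Un)
        have mk: "(U n *v (\<theta> n \<omega> - \<mu>)) $ k = sqrt c * m k" using c by (simp add: m_def matrix_vector_mul_component row_nth)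
        have "w $ k = sqrt n * (sqrt c * m k) - sqrt c * (s k / P.f0)"
          unfolding \<kappa>2[symmetric] w2 sc by (simp add: mk)
        also have "\<dots> = sqrt c * (sqrt n * m k - s k / P.f0)" by (simp add: algebra_simps)
        finally have "\<bar>w $ k\<bar> = sqrt c * \<bar>sqrt n * m k - s k / P.f0\<bar>" using c by (simp add: abs_mult)
        then show "\<bar>w $ k\<bar> \<le> sqrt c * \<delta>'" using exp[of k] c by simp
      qed
      also have "\<dots> = \<delta>" using d c by (simp add: \<delta>'_def d_def)
      finally show "norm (sqrt (real n) *\<^sub>R (\<theta> n \<omega> - \<mu>) - transpose (U' n) *v (\<kappa> *\<^sub>R Sm.scores (U' n) n \<omega>)) \<le> \<delta>" .
    qed
  qed
qed

theorem theorem5: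
  fixes \<mu> :: "real ^ 'n" and \<Sigma> :: "real ^ 'n ^ 'n" and h :: "real \<Rightarrow> real"
    and M :: "'a measure" and X :: "nat \<Rightarrow> 'a \<Rightarrow> real ^ 'n"
  assumes dim: "CARD('n) \<ge> 2"
    and sym: "transpose \<Sigma> = \<Sigma>" and posdef: "positive_definite \<Sigma>"
    and h_meas: "h \<in> borel_measurable (restrict_space borel {0..})"
    and h_nonneg: "\<forall>t\<ge>0. h t \<ge> 0"
    and c_pos: "0 < radial_const CARD('n) h" and c_fin: "radial_const CARD('n) h < \<infinity>"
    and h_bdd: "\<exists>\<epsilon>>0. bdd_above (h ` {0..\<epsilon>})"
    and prob: "prob_space M"
    and X_indep: "prob_space.indep_vars M (\<lambda>_. borel) X {1..}"
    and X_distr: "\<forall>k\<ge>1. distr M borel (X k) = elliptical \<mu> \<Sigma> h"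
  shows
    "(strictly_elliptical \<Sigma> \<longrightarrow>
       (\<forall>(\<theta> :: nat \<Rightarrow> (nat \<Rightarrow> real ^ 'n) \<Rightarrow> real ^ 'n)
         (U :: nat \<Rightarrow> (nat \<Rightarrow> real ^ 'n) \<Rightarrow> real ^ 'n ^ 'n).
          (\<forall>n\<ge>1. \<theta> n \<in> PiM {1..n} (\<lambda>_. borel) \<rightarrow>\<^sub>M borel \<and>
                 U n \<in> PiM {1..n} (\<lambda>_. borel) \<rightarrow>\<^sub>M restrict_space borel {V. orthogonal_matrix V}) \<longrightarrow>
          (\<forall>n\<ge>1. AE \<omega> in M. solves_quarter_median (empirical n (\<lambda>k. X k \<omega>))
                   (\<theta> n (\<lambda>k\<in>{1..n}. X k \<omega>)) (U n (\<lambda>k\<in>{1..n}. X k \<omega>))) \<longrightarrow>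
          converges_in_distribution M
            (\<lambda>n \<omega>. sqrt (real n) *\<^sub>R (\<theta> n (\<lambda>k\<in>{1..n}. X k \<omega>) - \<mu>))
            (multivariate_normal 0 (qmed_variance CARD('n) h *\<^sub>R \<Sigma>)))) \<and>
     ((\<exists>c>0. \<Sigma> = c *\<^sub>R mat 1) \<longrightarrow>
       (\<forall>(U :: nat \<Rightarrow> real ^ 'n ^ 'n) (\<theta> :: nat \<Rightarrow> 'a \<Rightarrow> real ^ 'n).
          (\<forall>n\<ge>1. orthogonal_matrix (U n)) \<longrightarrow>
          (\<forall>n\<ge>1. \<theta> n \<in> M \<rightarrow>\<^sub>M borel) \<longrightarrow>
          (\<forall>n\<ge>1. AE \<omega> in M. is_marginal_median (rotated (U n) (empirical n (\<lambda>k. X k \<omega>)))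
                              (U n *v \<theta> n \<omega>)) \<longrightarrow>
          converges_in_distribution M
            (\<lambda>n \<omega>. sqrt (real n) *\<^sub>R (\<theta> n \<omega> - \<mu>))
            (multivariate_normal 0 (qmed_variance CARD('n) h *\<^sub>R \<Sigma>))))"
proof -
  have prof: "profile h CARD('n)"
    using dim h_meas h_nonneg c_pos c_fin h_bdd by unfold_locales auto
  interpret M: prob_space M by fact
  show ?thesis
  proof (intro conjI impI allI)
    fix \<theta> :: "nat \<Rightarrow> (nat \<Rightarrow> real ^ 'n) \<Rightarrow> real ^ 'n" and U :: "nat \<Rightarrow> (nat \<Rightarrow> real ^ 'n) \<Rightarrow> real ^ 'n ^ 'n"
    assume strict: "strictly_elliptical \<Sigma>"
      and meas: "\<forall>n\<ge>1. \<theta> n \<in> PiM {1..n} (\<lambda>_. borel) \<rightarrow>\<^sub>M borel \<and>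
                 U n \<in> PiM {1..n} (\<lambda>_. borel) \<rightarrow>\<^sub>M restrict_space borel {V. orthogonal_matrix V}"
      and sol: "\<forall>n\<ge>1. AE \<omega> in M. solves_quarter_median (empirical n (\<lambda>k. X k \<omega>))
                   (\<theta> n (\<lambda>k\<in>{1..n}. X k \<omega>)) (U n (\<lambda>k\<in>{1..n}. X k \<omega>))"
    obtain E l where "eigenframe \<Sigma> E l" and inj: "\<And>i j. i \<noteq> j \<Longrightarrow> l i \<noteq> l j"
      using strictly_elliptical_eigenframe[OF sym posdef strict] by blast
    then interpret eigenframe \<Sigma> E l by simp
    show "converges_in_distribution M (\<lambda>n \<omega>. sqrt (real n) *\<^sub>R (\<theta> n (\<lambda>k\<in>{1..n}. X k \<omega>) - \<mu>))
            (multivariate_normal 0 (qmed_variance CARD('n) h *\<^sub>R \<Sigma>))"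
    proof (rule quarter_median_limit[OF prof prob X_indep _ inj])
      show "(\<lambda>\<omega>. \<theta> n (\<lambda>k\<in>{1..n}. X k \<omega>)) \<in> borel_measurable M" if n: "n \<ge> 1" for n
      proof -
        have "(\<lambda>\<omega>. \<lambda>k\<in>{1..n}. X k \<omega>) \<in> measurable M (PiM {1..n} (\<lambda>_. borel))"
          using X_indep by (intro measurable_restrict) (simp add: M.indep_vars_def)
        then show ?thesis using meas n by (auto intro: measurable_compose)
      qed
    qed (use X_distr sol in auto)
  next
    fix U :: "nat \<Rightarrow> real ^ 'n ^ 'n" and \<theta> :: "nat \<Rightarrow> 'a \<Rightarrow> real ^ 'n"
    assume "\<exists>c>0. \<Sigma> = c *\<^sub>R mat 1" and U: "\<forall>n\<ge>1. orthogonal_matrix (U n)"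
      and meas: "\<forall>n\<ge>1. \<theta> n \<in> M \<rightarrow>\<^sub>M borel"
      and sol: "\<forall>n\<ge>1. AE \<omega> in M. is_marginal_median (rotated (U n) (empirical n (\<lambda>k. X k \<omega>))) (U n *v \<theta> n \<omega>)"
    then obtain c where c: "c > 0" "\<Sigma> = c *\<^sub>R mat 1" by blast
    show "converges_in_distribution M (\<lambda>n \<omega>. sqrt (real n) *\<^sub>R (\<theta> n \<omega> - \<mu>))
            (multivariate_normal 0 (qmed_variance CARD('n) h *\<^sub>R \<Sigma>))"
      unfolding c(2)
      by (rule marginal_median_limit[OF prof prob X_indep c(1)]) (use X_distr U meas sol c(2) in auto)
  qed
qed

end
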